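(* Let $0<s<1\le p<\infty$ with $sp<n$, and let $\{u_k\}_{k\in\mathbb{N}}\subset \mathcal{D}^{s,p}(\mathbb{R}^n)$ be a weakly convergent sequence with weak limit $u$. Then there exist two bounded measures $\mu$ and $\nu$, an at most enumerable set of indices $I$, points $x_i\in\mathbb{R}^n$ and positive real numbers $\mu_i,\nu_i$, $i\in I$, such that the following convergences hold weakly in the sense of measures: $$|D^s u_k|^{p}\,dx \rightharpoonup \mu\ge |D^s u|^{p}\,dx + \sum_{i\in I} \mu_i \delta_{x_i},$$ $$|u_k|^{p^*_s}\,dx \rightharpoonup \nu = |u|^{p^*_s}\,dx + \sum_{i\in I} \nu_i \delta_{x_i},$$ and $$S^{\frac1p}\nu_i^{\frac{1}{p^*_s}} \le \mu_i^{\frac1p}\qquad \text{for all } i\in I.$$ Moreover, if we define $$\nu_\infty=\lim_{R\to\infty}\limsup_{k\to\infty}\int_{|x|>R}|u_k|^{p^*_s}\,dx,\qquad \mu_\infty=\lim_{R\to\infty}\limsup_{k\to\infty}\int_{|x|>R}|D^s u_k|^{p}\,dx,$$ then $$\limsup_{k\to\infty} \int_{\mathbb{R}^n} |D^s u_k|^{p}\,dx = \mu(\mathbb{R}^n) + \mu_\infty,$$ $$\limsup_{k\to\infty} \int_{\mathbb{R}^n} |u_k|^{p^*_s}\,dx = \nu(\mathbb{R}^n) + \nu_\infty,$$ $$S^{\frac1p}\nu_\infty^{\frac{1}{p^*_s}} \leq \mu_\infty^{\frac1p}.$$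
   Context: For $v\in L^1_{loc}(\mathbb{R}^n)$ the Gagliardo seminorm is $[v]_{s,p}^p := \iint_{\mathbb{R}^n\times\mathbb{R}^n} \frac{|v(x)-v(y)|^p}{|x-y|^{n+sp}}\, dx\,dy$. The critical exponent is $p^*_s=\frac{np}{n-sp}$. The space $\mathcal{D}^{s,p}(\mathbb{R}^n)$ is the closure of $C_c^\infty(\mathbb{R}^n)$ with respect to $[\cdot]_{s,p}$; it can also be characterized as $\{v\in L^{p^*_s}(\mathbb{R}^n): [v]_{s,p}<\infty\}$. For $v\in\mathcal{D}^{s,p}(\mathbb{R}^n)$ the $(s,p)$-gradient is defined for a.e. $x$ by $|D^s v(x)|^p = \int_{\mathbb{R}^n}\frac{|v(x+h)-v(x)|^p}{|h|^{n+sp}}\,dh$. The Sobolev constant is $S=S(n,p,s):=\inf\frac{[v]^p_{s,p}}{\|v\|^p_{p^*_s}}$, the infimum being over nonzero $v\in\mathcal{D}^{s,p}(\mathbb{R}^n)$, where $\|\cdot\|_{p^*_s}$ is the $L^{p^*_s}(\mathbb{R}^n)$ norm. $\delta_x$ is the Dirac mass at $x$.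
   Formalization: All conclusions (the convergences, the limits at infinity, the limsup identities and the inequalities) are asserted for a subsequence of u_k, since for the full sequence the measures need not converge (e.g. alternate 0 with concentrating bubbles). *)

theory Defs
  imports "HOL-Probability.Probability"
begin

text \<open>
  The space \<open>\<real>\<^sup>n\<close> is an arbitrary type of class \<open>euclidean_space\<close>, with \<open>n = DIM('a)\<close>.
  Elements of the function spaces are Borel functions and not equivalence classes (every
  Lebesgue class has a Borel representative); every notion below is invariant under changing
  the functions on a Lebesgue null set.
\<close>

subsection \<open>Test functions\<close>

text \<open>A function is of class \<open>C\<^sup>k\<^sup>+\<^sup>1\<close> if it is differentiable and its partial derivatives are
  of class \<open>C\<^sup>k\<close>.\<close>

primrec Ck_fun :: "nat \<Rightarrow> ('a::euclidean_space \<Rightarrow> real) \<Rightarrow> bool" where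
  "Ck_fun 0 f \<longleftrightarrow> continuous_on UNIV f"
| "Ck_fun (Suc k) f \<longleftrightarrow>
     f differentiable_on UNIV \<and>
     (\<forall>b\<in>Basis. Ck_fun k (\<lambda>x. frechet_derivative f (at x) b))"

definition test_functions :: "('a::euclidean_space \<Rightarrow> real) set" where
  "test_functions = {f. (\<forall>k. Ck_fun k f) \<and> compact (closure {x. f x \<noteq> 0})}"

subsection \<open>Fractional Sobolev spaces\<close>

definition crit_exp :: "'a::euclidean_space itself \<Rightarrow> real \<Rightarrow> real \<Rightarrow> real" where
  "crit_exp _ s p = real DIM('a) * p / (real DIM('a) - s * p)"

text \<open>\<open>gagliardo_pow s p v\<close> is \<open>[v]\<close> raised to the power \<open>p\<close>. The diagonal is a null set
  (and the integrand is \<open>0\<close> there).\<close>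

definition gagliardo_pow :: "real \<Rightarrow> real \<Rightarrow> ('a::euclidean_space \<Rightarrow> real) \<Rightarrow> ennreal" where
  "gagliardo_pow s p v =
     (\<integral>\<^sup>+(x, y). ennreal (\<bar>v x - v y\<bar> powr p / norm (x - y) powr (real DIM('a) + s * p))
        \<partial>(lborel \<Otimes>\<^sub>M lborel))"

text \<open>The real-valued seminorm is only meaningful where \<open>gagliardo_pow s p v < \<infinity>\<close>, which is
  the case on \<open>Dsp s p\<close>.\<close>

definition gagliardo_seminorm :: "real \<Rightarrow> real \<Rightarrow> ('a::euclidean_space \<Rightarrow> real) \<Rightarrow> real" where
  "gagliardo_seminorm s p v = enn2real (gagliardo_pow s p v) powr (1 / p)"

text \<open>\<open>frac_grad_pow s p v x\<close> is the \<open>p\<close>-th power of the modulus of the \<open>(s,p)\<close>-gradient.\<close>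

definition frac_grad_pow ::
    "real \<Rightarrow> real \<Rightarrow> ('a::euclidean_space \<Rightarrow> real) \<Rightarrow> 'a \<Rightarrow> ennreal" where
  "frac_grad_pow s p v x =
     (\<integral>\<^sup>+h. ennreal (\<bar>v (x + h) - v x\<bar> powr p / norm h powr (real DIM('a) + s * p)) \<partial>lborel)"

definition Lq :: "real \<Rightarrow> ('a::euclidean_space \<Rightarrow> real) set" where
  "Lq q = {v \<in> borel_measurable borel. integrable lborel (\<lambda>x. \<bar>v x\<bar> powr q)}"

definition Lq_norm :: "real \<Rightarrow> ('a::euclidean_space \<Rightarrow> real) \<Rightarrow> real" where
  "Lq_norm q v = (\<integral>x. \<bar>v x\<bar> powr q \<partial>lborel) powr (1 / q)"

text \<open>The closure of the test functions with respect to the Gagliardo seminorm, taken among the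
  functions of \<open>L\<^sup>q\<close> with \<open>q\<close> the critical exponent. The ambient space is what realizes the
  abstract completion as a space of functions: it singles out, by the Sobolev inequality, one
  representative modulo constants.\<close>

definition Dsp :: "real \<Rightarrow> real \<Rightarrow> ('a::euclidean_space \<Rightarrow> real) set" where
  "Dsp s p =
     {v \<in> Lq (crit_exp TYPE('a) s p).
        \<exists>\<phi>. (\<forall>j::nat. \<phi> j \<in> test_functions) \<and>
            (\<lambda>j. gagliardo_pow s p (\<lambda>x. v x - \<phi> j x)) \<longlonglongrightarrow> 0}"

definition sobolev_const :: "'a::euclidean_space itself \<Rightarrow> real \<Rightarrow> real \<Rightarrow> real" where
  "sobolev_const _ s p =
     (INF v \<in> {v \<in> Dsp s p. \<not> (AE x::'a in lborel. v x = 0)}.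
        gagliardo_seminorm s p v powr p / Lq_norm (crit_exp TYPE('a) s p) v powr p)"

subsection \<open>Weak convergence\<close>

definition Dsp_dual ::
    "real \<Rightarrow> real \<Rightarrow> (('a::euclidean_space \<Rightarrow> real) \<Rightarrow> real) set" where
  "Dsp_dual s p =
     {F. (\<forall>v\<in>Dsp s p. \<forall>w\<in>Dsp s p. F (\<lambda>x. v x + w x) = F v + F w) \<and>
         (\<forall>c. \<forall>v\<in>Dsp s p. F (\<lambda>x. c * v x) = c * F v) \<and>
         (\<exists>C. \<forall>v\<in>Dsp s p. \<bar>F v\<bar> \<le> C * gagliardo_seminorm s p v)}"

definition weakly_convergent_Dsp ::
    "real \<Rightarrow> real \<Rightarrow> (nat \<Rightarrow> 'a::euclidean_space \<Rightarrow> real) \<Rightarrow> ('a \<Rightarrow> real) \<Rightarrow> bool" where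
  "weakly_convergent_Dsp s p v w \<longleftrightarrow>
     (\<forall>k. v k \<in> Dsp s p) \<and> w \<in> Dsp s p \<and>
     (\<forall>F\<in>Dsp_dual s p. (\<lambda>k. F (v k)) \<longlonglongrightarrow> F w)"

text \<open>Weak convergence of bounded measures, by duality with the continuous functions vanishing
  at infinity: mass may be lost at infinity. (For sequences of bounded mass, compactly supported
  test functions give the same notion.)\<close>

definition weakly_convergent_measures ::
    "(nat \<Rightarrow> 'a::euclidean_space measure) \<Rightarrow> 'a measure \<Rightarrow> bool" where
  "weakly_convergent_measures M N \<longleftrightarrow>
     (\<forall>f::'a \<Rightarrow> real. continuous_on UNIV f \<and> (f \<longlongrightarrow> 0) at_infinity \<longrightarrow>
        (\<lambda>k. \<integral>x. f x \<partial>M k) \<longlonglongrightarrow> (\<integral>x. f x \<partial>N))"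

text \<open>The value on \<open>A\<close> of the sum over \<open>i \<in> I\<close> of \<open>w i\<close> times the Dirac mass at \<open>x i\<close>.\<close>

definition dirac_sum ::
    "nat set \<Rightarrow> (nat \<Rightarrow> 'a::euclidean_space) \<Rightarrow> (nat \<Rightarrow> real) \<Rightarrow> 'a set \<Rightarrow> ennreal" where
  "dirac_sum I x w A = (\<Sum>\<^sub>\<infinity>i\<in>I. ennreal (w i) * emeasure (return borel (x i)) A)"

end

theory Submission
  imports Defs
begin

text \<open>
  Bounded sequences of measures have weak limits along subsequences, so pass to weak limits
  \<open>\<mu>\<close> of \<open>\<bar>D\<^sup>s u\<^sub>k\<bar>\<^sup>p\<close>, \<open>\<nu>\<close> of \<open>\<bar>u\<^sub>k\<bar>\<^sup>q\<close> and \<open>\<nu>'\<close> of \<open>\<bar>u\<^sub>k - u\<bar>\<^sup>q\<close>. Averages of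
  \<open>u\<^sub>k - u\<close> over balls of radius \<open>r\<close> tend to \<open>0\<close> pointwise and differ from \<open>u\<^sub>k - u\<close> by
  \<open>O(r\<^sup>s)\<close> in \<open>L\<^sup>1\<close> of bounded sets, hence \<open>u\<^sub>k \<rightarrow> u\<close> almost everywhere along a subsequence. By the
  Brezis-Lieb lemma \<open>\<nu> = \<bar>u\<bar>\<^sup>q dx + \<nu>'\<close>. The Sobolev inequality applied to \<open>\<phi> (u\<^sub>k - u)\<close>,
  for a cutoff \<open>\<phi>\<close>, becomes in the limit a reverse Hoelder inequality
  \<open>S \<nu>'(E)\<^bsup>p/q\<^esup> \<le> (1 + e)\<^sup>2 \<mu>(E) + C\<^sub>e \<integral>\<^sub>E \<bar>D\<^sup>s u\<bar>\<^sup>p\<close>, because the nonlocal commutator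
  \<open>\<integral> \<bar>u\<^sub>k - u\<bar>\<^sup>p \<bar>D\<^sup>s \<phi>\<bar>\<^sup>p\<close> vanishes: its weight is bounded and integrable. Since \<open>p < q\<close>, the
  measure \<open>\<nu>'\<close> is purely atomic, and at an atom the absolutely continuous term disappears. The same
  inequality for \<open>1 - \<phi>\<close> gives the statement at infinity. The triangle inequality is replaced throughout
  by \<open>\<bar>a + b\<bar>\<^sup>p \<le> (1 + e) \<bar>a\<bar>\<^sup>p + C\<^sub>e \<bar>b\<bar>\<^sup>p\<close>.
\<close>

section \<open>Smooth cutoff functions\<close>

text \<open>The obstacle is nonlocality. A compactly supported cutoff \<open>\<phi>\<close> has a
  gradient \<open>frac_grad_pow s p \<phi>\<close> that lives on the whole space, so convergence of
  \<open>u k - u0\<close> on bounded sets does not remove the commutator. What removes it is that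
  \<open>u k - u0\<close> is bounded in \<open>Lq q\<close> with \<open>p < q\<close> and tends to 0
  almost everywhere. The constant C_e may blow up as e tends to 0, so the order of limits matters:
  first k tends to infinity, then the set shrinks to a point (or R grows), which kills the term with
  C_e, and only then e tends to 0. The two limit measures behave differently. For
  \<open>\<nu>\<close> there is an exact splitting. For \<open>\<mu>\<close> Fatou's lemma gives
  only a lower bound, and it adds up with the bound by the atoms because a density does not charge a
  countable set. The case p = 1 is included, so reflexivity is not at hand: boundedness of the
  sequence comes from explicit norming functionals, and most uses of Hoelder's inequality become a
  truncation at a level t that is chosen afterwards.\<close>

lemma Ck_fun_SucI:
  fixes f :: "'a::euclidean_space \<Rightarrow> real"
  assumes "\<And>x. (f has_derivative f' x) (at x)" and "\<And>b. b \<in> Basis \<Longrightarrow> Ck_fun k (\<lambda>x. f' x b)"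
  shows "Ck_fun (Suc k) f"
proof -
  have "frechet_derivative f (at x) = f' x" for x
    using frechet_derivative_at[OF assms(1)] by simp
  then show ?thesis
    using assms by (auto simp: differentiable_on_def differentiable_def)
qed

lemma Ck_fun_SucD:
  fixes f :: "'a::euclidean_space \<Rightarrow> real"
  assumes "Ck_fun (Suc k) f"
  shows "(f has_derivative frechet_derivative f (at x)) (at x)"
    and "b \<in> Basis \<Longrightarrow> Ck_fun k (\<lambda>x. frechet_derivative f (at x) b)"
  using assms by (auto simp: differentiable_on_def frechet_derivative_works)

lemma Ck_fun_continuous:
  fixes f :: "'a::euclidean_space \<Rightarrow> real"
  assumes "Ck_fun k f"
  shows "continuous_on UNIV f"
proof (cases k)
  case (Suc j)
  then show ?thesis
    using assms differentiable_imp_continuous_on by auto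
qed (use assms in auto)

text \<open>Derivatives of products, inverses and compositions still contain the undifferentiated
  functions, so the inductions below need these functions one level lower.\<close>

lemma Ck_fun_Suc_imp:
  fixes f :: "'a::euclidean_space \<Rightarrow> real"
  assumes "Ck_fun (Suc k) f"
  shows "Ck_fun k f"
  using assms
proof (induction k arbitrary: f)
  case 0
  then show ?case using Ck_fun_continuous[OF 0] by simp
next
  case (Suc k)
  show ?case
    by (rule Ck_fun_SucI[OF Ck_fun_SucD(1)[OF Suc.prems]])
       (use Suc Ck_fun_SucD(2)[OF Suc.prems] in blast)
qed

lemma Ck_fun_const [simp]: "Ck_fun k (\<lambda>_::'a::euclidean_space. c :: real)"
proof (induction k arbitrary: c)
  case (Suc k)
  show ?case
    by (rule Ck_fun_SucI[where f' = "\<lambda>_ _. 0"]) (auto intro: Suc)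
qed simp

lemma Ck_fun_add:
  fixes f g :: "'a::euclidean_space \<Rightarrow> real"
  assumes "Ck_fun k f" "Ck_fun k g"
  shows "Ck_fun k (\<lambda>x. f x + g x)"
  using assms
proof (induction k arbitrary: f g)
  case 0
  then show ?case by (auto intro: continuous_intros)
next
  case (Suc k)
  show ?case
    by (rule Ck_fun_SucI[OF has_derivative_add[OF Ck_fun_SucD(1)[OF Suc.prems(1)]
          Ck_fun_SucD(1)[OF Suc.prems(2)]]])
       (use Suc Ck_fun_SucD(2) in blast)
qed

lemma Ck_fun_mult:
  fixes f g :: "'a::euclidean_space \<Rightarrow> real"
  assumes "Ck_fun k f" "Ck_fun k g"
  shows "Ck_fun k (\<lambda>x. f x * g x)"
  using assms
proof (induction k arbitrary: f g)
  case 0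
  then show ?case by (auto intro: continuous_intros)
next
  case (Suc k)
  show ?case
    by (rule Ck_fun_SucI[OF has_derivative_mult[OF Ck_fun_SucD(1)[OF Suc.prems(1)]
          Ck_fun_SucD(1)[OF Suc.prems(2)]]])
       (intro Ck_fun_add Suc.IH Ck_fun_Suc_imp[OF Suc.prems(1)] Ck_fun_Suc_imp[OF Suc.prems(2)]
          Ck_fun_SucD(2)[OF Suc.prems(1)] Ck_fun_SucD(2)[OF Suc.prems(2)])
qed

lemma Ck_fun_diff:
  fixes f g :: "'a::euclidean_space \<Rightarrow> real"
  assumes "Ck_fun k f" "Ck_fun k g"
  shows "Ck_fun k (\<lambda>x. f x - g x)"
  using Ck_fun_add[OF assms(1) Ck_fun_mult[OF Ck_fun_const[of k "-1"] assms(2)]] by simp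

lemma Ck_fun_sum:
  fixes f :: "'i \<Rightarrow> 'a::euclidean_space \<Rightarrow> real"
  assumes "\<And>i. i \<in> I \<Longrightarrow> Ck_fun k (f i)"
  shows "Ck_fun k (\<lambda>x. \<Sum>i\<in>I. f i x)"
  using assms by (induction I rule: infinite_finite_induct) (auto intro: Ck_fun_add)

lemma Ck_fun_inverse:
  fixes f :: "'a::euclidean_space \<Rightarrow> real"
  assumes "Ck_fun k f" "\<And>x. f x \<noteq> 0"
  shows "Ck_fun k (\<lambda>x. inverse (f x))"
  using assms
proof (induction k arbitrary: f)
  case 0
  then show ?case by (auto intro!: continuous_intros)
next
  case (Suc k)
  have inv: "Ck_fun k (\<lambda>x. inverse (f x))"
    using Suc Ck_fun_Suc_imp by blast
  show ?case
  proof (rule Ck_fun_SucI)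
    show "((\<lambda>x. inverse (f x)) has_derivative
        (\<lambda>h. - 1 * (inverse (f x) * (frechet_derivative f (at x) h) * inverse (f x)))) (at x)" for x
      using Deriv.has_derivative_inverse[OF Suc.prems(2)[of x] Ck_fun_SucD(1)[OF Suc.prems(1)]] by simp
  qed (intro Ck_fun_mult inv Ck_fun_const Ck_fun_SucD(2)[OF Suc.prems(1)])
qed

lemma Ck_fun_compose:
  fixes h :: "real \<Rightarrow> real" and f :: "'a::euclidean_space \<Rightarrow> real"
  assumes "Ck_fun k h" "Ck_fun k f"
  shows "Ck_fun k (\<lambda>x. h (f x))"
  using assms
proof (induction k arbitrary: h f)
  case 0
  then show ?case using continuous_on_compose2[of UNIV h UNIV f] by auto
next
  case (Suc k)
  show ?case
  proof (rule Ck_fun_SucI)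
    fix x
    \<comment> \<open>A linear map on the line is multiplication by its value at 1. This turns the
      chain rule into a product of two scalar functions, to which \<open>Ck_fun_mult\<close>
      applies.\<close>
    have "(h has_derivative (\<lambda>t. t * frechet_derivative h (at (f x)) 1)) (at (f x))"
    proof -
      have lin: "linear (frechet_derivative h (at (f x)))"
        using Ck_fun_SucD(1)[OF Suc.prems(1)] has_derivative_linear by blast
      have "frechet_derivative h (at (f x)) t = t * frechet_derivative h (at (f x)) 1" for t
        using linear_cmul[OF lin, of t 1] by simp
      then have "frechet_derivative h (at (f x)) = (\<lambda>t. t * frechet_derivative h (at (f x)) 1)"
        by blast
      then show ?thesis
        using Ck_fun_SucD(1)[OF Suc.prems(1)] by metis
    qed
    from has_derivative_compose[OF Ck_fun_SucD(1)[OF Suc.prems(2)] this]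
    show "((\<lambda>x. h (f x)) has_derivative
        (\<lambda>v. frechet_derivative f (at x) v * frechet_derivative h (at (f x)) 1)) (at x)" .
  next
    fix b :: 'a assume "b \<in> Basis"
    have "Ck_fun k (\<lambda>t. frechet_derivative h (at t) 1)"
      by (rule Ck_fun_SucD(2)[OF Suc.prems(1)]) simp
    from Suc.IH[OF this Ck_fun_Suc_imp[OF Suc.prems(2)]]
    show "Ck_fun k (\<lambda>x. frechet_derivative f (at x) b * frechet_derivative h (at (f x)) 1)"
      by (intro Ck_fun_mult Ck_fun_SucD(2)[OF Suc.prems(2)] \<open>b \<in> Basis\<close>)
  qed
qed

lemma Ck_fun_inner: "Ck_fun k (\<lambda>x::'a::euclidean_space. x \<bullet> c)"
proof (cases k)
  case (Suc j)
  show ?thesis unfolding Suc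
    by (rule Ck_fun_SucI[where f' = "\<lambda>_ h. h \<bullet> c"])
       (auto intro!: bounded_linear_imp_has_derivative bounded_linear_inner_left)
qed (auto intro: continuous_intros)

lemma Ck_fun_dist_square: "Ck_fun k (\<lambda>x::'a::euclidean_space. (dist x a)\<^sup>2)"
proof -
  have "(dist x a)\<^sup>2 = (\<Sum>b\<in>Basis. (x \<bullet> b - a \<bullet> b) * (x \<bullet> b - a \<bullet> b))" for x
    unfolding dist_norm power2_norm_eq_inner
    by (subst euclidean_inner) (simp add: inner_diff_left)
  then show ?thesis
    by (auto intro!: Ck_fun_sum Ck_fun_mult Ck_fun_diff Ck_fun_inner)
qed

text \<open>The smooth function exp(-1/t), extended by 0, is the case \<open>m = 0\<close>. Its
  derivatives produce further negative powers of t; the family over all \<open>m\<close> is closed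
  under differentiation up to linear combinations, so that one induction gives smoothness.\<close>

definition exp_inv :: "nat \<Rightarrow> real \<Rightarrow> real" where
  "exp_inv m t = (if t \<le> 0 then 0 else exp (- 1 / t) / t ^ m)"

text \<open>In the variable 1/t this is the fact that the exponential beats every power.\<close>

lemma exp_inv_tendsto_0: "(exp_inv m \<longlongrightarrow> 0) (at 0)"
proof -
  have "((\<lambda>t::real. exp (- 1 / t) / t ^ m) \<longlongrightarrow> 0) (at_right 0)"
  proof -
    have "((\<lambda>y::real. y ^ m / exp y) \<longlongrightarrow> 0) at_top"
      by (rule tendsto_power_div_exp_0)
    then have "((\<lambda>t::real. (inverse t) ^ m / exp (inverse t)) \<longlongrightarrow> 0) (at_right 0)"
      by (rule filterlim_compose[OF _ filterlim_inverse_at_top_right])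
    moreover have "(inverse t) ^ m / exp (inverse t) = exp (- 1 / t) / t ^ m" for t :: real
      by (simp add: divide_inverse exp_minus power_inverse)
    ultimately show ?thesis by simp
  qed
  moreover have "\<forall>\<^sub>F t in at_right (0::real). exp (- 1 / t) / t ^ m = exp_inv m t"
    by (auto simp: eventually_at_filter exp_inv_def)
  ultimately have "(exp_inv m \<longlongrightarrow> 0) (at_right 0)"
    by (rule Lim_transform_eventually)
  moreover have "(exp_inv m \<longlongrightarrow> 0) (at_left 0)"
    by (rule Lim_transform_eventually[OF tendsto_const])
       (auto simp: eventually_at_filter exp_inv_def)
  ultimately show ?thesis
    by (simp add: filterlim_split_at)
qed

lemma exp_inv_has_field_derivative:
  "(exp_inv m has_field_derivative (exp_inv (m + 2) t - m * exp_inv (Suc m) t)) (at t)"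
proof (cases t "0 :: real" rule: linorder_cases)
  case less
  have "((\<lambda>_. 0) has_field_derivative 0) (at t)" by simp
  then have "(exp_inv m has_field_derivative 0) (at t)"
    by (rule DERIV_cong_ev[THEN iffD1, rotated -1])
       (use less eventually_nhds_in_open[of "{..<0}" t] in \<open>auto elim!: eventually_mono simp: exp_inv_def\<close>)
  then show ?thesis using less by (simp add: exp_inv_def)
next
  case equal
  \<comment> \<open>The difference quotient of \<open>exp_inv m\<close> at 0 is
    \<open>exp_inv (Suc m)\<close> itself.\<close>
  have "((\<lambda>h. (exp_inv m (0 + h) - exp_inv m 0) / h) \<longlongrightarrow> 0) (at 0)"
    by (rule Lim_transform_eventually[OF exp_inv_tendsto_0[of "Suc m"]])
       (auto simp: exp_inv_def eventually_at_filter mult.commute)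
  then have "(exp_inv m has_field_derivative 0) (at 0)"
    by (simp add: has_field_derivative_def DERIV_def field_has_derivative_at)
  then show ?thesis using equal by (simp add: exp_inv_def)
next
  case greater
  have "((\<lambda>t. exp (- 1 / t) / t ^ m) has_field_derivative
      (exp (-1/t) * (1 / t^2) * t ^ m - exp (-1/t) * (m * t ^ (m - 1))) / (t ^ m * t ^ m)) (at t)"
    using greater by (auto intro!: derivative_eq_intros simp: power2_eq_square)
  \<comment> \<open>The case \<open>m = 0\<close> is separate because \<open>m - 1\<close> is
    truncated subtraction; its factor \<open>m\<close> is 0 then.\<close>
  also have "(exp (-1/t) * (1 / t^2) * t ^ m - exp (-1/t) * (m * t ^ (m - 1))) / (t ^ m * t ^ m)
      = exp (-1/t) / t ^ (m + 2) - m * (exp (-1/t) / t ^ Suc m)"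
    using greater by (cases m) (auto simp: field_simps power2_eq_square)
  finally have "(exp_inv m has_field_derivative (exp (-1/t) / t ^ (m + 2) - m * (exp (-1/t) / t ^ Suc m))) (at t)"
    by (rule DERIV_cong_ev[THEN iffD1, rotated -1])
       (use greater eventually_nhds_in_open[of "{0<..}" t] in \<open>auto elim!: eventually_mono simp: exp_inv_def\<close>)
  then show ?thesis using greater by (simp add: exp_inv_def)
qed

lemma Ck_fun_exp_inv: "Ck_fun k (exp_inv m)"
proof (induction k arbitrary: m)
  case 0
  have "continuous (at t) (exp_inv m)" for t
    using exp_inv_has_field_derivative DERIV_isCont by blast
  then show ?case by (simp add: continuous_on_eq_continuous_at)
next
  case (Suc k)
  show ?case
  proof (rule Ck_fun_SucI)
    show "(exp_inv m has_derivative (\<lambda>h. (exp_inv (m + 2) t - m * exp_inv (Suc m) t) * h)) (at t)" for t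
      using exp_inv_has_field_derivative[of m t] by (simp add: has_field_derivative_def)
  qed (intro Ck_fun_mult Ck_fun_diff Suc Ck_fun_const)
qed

text \<open>No mollification: finitely many balls inside \<open>U\<close> cover \<open>K\<close>,
  and a sum of bumps gives a smooth \<open>g\<close> that is positive exactly on their union. By
  compactness \<open>g \<ge> c > 0\<close> on \<open>K\<close>, and the quotient of
  \<open>exp_inv 0 (g x)\<close> by \<open>exp_inv 0 (g x) + exp_inv 0 (c - g x)\<close> is 1 where
  \<open>g \<ge> c\<close> and 0 where \<open>g = 0\<close>.\<close>

lemma smooth_cutoff:
  fixes K U :: "'a::euclidean_space set"
  assumes "compact K" "open U" "K \<subseteq> U"
  obtains \<phi> where "\<phi> \<in> test_functions" "\<And>x. 0 \<le> \<phi> x" "\<And>x. \<phi> x \<le> 1"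
    "\<And>x. x \<in> K \<Longrightarrow> \<phi> x = 1" "\<And>x. x \<notin> U \<Longrightarrow> \<phi> x = 0"
proof -
  have "\<exists>r>0. ball x r \<subseteq> U" if "x \<in> K" for x
    using assms that open_contains_ball by blast
  then obtain r where r: "\<And>x. x \<in> K \<Longrightarrow> r x > 0 \<and> ball x (r x) \<subseteq> U" by metis
  obtain X where X: "finite X" "X \<subseteq> K" "K \<subseteq> (\<Union>x\<in>X. ball x (r x))"
  proof -
    have "\<exists>X\<subseteq>K. finite X \<and> K \<subseteq> (\<Union>x\<in>X. ball x (r x))"
      by (rule compactE_image[OF assms(1), of K "\<lambda>x. ball x (r x)"]) (use r in auto)
    then show ?thesis using that by auto
  qed
  define g where "g x = (\<Sum>a\<in>X. exp_inv 0 ((r a)\<^sup>2 - (dist x a)\<^sup>2))" for x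
  have exp_inv_nonneg: "exp_inv 0 t \<ge> 0" for t by (simp add: exp_inv_def)
  have exp_inv_pos: "exp_inv 0 t > 0 \<longleftrightarrow> t > 0" for t by (simp add: exp_inv_def)
  have g_nonneg: "g x \<ge> 0" for x unfolding g_def by (intro sum_nonneg exp_inv_nonneg)
  have in_ball: "(r a)\<^sup>2 - (dist x a)\<^sup>2 > 0 \<longleftrightarrow> x \<in> ball a (r a)" if "a \<in> X" for a x
    using r[of a] that X(2) abs_le_square_iff[of "r a" "dist x a"] by (auto simp: dist_commute)
  have g_pos: "g x > 0 \<longleftrightarrow> x \<in> (\<Union>a\<in>X. ball a (r a))" for x
  proof
    assume "g x > 0"
    show "x \<in> (\<Union>a\<in>X. ball a (r a))"
    proof (rule ccontr)
      assume "x \<notin> (\<Union>a\<in>X. ball a (r a))"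
      then have "exp_inv 0 ((r a)\<^sup>2 - (dist x a)\<^sup>2) = 0" if "a \<in> X" for a
        using in_ball[OF that, of x] that by (auto simp: exp_inv_def)
      then have "g x = 0" by (simp add: g_def)
      with \<open>g x > 0\<close> show False by simp
    qed
  next
    assume "x \<in> (\<Union>a\<in>X. ball a (r a))"
    then obtain a where "a \<in> X" "x \<in> ball a (r a)" by blast
    then have "exp_inv 0 ((r a)\<^sup>2 - (dist x a)\<^sup>2) > 0" using in_ball exp_inv_pos by blast
    then show "g x > 0" unfolding g_def
      by (intro sum_pos2[OF X(1) \<open>a \<in> X\<close>] exp_inv_nonneg)
  qed
  have Ck_g: "Ck_fun k g" for k
    unfolding g_def
    by (intro Ck_fun_sum Ck_fun_compose[OF Ck_fun_exp_inv] Ck_fun_diff Ck_fun_const Ck_fun_dist_square)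
  have "\<exists>c>0. \<forall>x\<in>K. g x \<ge> c"
  proof (cases "K = {}")
    case False
    obtain x where "x \<in> K" "\<forall>y\<in>K. g x \<le> g y"
      using continuous_attains_inf[OF assms(1) False, of g] Ck_fun_continuous[OF Ck_g]
        continuous_on_subset by blast
    then show ?thesis using g_pos X(3) by blast
  qed (auto intro: exI[of _ 1])
  then obtain c where c: "c > 0" "\<And>x. x \<in> K \<Longrightarrow> g x \<ge> c" by blast
  define D where "D x = exp_inv 0 (g x) + exp_inv 0 (c - g x)" for x
  define \<phi> where "\<phi> x = exp_inv 0 (g x) * inverse (D x)" for x
  \<comment> \<open>If \<open>g x\<close> is not positive, then \<open>c - g x\<close> is.\<close>
  have D_pos: "D x > 0" for x
    using exp_inv_pos[of "g x"] exp_inv_pos[of "c - g x"] exp_inv_nonneg[of "g x"]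
      exp_inv_nonneg[of "c - g x"] c(1) unfolding D_def
    by (cases "g x > 0") (auto intro: add_pos_nonneg add_nonneg_pos)
  have "Ck_fun k D" for k
    unfolding D_def
    by (intro Ck_fun_add Ck_fun_compose[OF Ck_fun_exp_inv] Ck_fun_diff Ck_fun_const Ck_g)
  then have Ck: "Ck_fun k \<phi>" for k
    unfolding \<phi>_def using D_pos
    by (intro Ck_fun_mult Ck_fun_inverse Ck_fun_compose[OF Ck_fun_exp_inv] Ck_g)
       (auto simp: less_le)
  have zero: "\<phi> x = 0" if "x \<notin> (\<Union>a\<in>X. ball a (r a))" for x
  proof -
    have "g x = 0" using g_pos[of x] g_nonneg[of x] that by linarith
    then show ?thesis by (simp add: \<phi>_def exp_inv_def)
  qed
  \<comment> \<open>The support is bounded because it lies in finitely many balls, even when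
    \<open>U\<close> is the whole space.\<close>
  have "bounded {x. \<phi> x \<noteq> 0}"
  proof (rule bounded_subset)
    show "bounded (\<Union>a\<in>X. ball a (r a))" using X(1) by auto
    show "{x. \<phi> x \<noteq> 0} \<subseteq> (\<Union>a\<in>X. ball a (r a))" using zero by blast
  qed
  then have cpt: "compact (closure {x. \<phi> x \<noteq> 0})" by simp
  show ?thesis
  proof (rule that)
    show "\<phi> \<in> test_functions" using Ck cpt by (simp add: test_functions_def)
    show "0 \<le> \<phi> x" "\<phi> x \<le> 1" for x
      using D_pos[of x] exp_inv_nonneg[of "g x"] exp_inv_nonneg[of "c - g x"]
      by (auto simp: \<phi>_def field_simps D_def)
    show "\<phi> x = 1" if "x \<in> K" for x
    proof -
      have "exp_inv 0 (c - g x) = 0" using c(2)[OF that] by (simp add: exp_inv_def)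
      then show ?thesis using D_pos[of x] by (simp add: \<phi>_def D_def)
    qed
    show "\<phi> x = 0" if "x \<notin> U" for x
      using zero that r X(2) by blast
  qed
qed

lemma test_functions_mult:
  assumes "\<phi> \<in> test_functions" "\<psi> \<in> test_functions"
  shows "(\<lambda>x. \<phi> x * \<psi> x) \<in> test_functions"
proof -
  have "compact (closure {x. \<phi> x * \<psi> x \<noteq> 0})"
    using assms(1) unfolding test_functions_def
    by (metis (mono_tags, lifting) bounded_closure bounded_subset closure_subset compact_closure compact_imp_bounded mem_Collect_eq mult_eq_0_iff subsetI)
  then show ?thesis
    using assms by (auto simp: test_functions_def intro: Ck_fun_mult)
qed

lemma test_functions_add:
  assumes "\<phi> \<in> test_functions" "\<psi> \<in> test_functions"
  shows "(\<lambda>x. \<phi> x + \<psi> x) \<in> test_functions"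
proof -
  have "bounded ({x. \<phi> x \<noteq> 0} \<union> {x. \<psi> x \<noteq> 0})"
    using assms by (auto simp: test_functions_def)
  then have "bounded {x. \<phi> x + \<psi> x \<noteq> 0}"
    by (rule bounded_subset) auto
  then show ?thesis
    using assms by (auto simp: test_functions_def intro: Ck_fun_add)
qed

lemma test_functions_cmult:
  assumes "\<phi> \<in> test_functions"
  shows "(\<lambda>x. c * \<phi> x) \<in> test_functions"
proof -
  have "bounded {x. \<phi> x \<noteq> 0}"
    using assms by (auto simp: test_functions_def)
  then have "bounded {x. c * \<phi> x \<noteq> 0}"
    by (rule bounded_subset) auto
  then show ?thesis
    using assms by (auto simp: test_functions_def intro: Ck_fun_mult)
qed

lemma test_functions_bounded:
  assumes "\<phi> \<in> test_functions"
  obtains B where "\<And>x. \<bar>\<phi> x\<bar> \<le> B"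
proof -
  have "compact (closure {x. \<phi> x \<noteq> 0})" "continuous_on (closure {x. \<phi> x \<noteq> 0}) \<phi>"
    using assms Ck_fun_continuous[of 0 \<phi>] continuous_on_subset
    by (auto simp: test_functions_def)
  then have "bounded (\<phi> ` closure {x. \<phi> x \<noteq> 0})"
    using compact_continuous_image compact_imp_bounded by blast
  then obtain B where B: "\<And>x. x \<in> closure {x. \<phi> x \<noteq> 0} \<Longrightarrow> \<bar>\<phi> x\<bar> \<le> B"
    by (auto simp: bounded_iff)
  have "\<bar>\<phi> x\<bar> \<le> max B 0" for x
    using B[of x] closure_subset[of "{x. \<phi> x \<noteq> 0}"] by (cases "\<phi> x = 0") (auto simp: max.coboundedI1)
  then show ?thesis using that by blast
qed

text \<open>The partial derivatives are continuous and vanish off the compact support, hence are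
  bounded; the mean value inequality on the convex whole space does the rest.\<close>

lemma test_functions_lipschitz:
  fixes \<phi> :: "'a::euclidean_space \<Rightarrow> real"
  assumes "\<phi> \<in> test_functions"
  obtains L where "0 \<le> L" "\<And>x y. \<bar>\<phi> x - \<phi> y\<bar> \<le> L * norm (x - y)"
proof -
  define K where "K = closure {x. \<phi> x \<noteq> 0}"
  have Ck: "Ck_fun (Suc k) \<phi>" for k using assms by (auto simp: test_functions_def simp del: Ck_fun.simps)
  have K: "compact K" using assms by (auto simp: test_functions_def K_def)
  let ?d = "\<lambda>x. frechet_derivative \<phi> (at x)"
  note D = Ck_fun_SucD(1)[OF Ck]
  \<comment> \<open>The complement of the closed support is open, so the function is constant near
    such a point.\<close>
  have zero: "?d x = (\<lambda>_. 0)" if "x \<notin> K" for x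
  proof -
    have op: "open (- K)" "x \<in> - K" using that by (auto simp: K_def)
    have eq: "0 = \<phi> y" if "y \<in> - K" for y
    proof -
      have "y \<notin> {x. \<phi> x \<noteq> 0}" using that closure_subset[of "{x. \<phi> x \<noteq> 0}"] by (auto simp: K_def)
      then show ?thesis by simp
    qed
    have "(\<phi> has_derivative (\<lambda>_. 0)) (at x)"
      by (rule has_derivative_transform_within_open[OF has_derivative_const op eq])
    from frechet_derivative_at[OF this] show ?thesis by simp
  qed
  have "\<exists>B. \<forall>x. \<bar>?d x b\<bar> \<le> B" if "b \<in> Basis" for b
  proof -
    have "continuous_on K (\<lambda>x. ?d x b)"
      using Ck_fun_continuous[OF Ck_fun_SucD(2)[OF Ck that, of 0]] continuous_on_subset by blast
    then have "bounded ((\<lambda>x. ?d x b) ` K)"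
      using K compact_continuous_image compact_imp_bounded by blast
    then obtain B where B: "\<And>x. x \<in> K \<Longrightarrow> \<bar>?d x b\<bar> \<le> B"
      by (auto simp: bounded_iff)
    have "\<bar>?d x b\<bar> \<le> max B 0" for x
      using B[of x] zero[of x] by (cases "x \<in> K") (auto simp: max.coboundedI1)
    then show ?thesis by blast
  qed
  then obtain B where B: "\<And>b x. b \<in> Basis \<Longrightarrow> \<bar>?d x b\<bar> \<le> B b" by metis
  define L where "L = (\<Sum>b\<in>Basis. B b)"
  have "onorm (?d x) \<le> L" for x
  proof (rule onorm_le)
    fix h :: 'a
    have lin: "linear (?d x)" using D has_derivative_linear by blast
    have "?d x h = ?d x (\<Sum>b\<in>Basis. (h \<bullet> b) *\<^sub>R b)" by (simp add: euclidean_representation)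
    also have "\<dots> = (\<Sum>b\<in>Basis. (h \<bullet> b) * ?d x b)"
      using lin by (simp add: linear_sum linear_cmul)
    finally have "norm (?d x h) \<le> (\<Sum>b\<in>Basis. norm ((h \<bullet> b) * ?d x b))"
      by (simp only: norm_sum)
    also have "\<dots> \<le> (\<Sum>b\<in>Basis. norm h * B b)"
      by (intro sum_mono) (auto simp: abs_mult intro!: mult_mono B Basis_le_norm)
    finally show "norm (?d x h) \<le> L * norm h" by (simp add: L_def sum_distrib_left mult.commute)
  qed
  then have lip: "\<bar>\<phi> x - \<phi> y\<bar> \<le> L * norm (x - y)" for x y
    using differentiable_bound[OF convex_UNIV, of \<phi> ?d L x y] D by simp
  have "0 \<le> B b" if "b \<in> Basis" for b
    using order_trans[OF abs_ge_zero B[OF that, of 0]] .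
  then have "0 \<le> L" unfolding L_def by (rule sum_nonneg)
  then show ?thesis using lip by (rule that)
qed

section \<open>Weak limits of bounded sequences of measures\<close>

definition C0_functions :: "('a::euclidean_space \<Rightarrow> real) set" where
  "C0_functions = {f. continuous_on UNIV f \<and> (f \<longlongrightarrow> 0) at_infinity}"

lemma C0_functions_add:
  "f \<in> C0_functions \<Longrightarrow> g \<in> C0_functions \<Longrightarrow> (\<lambda>x. f x + g x) \<in> C0_functions"
  by (auto simp: C0_functions_def intro: continuous_intros tendsto_add_zero)

lemma C0_functions_cmult: "f \<in> C0_functions \<Longrightarrow> (\<lambda>x. c * f x) \<in> C0_functions"
  by (auto simp: C0_functions_def intro: continuous_intros tendsto_mult_right_zero)

lemma C0_functions_diff:
  assumes "f \<in> C0_functions" "g \<in> C0_functions"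
  shows "(\<lambda>x. f x - g x) \<in> C0_functions"
  using C0_functions_add[OF assms(1) C0_functions_cmult[OF assms(2), of "-1"]] by simp

lemma C0_functions_zero: "(\<lambda>_. 0) \<in> C0_functions"
  by (simp add: C0_functions_def)

lemma C0_functions_dominated:
  assumes "f \<in> C0_functions" "continuous_on UNIV g" "\<And>x. \<bar>g x\<bar> \<le> c * \<bar>f x\<bar>"
  shows "g \<in> C0_functions"
proof -
  have "((\<lambda>x. c * f x) \<longlongrightarrow> 0) at_infinity"
    using assms(1) by (auto simp: C0_functions_def intro: tendsto_mult_right_zero)
  then have "((\<lambda>x. \<bar>c * f x\<bar>) \<longlongrightarrow> 0) at_infinity"
    by (rule tendsto_rabs_zero)
  then have "(g \<longlongrightarrow> 0) at_infinity"
  proof (rule Lim_null_comparison[rotated], intro always_eventually allI)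
    fix x
    have "\<bar>g x\<bar> \<le> c * \<bar>f x\<bar>" by (rule assms(3))
    also have "\<dots> \<le> \<bar>c * f x\<bar>" by (simp add: abs_mult mult_right_mono)
    finally show "norm (g x) \<le> \<bar>c * f x\<bar>" by simp
  qed
  then show ?thesis using assms(2) by (simp add: C0_functions_def)
qed

lemma C0_functions_compact_superlevel:
  assumes "f \<in> C0_functions" "0 < \<epsilon>"
  shows "compact {x. \<epsilon> \<le> \<bar>f x\<bar>}"
proof -
  have "closed {x. \<epsilon> \<le> \<bar>f x\<bar>}"
    using assms(1) by (intro closed_Collect_le continuous_intros) (auto simp: C0_functions_def)
  moreover have "bounded {x. \<epsilon> \<le> \<bar>f x\<bar>}"
  proof -
    have "\<forall>\<^sub>F x in at_infinity. dist (f x) 0 < \<epsilon>"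
      using assms by (intro tendstoD) (auto simp: C0_functions_def)
    then obtain b where "\<And>x. norm x \<ge> b \<Longrightarrow> \<bar>f x\<bar> < \<epsilon>"
      by (auto simp: eventually_at_infinity)
    then have "norm x \<le> b" if "\<epsilon> \<le> \<bar>f x\<bar>" for x
      using that by (meson linorder_not_less nle_le)
    then show ?thesis by (auto simp: bounded_iff)
  qed
  ultimately show ?thesis by (simp add: compact_eq_bounded_closed)
qed

lemma C0_functions_bounded:
  assumes "f \<in> C0_functions"
  obtains B where "\<And>x. \<bar>f x\<bar> \<le> B" "0 < B"
proof -
  have "compact {x. 1 \<le> \<bar>f x\<bar>}" using C0_functions_compact_superlevel[OF assms] by simp
  moreover have "continuous_on {x. 1 \<le> \<bar>f x\<bar>} f"
    using assms continuous_on_subset[of UNIV f] by (auto simp: C0_functions_def)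
  ultimately have "bounded (f ` {x. 1 \<le> \<bar>f x\<bar>})"
    using compact_continuous_image compact_imp_bounded by blast
  then obtain B where B: "\<And>x. 1 \<le> \<bar>f x\<bar> \<Longrightarrow> \<bar>f x\<bar> \<le> B" by (auto simp: bounded_iff)
  have "\<bar>f x\<bar> \<le> max B 1" for x using B[of x] by linarith
  then show ?thesis using that[of "max B 1"] by simp
qed

lemma integrable_C0_functions:
  fixes M :: "'a::euclidean_space measure"
  assumes "finite_measure M" "sets M = sets borel" "f \<in> C0_functions"
  shows "integrable M f"
proof -
  interpret finite_measure M by fact
  obtain B where "\<And>x. \<bar>f x\<bar> \<le> B" using C0_functions_bounded[OF assms(3)] by blast
  moreover have "f \<in> borel_measurable M"
    using assms borel_measurable_continuous_onI measurable_cong_sets[OF assms(2) refl]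
    by (auto simp: C0_functions_def)
  ultimately show ?thesis by (intro integrable_const_bound[of _ B]) auto
qed

section \<open>Riesz representation of positive functionals on \<open>C0_functions\<close>\<close>

lemma layer_cake:
  fixes a b :: "nat \<Rightarrow> real"
  assumes "\<And>j. j < n \<Longrightarrow> c (Suc j) \<le> a j \<and> a j \<le> c j" "\<And>j. j < n \<Longrightarrow> c (Suc j) \<le> b j \<and> b j \<le> c j"
  shows "\<bar>(\<Sum>j<n. a j) - (\<Sum>j<n. b j)\<bar> \<le> c 0 - c n"
  using assms
proof (induction n)
  case (Suc n)
  then have "\<bar>(\<Sum>j<n. a j) - (\<Sum>j<n. b j)\<bar> \<le> c 0 - c n" by simp
  moreover have "\<bar>a n - b n\<bar> \<le> c n - c (Suc n)" using Suc.prems[of n] by auto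
  ultimately show ?case by simp
qed simp

text \<open>The j-th summand is the part of t between the heights j and j + 1.\<close>

lemma layer_sum:
  fixes t :: real
  assumes "0 \<le> t" "t \<le> real n"
  shows "(\<Sum>j<n. max 0 (min 1 (t - real j))) = t"
  using assms
proof (induction n)
  case (Suc n)
  show ?case
  proof (cases "t \<le> real n")
    case True then show ?thesis using Suc by simp
  next
    case False
    then have "(\<Sum>j<n. max 0 (min 1 (t - real j))) = (\<Sum>j<n. 1)"
      by (intro sum.cong) (auto simp: min_def max_def)
    then show ?thesis using False Suc.prems by (simp add: min_def max_def)
  qed
qed simp

locale positive_C0_functional =
  fixes L :: "('a::euclidean_space \<Rightarrow> real) \<Rightarrow> real" and C :: real
  assumes add: "f \<in> C0_functions \<Longrightarrow> g \<in> C0_functions \<Longrightarrow> L (\<lambda>x. f x + g x) = L f + L g"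
    and cmult: "f \<in> C0_functions \<Longrightarrow> L (\<lambda>x. c * f x) = c * L f"
    and nonneg: "f \<in> C0_functions \<Longrightarrow> (\<And>x. 0 \<le> f x) \<Longrightarrow> 0 \<le> L f"
    and bound: "f \<in> C0_functions \<Longrightarrow> (\<And>x. 0 \<le> f x) \<Longrightarrow> (\<And>x. f x \<le> 1) \<Longrightarrow> L f \<le> C"
begin

lemma L_zero: "L (\<lambda>_. 0) = 0"
  using cmult[OF C0_functions_zero, of 0] by simp

lemma C_nonneg: "0 \<le> C"
  using bound[OF C0_functions_zero] L_zero by simp

lemma L_diff:
  assumes "f \<in> C0_functions" "g \<in> C0_functions"
  shows "L (\<lambda>x. f x - g x) = L f - L g"
  using add[OF assms(1) C0_functions_cmult[OF assms(2), of "-1"]] cmult[OF assms(2), of "-1"] by simp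

lemma L_mono:
  assumes "f \<in> C0_functions" "g \<in> C0_functions" "\<And>x. f x \<le> g x"
  shows "L f \<le> L g"
  using nonneg[OF C0_functions_diff[OF assms(2,1)]] L_diff[OF assms(2,1)] assms(3) by simp

lemma L_sum:
  assumes "\<And>i. i \<in> I \<Longrightarrow> f i \<in> C0_functions"
  shows "L (\<lambda>x. \<Sum>i\<in>I. f i x) = (\<Sum>i\<in>I. L (f i)) \<and> (\<lambda>x. \<Sum>i\<in>I. f i x) \<in> C0_functions"
  using assms
  by (induction I rule: infinite_finite_induct)
     (auto simp: L_zero C0_functions_zero add intro: C0_functions_add)

text \<open>Vanishing off \<open>U\<close> replaces the usual compact support inside
  \<open>U\<close>. The missing compactness is restored by \<open>truncate_sub\<close>.\<close>

definition sub :: "'a set \<Rightarrow> ('a \<Rightarrow> real) set" where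
  "sub U = {f \<in> C0_functions. (\<forall>x. 0 \<le> f x \<and> f x \<le> 1) \<and> (\<forall>x. x \<notin> U \<longrightarrow> f x = 0)}"

text \<open>The value that a representing measure is forced to take on open sets.\<close>

definition lam :: "'a set \<Rightarrow> ennreal" where
  "lam U = (SUP f\<in>sub U. ennreal (L f))"

definition outer :: "'a set \<Rightarrow> ennreal" where
  "outer A = (INF U\<in>{U. open U \<and> A \<subseteq> U}. lam U)"

lemma L_nonneg_sub: "f \<in> sub U \<Longrightarrow> 0 \<le> L f"
  by (auto simp: sub_def intro: nonneg)

lemma zero_in_sub: "(\<lambda>_. 0) \<in> sub U"
  using C0_functions_zero by (simp add: sub_def)

lemma L_le_lam: "f \<in> sub U \<Longrightarrow> ennreal (L f) \<le> lam U"
  unfolding lam_def by (rule SUP_upper)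

lemma lam_le: "(\<And>f. f \<in> sub U \<Longrightarrow> ennreal (L f) \<le> c) \<Longrightarrow> lam U \<le> c"
  unfolding lam_def by (rule SUP_least)

lemma lam_mono: "U \<subseteq> V \<Longrightarrow> lam U \<le> lam V"
  by (rule lam_le, rule L_le_lam) (auto simp: sub_def)

lemma lam_bound: "lam U \<le> ennreal C"
  by (rule lam_le) (auto simp: sub_def intro!: ennreal_leI bound)

lemma lam_empty: "lam {} = 0"
proof -
  have "lam {} \<le> 0"
  proof (rule lam_le)
    fix f assume "f \<in> sub {}"
    then have "f = (\<lambda>_. 0)" by (auto simp: sub_def)
    then show "ennreal (L f) \<le> 0" using L_zero by simp
  qed
  then show ?thesis by simp
qed

text \<open>What is cut off is \<open>min (f x) \<epsilon>\<close>, that is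
  \<open>\<epsilon>\<close> times a function with values in [0,1], so it costs at most
  \<open>\<epsilon> * C\<close>. What remains is 0 wherever f is below \<open>\<epsilon>\<close>,
  and the superlevel set of f is a compact subset of \<open>U\<close>.\<close>

lemma truncate_sub:
  assumes "f \<in> sub U" "0 < \<epsilon>"
  shows "(\<lambda>x. max (f x - \<epsilon>) 0) \<in> sub U" "L f \<le> L (\<lambda>x. max (f x - \<epsilon>) 0) + \<epsilon> * C"
proof -
  have f: "f \<in> C0_functions" "\<And>x. 0 \<le> f x" "\<And>x. f x \<le> 1" "\<And>x. x \<notin> U \<Longrightarrow> f x = 0"
    using assms(1) by (auto simp: sub_def)
  then have cont: "continuous_on UNIV f" by (auto simp: C0_functions_def)
  have t: "(\<lambda>x. max (f x - \<epsilon>) 0) \<in> C0_functions"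
  proof (rule C0_functions_dominated[OF f(1), of _ 1])
    show "\<bar>max (f x - \<epsilon>) 0\<bar> \<le> 1 * \<bar>f x\<bar>" for x
      using f(2)[of x] assms(2) by simp
  qed (intro continuous_intros cont)
  then show "(\<lambda>x. max (f x - \<epsilon>) 0) \<in> sub U"
    using f assms(2) by (auto simp: sub_def max_def) (meson add_increasing2 diff_le_eq f(3) less_imp_le order_trans)
  have m: "(\<lambda>x. min (f x) \<epsilon> / \<epsilon>) \<in> C0_functions"
  proof (rule C0_functions_dominated[OF f(1), of _ "1 / \<epsilon>"])
    show "\<bar>min (f x) \<epsilon> / \<epsilon>\<bar> \<le> 1 / \<epsilon> * \<bar>f x\<bar>" for x
      using f(2)[of x] assms(2) by (simp add: divide_right_mono)
  qed (use assms(2) in \<open>intro continuous_intros cont; simp\<close>)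
  have "L (\<lambda>x. max (f x - \<epsilon>) 0 + \<epsilon> * (min (f x) \<epsilon> / \<epsilon>)) = L (\<lambda>x. max (f x - \<epsilon>) 0) + \<epsilon> * L (\<lambda>x. min (f x) \<epsilon> / \<epsilon>)"
    using add[OF t C0_functions_cmult[OF m, of \<epsilon>]] cmult[OF m, of \<epsilon>] by (simp only:)
  moreover have "(\<lambda>x. max (f x - \<epsilon>) 0 + \<epsilon> * (min (f x) \<epsilon> / \<epsilon>)) = f"
    using assms(2) by (auto simp: fun_eq_iff max_def min_def)
  moreover have "L (\<lambda>x. min (f x) \<epsilon> / \<epsilon>) \<le> C"
    by (rule bound[OF m]) (use f(2) assms(2) in \<open>auto simp: min_def\<close>)
  ultimately show "L f \<le> L (\<lambda>x. max (f x - \<epsilon>) 0) + \<epsilon> * C"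
    using mult_left_mono[of _ C \<epsilon>] assms(2) by fastforce
qed

text \<open>A Urysohn function \<open>g\<close>, equal to 1 on the part of the superlevel set
  outside \<open>V\<close> and to 0 off \<open>U\<close>, splits the truncated f into a part living
  in \<open>U\<close> and a part living in \<open>V\<close>.\<close>

lemma lam_Un:
  assumes "open U" "open V"
  shows "lam (U \<union> V) \<le> lam U + lam V"
proof (rule lam_le)
  fix f assume f: "f \<in> sub (U \<union> V)"
  show "ennreal (L f) \<le> lam U + lam V"
  proof (rule ennreal_le_epsilon)
    fix e :: real assume "0 < e"
    \<comment> \<open>Adding 1 covers the case \<open>C = 0\<close>.\<close>
    define \<epsilon> where "\<epsilon> = e / (C + 1)"
    have \<epsilon>: "\<epsilon> > 0" "\<epsilon> * C \<le> e" using \<open>0 < e\<close> C_nonneg by (auto simp: \<epsilon>_def field_simps)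
    let ?f = "\<lambda>x. max (f x - \<epsilon>) 0"
    note t = truncate_sub[OF f \<epsilon>(1)]
    have cont: "continuous_on UNIV f" using f by (auto simp: sub_def C0_functions_def)
    define A where "A = {x. \<epsilon> \<le> f x} - V"
    have A: "closed A"
      unfolding A_def using assms
      by (intro closed_Diff closed_Collect_le continuous_intros cont)
    have "A \<inter> (- U) = {}"
      using f \<epsilon>(1) by (auto simp: A_def sub_def)
    then obtain g where g: "continuous_on UNIV g" "\<And>x. g x \<in> closed_segment 1 (0::real)"
        "\<And>x. x \<in> A \<Longrightarrow> g x = 1" "\<And>x. x \<in> - U \<Longrightarrow> g x = 0"
      using Urysohn[OF A, of "- U" 1 "0::real"] assms(1) by (metis closed_Compl)
    have g01: "0 \<le> g x" "g x \<le> 1" for x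
      using g(2)[of x] by (auto simp: closed_segment_eq_real_ivl)
    have f01: "0 \<le> ?f x" "?f x \<le> 1" for x using t(1) by (auto simp: sub_def)
    have f0: "?f \<in> C0_functions" using t(1) by (simp add: sub_def)
    have s1: "(\<lambda>x. g x * ?f x) \<in> sub U"
    proof -
      have "(\<lambda>x. g x * ?f x) \<in> C0_functions"
        by (rule C0_functions_dominated[OF f0, of _ 1])
           (use g01 f01 in \<open>auto intro!: continuous_intros cont g(1) mult_right_le_one_le mult_left_le_one_le simp: abs_mult\<close>)
      then show ?thesis
        using g01 f01 g(4) by (auto simp: sub_def intro!: mult_le_one mult_nonneg_nonneg)
    qed
    have s2: "(\<lambda>x. (1 - g x) * ?f x) \<in> sub V"
    proof -
      have "(\<lambda>x. (1 - g x) * ?f x) \<in> C0_functions"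
        by (rule C0_functions_dominated[OF f0, of _ 1])
           (use g01 f01 in \<open>auto intro!: continuous_intros cont g(1) mult_right_le_one_le mult_left_le_one_le simp: abs_mult\<close>)
      moreover have "(1 - g x) * ?f x = 0" if "x \<notin> V" for x
        using g(3)[of x] that by (cases "\<epsilon> \<le> f x") (auto simp: A_def)
      moreover have "0 \<le> (1 - g x) * ?f x" "(1 - g x) * ?f x \<le> 1" for x
        using g01[of x] f01[of x] by (intro mult_nonneg_nonneg mult_le_one; simp)+
      ultimately show ?thesis unfolding sub_def by blast
    qed
    have "L ?f = L (\<lambda>x. g x * ?f x + (1 - g x) * ?f x)"
      by (simp add: algebra_simps)
    also have "\<dots> = L (\<lambda>x. g x * ?f x) + L (\<lambda>x. (1 - g x) * ?f x)"
      using s1 s2 by (intro add) (auto simp: sub_def)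
    finally have "L f \<le> L (\<lambda>x. g x * ?f x) + L (\<lambda>x. (1 - g x) * ?f x) + e"
      using t(2) \<epsilon>(2) by simp
    then have "ennreal (L f) \<le> ennreal (L (\<lambda>x. g x * ?f x)) + ennreal (L (\<lambda>x. (1 - g x) * ?f x)) + ennreal e"
      using L_nonneg_sub[OF s1] L_nonneg_sub[OF s2] \<open>0 < e\<close>
      by (simp flip: ennreal_plus)
    also have "\<dots> \<le> lam U + lam V + ennreal e"
      by (intro add_mono L_le_lam s1 s2 order_refl)
    finally show "ennreal (L f) \<le> lam U + lam V + ennreal e" .
  qed
qed

lemma lam_UN_finite:
  assumes "\<And>i. open (U i)"
  shows "lam (\<Union>i<(n::nat). U i) \<le> (\<Sum>i<n. lam (U i))"
proof (induction n)
  case (Suc n)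
  have "lam (\<Union>i<Suc n. U i) \<le> lam (\<Union>i<n. U i) + lam (U n)"
    using lam_Un[of "\<Union>i<n. U i" "U n"] assms by (simp add: lessThan_Suc Un_commute open_UN)
  also have "\<dots> \<le> (\<Sum>i<n. lam (U i)) + lam (U n)" by (intro add_mono Suc order_refl)
  finally show ?case by simp
qed (simp add: lam_empty)

text \<open>The superlevel set of f is compact, so the truncated f already lives in finitely many of
  the \<open>U i\<close>.\<close>

lemma lam_UN:
  fixes U :: "nat \<Rightarrow> 'a set"
  assumes "\<And>i. open (U i)"
  shows "lam (\<Union>i. U i) \<le> (\<Sum>i. lam (U i))"
proof (rule lam_le)
  fix f assume f: "f \<in> sub (\<Union>i. U i)"
  show "ennreal (L f) \<le> (\<Sum>i. lam (U i))"
  proof (rule ennreal_le_epsilon)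
    fix e :: real assume "0 < e"
    define \<epsilon> where "\<epsilon> = e / (C + 1)"
    have \<epsilon>: "\<epsilon> > 0" "\<epsilon> * C \<le> e" using \<open>0 < e\<close> C_nonneg by (auto simp: \<epsilon>_def field_simps)
    let ?f = "\<lambda>x. max (f x - \<epsilon>) 0"
    note t = truncate_sub[OF f \<epsilon>(1)]
    have f': "f \<in> C0_functions" using f by (simp add: sub_def)
    have "compact {x. \<epsilon> \<le> \<bar>f x\<bar>}" by (rule C0_functions_compact_superlevel[OF f' \<epsilon>(1)])
    moreover have "{x. \<epsilon> \<le> \<bar>f x\<bar>} \<subseteq> (\<Union>i\<in>UNIV. U i)"
    proof
      fix x assume "x \<in> {x. \<epsilon> \<le> \<bar>f x\<bar>}"
      then have "f x \<noteq> 0" using \<epsilon>(1) by auto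
      then show "x \<in> (\<Union>i\<in>UNIV. U i)" using f by (auto simp: sub_def)
    qed
    ultimately obtain J where J: "finite J" "{x. \<epsilon> \<le> \<bar>f x\<bar>} \<subseteq> (\<Union>i\<in>J. U i)"
      using compactE_image[of _ UNIV U] assms by metis
    obtain n where n: "J \<subseteq> {..<n}" using J(1) finite_nat_iff_bounded by blast
    have "?f x = 0" if "x \<notin> (\<Union>i<n. U i)" for x
      using that J(2) n by (force simp: subset_iff)
    then have "?f \<in> sub (\<Union>i<n. U i)" using t(1) by (auto simp: sub_def)
    then have "ennreal (L ?f) \<le> lam (\<Union>i<n. U i)" by (rule L_le_lam)
    also have "\<dots> \<le> (\<Sum>i<n. lam (U i))" by (rule lam_UN_finite[OF assms])
    also have "\<dots> \<le> (\<Sum>i. lam (U i))" by (rule sum_le_suminf) auto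
    finally have le: "ennreal (L ?f) \<le> (\<Sum>i. lam (U i))" .
    have "ennreal (L f) \<le> ennreal (L ?f + e)"
      using t(2) \<epsilon>(2) by (intro ennreal_leI) simp
    also have "\<dots> = ennreal (L ?f) + ennreal e"
      using L_nonneg_sub[OF t(1)] \<open>0 < e\<close> by simp
    finally show "ennreal (L f) \<le> (\<Sum>i. lam (U i)) + ennreal e"
      using le by (meson add_mono order_refl order_trans)
  qed
qed

lemma outer_le: "open U \<Longrightarrow> A \<subseteq> U \<Longrightarrow> outer A \<le> lam U"
  unfolding outer_def by (rule INF_lower) simp

lemma outer_open: "open U \<Longrightarrow> outer U = lam U"
  unfolding outer_def by (rule antisym) (auto intro!: INF_lower INF_greatest lam_mono)

lemma outer_mono: "A \<subseteq> B \<Longrightarrow> outer A \<le> outer B"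
  unfolding outer_def by (rule INF_superset_mono) auto

lemma outer_approx:
  assumes "0 < e"
  obtains U where "open U" "A \<subseteq> U" "lam U \<le> outer A + ennreal e"
proof -
  have "outer A \<le> lam UNIV" by (rule outer_le) auto
  also have "\<dots> < \<top>" using lam_bound[of UNIV] by (simp add: le_less_trans)
  finally have "outer A < outer A + ennreal e"
    using assms by (cases "outer A") (auto simp flip: ennreal_plus simp: ennreal_less_iff)
  then obtain U where "open U" "A \<subseteq> U" "lam U < outer A + ennreal e"
    unfolding outer_def INF_less_iff[symmetric] by (subst (asm) (1) INF_less_iff) auto
  then show ?thesis using that by (auto intro: less_imp_le)
qed

lemma outer_measure_space_outer: "outer_measure_space UNIV outer"
  unfolding outer_measure_space_def positive_def increasing_def countably_subadditive_def
proof (intro conjI ballI allI impI)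
  show "outer {} = 0" by (simp add: outer_open lam_empty)
next
  fix A B :: "'a set" assume "A \<subseteq> B"
  then show "outer A \<le> outer B" by (rule outer_mono)
next
  fix A :: "nat \<Rightarrow> 'a set"
  show "outer (\<Union>i. A i) \<le> (\<Sum>i. outer (A i))"
  proof (rule ennreal_le_epsilon)
    fix e :: real assume "0 < e"
    have "\<exists>U. open U \<and> A i \<subseteq> U \<and> lam U \<le> outer (A i) + ennreal (e * (1/2) ^ Suc i)" for i
      by (rule outer_approx[of "e * (1/2) ^ Suc i" "A i"]) (use \<open>0 < e\<close> in auto)
    then obtain U where U: "\<And>i. open (U i)" "\<And>i. A i \<subseteq> U i"
        "\<And>i. lam (U i) \<le> outer (A i) + ennreal (e * (1/2) ^ Suc i)" by metis
    have sums: "(\<lambda>i. e * (1/2) ^ Suc i) sums e"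
      using sums_mult[OF power_half_series, of e] by simp
    have "outer (\<Union>i. A i) \<le> lam (\<Union>i. U i)"
      by (intro outer_le open_UN) (use U in auto)
    also have "\<dots> \<le> (\<Sum>i. lam (U i))" by (rule lam_UN[OF U(1)])
    also have "\<dots> \<le> (\<Sum>i. outer (A i) + ennreal (e * (1/2) ^ Suc i))"
      by (intro suminf_le U(3)) auto
    also have "\<dots> = (\<Sum>i. outer (A i)) + (\<Sum>i. ennreal (e * (1/2) ^ Suc i))"
      by (intro suminf_add[symmetric]) auto
    also have "(\<Sum>i. ennreal (e * (1/2) ^ Suc i)) = ennreal e"
      using sums \<open>0 < e\<close> by (intro suminf_ennreal_eq) auto
    finally show "outer (\<Union>i. A i) \<le> (\<Sum>i. outer (A i)) + ennreal e" .
  qed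
qed

lemma outer_Un: "outer (A \<union> B) \<le> outer A + outer B"
proof -
  interpret sigma_algebra UNIV "UNIV :: 'a set set" by (metis Pow_UNIV sigma_algebra_Pow)
  have "subadditive UNIV outer"
    by (rule countably_subadditive_subadditive)
       (use outer_measure_space_outer in \<open>auto simp: outer_measure_space_def\<close>)
  show ?thesis
  proof -
    have "outer (A \<union> (B - A)) \<le> outer A + outer (B - A)"
      by (rule subadditiveD[OF \<open>subadditive UNIV outer\<close>]) simp_all
    also have "\<dots> \<le> outer A + outer B" by (rule add_left_mono) (rule outer_mono, rule Diff_subset)
    finally show ?thesis by simp
  qed
qed

text \<open>This is the inequality behind Caratheodory's condition. After truncation f is 0 on
  \<open>W = U - {x. \<epsilon> \<le> f x}\<close>, an open set that still contains
  \<open>U - V\<close>. Any \<open>g\<close> in \<open>sub W\<close> can be added without exceeding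
  the value 1, and the supremum over g gives \<open>lam W\<close>.\<close>

lemma outer_split_open:
  assumes "open U" "open V"
  shows "outer (U \<inter> V) + outer (U - V) \<le> lam U"
proof -
  have "lam (U \<inter> V) + outer (U - V) \<le> lam U"
  proof -
    have step: "ennreal (L f) + outer (U - V) \<le> lam U + ennreal e" if f: "f \<in> sub (U \<inter> V)" and "0 < e" for f e
    proof -
      define \<epsilon> where "\<epsilon> = e / (C + 1)"
      have \<epsilon>: "\<epsilon> > 0" "\<epsilon> * C \<le> e" using \<open>0 < e\<close> C_nonneg by (auto simp: \<epsilon>_def field_simps)
      let ?f = "\<lambda>x. max (f x - \<epsilon>) 0"
      note t = truncate_sub[OF f \<epsilon>(1)]
      have cont: "continuous_on UNIV f" using f by (auto simp: sub_def C0_functions_def)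
      define W where "W = U - {x. \<epsilon> \<le> f x}"
      have W: "open W" unfolding W_def using assms(1)
        by (intro open_Diff closed_Collect_le continuous_intros cont)
      have "U - V \<subseteq> W" using f \<epsilon>(1) by (auto simp: W_def sub_def)
      then have "ennreal (L ?f) + outer (U - V) \<le> ennreal (L ?f) + lam W"
        by (intro add_mono order_refl outer_le W)
      also have "\<dots> = (SUP g\<in>sub W. ennreal (L ?f) + ennreal (L g))"
        unfolding lam_def
        by (rule ennreal_SUP_add_right) (use zero_in_sub in blast)
      also have "\<dots> \<le> lam U"
      proof (rule SUP_least)
        fix g assume g: "g \<in> sub W"
        have s: "(\<lambda>x. ?f x + g x) \<in> sub U"
        proof -
          have fx: "0 \<le> ?f x" "?f x \<le> 1" "x \<notin> U \<Longrightarrow> ?f x = 0" for x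
            using t(1) by (simp_all add: sub_def)
          have gx: "0 \<le> g x" "g x \<le> 1" "x \<notin> W \<Longrightarrow> g x = 0" for x
            using g by (simp_all add: sub_def)
          have "?f x + g x \<le> 1" for x
            using fx[of x] gx[of x] by (cases "\<epsilon> \<le> f x") (simp_all add: W_def)
          moreover have "?f x + g x = 0" if "x \<notin> U" for x
            using fx(3)[OF that] gx(3)[of x] that by (simp add: W_def)
          moreover have "0 \<le> ?f x + g x" for x
            using fx(1) gx(1) by (rule add_nonneg_nonneg)
          moreover have "(\<lambda>x. ?f x + g x) \<in> C0_functions"
            using t(1) g by (intro C0_functions_add) (auto simp: sub_def)
          ultimately show ?thesis unfolding sub_def by blast
        qed
        have "ennreal (L ?f) + ennreal (L g) = ennreal (L (\<lambda>x. ?f x + g x))"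
          using t(1) g L_nonneg_sub[OF t(1)] L_nonneg_sub[OF g]
          by (subst add) (auto simp: sub_def)
        also have "\<dots> \<le> lam U" by (rule L_le_lam[OF s])
        finally show "ennreal (L ?f) + ennreal (L g) \<le> lam U" .
      qed
      finally have *: "ennreal (L ?f) + outer (U - V) \<le> lam U" .
      have "ennreal (L f) \<le> ennreal (L ?f + e)"
        using t(2) \<epsilon>(2) by (intro ennreal_leI) simp
      also have "\<dots> = ennreal (L ?f) + ennreal e"
        using L_nonneg_sub[OF t(1)] \<open>0 < e\<close> by simp
      finally have "ennreal (L f) + outer (U - V) \<le> (ennreal (L ?f) + ennreal e) + outer (U - V)"
        by (rule add_right_mono)
      also have "\<dots> = (ennreal (L ?f) + outer (U - V)) + ennreal e"
        by (simp add: ac_simps)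
      also have "\<dots> \<le> lam U + ennreal e" using * by (rule add_right_mono)
      finally show ?thesis .
    qed
    have "lam (U \<inter> V) + outer (U - V) = (SUP f\<in>sub (U \<inter> V). ennreal (L f) + outer (U - V))"
      unfolding lam_def
      by (rule ennreal_SUP_add_left[symmetric]) (use zero_in_sub in blast)
    also have "\<dots> \<le> lam U"
    proof (rule SUP_least)
      fix f assume f: "f \<in> sub (U \<inter> V)"
      show "ennreal (L f) + outer (U - V) \<le> lam U"
        by (rule ennreal_le_epsilon) (rule step[OF f])
    qed
    finally show ?thesis .
  qed
  then show ?thesis using assms by (simp add: outer_open open_Int)
qed

text \<open>An arbitrary test set is replaced by an open superset of almost the same outer measure,
  where \<open>outer_split_open\<close> applies.\<close>

lemma open_in_lambda_system:
  assumes "open V"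
  shows "V \<in> lambda_system UNIV UNIV outer"
  unfolding lambda_system_def
proof (intro CollectI conjI ballI UNIV_I antisym)
  fix A :: "'a set"
  show "outer (V \<inter> A) + outer ((UNIV - V) \<inter> A) \<le> outer A"
  proof (rule ennreal_le_epsilon)
    fix e :: real assume "0 < e"
    then obtain U where U: "open U" "A \<subseteq> U" "lam U \<le> outer A + ennreal e"
      using outer_approx by blast
    have "outer (V \<inter> A) + outer ((UNIV - V) \<inter> A) \<le> outer (U \<inter> V) + outer (U - V)"
      by (intro add_mono outer_mono) (use U(2) in auto)
    also have "\<dots> \<le> lam U" by (rule outer_split_open[OF U(1) assms])
    also note U(3)
    finally show "outer (V \<inter> A) + outer ((UNIV - V) \<inter> A) \<le> outer A + ennreal e" .
  qed
next
  fix A :: "'a set"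
  have "(V \<inter> A) \<union> ((UNIV - V) \<inter> A) = A" by blast
  then show "outer A \<le> outer (V \<inter> A) + outer ((UNIV - V) \<inter> A)"
    using outer_Un[of "V \<inter> A" "(UNIV - V) \<inter> A"] by simp
qed

definition rep :: "'a measure" where "rep = measure_of UNIV (sets borel) outer"

lemma sets_rep: "sets rep = sets borel"
  unfolding rep_def using sets.sigma_sets_eq[of "borel :: 'a measure"] by simp

text \<open>The sets satisfying Caratheodory's condition form a sigma-algebra on which
  \<open>outer\<close> is countably additive. It contains the open sets, hence the Borel
  sets.\<close>

lemma emeasure_rep:
  assumes "A \<in> sets borel"
  shows "emeasure rep A = outer A"
proof -
  interpret U: sigma_algebra UNIV "UNIV :: 'a set set" by (metis Pow_UNIV sigma_algebra_Pow)
  have ms: "measure_space UNIV (lambda_system UNIV UNIV outer) outer"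
    by (rule U.caratheodory_lemma[OF outer_measure_space_outer])
  then interpret S: sigma_algebra UNIV "lambda_system UNIV UNIV outer"
    by (simp add: measure_space_def)
  have "sets borel \<subseteq> lambda_system UNIV UNIV outer"
    unfolding borel_def using open_in_lambda_system
    by (auto intro!: S.sigma_sets_subset)
  then have "measure_space UNIV (sets borel) outer"
    using ms sets.sigma_algebra_axioms[of "borel :: 'a measure"]
    by (auto simp: measure_space_def positive_def countably_additive_def)
  then show ?thesis
    unfolding rep_def using assms
    by (intro emeasure_measure_of_sigma) (auto simp: measure_space_def)
qed

lemma emeasure_rep_open: "open U \<Longrightarrow> emeasure rep U = lam U"
  by (simp add: emeasure_rep outer_open)

lemma finite_measure_rep: "finite_measure rep"
proof
  have "space rep = UNIV" using sets_eq_imp_space_eq[OF sets_rep] by simp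
  then have "emeasure rep (space rep) \<le> ennreal C"
    using emeasure_rep_open[of UNIV] lam_bound by simp
  then show "emeasure rep (space rep) \<noteq> \<infinity>" by (auto simp: top_unique)
qed

text \<open>\<open>n * f\<close> is cut into n slices of height 1. The j-th slice lies between the
  indicators of the superlevel sets at heights j + 1 and j, so its value under \<open>L\<close> and
  its integral both lie between \<open>c (Suc j)\<close> and \<open>c j\<close>. By telescoping the
  two sums differ by at most \<open>C\<close>, whence the error for f itself is at most C /
  n.\<close>

lemma L_eq_integral_01:
  assumes f: "f \<in> C0_functions" "\<And>x. 0 \<le> f x" "\<And>x. f x \<le> 1"
  shows "L f = (\<integral>x. f x \<partial>rep)"
proof -
  interpret R: finite_measure rep by (rule finite_measure_rep)
  have space: "space rep = UNIV" using sets_eq_imp_space_eq[OF sets_rep] by simp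
  have cont: "continuous_on UNIV f" using f by (auto simp: C0_functions_def)
  note int = integrable_C0_functions[OF finite_measure_rep sets_rep]
  have key: "real n * \<bar>L f - (\<integral>x. f x \<partial>rep)\<bar> \<le> C" for n
  proof -
    define g where "g j x = max 0 (min 1 (real n * f x - real j))" for j x
    define c where "c j = measure rep {x. real j < real n * f x}" for j
    have op: "open {x. real j < real n * f x}" for j
      by (intro open_Collect_less continuous_intros cont)
    have c_lam: "ennreal (c j) = lam {x. real j < real n * f x}" for j
      unfolding c_def R.emeasure_eq_measure[symmetric] by (rule emeasure_rep_open[OF op])
    have gC: "g j \<in> C0_functions" for j
    proof (rule C0_functions_dominated[OF f(1), of _ "real n"])
      show "\<bar>g j x\<bar> \<le> real n * \<bar>f x\<bar>" for x
        using f(2)[of x] mult_nonneg_nonneg[of "real n" "f x"] by (simp add: g_def)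
      show "continuous_on UNIV (g j)"
        unfolding g_def by (intro continuous_intros cont)
    qed
    have gs: "g j \<in> sub {x. real j < real n * f x}" for j
      using gC by (auto simp: sub_def g_def)
    have nf: "(\<lambda>x. real n * f x) = (\<lambda>x. \<Sum>j<n. g j x)"
      using layer_sum[of "real n * f _" n] f by (auto simp: g_def mult_left_le)
    have g_ge: "g j x = 1" if "real (Suc j) < real n * f x" for j x
      using that by (simp add: g_def)
    have L1: "c (Suc j) \<le> L (g j) \<and> L (g j) \<le> c j" for j
    proof
      have "ennreal (L (g j)) \<le> ennreal (c j)" unfolding c_lam by (rule L_le_lam[OF gs])
      then show "L (g j) \<le> c j" by (simp add: c_def)
      have "ennreal (c (Suc j)) \<le> ennreal (L (g j))"
        unfolding c_lam
      proof (intro lam_le ennreal_leI L_mono gC)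
        fix h x assume h: "h \<in> sub {x. real (Suc j) < real n * f x}"
        then show "h \<in> C0_functions" by (simp add: sub_def)
        show "h x \<le> g j x"
        proof (cases "real (Suc j) < real n * f x")
          case True then show ?thesis using g_ge[OF True] h by (simp add: sub_def)
        next
          case False then show ?thesis using gs[of j] h by (auto simp: sub_def)
        qed
      qed
      then show "c (Suc j) \<le> L (g j)" using L_nonneg_sub[OF gs] by simp
    qed
    have I1: "c (Suc j) \<le> (\<integral>x. g j x \<partial>rep) \<and> (\<integral>x. g j x \<partial>rep) \<le> c j" for j
    proof
      have m: "{x. real j < real n * f x} \<in> sets rep" for j using op by (simp add: sets_rep)
      have ii: "integrable rep (indicat_real {x. real j < real n * f x})" for j
        using m by (simp add: integrable_indicator_iff R.emeasure_eq_measure)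
      have ci: "c j = (\<integral>x. indicat_real {x. real j < real n * f x} x \<partial>rep)" for j
        by (simp add: c_def space)
      show "c (Suc j) \<le> (\<integral>x. g j x \<partial>rep)"
        unfolding ci using g_ge gs[of j]
        by (intro integral_mono ii int gC) (auto simp: indicator_def sub_def)
      show "(\<integral>x. g j x \<partial>rep) \<le> c j"
        unfolding ci using gs[of j]
        by (intro integral_mono ii int gC) (auto simp: indicator_def sub_def)
    qed
    have "real n * L f = (\<Sum>j<n. L (g j))"
      using cmult[OF f(1), of "real n"] L_sum[of "{..<n}" g] gC nf by simp
    moreover have "real n * (\<integral>x. f x \<partial>rep) = (\<Sum>j<n. (\<integral>x. g j x \<partial>rep))"
    proof -
      have "real n * (\<integral>x. f x \<partial>rep) = (\<integral>x. real n * f x \<partial>rep)" by simp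
      also have "\<dots> = (\<integral>x. (\<Sum>j<n. g j x) \<partial>rep)" using nf by simp
      also have "\<dots> = (\<Sum>j<n. (\<integral>x. g j x \<partial>rep))"
        by (rule Bochner_Integration.integral_sum) (rule int[OF gC])
      finally show ?thesis .
    qed
    moreover have "real n * \<bar>L f - (\<integral>x. f x \<partial>rep)\<bar> = \<bar>real n * L f - real n * (\<integral>x. f x \<partial>rep)\<bar>"
      by (simp add: abs_mult flip: right_diff_distrib)
    ultimately have "real n * \<bar>L f - (\<integral>x. f x \<partial>rep)\<bar> = \<bar>(\<Sum>j<n. L (g j)) - (\<Sum>j<n. (\<integral>x. g j x \<partial>rep))\<bar>"
      by (simp only:)
    also have "\<dots> \<le> c 0 - c n" by (intro layer_cake L1 I1)
    also have "\<dots> \<le> C"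
    proof -
      have "ennreal (c 0) \<le> ennreal C" unfolding c_lam by (rule lam_bound)
      then have "c 0 \<le> C" using C_nonneg by simp
      moreover have "0 \<le> c n" by (simp add: c_def)
      ultimately show ?thesis by simp
    qed
    finally show ?thesis .
  qed
  have "\<bar>L f - (\<integral>x. f x \<partial>rep)\<bar> \<le> 0"
  proof (rule ccontr)
    assume "\<not> ?thesis"
    then obtain n where "real n * \<bar>L f - (\<integral>x. f x \<partial>rep)\<bar> > C"
      using reals_Archimedean3[of "\<bar>L f - (\<integral>x. f x \<partial>rep)\<bar>"] by auto
    then show False using key[of n] by simp
  qed
  then show ?thesis by simp
qed

lemma L_eq_integral:
  assumes f: "f \<in> C0_functions"
  shows "L f = (\<integral>x. f x \<partial>rep)"
proof -
  interpret R: finite_measure rep by (rule finite_measure_rep)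
  note int = integrable_C0_functions[OF finite_measure_rep sets_rep]
  obtain B where B: "\<And>x. \<bar>f x\<bar> \<le> B" "0 < B" using C0_functions_bounded[OF f] by blast
  have cont: "continuous_on UNIV f" using f by (auto simp: C0_functions_def)
  \<comment> \<open>The signs \<open>c = 1\<close> and \<open>c = -1\<close> treat the positive and
    the negative part at once; division by \<open>B\<close> brings them into [0,1].\<close>
  have *: "L (\<lambda>x. max (c * f x) 0 / B) = (\<integral>x. max (c * f x) 0 / B \<partial>rep)
      \<and> (\<lambda>x. max (c * f x) 0 / B) \<in> C0_functions" if "c = 1 \<or> c = -1" for c
  proof -
    have "(\<lambda>x. max (c * f x) 0 / B) \<in> C0_functions"
    proof (rule C0_functions_dominated[OF f, of _ "1 / B"])
      have "max (c * f x) 0 \<le> \<bar>f x\<bar>" for x using that by auto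
      then show "\<bar>max (c * f x) 0 / B\<bar> \<le> 1 / B * \<bar>f x\<bar>" for x
        using B(2) by (simp add: divide_right_mono)
    qed (use B(2) in \<open>intro continuous_intros cont; simp\<close>)
    moreover have "L (\<lambda>x. max (c * f x) 0 / B) = (\<integral>x. max (c * f x) 0 / B \<partial>rep)"
    proof (rule L_eq_integral_01[OF calculation])
      fix x
      show "0 \<le> max (c * f x) 0 / B" using B(2) by simp
      have "max (c * f x) 0 \<le> B" using that B(1)[of x] B(2) by (auto simp: abs_le_iff)
      then show "max (c * f x) 0 / B \<le> 1" using B(2) by simp
    qed
    ultimately show ?thesis by blast
  qed
  note p = *[of 1, simplified] and m = *[of "-1", simplified]
  have eq: "f = (\<lambda>x. B * (max (f x) 0 / B - max (- f x) 0 / B))"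
    using B(2) by (auto simp: fun_eq_iff field_simps max_def)
  have "L f = B * (L (\<lambda>x. max (f x) 0 / B) - L (\<lambda>x. max (- f x) 0 / B))"
    using p m by (subst eq) (simp add: cmult C0_functions_diff L_diff)
  also have "\<dots> = B * (\<integral>x. max (f x) 0 / B - max (- f x) 0 / B \<partial>rep)"
    using p m int by (subst Bochner_Integration.integral_diff) auto
  also have "\<dots> = (\<integral>x. f x \<partial>rep)"
    by (subst (3) eq) simp
  finally show ?thesis .
qed

end

section \<open>Sequential compactness of bounded measures\<close>

lemma real_diagonal_subsequence:
  fixes a :: "nat \<Rightarrow> nat \<Rightarrow> real"
  assumes "\<And>n k. \<bar>a n k\<bar> \<le> C"
  shows "\<exists>r. strict_mono r \<and> (\<forall>n. convergent (\<lambda>k. a n (r k)))"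
proof -
  interpret subseqs "\<lambda>n s. convergent (\<lambda>k. a n (s k))"
  proof
    fix n and s :: "nat \<Rightarrow> nat" assume "strict_mono s"
    have "\<forall>f. (\<forall>n. f n \<in> cball (0::real) C) \<longrightarrow> (\<exists>l\<in>cball 0 C. \<exists>r. strict_mono (r :: nat \<Rightarrow> nat) \<and> (f \<circ> r) \<longlonglongrightarrow> l)"
      using compact_cball[of "0::real" C] unfolding compact_def .
    from spec[OF this, of "\<lambda>k. a n (s k)"]
    obtain l r where "strict_mono (r :: nat \<Rightarrow> nat)" "((\<lambda>k. a n (s k)) \<circ> r) \<longlonglongrightarrow> l"
      using assms by auto
    then show "\<exists>r. strict_mono r \<and> convergent (\<lambda>k. a n ((s \<circ> r) k))"
      by (auto simp: convergent_def o_def)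
  qed
  have "convergent (\<lambda>k. a n (diagseq k))" for n
  proof -
    have "convergent (\<lambda>k. a n ((diagseq \<circ> (+) (Suc n)) k))"
    proof (rule diagseq_holds)
      fix r s :: "nat \<Rightarrow> nat" and n assume "strict_mono r" "convergent (\<lambda>k. a n (s k))"
      from convergent_subseq_convergent[OF this(2,1)]
      show "convergent (\<lambda>k. a n ((s \<circ> r) k))" by (simp add: o_def)
    qed
    then have "convergent (\<lambda>k. a n (diagseq (k + Suc n)))" by (simp add: o_def add.commute)
    then show ?thesis by (subst (asm) convergent_ignore_initial_segment)
  qed
  then show ?thesis using subseq_diagseq by blast
qed

text \<open>The class \<open>S\<close> is kept abstract: later it is the class of functions whose
  integrals converge, and it only has to survive one step at a time. Differences of a basis set and
  a finite union of basis sets are used because there are only countably many of them and they make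
  a finite cover disjoint.\<close>

lemma C0_functions_step_approx:
  fixes f :: "'a::euclidean_space \<Rightarrow> real"
  assumes B: "topological_basis B" and f: "f \<in> C0_functions" and "0 < \<epsilon>"
    and S0: "(\<lambda>_. 0) \<in> S"
    and S: "\<And>g c U F. g \<in> S \<Longrightarrow> U \<in> B \<Longrightarrow> finite F \<Longrightarrow> F \<subseteq> B \<Longrightarrow>
      (\<lambda>x. g x + c * indicat_real (U - \<Union>F) x) \<in> S"
  obtains g where "g \<in> S" "\<And>x. \<bar>f x - g x\<bar> < \<epsilon>"
proof -
  have "\<exists>U\<in>B. x \<in> U \<and> (\<forall>y\<in>U. \<bar>f y - f x\<bar> < \<epsilon>)" for x
  proof -
    have cont: "continuous_on UNIV f" using f by (simp add: C0_functions_def)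
    have "open {y. \<bar>f y - f x\<bar> < \<epsilon>}"
      by (intro open_Collect_less continuous_intros cont)
    then obtain U where "U \<in> B" "x \<in> U" "U \<subseteq> {y. \<bar>f y - f x\<bar> < \<epsilon>}"
      using topological_basisE[OF B, of "{y. \<bar>f y - f x\<bar> < \<epsilon>}" x] \<open>0 < \<epsilon>\<close> by auto
    then show ?thesis by blast
  qed
  then obtain U where U: "\<And>x. U x \<in> B" "\<And>x. x \<in> U x" "\<And>x y. y \<in> U x \<Longrightarrow> \<bar>f y - f x\<bar> < \<epsilon>"
    by metis
  have "compact {x. \<epsilon> \<le> \<bar>f x\<bar>}" by (rule C0_functions_compact_superlevel[OF f \<open>0 < \<epsilon>\<close>])
  moreover have "open (U x)" for x using U(1) topological_basis_open[OF B] by blast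
  moreover have "{x. \<epsilon> \<le> \<bar>f x\<bar>} \<subseteq> (\<Union>x\<in>UNIV. U x)" using U(2) by blast
  ultimately obtain X where X: "finite X" "{x. \<epsilon> \<le> \<bar>f x\<bar>} \<subseteq> (\<Union>x\<in>X. U x)"
    using compactE_image[of "{x. \<epsilon> \<le> \<bar>f x\<bar>}" UNIV U] by metis
  have "\<exists>g\<in>S. (\<forall>y\<in>(\<Union>x\<in>X. U x). \<bar>f y - g y\<bar> < \<epsilon>) \<and> (\<forall>y. y \<notin> (\<Union>x\<in>X. U x) \<longrightarrow> g y = 0)"
    using X(1)
  proof induction
    case empty
    then show ?case using S0 by auto
  next
    case (insert x X)
    then obtain g where g: "g \<in> S" "\<And>y. y \<in> (\<Union>x\<in>X. U x) \<Longrightarrow> \<bar>f y - g y\<bar> < \<epsilon>"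
        "\<And>y. y \<notin> (\<Union>x\<in>X. U x) \<Longrightarrow> g y = 0" by blast
    \<comment> \<open>Subtracting the sets already treated leaves the earlier approximation
      untouched.\<close>
    let ?g = "\<lambda>y. g y + f x * indicat_real (U x - \<Union>(U ` X)) y"
    have "?g \<in> S" using insert.hyps by (intro S g(1) U(1)) (use U(1) in auto)
    moreover have "\<bar>f y - ?g y\<bar> < \<epsilon>" if "y \<in> (\<Union>x\<in>insert x X. U x)" for y
      using that g(2)[of y] g(3)[of y] U(3)[of y x] by (cases "y \<in> (\<Union>x\<in>X. U x)") (auto simp: indicator_def)
    moreover have "?g y = 0" if "y \<notin> (\<Union>x\<in>insert x X. U x)" for y
      using that g(3)[of y] by (auto simp: indicator_def)
    ultimately show ?case by (intro bexI[of _ ?g] conjI ballI allI impI)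
  qed
  then obtain g where g: "g \<in> S" "\<And>y. y \<in> (\<Union>x\<in>X. U x) \<Longrightarrow> \<bar>f y - g y\<bar> < \<epsilon>"
      "\<And>y. y \<notin> (\<Union>x\<in>X. U x) \<Longrightarrow> g y = 0" by blast
  have "\<bar>f x - g x\<bar> < \<epsilon>" for x
    using g(2)[of x] g(3)[of x] X(2) by (cases "x \<in> (\<Union>x\<in>X. U x)") (auto simp: subset_iff not_le)
  with g(1) show ?thesis by (rule that)
qed

text \<open>The diagonal argument runs over the measures of a countable family of sets. Step
  functions over this family approximate \<open>C0_functions\<close> uniformly, the bounded mass
  carries convergence over to all test functions, and the limit functional has a representing
  measure.\<close>

theorem weakly_convergent_measures_subseq:
  fixes M :: "nat \<Rightarrow> 'a::euclidean_space measure"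
  assumes sets: "\<And>k. sets (M k) = sets borel" and bound: "\<And>k. emeasure (M k) UNIV \<le> ennreal C"
  obtains r N where "strict_mono r" "finite_measure N" "sets N = sets borel"
    "weakly_convergent_measures (\<lambda>k. M (r k)) N"
proof -
  have space: "space (M k) = UNIV" for k using sets_eq_imp_space_eq[OF sets[of k]] by simp
  have fin: "finite_measure (M k)" for k
    by standard (use bound[of k] space in \<open>auto simp: top_unique\<close>)
  have meas: "measure (M k) A \<le> max C 0" for k A
  proof -
    have "measure (M k) A \<le> measure (M k) UNIV"
      using finite_measure.bounded_measure[OF fin[of k], of A] space by simp
    also have "\<dots> \<le> max C 0"
    proof -
      have "ennreal (measure (M k) UNIV) \<le> ennreal (max C 0)"
        using bound[of k] finite_measure.emeasure_eq_measure[OF fin[of k], of UNIV]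
        by (simp add: order_trans[OF _ ennreal_leI])
      then show ?thesis by (subst (asm) ennreal_le_iff) auto
    qed
    finally show ?thesis .
  qed
  obtain B :: "'a set set" where B: "countable B" "topological_basis B"
    using ex_countable_basis by blast
  define D where "D = (\<lambda>(U, F). U - \<Union>F) ` (B \<times> {F. finite F \<and> F \<subseteq> B})"
  have D: "countable D" unfolding D_def
    using B(1) by (intro countable_image countable_SIGMA) (auto simp: countable_Collect_finite_subset)
  \<comment> \<open>The limits obtained here need not be the values of the limit measure on these
    sets; they only serve to make the integrals of step functions converge.\<close>
  have "\<exists>r. strict_mono r \<and> (\<forall>n. convergent (\<lambda>k. measure (M (r k)) (from_nat_into D n)))"
    by (rule real_diagonal_subsequence[where C = "max C 0"]) (use meas in simp)
  then obtain r where r: "strict_mono r" "\<And>n. convergent (\<lambda>k. measure (M (r k)) (from_nat_into D n))"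
    by blast
  have conv_D: "convergent (\<lambda>k. measure (M (r k)) A)" if "A \<in> D" for A
    using r(2)[of "to_nat_on D A"] that D by (simp add: from_nat_into_to_nat_on)
  define S where "S = {g :: 'a \<Rightarrow> real. (\<forall>k. integrable (M k) g) \<and> convergent (\<lambda>k. \<integral>x. g x \<partial>M (r k))}"
  have S0: "(\<lambda>_. 0) \<in> S" by (simp add: S_def convergent_const)
  have S_step: "(\<lambda>x. g x + c * indicat_real (U - \<Union>F) x) \<in> S"
    if gS: "g \<in> S" and "U \<in> B" "finite F" "F \<subseteq> B" for g c U F
  proof -
    have op: "open U" "open (\<Union>F)" using that topological_basis_open[OF B(2)] by auto
    have mem: "U - \<Union>F \<in> D" using that by (auto simp: D_def)
    have "U - \<Union>F \<in> sets (M k)" for k using op by (simp add: sets)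
    then have int: "integrable (M k) (indicat_real (U - \<Union>F))" for k
      using finite_measure.emeasure_finite[OF fin[of k]] by (auto simp: integrable_indicator_iff less_top)
    have eq: "(\<integral>x. g x + c * indicat_real (U - \<Union>F) x \<partial>M (r k))
        = (\<integral>x. g x \<partial>M (r k)) + c * measure (M (r k)) (U - \<Union>F)" for k
      using gS int[of "r k"] space by (subst Bochner_Integration.integral_add) (auto simp: S_def)
    obtain l where l: "(\<lambda>k. \<integral>x. g x \<partial>M (r k)) \<longlonglongrightarrow> l"
      using gS by (auto simp: S_def convergent_def)
    obtain l' where l': "(\<lambda>k. measure (M (r k)) (U - \<Union>F)) \<longlonglongrightarrow> l'"
      using conv_D[OF mem] by (auto simp: convergent_def)
    have "(\<lambda>k. \<integral>x. g x + c * indicat_real (U - \<Union>F) x \<partial>M (r k)) \<longlonglongrightarrow> l + c * l'"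
      unfolding eq by (intro tendsto_add tendsto_mult_left l l')
    then have "convergent (\<lambda>k. \<integral>x. g x + c * indicat_real (U - \<Union>F) x \<partial>M (r k))"
      by (rule convergentI)
    then show ?thesis using gS int by (simp add: S_def)
  qed
  have int: "integrable (M k) f" if "f \<in> C0_functions" for f k
    by (rule integrable_C0_functions[OF fin sets that])
  have conv: "convergent (\<lambda>k. \<integral>x. f x \<partial>M (r k))" if f: "f \<in> C0_functions" for f
  proof (rule Cauchy_convergent, rule metric_CauchyI)
    fix e :: real assume "0 < e"
    define \<epsilon> where "\<epsilon> = e / (3 * (max C 0 + 1))"
    have \<epsilon>: "\<epsilon> > 0" "\<epsilon> * max C 0 < e / 3" using \<open>0 < e\<close> by (auto simp: \<epsilon>_def field_simps)
    obtain g where g: "g \<in> S" "\<And>x. \<bar>f x - g x\<bar> < \<epsilon>"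
      using C0_functions_step_approx[OF B(2) f \<epsilon>(1) S0 S_step] by blast
    have close: "\<bar>(\<integral>x. f x \<partial>M (r k)) - (\<integral>x. g x \<partial>M (r k))\<bar> < e / 3" for k
    proof -
      have ig: "integrable (M (r k)) g" using g(1) by (simp add: S_def)
      have "\<bar>(\<integral>x. f x \<partial>M (r k)) - (\<integral>x. g x \<partial>M (r k))\<bar> = \<bar>\<integral>x. f x - g x \<partial>M (r k)\<bar>"
        using int[OF f] ig by simp
      also have "\<dots> \<le> (\<integral>x. \<bar>f x - g x\<bar> \<partial>M (r k))" by (rule integral_abs_bound)
      also have "\<dots> \<le> (\<integral>x. \<epsilon> \<partial>M (r k))"
        using int[OF f, of "r k"] ig g(2) finite_measure.integrable_const[OF fin[of "r k"], of \<epsilon>]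
        by (intro integral_mono) (auto intro: less_imp_le)
      also have "\<dots> = \<epsilon> * measure (M (r k)) UNIV" by (simp add: space)
      also have "\<dots> \<le> \<epsilon> * max C 0" using \<epsilon>(1) meas by (intro mult_left_mono) auto
      also note \<epsilon>(2)
      finally show ?thesis .
    qed
    have "Cauchy (\<lambda>k. \<integral>x. g x \<partial>M (r k))"
      using g(1) by (auto simp: S_def convergent_Cauchy)
    then obtain K where K: "\<And>m n. m \<ge> K \<Longrightarrow> n \<ge> K \<Longrightarrow> dist (\<integral>x. g x \<partial>M (r m)) (\<integral>x. g x \<partial>M (r n)) < e / 3"
      using \<open>0 < e\<close> metric_CauchyD[of "\<lambda>k. \<integral>x. g x \<partial>M (r k)" "e / 3"] by auto
    show "\<exists>K. \<forall>m\<ge>K. \<forall>n\<ge>K. dist (\<integral>x. f x \<partial>M (r m)) (\<integral>x. f x \<partial>M (r n)) < e"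
    proof (intro exI[of _ K] allI impI)
      fix m n assume "K \<le> m" "K \<le> n"
      then show "dist (\<integral>x. f x \<partial>M (r m)) (\<integral>x. f x \<partial>M (r n)) < e"
        using K[of m n] close[of m] close[of n] unfolding dist_real_def by linarith
    qed
  qed
  define L where "L f = lim (\<lambda>k. \<integral>x. f x \<partial>M (r k))" for f :: "'a \<Rightarrow> real"
  have L: "(\<lambda>k. \<integral>x. f x \<partial>M (r k)) \<longlonglongrightarrow> L f" if "f \<in> C0_functions" for f
    using conv[OF that] by (simp add: L_def convergent_LIMSEQ_iff)
  interpret positive_C0_functional L "max C 0"
  proof
    fix f g :: "'a \<Rightarrow> real" assume f: "f \<in> C0_functions" and g: "g \<in> C0_functions"
    have "(\<lambda>k. \<integral>x. f x + g x \<partial>M (r k)) \<longlonglongrightarrow> L f + L g"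
      using tendsto_add[OF L[OF f] L[OF g]] int f g by simp
    then show "L (\<lambda>x. f x + g x) = L f + L g"
      using L[OF C0_functions_add[OF f g]] LIMSEQ_unique by blast
  next
    fix f :: "'a \<Rightarrow> real" and c assume f: "f \<in> C0_functions"
    have "(\<lambda>k. \<integral>x. c * f x \<partial>M (r k)) \<longlonglongrightarrow> c * L f"
      using tendsto_mult_left[OF L[OF f], of c] by simp
    then show "L (\<lambda>x. c * f x) = c * L f"
      using L[OF C0_functions_cmult[OF f]] LIMSEQ_unique by blast
  next
    fix f :: "'a \<Rightarrow> real" assume f: "f \<in> C0_functions" "\<And>x. 0 \<le> f x"
    show "0 \<le> L f"
      by (rule LIMSEQ_le_const[OF L[OF f(1)]]) (use f(2) in auto)
    show "L f \<le> max C 0" if "\<And>x. f x \<le> 1"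
    proof (rule LIMSEQ_le_const2[OF L[OF f(1)]], intro exI allI impI)
      fix k
      have "(\<integral>x. f x \<partial>M (r k)) \<le> (\<integral>x. 1 \<partial>M (r k))"
        using int[OF f(1), of "r k"] that finite_measure.integrable_const[OF fin[of "r k"], of "1::real"]
        by (intro integral_mono) auto
      also have "\<dots> \<le> max C 0" using meas[of "r k" UNIV] by (simp add: space)
      finally show "(\<integral>x. f x \<partial>M (r k)) \<le> max C 0" .
    qed
  qed
  have "weakly_convergent_measures (\<lambda>k. M (r k)) rep"
    unfolding weakly_convergent_measures_def
    using L L_eq_integral by (simp add: C0_functions_def)
  then show ?thesis using that r(1) finite_measure_rep sets_rep by blast
qed

section \<open>Mass balance with the part lost at infinity\<close>

lemma ennreal_limsup_tendsto_add:
  fixes a b :: "nat \<Rightarrow> ennreal"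
  assumes lim: "a \<longlonglongrightarrow> l" and "l \<noteq> \<top>"
  shows "limsup (\<lambda>k. a k + b k) = l + limsup b"
proof (rule antisym; rule ennreal_le_epsilon)
  fix e :: real assume "0 < e"
  have "l < l + ennreal e"
    using \<open>0 < e\<close> \<open>l \<noteq> \<top>\<close> by (cases l) (auto simp flip: ennreal_plus simp: ennreal_less_iff)
  then have "\<forall>\<^sub>F k in sequentially. a k < l + ennreal e" by (rule order_tendstoD[OF lim])
  then have "limsup (\<lambda>k. a k + b k) \<le> limsup (\<lambda>k. (l + ennreal e) + b k)"
    by (intro Limsup_mono) (auto elim!: eventually_mono intro!: add_right_mono)
  also have "\<dots> = l + ennreal e + limsup b" by (rule Limsup_const_add) simp
  finally show "limsup (\<lambda>k. a k + b k) \<le> l + limsup b + ennreal e" by (simp add: ac_simps)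
next
  fix e :: real assume "0 < e"
  \<comment> \<open>The case \<open>l = 0\<close> is split off because
    \<open>l - ennreal e < l\<close> requires \<open>l\<close> to be positive.\<close>
  have "\<forall>\<^sub>F k in sequentially. l \<le> a k + ennreal e"
  proof (cases "l = 0")
    case False
    then have "l - ennreal e < l" using \<open>0 < e\<close> \<open>l \<noteq> \<top>\<close>
      by (intro ennreal_between) (auto simp: zero_less_iff_neq_zero less_top)
    then have "\<forall>\<^sub>F k in sequentially. l - ennreal e < a k" by (rule order_tendstoD[OF lim])
    then show ?thesis
      by (rule eventually_mono) (drule less_imp_le, simp add: ennreal_minus_le_iff add.commute)
  qed simp
  then have "limsup (\<lambda>k. l + b k) \<le> limsup (\<lambda>k. ennreal e + (a k + b k))"
    by (intro Limsup_mono) (auto elim!: eventually_mono dest: add_right_mono simp: ac_simps)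
  then show "l + limsup b \<le> limsup (\<lambda>k. a k + b k) + ennreal e"
    by (simp add: Limsup_const_add add.commute)
qed

lemma C0_functions_compact_support:
  assumes "continuous_on UNIV f" "\<And>x. R < norm x \<Longrightarrow> f x = 0"
  shows "f \<in> C0_functions"
proof -
  have "\<forall>\<^sub>F x in at_infinity. f x = 0"
    unfolding eventually_at_infinity by (intro exI[of _ "R + 1"] allI impI assms(2)) linarith
  then have "(f \<longlongrightarrow> 0) at_infinity" by (rule tendsto_eventually)
  with assms(1) show ?thesis by (simp add: C0_functions_def)
qed

text \<open>A cutoff splits the total mass into a part that converges by weak convergence and a part
  near infinity, and the limsup of the sum is the sum of limit and limsup. The part near infinity is
  squeezed between the tails beyond j + 1 and beyond j; then j tends to infinity.\<close>

theorem weakly_convergent_measures_mass: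
  fixes M :: "nat \<Rightarrow> 'a::euclidean_space measure"
  assumes sets: "\<And>k. sets (M k) = sets borel" and bound: "\<And>k. emeasure (M k) UNIV \<le> ennreal C"
    and N: "finite_measure N" "sets N = sets borel" and weak: "weakly_convergent_measures M N"
  obtains m where "0 \<le> m"
    "((\<lambda>R::real. limsup (\<lambda>k. emeasure (M k) {x. R < norm x})) \<longlongrightarrow> ennreal m) at_top"
    "limsup (\<lambda>k. emeasure (M k) UNIV) = emeasure N UNIV + ennreal m"
proof -
  have space: "space (M k) = UNIV" for k using sets_eq_imp_space_eq[OF sets[of k]] by simp
  have fin: "finite_measure (M k)" for k
    by standard (use bound[of k] space in \<open>auto simp: top_unique\<close>)
  have spaceN: "space N = UNIV" using sets_eq_imp_space_eq[OF N(2)] by simp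
  define g where "g R = limsup (\<lambda>k. emeasure (M k) {x. R < norm x})" for R :: real
  have ms: "{x::'a. R < norm x} \<in> sets borel" for R :: real
    by (intro borel_open open_Collect_less continuous_intros)
  have g_mono: "g R' \<le> g R" if "R \<le> R'" for R R'
    unfolding g_def using that by (intro Limsup_mono always_eventually allI emeasure_mono) (auto simp: sets ms)
  have g_bound: "g R \<le> ennreal C" for R
  proof -
    have "emeasure (M k) {x. R < norm x} \<le> ennreal C" for k
      using emeasure_mono[of "{x. R < norm x}" UNIV "M k"] bound[of k] space[of k]
      by (metis order_trans sets.top top_greatest)
    then show ?thesis unfolding g_def by (intro Limsup_bounded always_eventually allI)
  qed
  \<comment> \<open>The tail function \<open>g\<close> decreases in R, so its limit exists and is
    its infimum.\<close>
  define l where "l = (INF R. g R)"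
  have "l \<le> ennreal C" unfolding l_def using g_bound by (meson INF_lower UNIV_I order_trans)
  then have l_fin: "l \<noteq> \<top>" by (auto simp: top_unique)
  have g_lim: "(g \<longlongrightarrow> l) at_top"
  proof (rule order_tendstoI)
    fix a assume "a < l"
    then have "a < g R" for R unfolding l_def by (meson INF_lower UNIV_I less_le_trans)
    then show "\<forall>\<^sub>F R in at_top. a < g R" by simp
  next
    fix a assume "l < a"
    then obtain R where "g R < a" unfolding l_def by (auto simp: INF_less_iff)
    then show "\<forall>\<^sub>F R in at_top. g R < a"
      using g_mono by (auto simp: eventually_at_top_linorder intro!: exI[of _ R] intro: le_less_trans)
  qed
  then have g_lim': "(\<lambda>j. g (real j)) \<longlonglongrightarrow> l"
    by (rule filterlim_compose) (rule filterlim_real_sequentially)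
  \<comment> \<open>A piecewise linear cutoff, 1 on the ball of radius j and 0 off the ball of
    radius j + 1. Continuity is all that weak convergence asks for.\<close>
  define \<theta> where "\<theta> j x = max 0 (min 1 (real j + 1 - norm x))" for j and x :: 'a
  have \<theta>: "\<theta> j \<in> C0_functions" for j
    by (rule C0_functions_compact_support[of _ "real j + 1"])
       (auto simp: \<theta>_def intro!: continuous_intros)
  have \<theta>01: "0 \<le> \<theta> j x" "\<theta> j x \<le> 1" for j x by (auto simp: \<theta>_def)
  have \<theta>m [measurable]: "\<theta> j \<in> borel_measurable borel" for j
    using \<theta>[of j] by (auto simp: C0_functions_def intro: borel_measurable_continuous_onI)
  have intM: "(\<integral>\<^sup>+x. ennreal (\<theta> j x) \<partial>M k) = ennreal (\<integral>x. \<theta> j x \<partial>M k)" for j k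
    by (intro nn_integral_eq_integral integrable_C0_functions fin sets \<theta>) (simp add: \<theta>01)
  have intN: "(\<integral>\<^sup>+x. ennreal (\<theta> j x) \<partial>N) = ennreal (\<integral>x. \<theta> j x \<partial>N)" for j
    by (intro nn_integral_eq_integral integrable_C0_functions N \<theta>) (simp add: \<theta>01)
  have lim: "(\<lambda>k. \<integral>\<^sup>+x. ennreal (\<theta> j x) \<partial>M k) \<longlonglongrightarrow> (\<integral>\<^sup>+x. ennreal (\<theta> j x) \<partial>N)" for j
    unfolding intM intN using weak \<theta>[of j]
    by (intro tendsto_ennrealI) (auto simp: weakly_convergent_measures_def C0_functions_def)
  have split: "emeasure (M k) UNIV = (\<integral>\<^sup>+x. ennreal (\<theta> j x) \<partial>M k) + (\<integral>\<^sup>+x. ennreal (1 - \<theta> j x) \<partial>M k)" for j k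
  proof -
    have [measurable_cong]: "sets (M k) = sets borel" by (rule sets)
    have "(\<integral>\<^sup>+x. ennreal (\<theta> j x) \<partial>M k) + (\<integral>\<^sup>+x. ennreal (1 - \<theta> j x) \<partial>M k)
        = (\<integral>\<^sup>+x. ennreal (\<theta> j x) + ennreal (1 - \<theta> j x) \<partial>M k)"
      by (intro nn_integral_add[symmetric]) auto
    also have "\<dots> = (\<integral>\<^sup>+x. 1 \<partial>M k)"
      using \<theta>01 by (intro nn_integral_cong) (simp flip: ennreal_plus)
    finally show ?thesis using space by simp
  qed
  have ls: "limsup (\<lambda>k. emeasure (M k) UNIV)
      = (\<integral>\<^sup>+x. ennreal (\<theta> j x) \<partial>N) + limsup (\<lambda>k. \<integral>\<^sup>+x. ennreal (1 - \<theta> j x) \<partial>M k)" for j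
    unfolding split[of _ j] by (rule ennreal_limsup_tendsto_add[OF lim]) (simp add: intN)
  have upper: "limsup (\<lambda>k. emeasure (M k) UNIV) \<le> emeasure N UNIV + g (real j)" for j
    unfolding ls[of j]
  proof (rule add_mono)
    have "(\<integral>\<^sup>+x. ennreal (\<theta> j x) \<partial>N) \<le> (\<integral>\<^sup>+x. 1 \<partial>N)"
      using \<theta>01 by (intro nn_integral_mono) auto
    then show "(\<integral>\<^sup>+x. ennreal (\<theta> j x) \<partial>N) \<le> emeasure N UNIV" using spaceN by simp
    show "limsup (\<lambda>k. \<integral>\<^sup>+x. ennreal (1 - \<theta> j x) \<partial>M k) \<le> g (real j)"
      unfolding g_def
    proof (intro Limsup_mono always_eventually allI)
      fix k
      have "(\<integral>\<^sup>+x. ennreal (1 - \<theta> j x) \<partial>M k) \<le> (\<integral>\<^sup>+x. indicator {x. real j < norm x} x \<partial>M k)"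
        by (intro nn_integral_mono) (auto simp: \<theta>_def indicator_def)
      then show "(\<integral>\<^sup>+x. ennreal (1 - \<theta> j x) \<partial>M k) \<le> emeasure (M k) {x. real j < norm x}"
        using ms sets by simp
    qed
  qed
  have lower: "emeasure N (cball 0 (real j)) + l \<le> limsup (\<lambda>k. emeasure (M k) UNIV)" for j
    unfolding ls[of j]
  proof (rule add_mono)
    have "(\<integral>\<^sup>+x. indicator (cball 0 (real j)) x \<partial>N) \<le> (\<integral>\<^sup>+x. ennreal (\<theta> j x) \<partial>N)"
      by (intro nn_integral_mono) (auto simp: \<theta>_def indicator_def)
    then show "emeasure N (cball 0 (real j)) \<le> (\<integral>\<^sup>+x. ennreal (\<theta> j x) \<partial>N)" using N(2) by simp
    have "l \<le> g (real j + 1)" unfolding l_def by (rule INF_lower) simp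
    also have "\<dots> \<le> limsup (\<lambda>k. \<integral>\<^sup>+x. ennreal (1 - \<theta> j x) \<partial>M k)"
      unfolding g_def
    proof (intro Limsup_mono always_eventually allI)
      fix k
      have "(\<integral>\<^sup>+x. indicator {x. real j + 1 < norm x} x \<partial>M k) \<le> (\<integral>\<^sup>+x. ennreal (1 - \<theta> j x) \<partial>M k)"
        by (intro nn_integral_mono) (auto simp: \<theta>_def indicator_def)
      then show "emeasure (M k) {x. real j + 1 < norm x} \<le> (\<integral>\<^sup>+x. ennreal (1 - \<theta> j x) \<partial>M k)"
        using ms sets by simp
    qed
    finally show "l \<le> limsup (\<lambda>k. \<integral>\<^sup>+x. ennreal (1 - \<theta> j x) \<partial>M k)" .
  qed
  have "limsup (\<lambda>k. emeasure (M k) UNIV) = emeasure N UNIV + l"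
  proof (rule antisym)
    show "limsup (\<lambda>k. emeasure (M k) UNIV) \<le> emeasure N UNIV + l"
      by (rule LIMSEQ_le_const[OF tendsto_add[OF tendsto_const g_lim']]) (use upper in auto)
    have "(\<lambda>j. emeasure N (cball 0 (real j))) \<longlonglongrightarrow> emeasure N (\<Union>j. cball 0 (real j))"
      by (rule Lim_emeasure_incseq) (auto simp: N(2) incseq_def)
    moreover have "(\<Union>j. cball (0::'a) (real j)) = UNIV"
      using real_arch_simple by (auto simp: set_eq_iff)
    ultimately have "(\<lambda>j. emeasure N (cball 0 (real j))) \<longlonglongrightarrow> emeasure N UNIV" by simp
    from tendsto_add[OF this tendsto_const]
    show "emeasure N UNIV + l \<le> limsup (\<lambda>k. emeasure (M k) UNIV)"
      by (rule LIMSEQ_le_const2) (use lower in auto)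
  qed
  moreover have "l = ennreal (enn2real l)" using l_fin by (simp add: less_top)
  ultimately show ?thesis
    using that[of "enn2real l"] g_lim unfolding g_def by (metis enn2real_nonneg)
qed

section \<open>Fractional gradients\<close>

text \<open>Either b is at most \<open>\<delta>\<close> times a in modulus, and the sum is bounded
  by a alone, or a is controlled by b. The value of \<open>\<delta>\<close> makes
  \<open>(1 + \<delta>) powr p\<close> equal to \<open>1 + e\<close>. Convexity does not enter, so
  the bound also serves exponents below 1.\<close>

lemma powr_add_le_eps:
  fixes p e :: real
  assumes "0 < p" "0 < e"
  obtains C where "0 \<le> C" "\<And>a b :: real. \<bar>a + b\<bar> powr p \<le> (1 + e) * \<bar>a\<bar> powr p + C * \<bar>b\<bar> powr p"
proof -
  define \<delta> where "\<delta> = (1 + e) powr (1 / p) - 1"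
  have \<delta>: "\<delta> > 0" "(1 + \<delta>) powr p = 1 + e"
    using assms by (auto simp: \<delta>_def powr_powr)
  define C where "C = (1 + 1 / \<delta>) powr p"
  have "\<bar>a + b\<bar> powr p \<le> (1 + e) * \<bar>a\<bar> powr p + C * \<bar>b\<bar> powr p" for a b :: real
  proof (cases "\<bar>b\<bar> \<le> \<delta> * \<bar>a\<bar>")
    case True
    then have "\<bar>a + b\<bar> \<le> (1 + \<delta>) * \<bar>a\<bar>" by (simp add: algebra_simps)
    then have "\<bar>a + b\<bar> powr p \<le> ((1 + \<delta>) * \<bar>a\<bar>) powr p"
      using assms by (intro powr_mono2) auto
    also have "\<dots> = (1 + e) * \<bar>a\<bar> powr p" using \<delta> by (simp add: powr_mult)
    also have "\<dots> \<le> (1 + e) * \<bar>a\<bar> powr p + C * \<bar>b\<bar> powr p" by (simp add: C_def)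
    finally show ?thesis .
  next
    case False
    then have "\<bar>a\<bar> \<le> \<bar>b\<bar> / \<delta>" using \<delta>(1) by (simp add: field_simps)
    then have "\<bar>a + b\<bar> \<le> (1 + 1 / \<delta>) * \<bar>b\<bar>" by (simp add: algebra_simps)
    then have "\<bar>a + b\<bar> powr p \<le> ((1 + 1 / \<delta>) * \<bar>b\<bar>) powr p"
      using assms by (intro powr_mono2) auto
    also have "\<dots> = C * \<bar>b\<bar> powr p" using \<delta> by (simp add: powr_mult C_def)
    also have "\<dots> \<le> (1 + e) * \<bar>a\<bar> powr p + C * \<bar>b\<bar> powr p" using assms by simp
    finally show ?thesis .
  qed
  then show ?thesis by (rule that[rotated]) (simp add: C_def)
qed

lemma powr_add_le:
  fixes a b :: real
  assumes "0 \<le> p"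
  shows "\<bar>a + b\<bar> powr p \<le> 2 powr p * (\<bar>a\<bar> powr p + \<bar>b\<bar> powr p)"
proof -
  have "\<bar>a + b\<bar> powr p \<le> (2 * max \<bar>a\<bar> \<bar>b\<bar>) powr p"
    using assms by (intro powr_mono2) auto
  also have "\<dots> = 2 powr p * max \<bar>a\<bar> \<bar>b\<bar> powr p" by (simp add: powr_mult)
  also have "max \<bar>a\<bar> \<bar>b\<bar> powr p \<le> \<bar>a\<bar> powr p + \<bar>b\<bar> powr p" by (simp add: max_def)
  finally show ?thesis by simp
qed

text \<open>Above the level t, the factor \<open>a powr (1 - \<beta>)\<close> is at most
  \<open>t powr (1 - \<beta>)\<close>. Integrated, and with t chosen to balance the two terms, this
  plays the part of Hoelder's inequality.\<close>

lemma truncation_bound: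
  fixes a t \<beta> :: real
  assumes "0 \<le> a" "0 < t" "1 \<le> \<beta>"
  shows "a \<le> t + t powr (1 - \<beta>) * a powr \<beta>"
proof (cases "a \<le> t")
  case False
  have "a = a powr (1 - \<beta>) * a powr \<beta>"
    using assms False by (simp flip: powr_add)
  also have "\<dots> \<le> t powr (1 - \<beta>) * a powr \<beta>"
    using assms False by (intro mult_right_mono powr_mono2') auto
  finally show ?thesis using assms by simp
qed (use assms in \<open>simp add: add_increasing2\<close>)

lemma nn_integral_lborel_shift:
  fixes f :: "'a::euclidean_space \<Rightarrow> ennreal"
  assumes [measurable]: "f \<in> borel_measurable borel"
  shows "(\<integral>\<^sup>+h. f (x + h) \<partial>lborel) = (\<integral>\<^sup>+y. f y \<partial>lborel)"
proof -
  have "(\<integral>\<^sup>+y. f y \<partial>lborel) = (\<integral>\<^sup>+y. f y \<partial>distr lborel borel ((+) x))"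
    by (simp add: lborel_distr_plus)
  also have "\<dots> = (\<integral>\<^sup>+h. f (x + h) \<partial>lborel)"
    by (subst nn_integral_distr) auto
  finally show ?thesis by simp
qed

text \<open>The kernel is summed over dyadic annuli, so that only the volume of balls is needed.\<close>

lemma nn_integral_kernel_finite:
  assumes "0 < s" "s < 1" "0 < p"
  shows "(\<integral>\<^sup>+(h::'a::euclidean_space). ennreal (min 1 (norm h powr p) / norm h powr (real DIM('a) + s * p)) \<partial>lborel) < \<infinity>"
proof -
  let ?n = "real DIM('a)"
  define a where "a = ?n + s * p"
  have a: "a > 0" using assms by (simp add: a_def add_nonneg_pos)
  define \<omega> where "\<omega> = unit_ball_vol ?n"
  have \<omega>: "\<omega> \<ge> 0" by (simp add: \<omega>_def)
  \<comment> \<open>\<open>c j\<close> bounds the integrand on the annulus between 2^(-j-1) and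
    2^(-j), and \<open>d j\<close> on the one between 2^j and 2^(j+1). Each annulus is then enlarged
    to the ball of its outer radius.\<close>
  define c where "c j = 2 powr (- real j * p) * 2 powr ((real j + 1) * a)" for j :: nat
  define d where "d j = 2 powr (- real j * a)" for j :: nat
  define f1 where "f1 j h = ennreal (c j) * indicator (ball 0 (2 powr (- real j))) h" for j and h :: 'a
  define f2 where "f2 j h = ennreal (d j) * indicator (ball 0 (2 powr (real j + 1))) h" for j and h :: 'a
  have [measurable]: "f1 j \<in> borel_measurable borel" for j
    unfolding f1_def
    by (intro borel_measurable_times_ennreal borel_measurable_const borel_measurable_indicator borel_open open_ball)
  have [measurable]: "f2 j \<in> borel_measurable borel" for j
    unfolding f2_def
    by (intro borel_measurable_times_ennreal borel_measurable_const borel_measurable_indicator borel_open open_ball)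
  have single: "f j \<le> (\<Sum>i. f i)" for f :: "nat \<Rightarrow> ennreal" and j
    using sum_le_suminf[of f "{j}"] by simp
  have pt: "ennreal (min 1 (norm h powr p) / norm h powr a) \<le> (\<Sum>j. f1 j h) + (\<Sum>j. f2 j h)" for h :: 'a
  proof (cases "h = 0")
    case False
    define m where "m = \<lfloor>log 2 (norm h)\<rfloor>"
    have m: "2 powr m \<le> norm h" "norm h < 2 powr (m + 1)"
      using False by (auto simp: m_def powr_le_iff less_powr_iff)
    show ?thesis
    proof (cases "m < 0")
      case True
      define j where "j = nat (- m - 1)"
      have j: "real_of_int m = - real j - 1" using True by (simp add: j_def)
      have h1: "2 powr (- real j - 1) \<le> norm h" "norm h < 2 powr (- real j)" using m by (simp_all add: j)
      have "min 1 (norm h powr p) / norm h powr a \<le> 2 powr (- real j * p) / 2 powr ((- real j - 1) * a)"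
      proof (rule frac_le)
        have "norm h powr p \<le> (2 powr (- real j)) powr p" using h1(2) assms by (intro powr_mono2) auto
        then show "min 1 (norm h powr p) \<le> 2 powr (- real j * p)" by (simp add: powr_powr)
        have "(2 powr (- real j - 1)) powr a \<le> norm h powr a" using h1(1) a by (intro powr_mono2) auto
        then show "2 powr ((- real j - 1) * a) \<le> norm h powr a" by (simp add: powr_powr)
      qed auto
      also have "\<dots> = 2 powr (- real j * p - (- real j - 1) * a)" by (rule powr_diff[symmetric])
      also have "\<dots> = c j" unfolding c_def powr_add[symmetric] by (simp add: algebra_simps)
      finally have "ennreal (min 1 (norm h powr p) / norm h powr a) \<le> f1 j h"
        using h1(2) by (simp add: f1_def ennreal_leI)
      also have "\<dots> \<le> (\<Sum>j. f1 j h)" by (rule single[of "\<lambda>j. f1 j h"])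
      also have "\<dots> \<le> (\<Sum>j. f1 j h) + (\<Sum>j. f2 j h)" by simp
      finally show ?thesis .
    next
      case False
      define j where "j = nat m"
      have j: "real_of_int m = real j" using False by (simp add: j_def)
      have h1: "2 powr real j \<le> norm h" "norm h < 2 powr (real j + 1)"
        using m by (simp_all only: j of_int_add of_int_1)
      have "min 1 (norm h powr p) / norm h powr a \<le> 1 / 2 powr (real j * a)"
      proof (rule frac_le)
        have "(2 powr real j) powr a \<le> norm h powr a" using h1(1) a by (intro powr_mono2) auto
        then show "2 powr (real j * a) \<le> norm h powr a" by (simp add: powr_powr)
      qed auto
      also have "\<dots> = d j" by (simp add: d_def powr_minus_divide)
      finally have "ennreal (min 1 (norm h powr p) / norm h powr a) \<le> f2 j h"
        using h1(2) by (simp add: f2_def ennreal_leI)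
      also have "\<dots> \<le> (\<Sum>j. f2 j h)" by (rule single[of "\<lambda>j. f2 j h"])
      also have "\<dots> \<le> (\<Sum>j. f1 j h) + (\<Sum>j. f2 j h)" by simp
      finally show ?thesis .
    qed
  qed simp
  have vol: "emeasure lborel (ball (0::'a) r) = ennreal (\<omega> * r powr ?n)" if "r > 0" for r
    using that by (simp add: emeasure_ball \<omega>_def powr_realpow)
  have geo: "(\<Sum>j. ennreal (k * x ^ j)) < \<top>" if "0 \<le> k" "0 \<le> x" "x < 1" for k x :: real
  proof -
    have "summable (\<lambda>j. k * x ^ j)" using that by (intro summable_mult summable_geometric) auto
    then have "(\<Sum>j. ennreal (k * x ^ j)) = ennreal (\<Sum>j. k * x ^ j)"
      using that by (intro suminf_ennreal2) auto
    then show ?thesis by simp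
  qed
  have pow: "2 powr (b * real j) = (2 powr b) ^ j" for b :: real and j
    by (simp add: powr_powr flip: powr_realpow)
  have i1: "(\<integral>\<^sup>+h. f1 j h \<partial>lborel) = ennreal ((2 powr a * \<omega>) * (2 powr (s * p - p)) ^ j)" for j
  proof -
    have "(\<integral>\<^sup>+h. f1 j h \<partial>lborel) = ennreal (c j) * ennreal (\<omega> * (2 powr (- real j)) powr ?n)"
      unfolding f1_def by (subst nn_integral_cmult_indicator) (simp_all add: vol)
    also have "\<dots> = ennreal (c j * (\<omega> * (2 powr (- real j)) powr ?n))"
      by (rule ennreal_mult[symmetric]) (use \<omega> in \<open>auto simp: c_def\<close>)
    also have "c j * (\<omega> * (2 powr (- real j)) powr ?n) = \<omega> * 2 powr (- real j * p + (real j + 1) * a + - real j * ?n)"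
      unfolding c_def powr_powr powr_add by simp
    also have "- real j * p + (real j + 1) * a + - real j * ?n = a + (s * p - p) * real j"
      by (simp add: a_def algebra_simps)
    also have "\<omega> * 2 powr (a + (s * p - p) * real j) = (2 powr a * \<omega>) * (2 powr (s * p - p)) ^ j"
      unfolding powr_add pow by simp
    finally show ?thesis .
  qed
  have i2: "(\<integral>\<^sup>+h. f2 j h \<partial>lborel) = ennreal ((2 powr ?n * \<omega>) * (2 powr (- s * p)) ^ j)" for j
  proof -
    have "(\<integral>\<^sup>+h. f2 j h \<partial>lborel) = ennreal (d j) * ennreal (\<omega> * (2 powr (real j + 1)) powr ?n)"
      unfolding f2_def by (subst nn_integral_cmult_indicator) (simp_all add: vol)
    also have "\<dots> = ennreal (d j * (\<omega> * (2 powr (real j + 1)) powr ?n))"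
      by (rule ennreal_mult[symmetric]) (use \<omega> in \<open>auto simp: d_def\<close>)
    also have "d j * (\<omega> * (2 powr (real j + 1)) powr ?n) = \<omega> * 2 powr (- real j * a + (real j + 1) * ?n)"
      unfolding d_def powr_powr unfolding powr_add by simp
    also have "- real j * a + (real j + 1) * ?n = ?n + (- s * p) * real j"
      by (simp add: a_def algebra_simps)
    also have "\<omega> * 2 powr (?n + (- s * p) * real j) = (2 powr ?n * \<omega>) * (2 powr (- s * p)) ^ j"
      unfolding powr_add pow by simp
    finally show ?thesis .
  qed
  have "(\<integral>\<^sup>+(h::'a). ennreal (min 1 (norm h powr p) / norm h powr a) \<partial>lborel)
      \<le> (\<integral>\<^sup>+h. (\<Sum>j. f1 j h) + (\<Sum>j. f2 j h) \<partial>lborel)"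
    by (intro nn_integral_mono pt)
  also have "\<dots> = (\<Sum>j. \<integral>\<^sup>+h. f1 j h \<partial>lborel) + (\<Sum>j. \<integral>\<^sup>+h. f2 j h \<partial>lborel)"
    by (subst nn_integral_add) (simp_all add: nn_integral_suminf)
  also have "\<dots> < \<top>"
    unfolding i1 i2
  proof -
    have less: "2 powr x < (1::real)" if "x < 0" for x
      using powr_less_mono[of x 0 "2::real"] that by simp
    \<comment> \<open>The geometric series near 0 converges because \<open>s < 1\<close>, the one at
      infinity because \<open>s > 0\<close>.\<close>
    have "s * p < 1 * p" using assms by (intro mult_strict_right_mono)
    then have "2 powr (s * p - p) < (1::real)" "2 powr (- s * p) < (1::real)"
      using assms by (auto intro!: less)
    then show "(\<Sum>j. ennreal ((2 powr a * \<omega>) * (2 powr (s * p - p)) ^ j)) + (\<Sum>j. ennreal ((2 powr ?n * \<omega>) * (2 powr (- s * p)) ^ j)) < \<top>"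
      unfolding ennreal_add_less_top by (intro conjI geo) (use \<omega> in auto)
  qed
  finally show ?thesis by (simp add: a_def)
qed

section \<open>Exponents, fractional gradients and the nonlocal Leibniz rule\<close>

locale frac_sobolev =
  fixes s p q :: real and T :: "'a::euclidean_space itself"
  assumes s_pos: "0 < s" and s_less: "s < 1" and p_ge: "1 \<le> p" and sp_less: "s * p < real DIM('a)"
    and q_def: "q = crit_exp TYPE('a) s p"
begin

lemma p_pos: "0 < p" using p_ge by simp

lemma q_eq: "q = real DIM('a) * p / (real DIM('a) - s * p)" by (simp add: q_def crit_exp_def)

lemma p_less_q: "p < q"
  using s_pos p_pos sp_less unfolding q_eq by (simp add: field_simps)

lemma q_pos: "0 < q" using p_less_q p_pos by simp

lemma p_div_q: "p / q = 1 - s * p / real DIM('a)"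
  using p_pos sp_less unfolding q_eq by (simp add: field_simps)

lemma frac_grad_pow_eq:
  fixes v :: "'a \<Rightarrow> real"
  assumes [measurable]: "v \<in> borel_measurable borel"
  shows "frac_grad_pow s p v x = (\<integral>\<^sup>+y. ennreal (\<bar>v x - v y\<bar> powr p / norm (x - y) powr (real DIM('a) + s * p)) \<partial>lborel)"
proof -
  have "frac_grad_pow s p v x
      = (\<integral>\<^sup>+h. (\<lambda>y. ennreal (\<bar>v x - v y\<bar> powr p / norm (x - y) powr (real DIM('a) + s * p))) (x + h) \<partial>lborel)"
    unfolding frac_grad_pow_def by (simp add: abs_minus_commute)
  also have "\<dots> = (\<integral>\<^sup>+y. ennreal (\<bar>v x - v y\<bar> powr p / norm (x - y) powr (real DIM('a) + s * p)) \<partial>lborel)"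
    by (rule nn_integral_lborel_shift) measurable
  finally show ?thesis .
qed

lemma measurable_frac_grad_pow [measurable]:
  fixes v :: "'a \<Rightarrow> real"
  assumes [measurable]: "v \<in> borel_measurable borel"
  shows "frac_grad_pow s p v \<in> borel_measurable borel"
proof -
  have "(\<lambda>x. frac_grad_pow s p v x) \<in> borel_measurable borel"
    unfolding frac_grad_pow_def by measurable
  then show ?thesis by simp
qed

lemma gagliardo_pow_fst:
  fixes v :: "'a \<Rightarrow> real"
  assumes [measurable]: "v \<in> borel_measurable borel"
  shows "gagliardo_pow s p v = (\<integral>\<^sup>+x. \<integral>\<^sup>+y. ennreal (\<bar>v x - v y\<bar> powr p / norm (x - y) powr (real DIM('a) + s * p)) \<partial>lborel \<partial>lborel)"
  unfolding gagliardo_pow_def by (subst lborel.nn_integral_fst[symmetric]) auto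

lemma gagliardo_pow_eq:
  fixes v :: "'a \<Rightarrow> real"
  assumes "v \<in> borel_measurable borel"
  shows "gagliardo_pow s p v = (\<integral>\<^sup>+x. frac_grad_pow s p v x \<partial>lborel)"
  using assms by (simp add: gagliardo_pow_fst frac_grad_pow_eq)

text \<open>The constants are left open because two versions are used: \<open>2 powr p\<close> on
  both terms for rough bounds, and \<open>1 + e\<close> with a large second constant when the first
  term must be kept sharply.\<close>

lemma frac_grad_pow_add_le:
  fixes v w :: "'a \<Rightarrow> real"
  assumes [measurable]: "v \<in> borel_measurable borel" "w \<in> borel_measurable borel"
    and "0 \<le> c" "0 \<le> C" and le: "\<And>a b :: real. \<bar>a + b\<bar> powr p \<le> c * \<bar>a\<bar> powr p + C * \<bar>b\<bar> powr p"
  shows "frac_grad_pow s p (\<lambda>x. v x + w x) x \<le> ennreal c * frac_grad_pow s p v x + ennreal C * frac_grad_pow s p w x"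
proof -
  let ?k = "\<lambda>y. norm (x - y) powr (real DIM('a) + s * p)"
  have "frac_grad_pow s p (\<lambda>x. v x + w x) x
     \<le> (\<integral>\<^sup>+y. ennreal c * ennreal (\<bar>v x - v y\<bar> powr p / ?k y) + ennreal C * ennreal (\<bar>w x - w y\<bar> powr p / ?k y) \<partial>lborel)"
    unfolding frac_grad_pow_eq[OF borel_measurable_add[OF assms(1,2)]]
  proof (rule nn_integral_mono)
    fix y
    have "\<bar>v x + w x - (v y + w y)\<bar> powr p \<le> c * \<bar>v x - v y\<bar> powr p + C * \<bar>w x - w y\<bar> powr p"
      using le[of "v x - v y" "w x - w y"] by (simp add: algebra_simps)
    then have "\<bar>v x + w x - (v y + w y)\<bar> powr p / ?k y \<le> (c * \<bar>v x - v y\<bar> powr p + C * \<bar>w x - w y\<bar> powr p) / ?k y"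
      by (rule divide_right_mono) simp
    also have "\<dots> = c * (\<bar>v x - v y\<bar> powr p / ?k y) + C * (\<bar>w x - w y\<bar> powr p / ?k y)"
      by (simp add: add_divide_distrib)
    finally show "ennreal (\<bar>v x + w x - (v y + w y)\<bar> powr p / ?k y)
      \<le> ennreal c * ennreal (\<bar>v x - v y\<bar> powr p / ?k y) + ennreal C * ennreal (\<bar>w x - w y\<bar> powr p / ?k y)"
      using assms(3,4) by (simp flip: ennreal_mult ennreal_plus add: ennreal_leI)
  qed
  also have "\<dots> = ennreal c * frac_grad_pow s p v x + ennreal C * frac_grad_pow s p w x"
    by (simp add: frac_grad_pow_eq nn_integral_add nn_integral_cmult)
  finally show ?thesis .
qed

lemma gagliardo_pow_add_le:
  fixes v w :: "'a \<Rightarrow> real"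
  assumes [measurable]: "v \<in> borel_measurable borel" "w \<in> borel_measurable borel"
  shows "gagliardo_pow s p (\<lambda>x. v x + w x) \<le> ennreal (2 powr p) * (gagliardo_pow s p v + gagliardo_pow s p w)"
proof -
  have "gagliardo_pow s p (\<lambda>x. v x + w x) = (\<integral>\<^sup>+x. frac_grad_pow s p (\<lambda>x. v x + w x) x \<partial>lborel)"
    by (rule gagliardo_pow_eq) measurable
  also have "\<dots> \<le> (\<integral>\<^sup>+x. ennreal (2 powr p) * frac_grad_pow s p v x + ennreal (2 powr p) * frac_grad_pow s p w x \<partial>lborel)"
    using powr_add_le[of p] p_pos
    by (intro nn_integral_mono frac_grad_pow_add_le assms) (auto simp: distrib_left)
  also have "\<dots> = ennreal (2 powr p) * (gagliardo_pow s p v + gagliardo_pow s p w)"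
    by (simp add: nn_integral_add nn_integral_cmult gagliardo_pow_eq distrib_left)
  finally show ?thesis .
qed

lemma frac_grad_pow_cmult:
  fixes v :: "'a \<Rightarrow> real"
  assumes [measurable]: "v \<in> borel_measurable borel"
  shows "frac_grad_pow s p (\<lambda>x. c * v x) x = ennreal (\<bar>c\<bar> powr p) * frac_grad_pow s p v x"
proof -
  have "ennreal (\<bar>c * a - c * b\<bar> powr p / k) = ennreal (\<bar>c\<bar> powr p) * ennreal (\<bar>a - b\<bar> powr p / k)"
    if "0 \<le> k" for a b k :: real
  proof -
    have "c * a - c * b = c * (a - b)" by (simp add: algebra_simps)
    then have eq: "\<bar>c * a - c * b\<bar> powr p / k = \<bar>c\<bar> powr p * (\<bar>a - b\<bar> powr p / k)"
      by (simp only: abs_mult powr_mult times_divide_eq_right abs_ge_zero)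
    show ?thesis using that unfolding eq by (intro ennreal_mult) auto
  qed
  then show ?thesis
    unfolding frac_grad_pow_def by (simp add: nn_integral_cmult)
qed

lemma gagliardo_pow_cmult:
  fixes v :: "'a \<Rightarrow> real"
  assumes [measurable]: "v \<in> borel_measurable borel"
  shows "gagliardo_pow s p (\<lambda>x. c * v x) = ennreal (\<bar>c\<bar> powr p) * gagliardo_pow s p v"
  by (simp add: gagliardo_pow_eq frac_grad_pow_cmult nn_integral_cmult)

text \<open>The nonlocal Leibniz rule: the difference of the products at x and y is
  \<open>\<phi> x * (v x - v y) + v y * (\<phi> x - \<phi> y)\<close>. In the second term Tonelli's
  theorem exchanges the integrals, so that the x-integral becomes the gradient of
  \<open>\<phi>\<close> at y, as a weight for v.\<close>

lemma gagliardo_pow_mult_le: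
  fixes \<phi> v :: "'a \<Rightarrow> real"
  assumes [measurable]: "v \<in> borel_measurable borel" "\<phi> \<in> borel_measurable borel"
    and "0 \<le> c" "0 \<le> C" and le: "\<And>a b :: real. \<bar>a + b\<bar> powr p \<le> c * \<bar>a\<bar> powr p + C * \<bar>b\<bar> powr p"
  shows "gagliardo_pow s p (\<lambda>x. \<phi> x * v x)
    \<le> ennreal c * (\<integral>\<^sup>+x. ennreal (\<bar>\<phi> x\<bar> powr p) * frac_grad_pow s p v x \<partial>lborel)
      + ennreal C * (\<integral>\<^sup>+y. ennreal (\<bar>v y\<bar> powr p) * frac_grad_pow s p \<phi> y \<partial>lborel)"
proof -
  let ?k = "\<lambda>x y. norm (x - y) powr (real DIM('a) + s * p)"
  have "gagliardo_pow s p (\<lambda>x. \<phi> x * v x)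
     \<le> (\<integral>\<^sup>+x. \<integral>\<^sup>+y. ennreal c * (ennreal (\<bar>\<phi> x\<bar> powr p) * ennreal (\<bar>v x - v y\<bar> powr p / ?k x y))
          + ennreal C * (ennreal (\<bar>v y\<bar> powr p) * ennreal (\<bar>\<phi> x - \<phi> y\<bar> powr p / ?k x y)) \<partial>lborel \<partial>lborel)"
    unfolding gagliardo_pow_fst[OF borel_measurable_times[OF assms(2,1)]]
  proof (intro nn_integral_mono)
    fix x y
    have "\<bar>\<phi> x * v x - \<phi> y * v y\<bar> powr p \<le> c * \<bar>\<phi> x * (v x - v y)\<bar> powr p + C * \<bar>v y * (\<phi> x - \<phi> y)\<bar> powr p"
      using le[of "\<phi> x * (v x - v y)" "v y * (\<phi> x - \<phi> y)"] by (simp add: algebra_simps)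
    then have "\<bar>\<phi> x * v x - \<phi> y * v y\<bar> powr p / ?k x y
        \<le> (c * \<bar>\<phi> x * (v x - v y)\<bar> powr p + C * \<bar>v y * (\<phi> x - \<phi> y)\<bar> powr p) / ?k x y"
      by (rule divide_right_mono) simp
    also have "\<dots> = c * (\<bar>\<phi> x\<bar> powr p * (\<bar>v x - v y\<bar> powr p / ?k x y)) + C * (\<bar>v y\<bar> powr p * (\<bar>\<phi> x - \<phi> y\<bar> powr p / ?k x y))"
      by (simp add: add_divide_distrib abs_mult powr_mult)
    finally show "ennreal (\<bar>\<phi> x * v x - \<phi> y * v y\<bar> powr p / ?k x y)
      \<le> ennreal c * (ennreal (\<bar>\<phi> x\<bar> powr p) * ennreal (\<bar>v x - v y\<bar> powr p / ?k x y))
          + ennreal C * (ennreal (\<bar>v y\<bar> powr p) * ennreal (\<bar>\<phi> x - \<phi> y\<bar> powr p / ?k x y))"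
      using assms(3,4) by (simp flip: ennreal_mult ennreal_plus add: ennreal_leI)
  qed
  also have "\<dots> = (\<integral>\<^sup>+x. ennreal c * (ennreal (\<bar>\<phi> x\<bar> powr p) * frac_grad_pow s p v x) \<partial>lborel)
      + (\<integral>\<^sup>+x. \<integral>\<^sup>+y. ennreal C * (ennreal (\<bar>v y\<bar> powr p) * ennreal (\<bar>\<phi> x - \<phi> y\<bar> powr p / ?k x y)) \<partial>lborel \<partial>lborel)"
    by (simp add: nn_integral_add nn_integral_cmult frac_grad_pow_eq)
  also have "(\<integral>\<^sup>+x. \<integral>\<^sup>+y. ennreal C * (ennreal (\<bar>v y\<bar> powr p) * ennreal (\<bar>\<phi> x - \<phi> y\<bar> powr p / ?k x y)) \<partial>lborel \<partial>lborel)
      = (\<integral>\<^sup>+y. \<integral>\<^sup>+x. ennreal C * (ennreal (\<bar>v y\<bar> powr p) * ennreal (\<bar>\<phi> x - \<phi> y\<bar> powr p / ?k x y)) \<partial>lborel \<partial>lborel)"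
    by (rule lborel_pair.Fubini') measurable
  also have "\<dots> = (\<integral>\<^sup>+y. ennreal C * (ennreal (\<bar>v y\<bar> powr p) * frac_grad_pow s p \<phi> y) \<partial>lborel)"
    by (simp add: nn_integral_cmult frac_grad_pow_eq abs_minus_commute norm_minus_commute)
  also have "(\<integral>\<^sup>+x. ennreal c * (ennreal (\<bar>\<phi> x\<bar> powr p) * frac_grad_pow s p v x) \<partial>lborel) = ennreal c * (\<integral>\<^sup>+x. ennreal (\<bar>\<phi> x\<bar> powr p) * frac_grad_pow s p v x \<partial>lborel)"
    by (rule nn_integral_cmult) measurable
  also have "(\<integral>\<^sup>+y. ennreal C * (ennreal (\<bar>v y\<bar> powr p) * frac_grad_pow s p \<phi> y) \<partial>lborel) = ennreal C * (\<integral>\<^sup>+y. ennreal (\<bar>v y\<bar> powr p) * frac_grad_pow s p \<phi> y \<partial>lborel)"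
    by (rule nn_integral_cmult) measurable
  finally show ?thesis .
qed

text \<open>The Lipschitz bound tames the kernel near 0, the bound on the values tames it at
  infinity. Together they give the integrand of \<open>nn_integral_kernel_finite\<close>, uniformly
  in x.\<close>

lemma frac_grad_pow_bounded:
  fixes \<phi> :: "'a \<Rightarrow> real"
  assumes "\<And>x. \<bar>\<phi> x\<bar> \<le> B" "0 \<le> L" "\<And>x y. \<bar>\<phi> x - \<phi> y\<bar> \<le> L * norm (x - y)"
  obtains W where "0 \<le> W" "\<And>x. frac_grad_pow s p \<phi> x \<le> ennreal W"
proof -
  define K where "K = max (2 * B) L powr p"
  have B: "0 \<le> B" using order_trans[OF abs_ge_zero assms(1)] .
  let ?I = "\<integral>\<^sup>+(h::'a). ennreal (min 1 (norm h powr p) / norm h powr (real DIM('a) + s * p)) \<partial>lborel"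
  have I: "?I < \<infinity>" by (rule nn_integral_kernel_finite[OF s_pos s_less p_pos])
  have "frac_grad_pow s p \<phi> x \<le> ennreal K * ?I" for x
  proof -
    have "frac_grad_pow s p \<phi> x
        \<le> (\<integral>\<^sup>+(h::'a). ennreal K * ennreal (min 1 (norm h powr p) / norm h powr (real DIM('a) + s * p)) \<partial>lborel)"
      unfolding frac_grad_pow_def
    proof (intro nn_integral_mono)
      fix h
      have "\<bar>\<phi> (x + h) - \<phi> x\<bar> \<le> 2 * B" using assms(1)[of "x + h"] assms(1)[of x] by linarith
      then have "\<bar>\<phi> (x + h) - \<phi> x\<bar> powr p \<le> K"
        unfolding K_def using p_pos by (intro powr_mono2) auto
      moreover have "\<bar>\<phi> (x + h) - \<phi> x\<bar> powr p \<le> K * norm h powr p"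
      proof -
        have "\<bar>\<phi> (x + h) - \<phi> x\<bar> \<le> L * norm h" using assms(3)[of "x + h" x] by simp
        also have "\<dots> \<le> max (2 * B) L * norm h" by (intro mult_right_mono) auto
        finally have "\<bar>\<phi> (x + h) - \<phi> x\<bar> powr p \<le> (max (2 * B) L * norm h) powr p"
          using p_pos by (intro powr_mono2) auto
        then show ?thesis using B by (simp add: K_def powr_mult)
      qed
      ultimately have "\<bar>\<phi> (x + h) - \<phi> x\<bar> powr p \<le> K * min 1 (norm h powr p)"
        by (auto simp: min_def)
      then have "\<bar>\<phi> (x + h) - \<phi> x\<bar> powr p / norm h powr (real DIM('a) + s * p) \<le> K * (min 1 (norm h powr p) / norm h powr (real DIM('a) + s * p))"
        by (simp add: divide_right_mono)
      then show "ennreal (\<bar>\<phi> (x + h) - \<phi> x\<bar> powr p / norm h powr (real DIM('a) + s * p))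
          \<le> ennreal K * ennreal (min 1 (norm h powr p) / norm h powr (real DIM('a) + s * p))"
        by (simp add: K_def ennreal_leI flip: ennreal_mult)
    qed
    then show ?thesis by (simp add: nn_integral_cmult)
  qed
  moreover have "ennreal K * ?I = ennreal (K * enn2real ?I)"
    using I by (simp add: ennreal_mult K_def)
  ultimately have "frac_grad_pow s p \<phi> x \<le> ennreal (K * enn2real ?I)" for x by metis
  then show ?thesis by (rule that[rotated]) (simp add: K_def)
qed

text \<open>The gradient is not compactly supported, but a pair (x, y) contributes only if one of
  its points lies in the support K. By symmetry both cases reduce to the integral of the bounded
  gradient over K, a set of finite volume.\<close>

lemma gagliardo_pow_test_function:
  fixes \<phi> :: "'a \<Rightarrow> real"
  assumes "\<phi> \<in> test_functions"
  obtains W where "0 \<le> W" "\<And>x. frac_grad_pow s p \<phi> x \<le> ennreal W" "gagliardo_pow s p \<phi> < \<infinity>"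
proof -
  have "continuous_on UNIV \<phi>" using assms Ck_fun_continuous[of 0 \<phi>] by (auto simp: test_functions_def)
  then have [measurable]: "\<phi> \<in> borel_measurable borel" by (rule borel_measurable_continuous_onI)
  obtain B where B: "\<And>x. \<bar>\<phi> x\<bar> \<le> B" using test_functions_bounded[OF assms] by blast
  obtain L where L: "0 \<le> L" "\<And>x y. \<bar>\<phi> x - \<phi> y\<bar> \<le> L * norm (x - y)"
    using test_functions_lipschitz[OF assms] by blast
  obtain W where W: "0 \<le> W" "\<And>x. frac_grad_pow s p \<phi> x \<le> ennreal W"
    using frac_grad_pow_bounded[OF B L] by blast
  define K where "K = closure {x. \<phi> x \<noteq> 0}"
  have K: "compact K" using assms by (auto simp: K_def test_functions_def)
  then have [measurable]: "K \<in> sets borel" by (intro borel_closed compact_imp_closed)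
  have zero: "\<phi> x = 0" if "x \<notin> K" for x
    using that closure_subset[of "{x. \<phi> x \<noteq> 0}"] by (auto simp: K_def)
  let ?f = "\<lambda>x y. ennreal (\<bar>\<phi> x - \<phi> y\<bar> powr p / norm (x - y) powr (real DIM('a) + s * p))"
  have "gagliardo_pow s p \<phi> \<le> (\<integral>\<^sup>+x. \<integral>\<^sup>+y. indicator K x * ?f x y + indicator K y * ?f x y \<partial>lborel \<partial>lborel)"
    unfolding gagliardo_pow_fst[OF \<open>\<phi> \<in> borel_measurable borel\<close>]
    by (intro nn_integral_mono) (auto simp: indicator_def zero)
  also have "\<dots> = (\<integral>\<^sup>+x. \<integral>\<^sup>+y. indicator K x * ?f x y \<partial>lborel \<partial>lborel) + (\<integral>\<^sup>+x. \<integral>\<^sup>+y. indicator K y * ?f x y \<partial>lborel \<partial>lborel)"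
    by (simp add: nn_integral_add)
  also have "(\<integral>\<^sup>+x. \<integral>\<^sup>+y. indicator K y * ?f x y \<partial>lborel \<partial>lborel) = (\<integral>\<^sup>+y. \<integral>\<^sup>+x. indicator K y * ?f x y \<partial>lborel \<partial>lborel)"
    by (rule lborel_pair.Fubini') measurable
  also have "\<dots> = (\<integral>\<^sup>+x. \<integral>\<^sup>+y. indicator K x * ?f x y \<partial>lborel \<partial>lborel)"
    by (simp add: abs_minus_commute norm_minus_commute)
  finally have le: "gagliardo_pow s p \<phi> \<le> (\<integral>\<^sup>+x. \<integral>\<^sup>+y. indicator K x * ?f x y \<partial>lborel \<partial>lborel)
    + (\<integral>\<^sup>+x. \<integral>\<^sup>+y. indicator K x * ?f x y \<partial>lborel \<partial>lborel)" .
  have "(\<integral>\<^sup>+x. \<integral>\<^sup>+y. indicator K x * ?f x y \<partial>lborel \<partial>lborel) = (\<integral>\<^sup>+x. frac_grad_pow s p \<phi> x * indicator K x \<partial>lborel)"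
    by (simp add: nn_integral_cmult frac_grad_pow_eq mult.commute)
  also have "\<dots> \<le> (\<integral>\<^sup>+x. ennreal W * indicator K x \<partial>lborel)"
    using W(2) by (intro nn_integral_mono mult_right_mono) auto
  also have "\<dots> = ennreal W * emeasure lborel K" by (simp add: nn_integral_cmult_indicator)
  also have "\<dots> < \<infinity>"
    using emeasure_bounded_finite[OF compact_imp_bounded[OF K]] by (simp add: ennreal_mult_less_top)
  finally have "gagliardo_pow s p \<phi> < \<infinity>" using le by (auto simp: le_less_trans)
  with W show ?thesis by (rule that)
qed

end

section \<open>The Sobolev inequality and closure properties\<close>

lemma test_functions_measurable:
  fixes \<phi> :: "'a::euclidean_space \<Rightarrow> real"
  assumes "\<phi> \<in> test_functions"
  shows "\<phi> \<in> borel_measurable borel"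
  using assms Ck_fun_continuous[of 0 \<phi>]
  by (intro borel_measurable_continuous_onI) (auto simp: test_functions_def)

lemma tendsto_0_le_cmult:
  fixes f g :: "nat \<Rightarrow> ennreal"
  assumes "g \<longlonglongrightarrow> 0" "\<And>j. f j \<le> ennreal C * g j"
  shows "f \<longlonglongrightarrow> 0"
proof (rule tendsto_sandwich[OF _ _ tendsto_const])
  show "(\<lambda>j. ennreal C * g j) \<longlonglongrightarrow> 0"
    using ennreal_tendsto_cmult[OF _ assms(1), of "ennreal C"] by simp
qed (use assms in auto)

context frac_sobolev
begin

text \<open>The p-th power of \<open>v x\<close> is compared with that of \<open>v y\<close> and
  averaged over y in the ball of radius r. There the kernel is at least
  \<open>r powr -(n + s * p)\<close>, so after division by the volume the differences cost
  \<open>r powr (s * p) * \<delta> / \<omega>\<close>. The average of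
  \<open>\<bar>v y\<bar> powr p\<close> is estimated by truncation.\<close>

lemma sobolev_pointwise:
  fixes v :: "'a \<Rightarrow> real"
  assumes [measurable]: "v \<in> borel_measurable borel" and int: "integrable lborel (\<lambda>x. \<bar>v x\<bar> powr q)"
    and A: "A = (\<integral>x. \<bar>v x\<bar> powr q \<partial>lborel)" "0 < A" and \<delta>: "frac_grad_pow s p v x = ennreal \<delta>" "0 \<le> \<delta>"
    and r: "0 < r" and \<omega>: "\<omega> = unit_ball_vol (real DIM('a))"
  shows "\<bar>v x\<bar> powr p \<le> 2 powr p * (r powr (s * p) * \<delta> / \<omega> + 2 * (A / (\<omega> * r powr real DIM('a))) powr (p / q))"
proof -
  let ?n = "real DIM('a)"
  define V where "V = \<omega> * r powr ?n"
  have \<omega>_pos: "0 < \<omega>" by (simp add: \<omega>)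
  have V: "0 < V" using \<omega>_pos r by (simp add: V_def)
  have vol: "emeasure lborel (ball x r) = ennreal V"
    using r by (simp add: emeasure_ball V_def \<omega> powr_realpow)
  \<comment> \<open>At this level the two terms of \<open>truncation_bound\<close>, integrated over
    the ball, coincide (\<open>tA\<close>); this produces the factor 2 in the conclusion.\<close>
  define t where "t = (A / V) powr (p / q)"
  have t: "0 < t" using A(2) V by (simp add: t_def)
  have tA: "t powr (1 - q / p) * A = t * V"
  proof -
    have "t powr (1 - q / p) = t * t powr (- (q / p))" using t by (simp add: powr_diff powr_minus_divide)
    also have "t powr (- (q / p)) = (A / V) powr (- 1)"
      using p_pos q_pos by (simp add: t_def powr_powr)
    also have "\<dots> = V / A" using A(2) V by (simp add: powr_minus_divide)
    finally show ?thesis using A(2) by simp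
  qed
  let ?K = "\<lambda>y. \<bar>v x - v y\<bar> powr p / norm (x - y) powr (?n + s * p)"
  define k where "k = 2 powr p * r powr (?n + s * p)"
  have pt: "\<bar>v x\<bar> powr p * indicator (ball x r) y
      \<le> k * ?K y + 2 powr p * (t * indicator (ball x r) y + t powr (1 - q / p) * \<bar>v y\<bar> powr q)" for y
  proof (cases "y \<in> ball x r")
    case True
    have "\<bar>v x\<bar> powr p \<le> 2 powr p * (\<bar>v x - v y\<bar> powr p + \<bar>v y\<bar> powr p)"
      using powr_add_le[of p "v x - v y" "v y"] p_pos by simp
    moreover have "\<bar>v x - v y\<bar> powr p \<le> r powr (?n + s * p) * ?K y"
    proof (cases "x = y")
      case False
      have "norm (x - y) powr (?n + s * p) \<le> r powr (?n + s * p)"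
        using True s_pos p_pos by (intro powr_mono2) (auto simp: dist_norm)
      then have "norm (x - y) powr (?n + s * p) * ?K y \<le> r powr (?n + s * p) * ?K y"
        by (rule mult_right_mono) simp
      then show ?thesis using False by simp
    qed simp
    moreover have "\<bar>v y\<bar> powr p \<le> t + t powr (1 - q / p) * \<bar>v y\<bar> powr q"
      using truncation_bound[of "\<bar>v y\<bar> powr p" t "q / p"] t p_pos p_less_q by (simp add: powr_powr)
    ultimately have "\<bar>v x\<bar> powr p \<le> 2 powr p * (r powr (?n + s * p) * ?K y + (t + t powr (1 - q / p) * \<bar>v y\<bar> powr q))"
      by (meson add_mono mult_left_mono order_trans powr_ge_zero)
    then show ?thesis using True by (simp add: k_def algebra_simps)
  next
    case False
    then show ?thesis by (simp add: k_def)
  qed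
  have k: "0 \<le> k" by (simp add: k_def)
  have "ennreal (V * \<bar>v x\<bar> powr p) = (\<integral>\<^sup>+y. ennreal (\<bar>v x\<bar> powr p) * indicator (ball x r) y \<partial>lborel)"
    by (subst nn_integral_cmult_indicator) (use V in \<open>auto simp: vol ennreal_mult mult.commute\<close>)
  also have "\<dots> = (\<integral>\<^sup>+y. ennreal (\<bar>v x\<bar> powr p * indicator (ball x r) y) \<partial>lborel)"
    by (intro nn_integral_cong) (auto simp: indicator_def)
  also have "\<dots> \<le> (\<integral>\<^sup>+y. ennreal (k * ?K y + 2 powr p * (t * indicator (ball x r) y + t powr (1 - q / p) * \<bar>v y\<bar> powr q)) \<partial>lborel)"
    by (intro nn_integral_mono ennreal_leI pt)
  also have "\<dots> = (\<integral>\<^sup>+y. ennreal k * ennreal (?K y) + (ennreal (2 powr p * t) * indicator (ball x r) y + ennreal (2 powr p * t powr (1 - q / p)) * ennreal (\<bar>v y\<bar> powr q)) \<partial>lborel)"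
    using k t by (intro nn_integral_cong) (auto simp: indicator_def algebra_simps simp flip: ennreal_mult ennreal_plus)
  also have "\<dots> = ennreal k * ennreal \<delta> + (ennreal (2 powr p * t) * ennreal V + ennreal (2 powr p * t powr (1 - q / p)) * ennreal A)"
  proof -
    have [measurable]: "ball x r \<in> sets borel" by simp
    have i1: "(\<integral>\<^sup>+y. ennreal k * ennreal (?K y) \<partial>lborel) = ennreal k * ennreal \<delta>"
      unfolding \<delta>(1)[symmetric] frac_grad_pow_eq[OF assms(1)] by (rule nn_integral_cmult) measurable
    have i2: "(\<integral>\<^sup>+y. ennreal (2 powr p * t) * indicator (ball x r) y \<partial>lborel) = ennreal (2 powr p * t) * ennreal V"
      unfolding vol[symmetric] by (rule nn_integral_cmult_indicator) simp
    have i3: "(\<integral>\<^sup>+y. ennreal (2 powr p * t powr (1 - q / p)) * ennreal (\<bar>v y\<bar> powr q) \<partial>lborel) = ennreal (2 powr p * t powr (1 - q / p)) * ennreal A"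
      unfolding A(1) nn_integral_eq_integral[OF int, symmetric, simplified] by (rule nn_integral_cmult) measurable
    show ?thesis
      unfolding i1[symmetric] i2[symmetric] i3[symmetric]
      by (subst nn_integral_add; (subst nn_integral_add)?; measurable?)
  qed
  also have "\<dots> = ennreal (k * \<delta> + (2 powr p * t * V + 2 powr p * t powr (1 - q / p) * A))"
    using k t V A(2) \<delta>(2) by (simp add: ennreal_mult)
  finally have "V * \<bar>v x\<bar> powr p \<le> k * \<delta> + (2 powr p * t * V + 2 powr p * (t powr (1 - q / p) * A))"
    using k t V A(2) \<delta>(2) by (subst (asm) ennreal_le_iff) (auto simp: mult.assoc)
  then have "\<bar>v x\<bar> powr p \<le> (k * \<delta> + 2 powr p * (2 * t * V)) / V"
    unfolding tA using V by (simp add: field_simps)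
  also have "\<dots> = k * \<delta> / V + 2 powr p * (2 * t)" using V by (simp add: field_simps)
  also have "k * \<delta> / V = 2 powr p * (r powr (s * p) * \<delta> / \<omega>)"
    using r \<omega>_pos by (simp add: k_def V_def powr_add)
  finally show ?thesis by (simp add: t_def V_def algebra_simps)
qed

text \<open>Balancing the two terms above in \<open>r\<close> gives a bound of \<open>\<bar>v\<bar>\<close> to the power \<open>q\<close> by the
  fractional gradient, pointwise. Its integral is the Sobolev inequality.\<close>

lemma sobolev_pointwise_optimal:
  obtains C where "0 < C" "\<And>(v :: 'a \<Rightarrow> real) A x \<delta>. v \<in> borel_measurable borel \<Longrightarrow>
      integrable lborel (\<lambda>x. \<bar>v x\<bar> powr q) \<Longrightarrow> A = (\<integral>x. \<bar>v x\<bar> powr q \<partial>lborel) \<Longrightarrow> 0 < A \<Longrightarrow>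
      frac_grad_pow s p v x = ennreal \<delta> \<Longrightarrow> 0 \<le> \<delta> \<Longrightarrow>
      \<bar>v x\<bar> powr q \<le> C * A powr (s * p / real DIM('a)) * \<delta>"
proof -
  let ?n = "real DIM('a)"
  define \<omega> where "\<omega> = unit_ball_vol ?n"
  have \<omega>: "0 < \<omega>" by (simp add: \<omega>_def)
  define \<theta> where "\<theta> = s * p / ?n"
  have \<theta>: "p / q = 1 - \<theta>" "0 < \<theta>" "\<theta> < 1"
    using p_div_q s_pos p_pos sp_less by (auto simp: \<theta>_def)
  define K where "K = 2 powr p * (1 / \<omega> + 2 * (1 / \<omega>) powr (p / q))"
  have K: "0 < K" using \<omega> by (auto simp: K_def intro!: mult_pos_pos add_pos_nonneg)
  have "\<bar>v x\<bar> powr q \<le> K powr (q / p) * A powr \<theta> * \<delta>"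
    if v: "v \<in> borel_measurable borel" "integrable lborel (\<lambda>x. \<bar>v x\<bar> powr q)"
      and A: "A = (\<integral>x. \<bar>v x\<bar> powr q \<partial>lborel)" "0 < A" and \<delta>: "frac_grad_pow s p v x = ennreal \<delta>" "0 \<le> \<delta>"
    for v :: "'a \<Rightarrow> real" and A x \<delta>
  proof -
    \<comment> \<open>The optimal radius divides by the gradient, which may be 0. A strictly larger
      \<open>\<delta>'\<close> avoids this and is let down to \<open>\<delta>\<close> at the
      end.\<close>
    have step: "\<bar>v x\<bar> powr q \<le> K powr (q / p) * A powr \<theta> * \<delta>'" if \<delta>': "\<delta> < \<delta>'" for \<delta>'
    proof -
      have \<delta>'_pos: "0 < \<delta>'" using \<delta>' \<delta>(2) by simp
      define B where "B = A powr (p / q)"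
      have B: "0 < B" using A(2) by (simp add: B_def)
      \<comment> \<open>With this radius both terms become multiples of
        \<open>B powr \<theta> * \<delta>' powr (1 - \<theta>)\<close>.\<close>
      define r where "r = (B / \<delta>') powr (1 / ?n)"
      have r: "0 < r" using B \<delta>'_pos by (simp add: r_def)
      have rn: "r powr ?n = B / \<delta>'" using B \<delta>'_pos by (simp add: r_def powr_powr)
      have e1: "r powr (s * p) * \<delta>' = B powr \<theta> * \<delta>' powr (1 - \<theta>)"
      proof -
        have "r powr (s * p) = (B / \<delta>') powr \<theta>" by (simp add: r_def powr_powr \<theta>_def)
        then show ?thesis using B \<delta>'_pos by (simp add: powr_divide powr_diff)
      qed
      have e2: "(A / (\<omega> * r powr ?n)) powr (p / q) = (1 / \<omega>) powr (p / q) * (B powr \<theta> * \<delta>' powr (1 - \<theta>))"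
      proof -
        have "(A / (\<omega> * r powr ?n)) powr (p / q) = (1 / \<omega>) powr (p / q) * (B / (B / \<delta>') powr (1 - \<theta>))"
          using A(2) \<omega> B \<delta>'_pos unfolding rn by (simp add: B_def powr_divide powr_mult \<theta>(1))
        also have "B / (B / \<delta>') powr (1 - \<theta>) = B powr \<theta> * \<delta>' powr (1 - \<theta>)"
          using B \<delta>'_pos by (simp add: powr_divide powr_diff)
        finally show ?thesis .
      qed
      have "\<bar>v x\<bar> powr p \<le> 2 powr p * (r powr (s * p) * \<delta> / \<omega> + 2 * (A / (\<omega> * r powr ?n)) powr (p / q))"
        by (rule sobolev_pointwise[OF v A \<delta> r \<omega>_def])
      also have "\<dots> \<le> 2 powr p * (r powr (s * p) * \<delta>' / \<omega> + 2 * (A / (\<omega> * r powr ?n)) powr (p / q))"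
        using \<delta>' \<omega> by (intro mult_left_mono add_right_mono divide_right_mono) auto
      also have "\<dots> = K * (B powr \<theta> * \<delta>' powr (1 - \<theta>))"
        unfolding e1 e2 by (simp add: K_def algebra_simps)
      finally have "(\<bar>v x\<bar> powr p) powr (q / p) \<le> (K * (B powr \<theta> * \<delta>' powr (1 - \<theta>))) powr (q / p)"
        using p_pos q_pos by (intro powr_mono2) auto
      also have "\<dots> = K powr (q / p) * (B powr (\<theta> * (q / p)) * \<delta>' powr ((1 - \<theta>) * (q / p)))"
        using K B \<delta>'_pos by (simp add: powr_mult powr_powr)
      \<comment> \<open>Criticality of q: the gradient enters linearly, so that the pointwise bound
        can be integrated.\<close>
      also have "(1 - \<theta>) * (q / p) = 1" using \<theta>(1) p_pos q_pos by (simp flip: \<theta>(1))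
      also have "B powr (\<theta> * (q / p)) = A powr \<theta>"
        using p_pos q_pos by (simp add: B_def powr_powr)
      finally show ?thesis using p_pos \<delta>'_pos by (simp add: powr_powr mult.assoc)
    qed
    show ?thesis
    proof (rule field_le_epsilon)
      fix e :: real assume "0 < e"
      define M where "M = K powr (q / p) * A powr \<theta>"
      have M: "0 < M" using K A(2) by (simp add: M_def)
      have "\<bar>v x\<bar> powr q \<le> M * (\<delta> + e / M)"
        unfolding M_def by (rule step) (use M \<open>0 < e\<close> in \<open>simp add: M_def\<close>)
      also have "\<dots> = M * \<delta> + e" using M by (simp add: distrib_left)
      finally show "\<bar>v x\<bar> powr q \<le> K powr (q / p) * A powr \<theta> * \<delta> + e"
        unfolding M_def .
    qed
  qed
  then show ?thesis using K by (intro that[of "K powr (q / p)"]) (auto simp: \<theta>_def)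
qed

text \<open>Integrating the pointwise bound gives \<open>A \<le> C * A powr \<theta> * g\<close>
  with A on both sides. Membership in \<open>Lq q\<close> makes A finite, so it can be divided out,
  and the exponent left over is \<open>1 - \<theta> = p / q\<close>.\<close>

theorem sobolev_inequality:
  obtains C where "0 < C" "\<And>v :: 'a \<Rightarrow> real. v \<in> Lq q \<Longrightarrow>
      ennreal ((\<integral>x. \<bar>v x\<bar> powr q \<partial>lborel) powr (p / q)) \<le> ennreal C * gagliardo_pow s p v"
proof -
  obtain C where C: "0 < C" "\<And>(v :: 'a \<Rightarrow> real) A x \<delta>. v \<in> borel_measurable borel \<Longrightarrow>
      integrable lborel (\<lambda>x. \<bar>v x\<bar> powr q) \<Longrightarrow> A = (\<integral>x. \<bar>v x\<bar> powr q \<partial>lborel) \<Longrightarrow> 0 < A \<Longrightarrow>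
      frac_grad_pow s p v x = ennreal \<delta> \<Longrightarrow> 0 \<le> \<delta> \<Longrightarrow>
      \<bar>v x\<bar> powr q \<le> C * A powr (s * p / real DIM('a)) * \<delta>"
    by (rule sobolev_pointwise_optimal) blast
  have "ennreal ((\<integral>x. \<bar>v x\<bar> powr q \<partial>lborel) powr (p / q)) \<le> ennreal C * gagliardo_pow s p v"
    if "v \<in> Lq q" for v :: "'a \<Rightarrow> real"
  proof -
    have v [measurable]: "v \<in> borel_measurable borel" and int: "integrable lborel (\<lambda>x. \<bar>v x\<bar> powr q)"
      using that by (auto simp: Lq_def)
    define A where "A = (\<integral>x. \<bar>v x\<bar> powr q \<partial>lborel)"
    have A0: "0 \<le> A" unfolding A_def by (rule Bochner_Integration.integral_nonneg) simp
    show ?thesis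
    proof (cases "A = 0 \<or> gagliardo_pow s p v = \<top>")
      case True
      then show ?thesis using C(1) by (auto simp: A_def[symmetric] ennreal_mult_top)
    next
      case False
      then have A: "0 < A" and fin: "gagliardo_pow s p v \<noteq> \<top>" using A0 by auto
      define \<theta> where "\<theta> = s * p / real DIM('a)"
      have pt: "ennreal (\<bar>v x\<bar> powr q) \<le> ennreal (C * A powr \<theta>) * frac_grad_pow s p v x" for x
      proof (cases "frac_grad_pow s p v x")
        case (real \<delta>)
        have "\<bar>v x\<bar> powr q \<le> C * A powr \<theta> * \<delta>"
          unfolding \<theta>_def using C(2)[OF v int A_def A _ real(1)] real by simp
        then show ?thesis using real C(1) by (simp flip: ennreal_mult add: ennreal_leI)
      next
        case top
        then show ?thesis using C(1) A by (simp add: ennreal_mult_top)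
      qed
      have "ennreal A = (\<integral>\<^sup>+x. ennreal (\<bar>v x\<bar> powr q) \<partial>lborel)"
        unfolding A_def by (rule nn_integral_eq_integral[OF int, symmetric]) simp
      also have "\<dots> \<le> (\<integral>\<^sup>+x. ennreal (C * A powr \<theta>) * frac_grad_pow s p v x \<partial>lborel)"
        by (intro nn_integral_mono pt)
      also have "\<dots> = ennreal (C * A powr \<theta>) * gagliardo_pow s p v"
        by (simp add: nn_integral_cmult gagliardo_pow_eq)
      finally have le: "ennreal A \<le> ennreal (C * A powr \<theta>) * gagliardo_pow s p v" .
      obtain g where g: "gagliardo_pow s p v = ennreal g" "0 \<le> g"
        using fin by (cases "gagliardo_pow s p v") auto
      have "A \<le> C * A powr \<theta> * g"
        using le C(1) g(2) by (simp add: g(1) flip: ennreal_mult)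
      then have "A / A powr \<theta> \<le> C * g" using A by (simp add: field_simps)
      also have "A / A powr \<theta> = A powr (p / q)"
        unfolding p_div_q \<theta>_def[symmetric] using A by (simp add: powr_diff)
      finally show ?thesis using C(1) g by (simp add: A_def[symmetric] ennreal_leI flip: ennreal_mult)
    qed
  qed
  with C(1) show ?thesis by (rule that)
qed

section \<open>Linear structure of \<open>Lq\<close> and \<open>Dsp\<close>, and multiplication by
  test functions\<close>

lemma Lq_add:
  fixes v w :: "'a \<Rightarrow> real"
  assumes "v \<in> Lq q" "w \<in> Lq q"
  shows "(\<lambda>x. v x + w x) \<in> Lq q"
proof -
  have [measurable]: "v \<in> borel_measurable borel" "w \<in> borel_measurable borel"
    using assms by (auto simp: Lq_def)
  have "integrable lborel (\<lambda>x. \<bar>v x + w x\<bar> powr q)"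
  proof (rule Bochner_Integration.integrable_bound)
    show "integrable lborel (\<lambda>x. 2 powr q * (\<bar>v x\<bar> powr q + \<bar>w x\<bar> powr q))"
      using assms by (auto simp: Lq_def)
    show "AE x in lborel. norm (\<bar>v x + w x\<bar> powr q) \<le> norm (2 powr q * (\<bar>v x\<bar> powr q + \<bar>w x\<bar> powr q))"
      using powr_add_le[of q] q_pos by simp
  qed measurable
  then show ?thesis by (simp add: Lq_def)
qed

lemma Lq_mult_bounded:
  fixes v \<phi> :: "'a \<Rightarrow> real"
  assumes "v \<in> Lq q" and [measurable]: "\<phi> \<in> borel_measurable borel" and B: "\<And>x. \<bar>\<phi> x\<bar> \<le> B"
  shows "(\<lambda>x. \<phi> x * v x) \<in> Lq q"
proof -
  have [measurable]: "v \<in> borel_measurable borel"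
    using assms by (auto simp: Lq_def)
  have "integrable lborel (\<lambda>x. \<bar>\<phi> x * v x\<bar> powr q)"
  proof (rule Bochner_Integration.integrable_bound)
    show "integrable lborel (\<lambda>x. B powr q * \<bar>v x\<bar> powr q)"
      using assms by (auto simp: Lq_def)
    have "\<bar>\<phi> x\<bar> powr q \<le> B powr q" for x using B q_pos by (intro powr_mono2) auto
    then show "AE x in lborel. norm (\<bar>\<phi> x * v x\<bar> powr q) \<le> norm (B powr q * \<bar>v x\<bar> powr q)"
      by (simp add: abs_mult powr_mult mult_right_mono)
  qed measurable
  then show ?thesis by (simp add: Lq_def)
qed

lemma Lq_cmult: "(v :: 'a \<Rightarrow> real) \<in> Lq q \<Longrightarrow> (\<lambda>x. c * v x) \<in> Lq q"
  by (rule Lq_mult_bounded[where \<phi> = "\<lambda>_. c" and B = "\<bar>c\<bar>"]) auto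

lemma Lq_diff:
  fixes v w :: "'a \<Rightarrow> real"
  assumes "v \<in> Lq q" "w \<in> Lq q"
  shows "(\<lambda>x. v x - w x) \<in> Lq q"
  using Lq_add[OF assms(1) Lq_cmult[OF assms(2), of "-1"]] by simp

lemma test_functions_Lq:
  assumes "\<phi> \<in> test_functions"
  shows "(\<phi> :: 'a \<Rightarrow> real) \<in> Lq q"
proof -
  note m [measurable] = test_functions_measurable[OF assms]
  obtain B where B: "\<And>x. \<bar>\<phi> x\<bar> \<le> B" using test_functions_bounded[OF assms] by blast
  define K where "K = closure {x. \<phi> x \<noteq> 0}"
  have K: "compact K" using assms by (auto simp: K_def test_functions_def)
  have [measurable]: "K \<in> sets borel" using K by (intro borel_closed compact_imp_closed)
  have "integrable lborel (\<lambda>x. B powr q * indicat_real K x)"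
    using emeasure_bounded_finite[OF compact_imp_bounded[OF K]] by (auto simp: integrable_indicator_iff)
  then have "integrable lborel (\<lambda>x. \<bar>\<phi> x\<bar> powr q)"
  proof (rule Bochner_Integration.integrable_bound)
    have "\<bar>\<phi> x\<bar> powr q \<le> B powr q * indicat_real K x" for x
    proof (cases "x \<in> K")
      case True
      then show ?thesis using B q_pos by (auto intro: powr_mono2)
    next
      case False
      then have "\<phi> x = 0" using closure_subset[of "{x. \<phi> x \<noteq> 0}"] by (auto simp: K_def)
      then show ?thesis by simp
    qed
    then show "AE x in lborel. norm (\<bar>\<phi> x\<bar> powr q) \<le> norm (B powr q * indicat_real K x)"
      by (simp add: abs_mult)
  qed measurable
  then show ?thesis by (simp add: Lq_def m)
qed

lemma DspD:
  fixes v :: "'a \<Rightarrow> real"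
  assumes "v \<in> Dsp s p"
  shows "v \<in> Lq q" "v \<in> borel_measurable borel" "integrable lborel (\<lambda>x. \<bar>v x\<bar> powr q)"
  using assms by (auto simp: Dsp_def q_def Lq_def)

lemma Dsp_approx:
  fixes v :: "'a \<Rightarrow> real"
  assumes "v \<in> Dsp s p"
  obtains \<phi> where "\<And>j::nat. \<phi> j \<in> test_functions" "(\<lambda>j. gagliardo_pow s p (\<lambda>x. v x - \<phi> j x)) \<longlonglongrightarrow> 0"
  using assms by (auto simp: Dsp_def)

lemma DspI:
  fixes v :: "'a \<Rightarrow> real"
  assumes "v \<in> Lq q" "\<And>j::nat. \<phi> j \<in> test_functions" "(\<lambda>j. gagliardo_pow s p (\<lambda>x. v x - \<phi> j x)) \<longlonglongrightarrow> 0"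
  shows "v \<in> Dsp s p"
  using assms by (auto simp: Dsp_def q_def)

lemma gagliardo_pow_finite:
  fixes v :: "'a \<Rightarrow> real"
  assumes "v \<in> Dsp s p"
  shows "gagliardo_pow s p v < \<infinity>"
proof -
  note [measurable] = DspD(2)[OF assms]
  obtain \<phi> where \<phi>: "\<And>j::nat. \<phi> j \<in> test_functions" "(\<lambda>j. gagliardo_pow s p (\<lambda>x. v x - \<phi> j x)) \<longlonglongrightarrow> 0"
    using Dsp_approx[OF assms] by blast
  have "\<forall>\<^sub>F j in sequentially. gagliardo_pow s p (\<lambda>x. v x - \<phi> j x) < \<infinity>"
    using \<phi>(2) by (rule order_tendstoD) simp
  then obtain j where j: "gagliardo_pow s p (\<lambda>x. v x - \<phi> j x) < \<infinity>"
    by (auto simp: eventually_sequentially)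
  note [measurable] = test_functions_measurable[OF \<phi>(1)]
  have "gagliardo_pow s p (\<phi> j) < \<infinity>" using gagliardo_pow_test_function[OF \<phi>(1)] by blast
  moreover have "gagliardo_pow s p (\<lambda>x. (v x - \<phi> j x) + \<phi> j x)
      \<le> ennreal (2 powr p) * (gagliardo_pow s p (\<lambda>x. v x - \<phi> j x) + gagliardo_pow s p (\<phi> j))"
    by (rule gagliardo_pow_add_le) measurable
  ultimately show ?thesis using j by (auto simp: ennreal_mult_less_top le_less_trans)
qed

lemma Dsp_add:
  fixes v w :: "'a \<Rightarrow> real"
  assumes "v \<in> Dsp s p" "w \<in> Dsp s p"
  shows "(\<lambda>x. v x + w x) \<in> Dsp s p"
proof -
  obtain \<phi> where \<phi>: "\<And>j::nat. \<phi> j \<in> test_functions" "(\<lambda>j. gagliardo_pow s p (\<lambda>x. v x - \<phi> j x)) \<longlonglongrightarrow> 0"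
    using Dsp_approx[OF assms(1)] by blast
  obtain \<psi> where \<psi>: "\<And>j::nat. \<psi> j \<in> test_functions" "(\<lambda>j. gagliardo_pow s p (\<lambda>x. w x - \<psi> j x)) \<longlonglongrightarrow> 0"
    using Dsp_approx[OF assms(2)] by blast
  note [measurable] = DspD(2)[OF assms(1)] DspD(2)[OF assms(2)]
    test_functions_measurable[OF \<phi>(1)] test_functions_measurable[OF \<psi>(1)]
  show ?thesis
  proof (rule DspI)
    show "(\<lambda>x. v x + w x) \<in> Lq q" using assms by (intro Lq_add DspD)
    show "(\<lambda>x. \<phi> j x + \<psi> j x) \<in> test_functions" for j by (intro test_functions_add \<phi> \<psi>)
    show "(\<lambda>j. gagliardo_pow s p (\<lambda>x. v x + w x - (\<phi> j x + \<psi> j x))) \<longlonglongrightarrow> 0"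
    proof (rule tendsto_0_le_cmult[OF _ ])
      show "(\<lambda>j. gagliardo_pow s p (\<lambda>x. v x - \<phi> j x) + gagliardo_pow s p (\<lambda>x. w x - \<psi> j x)) \<longlonglongrightarrow> 0"
        using tendsto_add[OF \<phi>(2) \<psi>(2)] by simp
      have "gagliardo_pow s p (\<lambda>x. (v x - \<phi> j x) + (w x - \<psi> j x))
        \<le> ennreal (2 powr p) * (gagliardo_pow s p (\<lambda>x. v x - \<phi> j x) + gagliardo_pow s p (\<lambda>x. w x - \<psi> j x))" for j
        by (rule gagliardo_pow_add_le) measurable
      then show "gagliardo_pow s p (\<lambda>x. v x + w x - (\<phi> j x + \<psi> j x))
        \<le> ennreal (2 powr p) * (gagliardo_pow s p (\<lambda>x. v x - \<phi> j x) + gagliardo_pow s p (\<lambda>x. w x - \<psi> j x))" for j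
        by (simp add: algebra_simps)
    qed
  qed
qed

lemma Dsp_cmult:
  fixes v :: "'a \<Rightarrow> real"
  assumes "v \<in> Dsp s p"
  shows "(\<lambda>x. c * v x) \<in> Dsp s p"
proof -
  obtain \<phi> where \<phi>: "\<And>j::nat. \<phi> j \<in> test_functions" "(\<lambda>j. gagliardo_pow s p (\<lambda>x. v x - \<phi> j x)) \<longlonglongrightarrow> 0"
    using Dsp_approx[OF assms(1)] by blast
  note [measurable] = DspD(2)[OF assms(1)] test_functions_measurable[OF \<phi>(1)]
  show ?thesis
  proof (rule DspI)
    show "(\<lambda>x. c * v x) \<in> Lq q" using assms by (intro Lq_cmult DspD)
    show "(\<lambda>x. c * \<phi> j x) \<in> test_functions" for j by (intro test_functions_cmult \<phi>)
    show "(\<lambda>j. gagliardo_pow s p (\<lambda>x. c * v x - c * \<phi> j x)) \<longlonglongrightarrow> 0"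
    proof (rule tendsto_0_le_cmult[OF \<phi>(2)])
      show "gagliardo_pow s p (\<lambda>x. c * v x - c * \<phi> j x) \<le> ennreal (\<bar>c\<bar> powr p) * gagliardo_pow s p (\<lambda>x. v x - \<phi> j x)" for j
        using gagliardo_pow_cmult[of "\<lambda>x. v x - \<phi> j x" c] by (simp add: right_diff_distrib)
    qed
  qed
qed

lemma Dsp_diff:
  fixes v w :: "'a \<Rightarrow> real"
  assumes "v \<in> Dsp s p" "w \<in> Dsp s p"
  shows "(\<lambda>x. v x - w x) \<in> Dsp s p"
  using Dsp_add[OF assms(1) Dsp_cmult[OF assms(2), of "-1"]] by simp

text \<open>Below the level t the integral is paid by the mass I of the weight, above it by its
  bound W and the L^q integral of v; \<open>t = A powr (b / q)\<close> balances both. The exponent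
  \<open>b = p\<close> serves the commutator, \<open>b = 1\<close> the integrals over balls.\<close>

lemma weighted_Lp_bound:
  fixes v :: "'a \<Rightarrow> real" and w :: "'a \<Rightarrow> ennreal"
  assumes b: "0 < b" "b < q" and "v \<in> Lq q" and [measurable]: "w \<in> borel_measurable borel"
    and w: "\<And>x. w x \<le> ennreal W" "0 \<le> W" "(\<integral>\<^sup>+x. w x \<partial>lborel) = ennreal I" "0 \<le> I"
  shows "(\<integral>\<^sup>+x. ennreal (\<bar>v x\<bar> powr b) * w x \<partial>lborel) \<le> ennreal ((I + W) * (\<integral>x. \<bar>v x\<bar> powr q \<partial>lborel) powr (b / q))"
proof -
  have v [measurable]: "v \<in> borel_measurable borel" and int: "integrable lborel (\<lambda>x. \<bar>v x\<bar> powr q)"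
    using assms(3) by (auto simp: Lq_def)
  define A where "A = (\<integral>x. \<bar>v x\<bar> powr q \<partial>lborel)"
  have A0: "0 \<le> A" unfolding A_def by (rule Bochner_Integration.integral_nonneg) simp
  show ?thesis
  proof (cases "A = 0")
    case True
    then have "AE x in lborel. \<bar>v x\<bar> powr q = 0"
      using integral_nonneg_eq_0_iff_AE[OF int] by (simp add: A_def)
    then have "AE x in lborel. ennreal (\<bar>v x\<bar> powr b) * w x = 0"
      by eventually_elim simp
    then have "(\<integral>\<^sup>+x. ennreal (\<bar>v x\<bar> powr b) * w x \<partial>lborel) = 0"
      by (subst nn_integral_0_iff_AE) auto
    then show ?thesis by simp
  next
    case False
    then have A: "0 < A" using A0 by simp
    define t where "t = A powr (b / q)"
    have t: "0 < t" using A by (simp add: t_def)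
    define k where "k = t powr (1 - q / b)"
    have k: "0 \<le> k" by (simp add: k_def)
    have kA: "k * A = t"
    proof -
      have "k = t * t powr (- (q / b))" using t by (simp add: k_def powr_diff powr_minus_divide)
      also have "t powr (- (q / b)) = 1 / A"
        using b q_pos A by (simp add: t_def powr_powr powr_minus_divide)
      finally show ?thesis using A by simp
    qed
    have "(\<integral>\<^sup>+x. ennreal (\<bar>v x\<bar> powr b) * w x \<partial>lborel) \<le> (\<integral>\<^sup>+x. ennreal t * w x + ennreal (k * W) * ennreal (\<bar>v x\<bar> powr q) \<partial>lborel)"
    proof (rule nn_integral_mono)
      fix x
      have "\<bar>v x\<bar> powr b \<le> t + k * \<bar>v x\<bar> powr q"
        using truncation_bound[of "\<bar>v x\<bar> powr b" t "q / b"] t b by (simp add: powr_powr k_def)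
      then have "ennreal (\<bar>v x\<bar> powr b) * w x \<le> ennreal (t + k * \<bar>v x\<bar> powr q) * w x"
        by (intro mult_right_mono ennreal_leI) auto
      also have "\<dots> = ennreal t * w x + ennreal (k * \<bar>v x\<bar> powr q) * w x"
        using t k by (simp add: distrib_right)
      also have "\<dots> \<le> ennreal t * w x + ennreal (k * \<bar>v x\<bar> powr q) * ennreal W"
        by (intro add_left_mono mult_left_mono w) auto
      also have "ennreal (k * \<bar>v x\<bar> powr q) * ennreal W = ennreal (k * W) * ennreal (\<bar>v x\<bar> powr q)"
        using k w(2) by (simp add: mult_ac flip: ennreal_mult)
      finally show "ennreal (\<bar>v x\<bar> powr b) * w x \<le> ennreal t * w x + ennreal (k * W) * ennreal (\<bar>v x\<bar> powr q)" .
    qed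
    also have "\<dots> = ennreal t * ennreal I + ennreal (k * W) * ennreal A"
      by (simp add: nn_integral_add nn_integral_cmult w(3) nn_integral_eq_integral[OF int] A_def)
    also have "\<dots> = ennreal (t * I + k * W * A)"
      using t k w A by (simp add: ennreal_mult)
    also have "t * I + k * W * A = (I + W) * t" using kA by (simp add: algebra_simps)
    finally show ?thesis by (simp add: t_def A_def)
  qed
qed

text \<open>The commutator term of the Leibniz rule contains v itself and not its differences. The
  Sobolev inequality brings it back to the seminorm, which makes multiplication by
  \<open>\<phi>\<close> continuous and lets it pass to the closure of the test functions.\<close>

lemma gagliardo_pow_mult_test_function:
  fixes \<phi> :: "'a \<Rightarrow> real"
  assumes "\<phi> \<in> test_functions"
  obtains C where "0 < C" "\<And>v :: 'a \<Rightarrow> real. v \<in> Lq q \<Longrightarrow> gagliardo_pow s p (\<lambda>x. \<phi> x * v x) \<le> ennreal C * gagliardo_pow s p v"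
proof -
  note m [measurable] = test_functions_measurable[OF assms]
  obtain B where B: "\<And>x. \<bar>\<phi> x\<bar> \<le> B" using test_functions_bounded[OF assms] by blast
  have B0: "0 \<le> B" using order_trans[OF abs_ge_zero B] .
  obtain W where W: "0 \<le> W" "\<And>x. frac_grad_pow s p \<phi> x \<le> ennreal W" "gagliardo_pow s p \<phi> < \<infinity>"
    using gagliardo_pow_test_function[OF assms] by blast
  obtain S where S: "0 < S" "\<And>v :: 'a \<Rightarrow> real. v \<in> Lq q \<Longrightarrow>
      ennreal ((\<integral>x. \<bar>v x\<bar> powr q \<partial>lborel) powr (p / q)) \<le> ennreal S * gagliardo_pow s p v"
    by (rule sobolev_inequality) blast
  define I where "I = enn2real (gagliardo_pow s p \<phi>)"
  have I: "(\<integral>\<^sup>+x. frac_grad_pow s p \<phi> x \<partial>lborel) = ennreal I" "0 \<le> I"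
    using W(3) by (auto simp: I_def gagliardo_pow_eq[OF m])
  define C where "C = 2 powr p * (B powr p + (I + W) * S) + 1"
  have "gagliardo_pow s p (\<lambda>x. \<phi> x * v x) \<le> ennreal C * gagliardo_pow s p v" if v: "v \<in> Lq q" for v :: "'a \<Rightarrow> real"
  proof -
    have vm [measurable]: "v \<in> borel_measurable borel" using v by (simp add: Lq_def)
    have "gagliardo_pow s p (\<lambda>x. \<phi> x * v x)
    \<le> ennreal (2 powr p) * (\<integral>\<^sup>+x. ennreal (\<bar>\<phi> x\<bar> powr p) * frac_grad_pow s p v x \<partial>lborel)
      + ennreal (2 powr p) * (\<integral>\<^sup>+y. ennreal (\<bar>v y\<bar> powr p) * frac_grad_pow s p \<phi> y \<partial>lborel)"
      using powr_add_le[of p] p_pos by (intro gagliardo_pow_mult_le vm m) (auto simp: distrib_left)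
    also have "\<dots> \<le> ennreal (2 powr p) * (ennreal (B powr p) * gagliardo_pow s p v)
       + ennreal (2 powr p) * (ennreal (I + W) * (ennreal S * gagliardo_pow s p v))"
    proof (intro add_mono mult_left_mono)
      have "(\<integral>\<^sup>+x. ennreal (\<bar>\<phi> x\<bar> powr p) * frac_grad_pow s p v x \<partial>lborel)
          \<le> (\<integral>\<^sup>+x. ennreal (B powr p) * frac_grad_pow s p v x \<partial>lborel)"
        using B p_pos by (intro nn_integral_mono mult_right_mono ennreal_leI powr_mono2) auto
      then show "(\<integral>\<^sup>+x. ennreal (\<bar>\<phi> x\<bar> powr p) * frac_grad_pow s p v x \<partial>lborel) \<le> ennreal (B powr p) * gagliardo_pow s p v"
        by (simp add: nn_integral_cmult gagliardo_pow_eq)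
      have "(\<integral>\<^sup>+y. ennreal (\<bar>v y\<bar> powr p) * frac_grad_pow s p \<phi> y \<partial>lborel)
          \<le> ennreal ((I + W) * (\<integral>x. \<bar>v x\<bar> powr q \<partial>lborel) powr (p / q))"
        by (rule weighted_Lp_bound[OF p_pos p_less_q v _ W(2,1) I]) measurable
      also have "\<dots> = ennreal (I + W) * ennreal ((\<integral>x. \<bar>v x\<bar> powr q \<partial>lborel) powr (p / q))"
        using I(2) W(1) by (intro ennreal_mult) auto
      also have "\<dots> \<le> ennreal (I + W) * (ennreal S * gagliardo_pow s p v)"
        by (intro mult_left_mono S(2) v) auto
      finally show "(\<integral>\<^sup>+y. ennreal (\<bar>v y\<bar> powr p) * frac_grad_pow s p \<phi> y \<partial>lborel)
          \<le> ennreal (I + W) * (ennreal S * gagliardo_pow s p v)" .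
    qed auto
    also have "\<dots> = ennreal (2 powr p * (B powr p + (I + W) * S)) * gagliardo_pow s p v"
      using I(2) W(1) S(1) by (simp add: ennreal_mult ennreal_plus[symmetric] distrib_left distrib_right mult.assoc del: ennreal_plus)
         (simp add: ennreal_mult distrib_left distrib_right mult.assoc)
    also have "\<dots> \<le> ennreal C * gagliardo_pow s p v"
      by (intro mult_right_mono ennreal_leI) (auto simp: C_def)
    finally show ?thesis .
  qed
  moreover have "0 < C" unfolding C_def
    using I(2) W(1) S(1) by (intro add_nonneg_pos mult_nonneg_nonneg add_nonneg_nonneg) auto
  ultimately show ?thesis by (intro that)
qed

lemma Dsp_mult_test_function:
  fixes \<phi> v :: "'a \<Rightarrow> real"
  assumes \<phi>: "\<phi> \<in> test_functions" and v: "v \<in> Dsp s p"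
  shows "(\<lambda>x. \<phi> x * v x) \<in> Dsp s p"
proof -
  obtain \<psi> where \<psi>: "\<And>j::nat. \<psi> j \<in> test_functions" "(\<lambda>j. gagliardo_pow s p (\<lambda>x. v x - \<psi> j x)) \<longlonglongrightarrow> 0"
    using Dsp_approx[OF v] by blast
  obtain B where B: "\<And>x. \<bar>\<phi> x\<bar> \<le> B" using test_functions_bounded[OF \<phi>] by blast
  obtain C where C: "\<And>v :: 'a \<Rightarrow> real. v \<in> Lq q \<Longrightarrow> gagliardo_pow s p (\<lambda>x. \<phi> x * v x) \<le> ennreal C * gagliardo_pow s p v"
    using gagliardo_pow_mult_test_function[OF \<phi>] by blast
  show ?thesis
  proof (rule DspI)
    show "(\<lambda>x. \<phi> x * v x) \<in> Lq q"
      by (rule Lq_mult_bounded[OF DspD(1)[OF v] test_functions_measurable[OF \<phi>] B])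
    show "(\<lambda>x. \<phi> x * \<psi> j x) \<in> test_functions" for j by (intro test_functions_mult \<phi> \<psi>)
    show "(\<lambda>j. gagliardo_pow s p (\<lambda>x. \<phi> x * v x - \<phi> x * \<psi> j x)) \<longlonglongrightarrow> 0"
    proof (rule tendsto_0_le_cmult[OF \<psi>(2)])
      show "gagliardo_pow s p (\<lambda>x. \<phi> x * v x - \<phi> x * \<psi> j x) \<le> ennreal C * gagliardo_pow s p (\<lambda>x. v x - \<psi> j x)" for j
        using C[OF Lq_diff[OF DspD(1)[OF v] test_functions_Lq[OF \<psi>(1)]]] by (simp add: right_diff_distrib)
    qed
  qed
qed

end

section \<open>Boundedness of weakly convergent sequences and the Brezis-Lieb lemma\<close>

text \<open>The gliding hump: the coefficients are chosen so that the \<open>j\<close>-th partial sum is large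
  at \<open>u (\<kappa> j)\<close>, and the tail cannot cancel it since the powers of \<open>1/3\<close> sum up to \<open>1/2\<close> of
  the last one.\<close>

lemma gliding_hump:
  fixes N :: "'v \<Rightarrow> real" and G :: "nat \<Rightarrow> 'v \<Rightarrow> real" and u :: "nat \<Rightarrow> 'v"
  assumes G: "\<And>k l. \<bar>G k (u l)\<bar> \<le> N (u l)" and norming: "\<And>k. G k (u k) = N (u k)"
    and bdd: "\<And>c \<kappa>. (\<And>j. \<bar>c j\<bar> \<le> (1/3) ^ j) \<Longrightarrow> \<exists>B. \<forall>k. \<bar>\<Sum>j. c j * G (\<kappa> j) (u k)\<bar> \<le> B"
  shows "\<exists>B. \<forall>k. N (u k) \<le> B"
proof (rule ccontr)
  assume "\<not> ?thesis"
  \<comment> \<open>The norms are chosen so large that they still exceed j after multiplication by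
    the coefficient 3^(-j).\<close>
  then have "\<exists>k. real j * 3 ^ j < N (u k)" for j :: nat by (meson not_le)
  then obtain \<kappa> where \<kappa>: "\<And>j. real j * 3 ^ j < N (u (\<kappa> j))" by metis
  have N0: "0 \<le> N (u l)" for l using order_trans[OF abs_ge_zero G] .
  \<comment> \<open>The sign of the previous partial sum at \<open>u (\<kappa> j)\<close>: the new
    term then adds to it in modulus and cannot cancel it.\<close>
  define \<sigma> where "\<sigma> P j = (if 0 \<le> P (u (\<kappa> j)) then 1 else - 1 :: real)" for P :: "'v \<Rightarrow> real" and j
  \<comment> \<open>Partial sums are built as functions, since each sign depends on the value of the
    whole previous sum at the next point.\<close>
  define P where "P = rec_nat (\<lambda>_. 0) (\<lambda>j P v. P v + \<sigma> P j * (1/3) ^ j * G (\<kappa> j) v)"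
  have P_0: "P 0 v = 0" and P_Suc: "P (Suc j) v = P j v + \<sigma> (P j) j * (1/3) ^ j * G (\<kappa> j) v" for j v
    by (simp_all add: P_def)
  define c where "c j = \<sigma> (P j) j * (1/3) ^ j" for j
  have c: "\<bar>c j\<bar> \<le> (1/3) ^ j" for j by (simp add: c_def \<sigma>_def)
  have P_sum: "P j v = (\<Sum>i<j. c i * G (\<kappa> i) v)" for j v
    by (induction j) (simp_all add: P_0 P_Suc c_def)
  have P_big: "(1/3) ^ j * N (u (\<kappa> j)) \<le> \<bar>P (Suc j) (u (\<kappa> j))\<bar>" for j
  proof -
    have "0 \<le> (1/3) ^ j * N (u (\<kappa> j))" using N0 by simp
    then show ?thesis by (auto simp: P_Suc \<sigma>_def norming)
  qed
  have term_le: "\<bar>c i * G (\<kappa> i) (u l)\<bar> \<le> (1/3) ^ i * N (u l)" for i l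
    unfolding abs_mult by (intro mult_mono c G) auto
  have summ: "summable (\<lambda>i. (1/3) ^ i * N (u l))" for l
    by (intro summable_mult2 summable_geometric) simp
  have summ': "summable (\<lambda>i. c i * G (\<kappa> i) (u l))" for l
    by (rule summable_comparison_test[OF _ summ]) (use term_le in auto)
  \<comment> \<open>The partial sum up to j is at least the j-th bound, and the tail is at most
    (3/2) * 3^(-j-1), half of it.\<close>
  have big: "(1/2) * ((1/3) ^ j * N (u (\<kappa> j))) \<le> \<bar>\<Sum>i. c i * G (\<kappa> i) (u (\<kappa> j))\<bar>" for j
  proof -
    let ?f = "\<lambda>i. c i * G (\<kappa> i) (u (\<kappa> j))" and ?N = "N (u (\<kappa> j))"
    have "(\<Sum>i. ?f i) = (\<Sum>i. ?f (i + Suc j)) + P (Suc j) (u (\<kappa> j))"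
      unfolding P_sum by (rule suminf_split_initial_segment[OF summ'])
    moreover have "\<bar>\<Sum>i. ?f (i + Suc j)\<bar> \<le> (1/2) * ((1/3) ^ j * ?N)"
    proof -
      have le: "\<bar>?f (i + Suc j)\<bar> \<le> (1/3) ^ i * ((1/3) ^ Suc j * ?N)" for i
        using term_le[of "i + Suc j" "\<kappa> j"] by (simp add: power_add mult_ac)
      have s3: "(\<lambda>i. (1/3) ^ i * ((1/3) ^ Suc j * ?N)) sums (3/2 * ((1/3) ^ Suc j * ?N))"
        using sums_mult2[OF geometric_sums[of "1/3::real"], of "(1/3) ^ Suc j * ?N"] by simp
      have sa: "summable (\<lambda>i. \<bar>?f (i + Suc j)\<bar>)"
        by (rule summable_comparison_test[OF _ sums_summable[OF s3]]) (use le in auto)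
      have "\<bar>\<Sum>i. ?f (i + Suc j)\<bar> \<le> (\<Sum>i. \<bar>?f (i + Suc j)\<bar>)" by (rule summable_rabs[OF sa])
      also have "\<dots> \<le> (\<Sum>i. (1/3) ^ i * ((1/3) ^ Suc j * ?N))"
        by (rule suminf_le[OF le sa sums_summable[OF s3]])
      also have "\<dots> = 3/2 * ((1/3) ^ Suc j * ?N)" using s3 by (rule sums_unique[symmetric])
      finally show ?thesis by (simp add: mult.commute)
    qed
    ultimately show ?thesis using P_big[of j] by linarith
  qed
  obtain B where B: "\<And>k. \<bar>\<Sum>j. c j * G (\<kappa> j) (u k)\<bar> \<le> B" using bdd[OF c, of \<kappa>] by blast
  obtain j where j: "2 * B < real j" using reals_Archimedean2 by blast
  have "real j = (1/3) ^ j * (real j * 3 ^ j)" by (simp add: power_one_over)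
  also have "\<dots> \<le> (1/3) ^ j * N (u (\<kappa> j))" using \<kappa>[of j] by (intro mult_left_mono) auto
  also have "\<dots> \<le> 2 * B" using big[of j] B[of "\<kappa> j"] by linarith
  finally show False using j by simp
qed

section \<open>Norming functionals of L^p\<close>

lemma young_powr:
  fixes a b p :: real
  assumes "1 \<le> p" "0 \<le> a" "0 \<le> b"
  shows "a powr (p - 1) * b \<le> (1 - 1 / p) * a powr p + 1 / p * b powr p"
\<comment> \<open>For \<open>p = 1\<close> and \<open>a = 0\<close> the left-hand side is 0, by the
  convention \<open>0 powr 0 = 0\<close>.\<close>
proof (cases "a = 0 \<or> b = 0")
  case True
  then show ?thesis using assms by auto
next
  case False
  then have "(a powr p) powr (1 - 1 / p) * (b powr p) powr (1 / p) \<le> (1 - 1 / p) * a powr p + 1 / p * b powr p"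
    using assms by (intro Youngs_inequality_0) auto
  moreover have "(a powr p) powr (1 - 1 / p) = a powr (p - 1)" "(b powr p) powr (1 / p) = b"
    using assms False by (auto simp: powr_powr right_diff_distrib)
  ultimately show ?thesis by simp
qed

text \<open>The normalized duality map of L^p: as a functional of g it has norm at most 1 and
  attains the norm at \<open>g = f\<close>. For \<open>p = 1\<close> the integrand is
  \<open>sgn (f x) * g x\<close>; for f of norm 0 the quotient is 0.\<close>

definition Lp_norming :: "real \<Rightarrow> 'a measure \<Rightarrow> ('a \<Rightarrow> real) \<Rightarrow> ('a \<Rightarrow> real) \<Rightarrow> real" where
  "Lp_norming p M f g = (\<integral>x. \<bar>f x\<bar> powr (p - 1) * sgn (f x) * g x \<partial>M) / (\<integral>x. \<bar>f x\<bar> powr p \<partial>M) powr (1 - 1 / p)"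

lemma Lp_norming_integrable:
  fixes p :: real and f g :: "'a \<Rightarrow> real"
  assumes p: "1 \<le> p" and [measurable]: "f \<in> borel_measurable M" "g \<in> borel_measurable M"
    and f: "integrable M (\<lambda>x. \<bar>f x\<bar> powr p)" and g: "integrable M (\<lambda>x. \<bar>g x\<bar> powr p)"
  shows "integrable M (\<lambda>x. \<bar>f x\<bar> powr (p - 1) * sgn (f x) * g x)"
proof (rule Bochner_Integration.integrable_bound)
  show "integrable M (\<lambda>x. (1 - 1 / p) * \<bar>f x\<bar> powr p + 1 / p * \<bar>g x\<bar> powr p)"
    using f g by (intro Bochner_Integration.integrable_add integrable_mult_right) auto
  have "\<bar>\<bar>f x\<bar> powr (p - 1) * sgn (f x) * g x\<bar> \<le> \<bar>(1 - 1 / p) * \<bar>f x\<bar> powr p + 1 / p * \<bar>g x\<bar> powr p\<bar>" for x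
  proof -
    have "\<bar>\<bar>f x\<bar> powr (p - 1) * sgn (f x) * g x\<bar> \<le> \<bar>f x\<bar> powr (p - 1) * \<bar>g x\<bar>"
      by (simp add: abs_mult abs_sgn_eq)
    also have "\<dots> \<le> (1 - 1 / p) * \<bar>f x\<bar> powr p + 1 / p * \<bar>g x\<bar> powr p"
      using p by (intro young_powr) auto
    finally show ?thesis by linarith
  qed
  then show "AE x in M. norm (\<bar>f x\<bar> powr (p - 1) * sgn (f x) * g x) \<le> norm ((1 - 1 / p) * \<bar>f x\<bar> powr p + 1 / p * \<bar>g x\<bar> powr p)"
    by simp
qed measurable

lemma Lp_norming_self:
  assumes "1 \<le> p"
  shows "Lp_norming p M f f = (\<integral>x. \<bar>f x\<bar> powr p \<partial>M) powr (1 / p)"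
proof -
  have "\<bar>f x\<bar> powr (p - 1) * sgn (f x) * f x = \<bar>f x\<bar> powr p" for x
  proof -
    have "sgn (f x) * f x = \<bar>f x\<bar>" by (simp add: abs_sgn mult.commute)
    then have "\<bar>f x\<bar> powr (p - 1) * sgn (f x) * f x = \<bar>f x\<bar> powr (p - 1) * \<bar>f x\<bar>" by (simp add: mult.assoc)
    also have "\<dots> = \<bar>f x\<bar> powr p" by (cases "f x = 0") (simp_all add: powr_diff)
    finally show ?thesis .
  qed
  then have "Lp_norming p M f f = (\<integral>x. \<bar>f x\<bar> powr p \<partial>M) / (\<integral>x. \<bar>f x\<bar> powr p \<partial>M) powr (1 - 1 / p)"
    by (simp add: Lp_norming_def)
  moreover have "0 \<le> (\<integral>x. \<bar>f x\<bar> powr p \<partial>M)" by (rule Bochner_Integration.integral_nonneg) simp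
  ultimately show ?thesis
    by (cases "(\<integral>x. \<bar>f x\<bar> powr p \<partial>M) = 0") (simp_all add: powr_diff)
qed

text \<open>Hoelder's inequality, obtained from Young's after f and g have been divided by their
  norms \<open>\<alpha>\<close> and \<open>\<beta>\<close>.\<close>

lemma Lp_norming_bound:
  fixes p :: real and f g :: "'a \<Rightarrow> real"
  assumes p: "1 \<le> p" and m [measurable]: "f \<in> borel_measurable M" "g \<in> borel_measurable M"
    and f: "integrable M (\<lambda>x. \<bar>f x\<bar> powr p)" and g: "integrable M (\<lambda>x. \<bar>g x\<bar> powr p)"
  shows "\<bar>Lp_norming p M f g\<bar> \<le> (\<integral>x. \<bar>g x\<bar> powr p \<partial>M) powr (1 / p)"
proof -
  define F where "F = (\<integral>x. \<bar>f x\<bar> powr p \<partial>M)"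
  define H where "H = (\<integral>x. \<bar>g x\<bar> powr p \<partial>M)"
  have F0: "0 \<le> F" and H0: "0 \<le> H"
    unfolding F_def H_def by (rule Bochner_Integration.integral_nonneg; simp)+
  let ?I = "\<integral>x. \<bar>f x\<bar> powr (p - 1) * sgn (f x) * g x \<partial>M"
  note int = Lp_norming_integrable[OF p m f g]
  show ?thesis
  proof (cases "F = 0 \<or> H = 0")
    case True
    have "AE x in M. \<bar>f x\<bar> powr (p - 1) * sgn (f x) * g x = 0"
    proof (cases "F = 0")
      case True
      then have "AE x in M. \<bar>f x\<bar> powr p = 0"
        using integral_nonneg_eq_0_iff_AE[OF f] by (simp add: F_def)
      then show ?thesis by eventually_elim simp
    next
      case False
      with True have "AE x in M. \<bar>g x\<bar> powr p = 0"
        using integral_nonneg_eq_0_iff_AE[OF g] by (simp add: H_def)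
      then show ?thesis by eventually_elim simp
    qed
    then have "?I = 0" by (rule integral_eq_zero_AE)
    then show ?thesis by (simp add: Lp_norming_def)
  next
    case False
    then have F: "0 < F" and H: "0 < H" using F0 H0 by auto
    define \<alpha> where "\<alpha> = F powr (1 / p)"
    define \<beta> where "\<beta> = H powr (1 / p)"
    have \<alpha>: "0 < \<alpha>" "\<alpha> powr p = F" and \<beta>: "0 < \<beta>" "\<beta> powr p = H"
      using F H p by (simp_all add: \<alpha>_def \<beta>_def powr_powr)
    have le: "\<bar>\<bar>f x\<bar> powr (p - 1) * sgn (f x) * g x\<bar>
        \<le> \<alpha> powr (p - 1) * \<beta> * ((1 - 1 / p) / F * \<bar>f x\<bar> powr p + 1 / p / H * \<bar>g x\<bar> powr p)" for x
    proof -
      have "\<bar>\<bar>f x\<bar> powr (p - 1) * sgn (f x) * g x\<bar> \<le> \<bar>f x\<bar> powr (p - 1) * \<bar>g x\<bar>"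
        by (simp add: abs_mult abs_sgn_eq)
      also have "\<dots> = \<alpha> powr (p - 1) * \<beta> * ((\<bar>f x\<bar> / \<alpha>) powr (p - 1) * (\<bar>g x\<bar> / \<beta>))"
        using \<alpha> \<beta> by (simp add: powr_divide)
      also have "\<dots> \<le> \<alpha> powr (p - 1) * \<beta> * ((1 - 1 / p) * (\<bar>f x\<bar> / \<alpha>) powr p + 1 / p * (\<bar>g x\<bar> / \<beta>) powr p)"
        using \<alpha> \<beta> p by (intro mult_left_mono young_powr) auto
      also have "(\<bar>f x\<bar> / \<alpha>) powr p = \<bar>f x\<bar> powr p / F" using \<alpha> by (simp add: powr_divide)
      also have "(\<bar>g x\<bar> / \<beta>) powr p = \<bar>g x\<bar> powr p / H" using \<beta> by (simp add: powr_divide)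
      finally show ?thesis by simp
    qed
    have "\<bar>?I\<bar> \<le> (\<integral>x. \<bar>\<bar>f x\<bar> powr (p - 1) * sgn (f x) * g x\<bar> \<partial>M)" by (rule integral_abs_bound)
    also have "\<dots> \<le> (\<integral>x. \<alpha> powr (p - 1) * \<beta> * ((1 - 1 / p) / F * \<bar>f x\<bar> powr p + 1 / p / H * \<bar>g x\<bar> powr p) \<partial>M)"
      using int f g
      by (intro integral_mono le integrable_abs integrable_mult_right Bochner_Integration.integrable_add) auto
    also have "\<dots> = \<alpha> powr (p - 1) * \<beta> * ((1 - 1 / p) / F * F + 1 / p / H * H)"
      using f g by (simp add: F_def H_def)
    also have "\<dots> = \<alpha> powr (p - 1) * \<beta>" using F H by simp
    finally have "\<bar>?I\<bar> \<le> \<alpha> powr (p - 1) * \<beta>" .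
    moreover have "\<alpha> powr (p - 1) = F powr (1 - 1 / p)"
      using p by (simp add: \<alpha>_def powr_powr diff_divide_distrib)
    ultimately have "\<bar>?I\<bar> / F powr (1 - 1 / p) \<le> \<beta>" using F by (simp add: pos_divide_le_eq mult.commute)
    then show ?thesis by (simp add: Lp_norming_def F_def[symmetric] \<beta>_def H_def)
  qed
qed

section \<open>The Brezis-Lieb lemma\<close>

lemma brezis_lieb_pointwise:
  fixes q e :: real
  assumes "0 < q" "0 < e"
  obtains C where "0 \<le> C" "\<And>a b :: real. \<bar>\<bar>a + b\<bar> powr q - \<bar>a\<bar> powr q\<bar> \<le> e * \<bar>a\<bar> powr q + C * \<bar>b\<bar> powr q"
proof -
  \<comment> \<open>The lower estimate uses the upper one twice, which turns d into
    \<open>d * (1 + d)\<close>; this must not exceed e.\<close>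
  define d where "d = min 1 (e / 2)"
  have d: "0 < d" "d * (1 + d) \<le> e" "d \<le> e" "d \<le> 1"
  proof -
    show "0 < d" "d \<le> e" "d \<le> 1" using assms by (auto simp: d_def)
    have "d * (1 + d) \<le> d * 2" using \<open>0 < d\<close> \<open>d \<le> 1\<close> by (intro mult_left_mono) auto
    also have "\<dots> \<le> e" by (simp add: d_def)
    finally show "d * (1 + d) \<le> e" .
  qed
  obtain C where C: "0 \<le> C" "\<And>a b :: real. \<bar>a + b\<bar> powr q \<le> (1 + d) * \<bar>a\<bar> powr q + C * \<bar>b\<bar> powr q"
    using powr_add_le_eps[OF assms(1) d(1)] by blast
  have "\<bar>\<bar>a + b\<bar> powr q - \<bar>a\<bar> powr q\<bar> \<le> e * \<bar>a\<bar> powr q + (d * C + C) * \<bar>b\<bar> powr q" for a b :: real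
  proof -
    have u: "\<bar>a + b\<bar> powr q - \<bar>a\<bar> powr q \<le> d * \<bar>a\<bar> powr q + C * \<bar>b\<bar> powr q"
      using C(2)[of a b] by (simp add: algebra_simps)
    \<comment> \<open>The upper estimate for a written as the sum of \<open>a + b\<close> and
      \<open>- b\<close>.\<close>
    have "\<bar>a\<bar> powr q - \<bar>a + b\<bar> powr q \<le> d * \<bar>a + b\<bar> powr q + C * \<bar>b\<bar> powr q"
      using C(2)[of "a + b" "- b"] by (simp add: algebra_simps)
    also have "\<dots> \<le> d * ((1 + d) * \<bar>a\<bar> powr q + C * \<bar>b\<bar> powr q) + C * \<bar>b\<bar> powr q"
      using d(1) C(2)[of a b] by (intro add_right_mono mult_left_mono) auto
    also have "\<dots> = d * (1 + d) * \<bar>a\<bar> powr q + (d * C + C) * \<bar>b\<bar> powr q"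
      by (simp add: algebra_simps)
    also have "\<dots> \<le> e * \<bar>a\<bar> powr q + (d * C + C) * \<bar>b\<bar> powr q"
      using d(2) by (intro add_right_mono mult_right_mono) auto
    finally have l: "\<bar>a\<bar> powr q - \<bar>a + b\<bar> powr q \<le> e * \<bar>a\<bar> powr q + (d * C + C) * \<bar>b\<bar> powr q" .
    have "d * \<bar>a\<bar> powr q \<le> e * \<bar>a\<bar> powr q" using d(3) by (intro mult_right_mono) auto
    moreover have "0 \<le> d * C * \<bar>b\<bar> powr q" using d(1) C(1) by simp
    ultimately show ?thesis using u l by (simp add: abs_le_iff distrib_right)
  qed
  then show ?thesis by (rule that[rotated]) (use d C in simp)
qed

text \<open>Here v is the remainder and \<open>v k + u\<close> the given sequence. The integrand
  need not be dominated, but its excess over \<open>d * \<bar>v k\<bar> powr q\<close> is, by a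
  multiple of \<open>\<bar>u\<bar> powr q\<close>. The part removed is at most \<open>d * A\<close>,
  uniformly in k.\<close>

theorem brezis_lieb:
  fixes v :: "nat \<Rightarrow> 'a \<Rightarrow> real" and u :: "'a \<Rightarrow> real"
  assumes q: "0 < q" and v [measurable]: "\<And>k. v k \<in> borel_measurable M" and u [measurable]: "u \<in> borel_measurable M"
    and iv: "\<And>k. integrable M (\<lambda>x. \<bar>v k x\<bar> powr q)" and iu: "integrable M (\<lambda>x. \<bar>u x\<bar> powr q)"
    and bound: "\<And>k. (\<integral>x. \<bar>v k x\<bar> powr q \<partial>M) \<le> A" and ae: "AE x in M. (\<lambda>k. v k x) \<longlonglongrightarrow> 0"
  shows "(\<lambda>k. \<integral>x. \<bar>\<bar>v k x + u x\<bar> powr q - \<bar>v k x\<bar> powr q - \<bar>u x\<bar> powr q\<bar> \<partial>M) \<longlonglongrightarrow> 0"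
proof -
  let ?D = "\<lambda>k x. \<bar>\<bar>v k x + u x\<bar> powr q - \<bar>v k x\<bar> powr q - \<bar>u x\<bar> powr q\<bar>"
  have A: "0 \<le> A" using order_trans[OF Bochner_Integration.integral_nonneg bound] by simp
  show ?thesis
  proof (rule LIMSEQ_I)
    fix e :: real assume "0 < e"
    define d where "d = e / (2 * (A + 1))"
    have d: "0 < d" "d * A < e / 2" using \<open>0 < e\<close> A by (auto simp: d_def field_simps)
    obtain C where C: "0 \<le> C" "\<And>a b :: real. \<bar>\<bar>a + b\<bar> powr q - \<bar>a\<bar> powr q\<bar> \<le> d * \<bar>a\<bar> powr q + C * \<bar>b\<bar> powr q"
      using brezis_lieb_pointwise[OF q d(1)] by blast
    let ?W = "\<lambda>k x. max 0 (?D k x - d * \<bar>v k x\<bar> powr q)"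
    have D_le: "?D k x \<le> d * \<bar>v k x\<bar> powr q + (C + 1) * \<bar>u x\<bar> powr q" for k x
      using C(2)[of "v k x" "u x"] powr_ge_zero[of "\<bar>u x\<bar>" q]
      unfolding abs_le_iff distrib_right by linarith
    have W_le: "\<bar>?W k x\<bar> \<le> (C + 1) * \<bar>u x\<bar> powr q" for k x
      using D_le[of k x] C(1) by (simp add: max_def)
    have iW: "integrable M (\<lambda>x. (C + 1) * \<bar>u x\<bar> powr q)" using iu by simp
    have lim: "(\<lambda>k. \<integral>x. ?W k x \<partial>M) \<longlonglongrightarrow> (\<integral>x. 0 \<partial>M)"
    proof (rule integral_dominated_convergence[OF _ _ iW])
      show "AE x in M. (\<lambda>k. ?W k x) \<longlonglongrightarrow> 0"
        using ae
      proof eventually_elim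
        case (elim x)
        have p: "(\<lambda>k. \<bar>v k x\<bar> powr q) \<longlonglongrightarrow> 0"
          using tendsto_powr'[OF tendsto_rabs[OF elim] tendsto_const[of q]] q by simp
        have p': "(\<lambda>k. \<bar>v k x + u x\<bar> powr q) \<longlonglongrightarrow> \<bar>0 + u x\<bar> powr q"
          using q by (intro tendsto_powr' tendsto_rabs tendsto_add elim tendsto_const) auto
        have "(\<lambda>k. ?W k x) \<longlonglongrightarrow> max 0 (\<bar>\<bar>0 + u x\<bar> powr q - 0 - \<bar>u x\<bar> powr q\<bar> - d * 0)"
          by (intro tendsto_max tendsto_diff tendsto_rabs tendsto_mult tendsto_const p p')
        then show ?case by simp
      qed
      show "AE x in M. norm (?W k x) \<le> (C + 1) * \<bar>u x\<bar> powr q" for k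
        using W_le by simp
    qed measurable
    then have "\<forall>\<^sub>F k in sequentially. (\<integral>x. ?W k x \<partial>M) < e / 2"
      using \<open>0 < e\<close> by (intro order_tendstoD) auto
    then obtain K where K: "\<And>k. K \<le> k \<Longrightarrow> (\<integral>x. ?W k x \<partial>M) < e / 2"
      by (auto simp: eventually_sequentially)
    have intD: "integrable M (?D k)" for k
      by (rule Bochner_Integration.integrable_bound[of _ "\<lambda>x. d * \<bar>v k x\<bar> powr q + (C + 1) * \<bar>u x\<bar> powr q"])
         (use iv iu D_le in \<open>auto intro!: order_trans[OF _ abs_ge_self]\<close>)
    have intW: "integrable M (?W k)" for k
      by (rule Bochner_Integration.integrable_bound[OF iW]) (use W_le in \<open>auto intro!: order_trans[OF _ abs_ge_self]\<close>)
    have le: "(\<integral>x. ?D k x \<partial>M) \<le> (\<integral>x. ?W k x \<partial>M) + d * A" for k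
    proof -
      have "(\<integral>x. ?D k x \<partial>M) \<le> (\<integral>x. ?W k x + d * \<bar>v k x\<bar> powr q \<partial>M)"
        using intD intW iv by (intro integral_mono) (auto simp: max_def)
      also have "\<dots> = (\<integral>x. ?W k x \<partial>M) + d * (\<integral>x. \<bar>v k x\<bar> powr q \<partial>M)"
        using intW iv by simp
      also have "\<dots> \<le> (\<integral>x. ?W k x \<partial>M) + d * A"
        using d(1) bound by (intro add_left_mono mult_left_mono) auto
      finally show ?thesis .
    qed
    have "(\<integral>x. ?D k x \<partial>M) < e" if "K \<le> k" for k
      using le[of k] K[OF that] d(2) by linarith
    moreover have "0 \<le> (\<integral>x. ?D k x \<partial>M)" for k by (rule Bochner_Integration.integral_nonneg) simp
    ultimately show "\<exists>K. \<forall>k\<ge>K. norm ((\<integral>x. ?D k x \<partial>M) - 0) < e"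
      by (intro exI[of _ K]) simp
  qed
qed

section \<open>Local compactness\<close>

lemma nn_integral_cmult_indicator_add:
  assumes [measurable]: "C \<in> sets M" "f \<in> borel_measurable M"
  shows "(\<integral>\<^sup>+x. c * (indicator C x + d * f x) \<partial>M) = c * (emeasure M C + d * (\<integral>\<^sup>+x. f x \<partial>M))"
  by (simp add: nn_integral_cmult nn_integral_add)

context frac_sobolev
begin

text \<open>For this measure the seminorm of v is the L^p norm of the difference function v(x) -
  v(y). So \<open>Dsp\<close> sits isometrically in an L^p space and inherits its norming
  functionals.\<close>

definition kernel_measure :: "('a \<times> 'a) measure" where
  "kernel_measure = density (lborel \<Otimes>\<^sub>M lborel) (\<lambda>(x, y). ennreal (1 / norm (x - y) powr (real DIM('a) + s * p)))"

lemma sets_kernel_measure [measurable_cong]: "sets kernel_measure = sets (borel \<Otimes>\<^sub>M borel)"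
  by (simp add: kernel_measure_def cong: sets_pair_measure_cong)

lemma kernel_measure_Dsp:
  fixes v :: "'a \<Rightarrow> real"
  assumes "v \<in> Dsp s p"
  shows "integrable kernel_measure (\<lambda>z. \<bar>v (fst z) - v (snd z)\<bar> powr p)"
    and "(\<integral>z. \<bar>v (fst z) - v (snd z)\<bar> powr p \<partial>kernel_measure) powr (1 / p) = gagliardo_seminorm s p v"
proof -
  note [measurable] = DspD(2)[OF assms]
  have eq: "(\<integral>\<^sup>+z. ennreal (\<bar>v (fst z) - v (snd z)\<bar> powr p) \<partial>kernel_measure) = gagliardo_pow s p v"
    unfolding kernel_measure_def gagliardo_pow_def
    by (subst nn_integral_density)
       (auto intro!: nn_integral_cong simp: split_beta simp flip: ennreal_mult)
  then show int: "integrable kernel_measure (\<lambda>z. \<bar>v (fst z) - v (snd z)\<bar> powr p)"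
    using gagliardo_pow_finite[OF assms] by (intro integrableI_nonneg) auto
  have "(\<integral>z. \<bar>v (fst z) - v (snd z)\<bar> powr p \<partial>kernel_measure) = enn2real (gagliardo_pow s p v)"
    unfolding eq[symmetric] by (rule integral_eq_nn_integral) auto
  then show "(\<integral>z. \<bar>v (fst z) - v (snd z)\<bar> powr p \<partial>kernel_measure) powr (1 / p) = gagliardo_seminorm s p v"
    by (simp add: gagliardo_seminorm_def)
qed

text \<open>The uniform boundedness principle. For coefficients bounded by powers of 1/3 the series
  of norming functionals is itself an element of \<open>Dsp_dual\<close>, so its values along the
  weakly convergent sequence are bounded, as \<open>gliding_hump\<close> demands.\<close>

theorem weakly_convergent_Dsp_bounded:
  fixes u :: "nat \<Rightarrow> 'a \<Rightarrow> real"
  assumes weak: "weakly_convergent_Dsp s p u u0"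
  obtains M where "0 \<le> M" "\<And>k. gagliardo_pow s p (u k) \<le> ennreal M"
proof -
  have u: "u k \<in> Dsp s p" for k using weak by (simp add: weakly_convergent_Dsp_def)
  let ?d = "\<lambda>(v :: 'a \<Rightarrow> real) z. v (fst z) - v (snd z)"
  define G where "G k v = Lp_norming p kernel_measure (?d (u k)) (?d v)" for k and v :: "'a \<Rightarrow> real"
  have m: "?d v \<in> borel_measurable kernel_measure" if "v \<in> Dsp s p" for v
  proof -
    note [measurable] = DspD(2)[OF that]
    show ?thesis by measurable
  qed
  note int = Lp_norming_integrable[OF p_ge m[OF u] m kernel_measure_Dsp(1)[OF u] kernel_measure_Dsp(1)]
  have G_bound: "\<bar>G k v\<bar> \<le> gagliardo_seminorm s p v" if "v \<in> Dsp s p" for k v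
    unfolding G_def kernel_measure_Dsp(2)[OF that, symmetric]
    by (rule Lp_norming_bound[OF p_ge m[OF u] m[OF that] kernel_measure_Dsp(1)[OF u] kernel_measure_Dsp(1)[OF that]])
  have G_self: "G k (u k) = gagliardo_seminorm s p (u k)" for k
    unfolding G_def Lp_norming_self[OF p_ge] by (rule kernel_measure_Dsp(2)[OF u])
  have G_add: "G k (\<lambda>x. v x + w x) = G k v + G k w" if "v \<in> Dsp s p" "w \<in> Dsp s p" for k v w
  proof -
    have "\<bar>?d (u k) z\<bar> powr (p - 1) * sgn (?d (u k) z) * ?d (\<lambda>x. v x + w x) z
      = \<bar>?d (u k) z\<bar> powr (p - 1) * sgn (?d (u k) z) * ?d v z + \<bar>?d (u k) z\<bar> powr (p - 1) * sgn (?d (u k) z) * ?d w z" for z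
      by (simp add: algebra_simps)
    then show ?thesis
      unfolding G_def Lp_norming_def
      using Bochner_Integration.integral_add[OF int[OF that(1) that(1), of k] int[OF that(2) that(2), of k]]
      by (simp only: add_divide_distrib)
  qed
  have G_cmult: "G k (\<lambda>x. c * v x) = c * G k v" for k c v
  proof -
    have "\<bar>?d (u k) z\<bar> powr (p - 1) * sgn (?d (u k) z) * ?d (\<lambda>x. c * v x) z
      = c * (\<bar>?d (u k) z\<bar> powr (p - 1) * sgn (?d (u k) z) * ?d v z)" for z
      by (simp add: algebra_simps)
    then show ?thesis
      unfolding G_def Lp_norming_def by (simp only: integral_mult_right_zero times_divide_eq_right)
  qed
  have "\<exists>B. \<forall>k. gagliardo_seminorm s p (u k) \<le> B"
  proof (rule gliding_hump[where G = G and N = "gagliardo_seminorm s p" and u = u])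
    show "\<bar>G k (u l)\<bar> \<le> gagliardo_seminorm s p (u l)" for k l by (rule G_bound[OF u])
    show "G k (u k) = gagliardo_seminorm s p (u k)" for k by (rule G_self)
  next
    fix c :: "nat \<Rightarrow> real" and \<kappa> :: "nat \<Rightarrow> nat" assume c: "\<And>j. \<bar>c j\<bar> \<le> (1/3) ^ j"
    define F where "F v = (\<Sum>j. c j * G (\<kappa> j) v)" for v
    have geo: "(\<lambda>j. (1/3) ^ j * gagliardo_seminorm s p v) sums (3/2 * gagliardo_seminorm s p v)" for v :: "'a \<Rightarrow> real"
      using sums_mult2[OF geometric_sums[of "1/3::real"], of "gagliardo_seminorm s p v"] by simp
    have le: "\<bar>c j * G (\<kappa> j) v\<bar> \<le> (1/3) ^ j * gagliardo_seminorm s p v" if "v \<in> Dsp s p" for j v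
      unfolding abs_mult by (intro mult_mono c G_bound that) auto
    have sa: "summable (\<lambda>j. \<bar>c j * G (\<kappa> j) v\<bar>)" if "v \<in> Dsp s p" for v
      by (rule summable_comparison_test[OF _ sums_summable[OF geo[of v]]]) (use le[OF that] in auto)
    have summ: "summable (\<lambda>j. c j * G (\<kappa> j) v)" if "v \<in> Dsp s p" for v
      using sa[OF that] by (rule summable_rabs_cancel)
    have "F \<in> Dsp_dual s p"
      unfolding Dsp_dual_def
    proof (intro CollectI conjI ballI allI)
      show "F (\<lambda>x. v x + w x) = F v + F w" if "v \<in> Dsp s p" "w \<in> Dsp s p" for v w
        unfolding F_def suminf_add[OF summ[OF that(1)] summ[OF that(2)]] G_add[OF that] distrib_left ..
      show "F (\<lambda>x. a * v x) = a * F v" if "v \<in> Dsp s p" for a v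
        unfolding F_def suminf_mult[OF summ[OF that], symmetric] G_cmult by (simp only: mult.left_commute)
      have "\<bar>F v\<bar> \<le> 3/2 * gagliardo_seminorm s p v" if "v \<in> Dsp s p" for v
      proof -
        have "\<bar>F v\<bar> \<le> (\<Sum>j. \<bar>c j * G (\<kappa> j) v\<bar>)" unfolding F_def by (rule summable_rabs[OF sa[OF that]])
        also have "\<dots> \<le> (\<Sum>j. (1/3) ^ j * gagliardo_seminorm s p v)"
          by (rule suminf_le[OF le[OF that] sa[OF that] sums_summable[OF geo]])
        also have "\<dots> = 3/2 * gagliardo_seminorm s p v" using geo by (rule sums_unique[symmetric])
        finally show ?thesis .
      qed
      then show "\<exists>C. \<forall>v\<in>Dsp s p. \<bar>F v\<bar> \<le> C * gagliardo_seminorm s p v" by blast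
    qed
    then have "(\<lambda>k. F (u k)) \<longlonglongrightarrow> F u0" using weak by (simp add: weakly_convergent_Dsp_def)
    then have "Bseq (\<lambda>k. F (u k))" by (intro convergent_imp_Bseq convergentI)
    then obtain B where "\<And>k. norm (F (u k)) \<le> B" unfolding Bseq_def by blast
    then show "\<exists>B. \<forall>k. \<bar>\<Sum>j. c j * G (\<kappa> j) (u k)\<bar> \<le> B" by (auto simp: F_def)
  qed
  then obtain B where B: "\<And>k. gagliardo_seminorm s p (u k) \<le> B" by blast
  have "gagliardo_pow s p (u k) \<le> ennreal (B powr p)" for k
  proof -
    define g where "g = enn2real (gagliardo_pow s p (u k))"
    have g: "gagliardo_pow s p (u k) = ennreal g" "0 \<le> g"
      using gagliardo_pow_finite[OF u] by (simp_all add: g_def)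
    have "(g powr (1 / p)) powr p \<le> B powr p"
      using B[of k] p_pos by (intro powr_mono2) (auto simp: gagliardo_seminorm_def g_def)
    then show ?thesis using g p_pos by (simp add: powr_powr ennreal_leI)
  qed
  then show ?thesis by (rule that[rotated]) simp
qed

section \<open>Compactness from averages over balls\<close>

lemma sobolev_real:
  obtains C where "0 < C" "\<And>v :: 'a \<Rightarrow> real. v \<in> Dsp s p \<Longrightarrow>
    (\<integral>x. \<bar>v x\<bar> powr q \<partial>lborel) powr (p / q) \<le> C * enn2real (gagliardo_pow s p v)"
proof -
  obtain C where C: "0 < C" "\<And>v :: 'a \<Rightarrow> real. v \<in> Lq q \<Longrightarrow>
      ennreal ((\<integral>x. \<bar>v x\<bar> powr q \<partial>lborel) powr (p / q)) \<le> ennreal C * gagliardo_pow s p v"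
    by (rule sobolev_inequality) blast
  have "(\<integral>x. \<bar>v x\<bar> powr q \<partial>lborel) powr (p / q) \<le> C * enn2real (gagliardo_pow s p v)"
    if "v \<in> Dsp s p" for v :: "'a \<Rightarrow> real"
  proof -
    define g where "g = enn2real (gagliardo_pow s p v)"
    have g: "gagliardo_pow s p v = ennreal g" "0 \<le> g"
      using gagliardo_pow_finite[OF that] by (simp_all add: g_def)
    show ?thesis
      using C(2)[OF DspD(1)[OF that]] C(1) g(2) unfolding g_def[symmetric]
      by (simp add: g(1) flip: ennreal_mult)
  qed
  with C(1) show ?thesis by (rule that)
qed

text \<open>The constant depends on the radius but not on the centre. This uniformity later provides
  a dominating function for averages with moving centre.\<close>

lemma nn_integral_ball_le:
  obtains K where "0 \<le> K" "\<And>(v :: 'a \<Rightarrow> real) x. v \<in> Lq q \<Longrightarrow>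
    (\<integral>\<^sup>+y. ennreal \<bar>v y\<bar> * indicator (ball x r) y \<partial>lborel) \<le> ennreal (K * (\<integral>x. \<bar>v x\<bar> powr q \<partial>lborel) powr (1 / q))"
proof -
  define V where "V = (if 0 \<le> r then unit_ball_vol (real DIM('a)) * r ^ DIM('a) else 0)"
  have V: "emeasure lborel (ball x r) = ennreal V" "0 \<le> V" for x :: 'a
    by (auto simp: V_def emeasure_ball ball_empty)
  have V0: "0 \<le> V" by (simp add: V_def)
  have "(\<integral>\<^sup>+y. ennreal \<bar>v y\<bar> * indicator (ball x r) y \<partial>lborel) \<le> ennreal ((V + 1) * (\<integral>x. \<bar>v x\<bar> powr q \<partial>lborel) powr (1 / q))"
    if "v \<in> Lq q" for v :: "'a \<Rightarrow> real" and x
  proof -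
    have [measurable]: "ball x r \<in> sets borel" by simp
    have "(\<integral>\<^sup>+y. ennreal (\<bar>v y\<bar> powr 1) * indicator (ball x r) y \<partial>lborel) \<le> ennreal ((V + 1) * (\<integral>x. \<bar>v x\<bar> powr q \<partial>lborel) powr (1 / q))"
    proof (rule weighted_Lp_bound)
      show "(\<integral>\<^sup>+y. indicator (ball x r) y \<partial>lborel) = ennreal V" using V(1) by simp
      show "indicator (ball x r) y \<le> ennreal 1" for y :: 'a by (simp add: indicator_def)
    qed (use that p_ge p_less_q V0 in auto)
    then show ?thesis by simp
  qed
  then show ?thesis by (rule that[OF add_nonneg_nonneg[OF V0 zero_le_one]])
qed

lemma integrable_ball:
  fixes v :: "'a \<Rightarrow> real"
  assumes "v \<in> Lq q"
  shows "integrable lborel (\<lambda>y. indicator (ball x r) y * v y)"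
proof -
  have [measurable]: "v \<in> borel_measurable borel" using assms by (simp add: Lq_def)
  have [measurable]: "ball x r \<in> sets borel" by simp
  obtain K where K: "\<And>(v :: 'a \<Rightarrow> real) x. v \<in> Lq q \<Longrightarrow>
    (\<integral>\<^sup>+y. ennreal \<bar>v y\<bar> * indicator (ball x r) y \<partial>lborel) \<le> ennreal (K * (\<integral>x. \<bar>v x\<bar> powr q \<partial>lborel) powr (1 / q))"
    by (rule nn_integral_ball_le[of r]) blast
  have "(\<integral>\<^sup>+y. ennreal (norm (indicator (ball x r) y * v y)) \<partial>lborel) = (\<integral>\<^sup>+y. ennreal \<bar>v y\<bar> * indicator (ball x r) y \<partial>lborel)"
    by (intro nn_integral_cong) (auto simp: indicator_def)
  also have "\<dots> < \<infinity>" using le_less_trans[OF K[OF assms, of x] ennreal_less_top] by simp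
  finally show ?thesis by (intro integrableI_bounded) auto
qed

lemma ball_integral_bound:
  obtains K where "0 \<le> K" "\<And>(v :: 'a \<Rightarrow> real) x. v \<in> Lq q \<Longrightarrow>
    \<bar>\<integral>y. indicator (ball x r) y * v y \<partial>lborel\<bar> \<le> K * (\<integral>x. \<bar>v x\<bar> powr q \<partial>lborel) powr (1 / q)"
proof -
  obtain K where K: "0 \<le> K" "\<And>(v :: 'a \<Rightarrow> real) x. v \<in> Lq q \<Longrightarrow>
    (\<integral>\<^sup>+y. ennreal \<bar>v y\<bar> * indicator (ball x r) y \<partial>lborel) \<le> ennreal (K * (\<integral>x. \<bar>v x\<bar> powr q \<partial>lborel) powr (1 / q))"
    by (rule nn_integral_ball_le[of r]) blast
  have "\<bar>\<integral>y. indicator (ball x r) y * v y \<partial>lborel\<bar> \<le> K * (\<integral>x. \<bar>v x\<bar> powr q \<partial>lborel) powr (1 / q)"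
    if v: "v \<in> Lq q" for v :: "'a \<Rightarrow> real" and x
  proof -
    have "ennreal \<bar>\<integral>y. indicator (ball x r) y * v y \<partial>lborel\<bar> \<le> (\<integral>\<^sup>+y. ennreal (norm (indicator (ball x r) y * v y)) \<partial>lborel)"
      using integral_norm_bound_ennreal[OF integrable_ball[OF v, of x r]] by simp
    also have "\<dots> = (\<integral>\<^sup>+y. ennreal \<bar>v y\<bar> * indicator (ball x r) y \<partial>lborel)"
      by (intro nn_integral_cong) (auto simp: indicator_def)
    also note K(2)[OF v]
    finally show ?thesis using K(1) by (subst (asm) ennreal_le_iff) auto
  qed
  with K(1) show ?thesis by (rule that)
qed

text \<open>Continuity is the Sobolev inequality. Apart from boundedness, this is the only
  information drawn from weak convergence: all integrals over balls converge.\<close>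

lemma ball_integral_dual: "(\<lambda>v :: 'a \<Rightarrow> real. \<integral>y. indicator (ball x r) y * v y \<partial>lborel) \<in> Dsp_dual s p"
proof -
  let ?F = "\<lambda>v :: 'a \<Rightarrow> real. \<integral>y. indicator (ball x r) y * v y \<partial>lborel"
  obtain K where K: "0 \<le> K" "\<And>(v :: 'a \<Rightarrow> real) x. v \<in> Lq q \<Longrightarrow>
    \<bar>\<integral>y. indicator (ball x r) y * v y \<partial>lborel\<bar> \<le> K * (\<integral>x. \<bar>v x\<bar> powr q \<partial>lborel) powr (1 / q)"
    by (rule ball_integral_bound[of r]) blast
  obtain C where C: "0 < C" "\<And>v :: 'a \<Rightarrow> real. v \<in> Dsp s p \<Longrightarrow>
    (\<integral>x. \<bar>v x\<bar> powr q \<partial>lborel) powr (p / q) \<le> C * enn2real (gagliardo_pow s p v)"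
    by (rule sobolev_real) blast
  have "\<bar>?F v\<bar> \<le> K * C powr (1 / p) * gagliardo_seminorm s p v" if v: "v \<in> Dsp s p" for v
  proof -
    have "((\<integral>x. \<bar>v x\<bar> powr q \<partial>lborel) powr (p / q)) powr (1 / p) \<le> (C * enn2real (gagliardo_pow s p v)) powr (1 / p)"
      using C(2)[OF v] p_pos by (intro powr_mono2) auto
    then have "(\<integral>x. \<bar>v x\<bar> powr q \<partial>lborel) powr (1 / q) \<le> C powr (1 / p) * gagliardo_seminorm s p v"
      using p_pos C(1) by (simp add: powr_powr powr_mult gagliardo_seminorm_def)
    then have "K * (\<integral>x. \<bar>v x\<bar> powr q \<partial>lborel) powr (1 / q) \<le> K * (C powr (1 / p) * gagliardo_seminorm s p v)"
      using K(1) by (rule mult_left_mono)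
    then show ?thesis using K(2)[OF DspD(1)[OF v], of x] by (simp add: mult.assoc)
  qed
  moreover have "?F (\<lambda>x. v x + w x) = ?F v + ?F w" if "v \<in> Dsp s p" "w \<in> Dsp s p" for v w
    using integrable_ball[OF DspD(1)[OF that(1)], of x r] integrable_ball[OF DspD(1)[OF that(2)], of x r]
    by (simp add: distrib_left)
  moreover have "?F (\<lambda>x. c * v x) = c * ?F v" for c v
    by (simp add: mult.left_commute)
  ultimately show ?thesis unfolding Dsp_dual_def by blast
qed

text \<open>The distance of \<open>v x\<close> from its average over the ball is at most the average
  of \<open>\<bar>v x - v y\<bar>\<close>. Truncation turns this first power into a p-th power,
  which the gradient controls. The bound is linear in \<open>frac_grad_pow\<close>, hence integrable
  in x.\<close>

lemma local_average:
  fixes v :: "'a \<Rightarrow> real"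
  assumes v: "v \<in> Lq q" and r: "0 < r" and \<omega>: "\<omega> = unit_ball_vol (real DIM('a))"
  shows "ennreal \<bar>v x\<bar> \<le> ennreal (\<bar>\<integral>y. indicator (ball x r) y * v y \<partial>lborel\<bar> / (\<omega> * r powr real DIM('a)))
    + ennreal (r powr s) * (1 + ennreal (1 / \<omega>) * frac_grad_pow s p v x)"
proof (cases "frac_grad_pow s p v x")
  case top
  moreover have "0 < \<omega>" by (simp add: \<omega>)
  ultimately show ?thesis using r by (simp add: ennreal_mult_top)
next
  case (real \<delta>)
  let ?n = "real DIM('a)"
  have m [measurable]: "v \<in> borel_measurable borel" using v by (simp add: Lq_def)
  have [measurable]: "ball x r \<in> sets borel" by simp
  define V where "V = \<omega> * r powr ?n"
  have \<omega>_pos: "0 < \<omega>" by (simp add: \<omega>)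
  have V: "0 < V" using \<omega>_pos r by (simp add: V_def)
  have vol: "emeasure lborel (ball x r) = ennreal V" 
    using r by (simp add: emeasure_ball V_def \<omega> powr_realpow)
  then have vol': "measure lborel (ball x r) = V" using V by (simp add: measure_def)
  let ?I = "\<integral>y. indicator (ball x r) y * v y \<partial>lborel"
  let ?K = "\<lambda>y. \<bar>v x - v y\<bar> powr p / norm (x - y) powr (?n + s * p)"
  \<comment> \<open>With this level \<open>k / V\<close> equals \<open>t / \<omega>\<close>, so both
    error terms carry the same factor \<open>r powr s\<close>.\<close>
  define t where "t = r powr s"
  have t: "0 < t" using r by (simp add: t_def)
  define k where "k = t powr (1 - p) * r powr (?n + s * p)"
  have k0: "0 \<le> k" by (simp add: k_def)
  have intB: "integrable lborel (\<lambda>y. indicator (ball x r) y * v x)"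
    using vol by (intro integrable_mult_left) (simp add: integrable_indicator_iff)
  note intv = integrable_ball[OF v, of x r]
  have "V * v x - ?I = (\<integral>y. indicator (ball x r) y * v x - indicator (ball x r) y * v y \<partial>lborel)"
    using intB intv vol' by (subst Bochner_Integration.integral_diff) auto
  then have "ennreal \<bar>V * v x - ?I\<bar> \<le> (\<integral>\<^sup>+y. ennreal (norm (indicator (ball x r) y * v x - indicator (ball x r) y * v y)) \<partial>lborel)"
    using integral_norm_bound_ennreal[OF Bochner_Integration.integrable_diff[OF intB intv]] by simp
  also have "\<dots> \<le> (\<integral>\<^sup>+y. ennreal t * indicator (ball x r) y + ennreal k * ennreal (?K y) \<partial>lborel)"
  proof (rule nn_integral_mono)
    fix y
    show "ennreal (norm (indicator (ball x r) y * v x - indicator (ball x r) y * v y)) \<le> ennreal t * indicator (ball x r) y + ennreal k * ennreal (?K y)"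
    proof (cases "y \<in> ball x r")
      case True
      have tr: "\<bar>v x - v y\<bar> \<le> t + t powr (1 - p) * \<bar>v x - v y\<bar> powr p"
        using t p_ge by (intro truncation_bound) auto
      have "\<bar>v x - v y\<bar> powr p \<le> r powr (?n + s * p) * ?K y"
      proof (cases "x = y")
        case False
        have "norm (x - y) powr (?n + s * p) \<le> r powr (?n + s * p)"
          using True s_pos p_pos by (intro powr_mono2) (auto simp: dist_norm)
        then have "norm (x - y) powr (?n + s * p) * ?K y \<le> r powr (?n + s * p) * ?K y"
          by (rule mult_right_mono) simp
        then show ?thesis using False by simp
      qed simp
      then have "t powr (1 - p) * \<bar>v x - v y\<bar> powr p \<le> t powr (1 - p) * (r powr (?n + s * p) * ?K y)"
        by (rule mult_left_mono) simp
      then have "\<bar>v x - v y\<bar> \<le> t + k * ?K y"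
        using tr unfolding k_def mult.assoc by linarith
      then have "ennreal \<bar>v x - v y\<bar> \<le> ennreal (t + k * ?K y)" by (rule ennreal_leI)
      also have "\<dots> = ennreal t + ennreal k * ennreal (?K y)"
        using t k0 by (simp flip: ennreal_mult)
      finally show ?thesis using True by simp
    qed simp
  qed
  also have "\<dots> = ennreal t * ennreal V + ennreal k * ennreal \<delta>"
  proof -
    have i1: "(\<integral>\<^sup>+y. ennreal k * ennreal (?K y) \<partial>lborel) = ennreal k * ennreal \<delta>"
      unfolding real(2)[symmetric] frac_grad_pow_eq[OF m] by (rule nn_integral_cmult) measurable
    have i2: "(\<integral>\<^sup>+y. ennreal t * indicator (ball x r) y \<partial>lborel) = ennreal t * ennreal V"
      unfolding vol[symmetric] by (rule nn_integral_cmult_indicator) simp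
    show ?thesis unfolding i1[symmetric] i2[symmetric] by (rule nn_integral_add) measurable
  qed
  also have "\<dots> = ennreal (t * V + k * \<delta>)" using t V k0 real by (simp add: ennreal_mult)
  finally have "\<bar>V * v x - ?I\<bar> \<le> t * V + k * \<delta>"
    using t V k0 real by (subst (asm) ennreal_le_iff) auto
  then have "V * \<bar>v x\<bar> \<le> \<bar>?I\<bar> + t * V + k * \<delta>"
    using abs_triangle_ineq[of "V * v x - ?I" ?I] V by (simp add: abs_mult)
  then have "\<bar>v x\<bar> \<le> (\<bar>?I\<bar> + t * V + k * \<delta>) / V" using V by (simp add: field_simps)
  also have "\<dots> = \<bar>?I\<bar> / V + (t + k / V * \<delta>)" using V by (simp add: field_simps)
  also have "k / V = t * (1 / \<omega>)"
  proof -
    have "t powr (1 - p) = r powr (s - s * p)" using r by (simp add: t_def powr_powr right_diff_distrib)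
    then have "k = r powr (s + ?n)" using r by (simp add: k_def flip: powr_add)
    then show ?thesis using r \<omega>_pos by (simp add: V_def t_def powr_add)
  qed
  also have "t + t * (1 / \<omega>) * \<delta> = t * (1 + 1 / \<omega> * \<delta>)" by (simp add: algebra_simps)
  finally have "ennreal \<bar>v x\<bar> \<le> ennreal (\<bar>?I\<bar> / V + t * (1 + 1 / \<omega> * \<delta>))" by (rule ennreal_leI)
  also have "\<dots> = ennreal (\<bar>?I\<bar> / V) + ennreal (t * (1 + 1 / \<omega> * \<delta>))"
    using t V \<omega>_pos real by (intro ennreal_plus) auto
  also have "ennreal (t * (1 + 1 / \<omega> * \<delta>)) = ennreal t * (1 + ennreal (1 / \<omega>) * ennreal \<delta>)"
    using t \<omega>_pos real by (subst ennreal_mult) (simp_all add: ennreal_mult del: times_divide_eq_left)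
  finally show ?thesis unfolding real(2) t_def V_def .
qed

text \<open>For a fixed radius r the averages tend to 0 pointwise and are dominated on the bounded
  set. The error left is \<open>r powr s\<close> times a constant independent of k, and r is sent to
  0 only afterwards.\<close>

lemma weakly_null_L1_local:
  fixes v :: "nat \<Rightarrow> 'a \<Rightarrow> real"
  assumes v: "\<And>k. v k \<in> Lq q" and A: "\<And>k. (\<integral>x. \<bar>v k x\<bar> powr q \<partial>lborel) \<le> A"
    and M: "\<And>k. gagliardo_pow s p (v k) \<le> ennreal M" "0 \<le> M"
    and null: "\<And>x r. (\<lambda>k. \<integral>y. indicator (ball x r) y * v k y \<partial>lborel) \<longlonglongrightarrow> 0"
  shows "(\<lambda>k. \<integral>\<^sup>+x. ennreal \<bar>v k x\<bar> * indicator (cball 0 R) x \<partial>lborel) \<longlonglongrightarrow> 0"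
proof (rule tendsto_0_if_Limsup_eq_0_ennreal)
  have m [measurable]: "v k \<in> borel_measurable borel" for k using v by (simp add: Lq_def)
  define \<omega> where "\<omega> = unit_ball_vol (real DIM('a))"
  have \<omega>: "0 < \<omega>" by (simp add: \<omega>_def)
  define VR where "VR = measure lborel (cball (0::'a) R)"
  have VR: "emeasure lborel (cball (0::'a) R) = ennreal VR" "0 \<le> VR"
    using emeasure_bounded_finite[of "cball (0::'a) R"] by (simp_all add: VR_def emeasure_eq_ennreal_measure less_top)
  have A0: "0 \<le> A" using order_trans[OF Bochner_Integration.integral_nonneg A] by simp
  have step: "limsup (\<lambda>k. \<integral>\<^sup>+x. ennreal \<bar>v k x\<bar> * indicator (cball 0 R) x \<partial>lborel) \<le> ennreal (r powr s * (VR + 1 / \<omega> * M))"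
    if r: "0 < r" for r
  proof -
    let ?V = "\<omega> * r powr real DIM('a)"
    have V: "0 < ?V" using \<omega> r by simp
    define J where "J k x = (\<integral>y. indicator (ball x r) y * v k y \<partial>lborel)" for k and x :: 'a
    have meas_J [measurable]: "J k \<in> borel_measurable borel" for k
    proof -
      \<comment> \<open>Writing the indicator through \<open>dist\<close> displays the joint
        measurability in x and y.\<close>
      have "(\<lambda>x. \<integral>y. (if dist x y < r then 1 else 0) * v k y \<partial>lborel) \<in> borel_measurable borel"
        by measurable
      then show ?thesis by (simp add: J_def[abs_def] indicator_def of_bool_def mem_ball)
    qed
    have mJ: "(\<lambda>x. ennreal (\<bar>J k x\<bar> / c)) \<in> borel_measurable borel" for k c
      by measurable
    have mJ': "(\<lambda>x. ennreal (\<bar>J k x\<bar> / ?V) * indicator (cball 0 R) x) \<in> borel_measurable lborel" for k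
      by (intro borel_measurable_times_ennreal borel_measurable_indicator) (simp_all add: mJ)
    have null': "(\<lambda>k. J k x) \<longlonglongrightarrow> 0" for x unfolding J_def by (rule null)
    obtain K where K: "0 \<le> K" "\<And>(v :: 'a \<Rightarrow> real) x. v \<in> Lq q \<Longrightarrow>
        \<bar>\<integral>y. indicator (ball x r) y * v y \<partial>lborel\<bar> \<le> K * (\<integral>x. \<bar>v x\<bar> powr q \<partial>lborel) powr (1 / q)"
      by (rule ball_integral_bound[of r]) blast
    have lim: "(\<lambda>k. \<integral>\<^sup>+x. ennreal (\<bar>J k x\<bar> / ?V) * indicator (cball 0 R) x \<partial>lborel) \<longlonglongrightarrow> (\<integral>\<^sup>+x. 0 \<partial>(lborel :: 'a measure))"
    proof (rule nn_integral_dominated_convergence[where w = "\<lambda>x. ennreal (K * A powr (1 / q) / ?V) * indicator (cball 0 R) x"])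
      show "AE x in lborel. ennreal (\<bar>J k x\<bar> / ?V) * indicator (cball 0 R) x \<le> ennreal (K * A powr (1 / q) / ?V) * indicator (cball 0 R) x" for k
      proof (intro AE_I2 mult_right_mono ennreal_leI divide_right_mono)
        fix x
        have "\<bar>J k x\<bar> \<le> K * (\<integral>x. \<bar>v k x\<bar> powr q \<partial>lborel) powr (1 / q)" unfolding J_def by (rule K(2)[OF v])
        also have "\<dots> \<le> K * A powr (1 / q)"
          using K(1) A q_pos by (intro mult_left_mono powr_mono2) (auto intro: Bochner_Integration.integral_nonneg)
        finally show "\<bar>J k x\<bar> \<le> K * A powr (1 / q)" .
      qed (use V in auto)
      show "(\<integral>\<^sup>+x. ennreal (K * A powr (1 / q) / ?V) * indicator (cball (0::'a) R) x \<partial>lborel) < \<infinity>"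
        by (subst nn_integral_cmult_indicator) (auto simp: VR ennreal_mult_less_top)
      have "(\<lambda>k. ennreal (\<bar>J k x\<bar> / ?V) * indicator (cball 0 R) x) \<longlonglongrightarrow> ennreal (\<bar>0\<bar> / ?V) * indicator (cball 0 R) x" for x
        using V by (intro tendsto_mult_ennreal tendsto_ennrealI tendsto_divide tendsto_rabs null' tendsto_const) (auto simp: indicator_def)
      then show "AE x in lborel. (\<lambda>k. ennreal (\<bar>J k x\<bar> / ?V) * indicator (cball 0 R) x) \<longlonglongrightarrow> 0"
        by simp
      show "(\<lambda>x. ennreal (K * A powr (1 / q) / ?V) * indicator (cball 0 R) x) \<in> borel_measurable lborel"
        by (intro borel_measurable_times_ennreal borel_measurable_indicator) simp_all
    qed (simp_all only: mJ' borel_measurable_const)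
    have "(\<integral>\<^sup>+x. ennreal \<bar>v k x\<bar> * indicator (cball 0 R) x \<partial>lborel)
      \<le> (\<integral>\<^sup>+x. ennreal (\<bar>J k x\<bar> / ?V) * indicator (cball 0 R) x \<partial>lborel) + ennreal (r powr s * (VR + 1 / \<omega> * M))" for k
    proof -
      have "(\<integral>\<^sup>+x. ennreal \<bar>v k x\<bar> * indicator (cball 0 R) x \<partial>lborel)
        \<le> (\<integral>\<^sup>+x. ennreal (\<bar>J k x\<bar> / ?V) * indicator (cball 0 R) x
            + ennreal (r powr s) * (indicator (cball 0 R) x + ennreal (1 / \<omega>) * frac_grad_pow s p (v k) x) \<partial>lborel)"
      proof (rule nn_integral_mono)
        fix x
        show "ennreal \<bar>v k x\<bar> * indicator (cball 0 R) x \<le> ennreal (\<bar>J k x\<bar> / ?V) * indicator (cball 0 R) x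
            + ennreal (r powr s) * (indicator (cball 0 R) x + ennreal (1 / \<omega>) * frac_grad_pow s p (v k) x)"
        proof (cases "x \<in> cball 0 R")
          case True
          show ?thesis
            using local_average[OF v r \<omega>_def, of k x] unfolding J_def indicator_simps(1)[OF True] mult_1_right .
        next
          case False
          show ?thesis unfolding indicator_simps(2)[OF False] mult_zero_right by (rule zero_le)
        qed
      qed
      also have "\<dots> = (\<integral>\<^sup>+x. ennreal (\<bar>J k x\<bar> / ?V) * indicator (cball 0 R) x \<partial>lborel)
        + ennreal (r powr s) * (ennreal VR + ennreal (1 / \<omega>) * gagliardo_pow s p (v k))"
      proof -
        have c: "cball 0 R \<in> sets (lborel :: 'a measure)" by simp
        have f: "frac_grad_pow s p (v k) \<in> borel_measurable lborel" using m by simp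
        have eq: "(\<integral>\<^sup>+x. ennreal (r powr s) * (indicator (cball 0 R) x + ennreal (1 / \<omega>) * frac_grad_pow s p (v k) x) \<partial>lborel)
          = ennreal (r powr s) * (ennreal VR + ennreal (1 / \<omega>) * gagliardo_pow s p (v k))"
          unfolding gagliardo_pow_eq[OF m] VR(1)[symmetric] by (rule nn_integral_cmult_indicator_add[OF c f])
        have "(\<lambda>x. ennreal (r powr s) * (indicator (cball 0 R) x + ennreal (1 / \<omega>) * frac_grad_pow s p (v k) x)) \<in> borel_measurable lborel"
          by (intro borel_measurable_times_ennreal borel_measurable_add borel_measurable_const borel_measurable_indicator c f)
        then show ?thesis unfolding eq[symmetric] by (rule nn_integral_add[OF mJ'])
      qed
      also have "\<dots> \<le> (\<integral>\<^sup>+x. ennreal (\<bar>J k x\<bar> / ?V) * indicator (cball 0 R) x \<partial>lborel)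
        + ennreal (r powr s) * (ennreal VR + ennreal (1 / \<omega>) * ennreal M)"
        by (intro add_left_mono mult_left_mono M) auto
      also have "ennreal (r powr s) * (ennreal VR + ennreal (1 / \<omega>) * ennreal M) = ennreal (r powr s * (VR + 1 / \<omega> * M))"
      proof -
        have "0 \<le> 1 / \<omega>" using \<omega> by simp
        then show ?thesis
          using VR(2) M(2) by (simp only: ennreal_mult ennreal_plus add_nonneg_nonneg mult_nonneg_nonneg powr_ge_zero)
      qed
      finally show ?thesis .
    qed
    then have "limsup (\<lambda>k. \<integral>\<^sup>+x. ennreal \<bar>v k x\<bar> * indicator (cball 0 R) x \<partial>lborel)
      \<le> limsup (\<lambda>k. (\<integral>\<^sup>+x. ennreal (\<bar>J k x\<bar> / ?V) * indicator (cball 0 R) x \<partial>lborel) + ennreal (r powr s * (VR + 1 / \<omega> * M)))"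
      by (intro Limsup_mono always_eventually allI)
    also have "\<dots> = ennreal (r powr s * (VR + 1 / \<omega> * M))"
      by (rule lim_imp_Limsup) (use tendsto_add[OF lim tendsto_const] in \<open>auto simp: mult.commute\<close>)
    finally show ?thesis .
  qed
  \<comment> \<open>The value at the endpoint is \<open>0 powr s = 0\<close>.\<close>
  have "((\<lambda>r. ennreal (r powr s * (VR + 1 / \<omega> * M))) \<longlongrightarrow> ennreal (0 powr s * (VR + 1 / \<omega> * M))) (at_right 0)"
    using s_pos by (intro tendsto_ennrealI tendsto_mult tendsto_const tendsto_powr' tendsto_ident_at) (auto simp: eventually_at_right_less eventually_at_filter)
  moreover have "\<forall>\<^sub>F r in at_right 0. limsup (\<lambda>k. \<integral>\<^sup>+x. ennreal \<bar>v k x\<bar> * indicator (cball 0 R) x \<partial>lborel) \<le> ennreal (r powr s * (VR + 1 / \<omega> * M))"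
    using step by (simp add: eventually_at_filter)
  ultimately have "limsup (\<lambda>k. \<integral>\<^sup>+x. ennreal \<bar>v k x\<bar> * indicator (cball 0 R) x \<partial>lborel) \<le> ennreal (0 powr s * (VR + 1 / \<omega> * M))"
    by (intro tendsto_lowerbound) auto
  then show "limsup (\<lambda>k. \<integral>\<^sup>+x. ennreal \<bar>v k x\<bar> * indicator (cball 0 R) x \<partial>lborel) = 0" by simp
qed

end

section \<open>Comparison of measures and cutoffs\<close>

lemma eventually_imp_strict_mono_choice:
  assumes "\<And>k::nat. \<forall>\<^sub>F n in sequentially. P k n"
  obtains r :: "nat \<Rightarrow> nat" where "strict_mono r" "\<And>k. P k (r k)"
proof -
  have "\<exists>N. \<forall>n\<ge>N. P k n" for k using assms[of k] by (simp add: eventually_sequentially)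
  then obtain N where N: "\<And>k n. N k \<le> n \<Longrightarrow> P k n" by metis
  define r where "r k = (\<Sum>i\<le>k. Suc (N i))" for k
  have "strict_mono r" by (simp add: strict_mono_Suc_iff r_def)
  moreover have "N k \<le> r k" for k
    unfolding r_def by (cases k) auto
  ultimately show ?thesis using that N by blast
qed

text \<open>The k-th index is chosen with integral below 2^(-k) on the ball of radius k. The sum
  over k is finite almost everywhere, so its terms tend to 0, and a fixed point lies in all balls
  from some k on.\<close>

lemma AE_subsequence_of_local_L1:
  fixes v :: "nat \<Rightarrow> 'a::euclidean_space \<Rightarrow> real"
  assumes [measurable]: "\<And>k. v k \<in> borel_measurable borel"
    and lim: "\<And>R. (\<lambda>k. \<integral>\<^sup>+x. ennreal \<bar>v k x\<bar> * indicator (cball 0 R) x \<partial>lborel) \<longlonglongrightarrow> 0"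
  obtains r :: "nat \<Rightarrow> nat" where "strict_mono r" "AE x in lborel. (\<lambda>k. v (r k) x) \<longlonglongrightarrow> 0"
proof -
  have "\<forall>\<^sub>F n in sequentially. (\<integral>\<^sup>+x. ennreal \<bar>v n x\<bar> * indicator (cball 0 (real k)) x \<partial>lborel) < ennreal ((1/2) ^ k)" for k
    using lim[of "real k"] by (rule order_tendstoD) simp
  then obtain r where r: "strict_mono r"
    and less: "\<And>k. (\<integral>\<^sup>+x. ennreal \<bar>v (r k) x\<bar> * indicator (cball 0 (real k)) x \<partial>lborel) < ennreal ((1/2) ^ k)"
    by (rule eventually_imp_strict_mono_choice[where P = "\<lambda>k n. (\<integral>\<^sup>+x. ennreal \<bar>v n x\<bar> * indicator (cball 0 (real k)) x \<partial>lborel) < ennreal ((1/2) ^ k)"]) blast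
  let ?f = "\<lambda>k x. \<bar>v (r k) x\<bar> * indicator (cball 0 (real k)) x"
  have f_eq: "ennreal (?f k x) = ennreal \<bar>v (r k) x\<bar> * indicator (cball 0 (real k)) x" for k x
    by (simp add: indicator_def)
  have fm: "(\<lambda>x. ennreal (?f k x)) \<in> borel_measurable lborel" for k
    unfolding f_eq by (intro borel_measurable_times_ennreal borel_measurable_indicator) auto
  have "(\<integral>\<^sup>+x. (\<Sum>k. ennreal (?f k x)) \<partial>lborel) = (\<Sum>k. \<integral>\<^sup>+x. ennreal (?f k x) \<partial>lborel)"
    by (rule nn_integral_suminf[OF fm])
  also have "\<dots> \<le> (\<Sum>k. ennreal ((1/2) ^ k))"
    unfolding f_eq using less by (intro suminf_le) (auto intro: less_imp_le)
  also have "\<dots> = ennreal (\<Sum>k. (1/2) ^ k)"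
    by (intro suminf_ennreal2 summable_geometric) auto
  also have "\<dots> < \<infinity>" by simp
  finally have "(\<integral>\<^sup>+x. (\<Sum>k. ennreal (?f k x)) \<partial>lborel) \<noteq> \<infinity>" by simp
  then have "AE x in lborel. (\<Sum>k. ennreal (?f k x)) \<noteq> \<infinity>"
    by (rule nn_integral_PInf_AE[rotated]) (intro borel_measurable_suminf_order fm)
  then have "AE x in lborel. (\<lambda>k. v (r k) x) \<longlonglongrightarrow> 0"
  proof eventually_elim
    case (elim x)
    have "summable (\<lambda>k. ?f k x)"
      by (rule summable_suminf_not_top) (use elim in auto)
    then have lim0: "(\<lambda>k. ?f k x) \<longlonglongrightarrow> 0" by (rule summable_LIMSEQ_zero)
    obtain K where K: "norm x \<le> real K" using real_arch_simple by blast
    have "\<forall>\<^sub>F k in sequentially. ?f k x = \<bar>v (r k) x\<bar>"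
      using eventually_ge_at_top[of K] by eventually_elim (use K in \<open>auto simp: indicator_def\<close>)
    then have "(\<lambda>k. \<bar>v (r k) x\<bar>) \<longlonglongrightarrow> 0" by (rule Lim_transform_eventually[OF lim0])
    then show ?case by (rule tendsto_rabs_zero_cancel)
  qed
  with r show ?thesis by (rule that)
qed

section \<open>Comparison of measures and their atoms\<close>

lemma infdist_neighbourhoods:
  fixes K :: "'a::metric_space set"
  assumes "closed K" "K \<noteq> {}"
  shows "(\<Inter>j. {x. infdist x K < 1 / real (Suc j)}) = K"
proof (intro equalityI subsetI)
  fix x assume x: "x \<in> (\<Inter>j. {x. infdist x K < 1 / real (Suc j)})"
  have "infdist x K \<le> 0"
  proof (rule ccontr)
    assume "\<not> ?thesis"
    then obtain j where "1 / real (Suc j) < infdist x K"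
      using reals_Archimedean[of "infdist x K"] by (auto simp: inverse_eq_divide)
    moreover have "infdist x K < 1 / real (Suc j)" using x by blast
    ultimately show False by simp
  qed
  then show "x \<in> K" using in_closed_iff_infdist_zero[OF assms, of x] infdist_nonneg[of x K] by simp
qed (simp add: infdist_zero)

text \<open>Cutoffs compare a compact set only with its open neighbourhoods. Continuity of H closes
  this gap as the neighbourhoods shrink to K, and inner regularity of N with monotonicity of H
  extends the bound to Borel sets. H is a power in the reverse Hoelder inequality and the identity
  in the linear comparisons.\<close>

lemma regular_comparison:
  fixes N M1 M2 :: "'a::euclidean_space measure" and H :: "real \<Rightarrow> real"
  assumes N: "finite_measure N" "sets N = sets borel" and M1: "finite_measure M1" "sets M1 = sets borel"
    and M2: "finite_measure M2" "sets M2 = sets borel" and ab: "0 \<le> a" "0 \<le> b"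
    and H: "continuous_on {0..} H" "mono_on {0..} H"
    and le: "\<And>K U. compact K \<Longrightarrow> open U \<Longrightarrow> K \<subseteq> U \<Longrightarrow> measure N K \<le> H (a * measure M1 U + b * measure M2 U)"
    and E: "E \<in> sets borel"
  shows "measure N E \<le> H (a * measure M1 E + b * measure M2 E)"
proof -
  interpret N: finite_measure N by fact
  interpret M1: finite_measure M1 by fact
  interpret M2: finite_measure M2 by fact
  have compact_le: "measure N K \<le> H (a * measure M1 K + b * measure M2 K)" if K: "compact K" for K
  proof (cases "K = {}")
    case True
    then show ?thesis using le[of K "{}"] by simp
  next
    case False
    define U where "U j = {x. infdist x K < 1 / real (Suc j)}" for j
    have op: "open (U j)" for j
      unfolding U_def by (intro open_Collect_less continuous_intros)
    have sub: "K \<subseteq> U j" for j by (auto simp: U_def infdist_zero)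
    have inter: "(\<Inter>j. U j) = K"
      unfolding U_def by (rule infdist_neighbourhoods[OF compact_imp_closed[OF K] False])
    have dec: "decseq U"
      unfolding decseq_def U_def by (auto elim!: less_le_trans intro!: frac_le)
    have rng: "range U \<subseteq> sets borel" using op by (auto intro: borel_open)
    have l1: "(\<lambda>j. measure M1 (U j)) \<longlonglongrightarrow> measure M1 K"
      using M1.finite_Lim_measure_decseq[of U] rng dec unfolding M1(2) inter by blast
    have l2: "(\<lambda>j. measure M2 (U j)) \<longlonglongrightarrow> measure M2 K"
      using M2.finite_Lim_measure_decseq[of U] rng dec unfolding M2(2) inter by blast
    have lim: "(\<lambda>j. a * measure M1 (U j) + b * measure M2 (U j)) \<longlonglongrightarrow> a * measure M1 K + b * measure M2 K"
      by (intro tendsto_add tendsto_mult_left l1 l2)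
    have "(\<lambda>j. H (a * measure M1 (U j) + b * measure M2 (U j))) \<longlonglongrightarrow> H (a * measure M1 K + b * measure M2 K)"
      by (rule continuous_on_tendsto_compose[OF H(1) lim]) (use ab in auto)
    then show ?thesis
      by (rule LIMSEQ_le_const) (use le[OF K op sub] in auto)
  qed
  show ?thesis
  proof (rule field_le_epsilon)
    fix e :: real assume "0 < e"
    have "emeasure N E = (SUP K\<in>{K. K \<subseteq> E \<and> compact K}. emeasure N K)"
      by (rule inner_regular[OF N(2) _ E]) simp
    moreover have "emeasure N E < emeasure N E + ennreal e"
      using \<open>0 < e\<close> by (simp add: N.emeasure_eq_measure ennreal_less_iff flip: ennreal_plus)
    moreover have ne: "{K. K \<subseteq> E \<and> compact K} \<noteq> {}" by (auto intro: exI[of _ "{}"])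
    ultimately have "\<exists>K. K \<subseteq> E \<and> compact K \<and> emeasure N E < emeasure N K + ennreal e"
      by (auto simp: ennreal_SUP_add_left[OF ne, symmetric] less_SUP_iff)
    then obtain K where K: "K \<subseteq> E" "compact K" "emeasure N E < emeasure N K + ennreal e" by blast
    then have "measure N E \<le> measure N K + e"
      using \<open>0 < e\<close> by (simp add: N.emeasure_eq_measure ennreal_less_iff flip: ennreal_plus)
    also have "measure N K \<le> H (a * measure M1 K + b * measure M2 K)" by (rule compact_le[OF K(2)])
    also have "\<dots> \<le> H (a * measure M1 E + b * measure M2 E)"
    proof (rule mono_onD[OF H(2)])
      show "a * measure M1 K + b * measure M2 K \<le> a * measure M1 E + b * measure M2 E"
        using K(1) E by (intro add_mono mult_left_mono ab M1.finite_measure_mono M2.finite_measure_mono) (simp_all add: M1(2) M2(2))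
    qed (use ab in auto)
    finally show "measure N E \<le> H (a * measure M1 E + b * measure M2 E) + e" by simp
  qed
qed

text \<open>The complement of the atoms is cut into countably many pieces of small measure.\<close>

lemma no_diffuse_part:
  fixes N M1 M2 :: "'a::euclidean_space measure"
  assumes N: "finite_measure N" "sets N = sets borel" and M1: "finite_measure M1" "sets M1 = sets borel"
    and M2: "finite_measure M2" "sets M2 = sets borel" and ab: "0 \<le> a" "0 \<le> b" and c: "0 < c" and \<beta>: "1 < \<beta>"
    and le: "\<And>E. E \<in> sets borel \<Longrightarrow> measure N E \<le> c * (a * measure M1 E + b * measure M2 E) powr \<beta>"
    and nonatomic: "\<And>x. measure M2 {x} = 0"
  shows "measure N (- {x. measure M1 {x} \<noteq> 0}) = 0"
proof -
  interpret N: finite_measure N by fact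
  interpret M1: finite_measure M1 by fact
  interpret M2: finite_measure M2 by fact
  define Y where "Y = {x. measure M1 {x} \<noteq> 0}"
  have "countable Y" unfolding Y_def by (rule M1.countable_support)
  then have Y: "Y \<in> sets borel" by (rule sets.countable[rotated]) simp
  define \<eta> where "\<eta> E = a * measure M1 E + b * measure M2 E" for E
  have \<eta>0: "0 \<le> \<eta> E" for E using ab by (simp add: \<eta>_def)
  have \<eta>_mono: "\<eta> A \<le> \<eta> B" if "A \<subseteq> B" "B \<in> sets borel" for A B
    unfolding \<eta>_def using that
    by (intro add_mono mult_left_mono ab M1.finite_measure_mono M2.finite_measure_mono) (simp_all add: M1(2) M2(2))
  have small: "measure N (- Y) \<le> c * \<delta> powr (\<beta> - 1) * \<eta> UNIV" if \<delta>: "0 < \<delta>" for \<delta>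
  proof -
    \<comment> \<open>Off Y neither measure has an atom at x, so the mass of shrinking balls tends
      to 0.\<close>
    have "\<exists>r>0. \<eta> (ball x r) < \<delta>" if x: "x \<notin> Y" for x
    proof -
      let ?B = "\<lambda>j. ball x (1 / real (Suc j))"
      have dec: "decseq ?B" unfolding decseq_def by (auto elim!: less_le_trans intro!: frac_le)
      have inter: "(\<Inter>j. ?B j) = {x}"
      proof (intro equalityI subsetI)
        fix y assume y: "y \<in> (\<Inter>j. ?B j)"
        show "y \<in> {x}"
        proof (rule ccontr)
          assume "y \<notin> {x}"
          then have "0 < dist x y" by auto
          then obtain j where "1 / real (Suc j) < dist x y"
            using reals_Archimedean[of "dist x y"] by (auto simp: inverse_eq_divide)
          moreover have "y \<in> ?B j" using y by blast
          ultimately show False by simp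
        qed
      qed auto
      have rng: "range ?B \<subseteq> sets borel" by auto
      have "(\<lambda>j. measure M1 (?B j)) \<longlonglongrightarrow> measure M1 {x}"
        using M1.finite_Lim_measure_decseq[of ?B] rng dec unfolding M1(2) inter by blast
      then have l1: "(\<lambda>j. measure M1 (?B j)) \<longlonglongrightarrow> 0" using x by (simp add: Y_def)
      have "(\<lambda>j. measure M2 (?B j)) \<longlonglongrightarrow> measure M2 {x}"
        using M2.finite_Lim_measure_decseq[of ?B] rng dec unfolding M2(2) inter by blast
      then have l2: "(\<lambda>j. measure M2 (?B j)) \<longlonglongrightarrow> 0" using nonatomic[of x] by simp
      have "(\<lambda>j. \<eta> (?B j)) \<longlonglongrightarrow> a * 0 + b * 0"
        unfolding \<eta>_def by (intro tendsto_add tendsto_mult_left l1 l2)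
      then have "\<forall>\<^sub>F j in sequentially. \<eta> (?B j) < \<delta>" by (rule order_tendstoD) (use \<delta> in simp)
      then obtain j where "\<eta> (?B j) < \<delta>" by (auto simp: eventually_sequentially)
      then show ?thesis by (intro exI[of _ "1 / real (Suc j)"]) auto
    qed
    then obtain r where r: "\<And>x. x \<notin> Y \<Longrightarrow> 0 < r x" "\<And>x. x \<notin> Y \<Longrightarrow> \<eta> (ball x (r x)) < \<delta>" by metis
    obtain F where F: "F \<subseteq> (\<lambda>x. ball x (r x)) ` (- Y)" "countable F" "\<Union>F = (\<Union>x\<in>- Y. ball x (r x))"
      by (rule Lindelof[of "(\<lambda>x. ball x (r x)) ` (- Y)"]) auto
    \<comment> \<open>The empty set is inserted because the enumeration needs a nonempty set; it is
      harmless in a cover.\<close>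
    define B where "B = from_nat_into (insert {} F)"
    have rangeB: "range B = insert {} F"
      unfolding B_def by (rule range_from_nat_into) (use F(2) in auto)
    have B_open: "open (B j)" and B_small: "\<eta> (B j) \<le> \<delta>" for j
    proof -
      have "B j \<in> insert {} F" using rangeB by blast
      then consider "B j = {}" | x where "x \<notin> Y" "B j = ball x (r x)" using F(1) by auto
      then have "open (B j) \<and> \<eta> (B j) \<le> \<delta>"
      proof cases
        case 1
        then show ?thesis using \<delta> by (simp add: \<eta>_def)
      next
        case 2
        then show ?thesis using r(2)[of x] by simp
      qed
      then show "open (B j)" "\<eta> (B j) \<le> \<delta>" by blast+
    qed
    have cover: "- Y \<subseteq> (\<Union>j. B j)"
    proof
      fix x assume "x \<in> - Y"
      then have "x \<in> (\<Union>x\<in>- Y. ball x (r x))" using r(1)[of x] by (intro UN_I[of x]) auto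
      then have "x \<in> \<Union>F" using F(3) by simp
      then show "x \<in> (\<Union>j. B j)" using rangeB by auto
    qed
    define E where "E = disjointed (\<lambda>j. B j - Y)"
    have E_sets: "E j \<in> sets borel" for j
    proof -
      have "range (\<lambda>j. B j - Y) \<subseteq> sets borel" using B_open Y by auto
      then show ?thesis unfolding E_def using sets.range_disjointed_sets by blast
    qed
    have E_disj: "disjoint_family E" unfolding E_def by (rule disjoint_family_disjointed)
    have E_UN: "(\<Union>j. E j) = - Y"
      unfolding E_def UN_disjointed_eq using cover by auto
    have E_sub: "E j \<subseteq> B j" for j
      unfolding E_def using disjointed_subset[of "\<lambda>j. B j - Y" j] by auto
    \<comment> \<open>On a piece with mass at most \<open>\<delta>\<close> the power
      \<open>\<beta> > 1\<close> yields the small factor \<open>\<delta> powr (\<beta> - 1)\<close>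
      times an additive quantity, which can be summed over the pieces.\<close>
    have piece: "measure N (E j) \<le> c * \<delta> powr (\<beta> - 1) * \<eta> (E j)" for j
    proof -
      have le\<delta>: "\<eta> (E j) \<le> \<delta>"
        using \<eta>_mono[OF E_sub borel_open[OF B_open]] B_small[of j] by (rule order_trans)
      have "\<eta> (E j) powr \<beta> \<le> \<delta> powr (\<beta> - 1) * \<eta> (E j)"
      proof (cases "\<eta> (E j) = 0")
        case False
        then have "\<eta> (E j) powr \<beta> = \<eta> (E j) powr (\<beta> - 1) * \<eta> (E j)"
          using \<eta>0[of "E j"] by (simp add: powr_diff)
        also have "\<dots> \<le> \<delta> powr (\<beta> - 1) * \<eta> (E j)"
          using le\<delta> \<eta>0[of "E j"] \<beta> by (intro mult_right_mono powr_mono2) auto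
        finally show ?thesis .
      qed simp
      then have "c * \<eta> (E j) powr \<beta> \<le> c * (\<delta> powr (\<beta> - 1) * \<eta> (E j))"
        using c by (intro mult_left_mono) auto
      then show ?thesis using le[OF E_sets[of j]] by (simp add: \<eta>_def mult.assoc)
    qed
    have sums_N: "(\<lambda>j. measure N (E j)) sums measure N (- Y)"
      using N.finite_measure_UNION[of E] E_sets E_disj by (auto simp: N(2) E_UN)
    have sums_\<eta>: "(\<lambda>j. \<eta> (E j)) sums \<eta> (- Y)"
      unfolding \<eta>_def
      using M1.finite_measure_UNION[of E] M2.finite_measure_UNION[of E] E_sets E_disj
      by (intro sums_add sums_mult) (auto simp: M1(2) M2(2) E_UN)
    have "measure N (- Y) \<le> c * \<delta> powr (\<beta> - 1) * \<eta> (- Y)"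
      by (rule sums_le[OF piece sums_N sums_mult[OF sums_\<eta>]])
    also have "\<dots> \<le> c * \<delta> powr (\<beta> - 1) * \<eta> UNIV"
      using c by (intro mult_left_mono \<eta>_mono) auto
    finally show ?thesis .
  qed
  have "((\<lambda>\<delta>. c * \<delta> powr (\<beta> - 1) * \<eta> UNIV) \<longlongrightarrow> c * 0 powr (\<beta> - 1) * \<eta> UNIV) (at_right 0)"
    using \<beta> by (intro tendsto_mult tendsto_const tendsto_powr' tendsto_ident_at) (auto simp: eventually_at_filter)
  moreover have "\<forall>\<^sub>F \<delta> in at_right 0. measure N (- Y) \<le> c * \<delta> powr (\<beta> - 1) * \<eta> UNIV"
    using small by (simp add: eventually_at_filter)
  ultimately have "measure N (- Y) \<le> c * 0 powr (\<beta> - 1) * \<eta> UNIV"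
    by (intro tendsto_lowerbound) auto
  then show ?thesis by (simp add: Y_def measure_le_0_iff)
qed

text \<open>Finite partial sums are measures of finite sets of points, disjoint singletons by
  injectivity. The infinite sum is the supremum of these, reached along the finite sets
  \<open>I \<inter> {..<j}\<close>.\<close>

lemma dirac_sum_atoms:
  fixes M :: "'a::euclidean_space measure"
  assumes M: "finite_measure M" "sets M = sets borel" and inj: "inj_on x I" and A: "A \<in> sets borel"
  shows "dirac_sum I x (\<lambda>i. measure M {x i}) A = emeasure M (A \<inter> x ` I)"
proof -
  interpret M: finite_measure M by fact
  have fin: "(\<Sum>i\<in>F. ennreal (measure M {x i}) * emeasure (return borel (x i)) A) = emeasure M (A \<inter> x ` F)"
    if F: "finite F" "F \<subseteq> I" for F
  proof -
    have "(\<Sum>i\<in>F. ennreal (measure M {x i}) * emeasure (return borel (x i)) A) = (\<Sum>i\<in>F. emeasure M (A \<inter> {x i}))"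
      using A by (intro sum.cong refl) (auto simp: indicator_def M.emeasure_eq_measure)
    also have "\<dots> = emeasure M (\<Union>i\<in>F. A \<inter> {x i})"
    proof (rule sum_emeasure)
      show "(\<lambda>i. A \<inter> {x i}) ` F \<subseteq> sets M" using A by (auto simp: M(2))
      show "disjoint_family_on (\<lambda>i. A \<inter> {x i}) F"
        using inj F(2) by (auto simp: disjoint_family_on_def inj_on_def)
    qed (rule F(1))
    also have "(\<Union>i\<in>F. A \<inter> {x i}) = A \<inter> x ` F" by auto
    finally show ?thesis .
  qed
  have xI: "x ` F \<in> sets M" for F :: "nat set"
    unfolding M(2) by (rule sets.countable) simp_all
  have sup: "dirac_sum I x (\<lambda>i. measure M {x i}) A = (SUP F\<in>{F. finite F \<and> F \<subseteq> I}. emeasure M (A \<inter> x ` F))"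
    unfolding dirac_sum_def by (subst nonneg_infsum_complete) (auto intro!: SUP_cong simp: fin)
  show ?thesis
    unfolding sup
  proof (rule antisym)
    show "(SUP F\<in>{F. finite F \<and> F \<subseteq> I}. emeasure M (A \<inter> x ` F)) \<le> emeasure M (A \<inter> x ` I)"
      using A xI[of I] by (intro SUP_least emeasure_mono) (auto simp: M(2))
    have "(\<lambda>j. emeasure M (A \<inter> x ` (I \<inter> {..<j}))) \<longlonglongrightarrow> emeasure M (\<Union>j. A \<inter> x ` (I \<inter> {..<j}))"
      using A xI by (intro Lim_emeasure_incseq) (auto simp: incseq_def M(2))
    also have "(\<Union>j. A \<inter> x ` (I \<inter> {..<j})) = A \<inter> x ` I" by (auto intro: lessI)
    finally show "emeasure M (A \<inter> x ` I) \<le> (SUP F\<in>{F. finite F \<and> F \<subseteq> I}. emeasure M (A \<inter> x ` F))"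
      by (rule LIMSEQ_le_const2) (auto intro!: SUP_upper)
  qed
qed

lemma nn_integral_lincomb:
  assumes [measurable]: "f \<in> borel_measurable M" "g \<in> borel_measurable M"
  shows "(\<integral>\<^sup>+x. a * f x + b * g x \<partial>M) = a * (\<integral>\<^sup>+x. f x \<partial>M) + b * (\<integral>\<^sup>+x. g x \<partial>M)"
  by (simp add: nn_integral_cmult nn_integral_add)

section \<open>Vanishing of the nonlocal commutator\<close>

context frac_sobolev
begin

text \<open>The part of \<open>\<bar>v k\<bar> powr p\<close> below t vanishes by dominated
  convergence, the weight being integrable. The part above t is at most
  \<open>t powr (1 - q / p)\<close> times the q-th power; since the weight is bounded and
  \<open>p < q\<close>, it is small for large t, uniformly in k.\<close>

lemma weighted_Lp_vanishing:
  fixes v :: "nat \<Rightarrow> 'a \<Rightarrow> real" and w :: "'a \<Rightarrow> ennreal"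
  assumes v: "\<And>k. v k \<in> Lq q" and A: "\<And>k. (\<integral>x. \<bar>v k x\<bar> powr q \<partial>lborel) \<le> A"
    and ae: "AE x in lborel. (\<lambda>k. v k x) \<longlonglongrightarrow> 0"
    and [measurable]: "w \<in> borel_measurable borel" and w: "\<And>x. w x \<le> ennreal W" "0 \<le> W" "(\<integral>\<^sup>+x. w x \<partial>lborel) < \<infinity>"
  shows "(\<lambda>k. \<integral>\<^sup>+x. ennreal (\<bar>v k x\<bar> powr p) * w x \<partial>lborel) \<longlonglongrightarrow> 0"
proof (rule tendsto_0_if_Limsup_eq_0_ennreal)
  have m [measurable]: "v k \<in> borel_measurable borel" and int: "integrable lborel (\<lambda>x. \<bar>v k x\<bar> powr q)" for k
    using v by (auto simp: Lq_def)
  have A0: "0 \<le> A" using order_trans[OF Bochner_Integration.integral_nonneg A] by simp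
  let ?L = "limsup (\<lambda>k. \<integral>\<^sup>+x. ennreal (\<bar>v k x\<bar> powr p) * w x \<partial>lborel)"
  have step: "?L \<le> ennreal (t powr (1 - q / p) * W * A)" if t: "0 < t" for t
  proof -
    have lim: "(\<lambda>k. \<integral>\<^sup>+x. ennreal (min t (\<bar>v k x\<bar> powr p)) * w x \<partial>lborel) \<longlonglongrightarrow> (\<integral>\<^sup>+x. 0 \<partial>(lborel :: 'a measure))"
    proof (rule nn_integral_dominated_convergence[where w = "\<lambda>x. ennreal t * w x"])
      show "AE x in lborel. ennreal (min t (\<bar>v k x\<bar> powr p)) * w x \<le> ennreal t * w x" for k
        by (intro AE_I2 mult_right_mono ennreal_leI) auto
      show "(\<integral>\<^sup>+x. ennreal t * w x \<partial>lborel) < \<infinity>"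
        using w(3) by (simp add: nn_integral_cmult ennreal_mult_less_top)
      show "AE x in lborel. (\<lambda>k. ennreal (min t (\<bar>v k x\<bar> powr p)) * w x) \<longlonglongrightarrow> 0"
        using ae
      proof eventually_elim
        case (elim x)
        have "(\<lambda>k. min t (\<bar>v k x\<bar> powr p)) \<longlonglongrightarrow> min t (\<bar>0\<bar> powr p)"
          using p_pos by (intro tendsto_min tendsto_const tendsto_powr' tendsto_rabs elim) auto
        then have lim0: "(\<lambda>k. ennreal (min t (\<bar>v k x\<bar> powr p))) \<longlonglongrightarrow> 0"
          using t tendsto_ennrealI by fastforce
        have "w x \<noteq> \<top>" using w(1)[of x] by (auto simp: top_unique)
        then have "(\<lambda>k. w x * ennreal (min t (\<bar>v k x\<bar> powr p))) \<longlonglongrightarrow> w x * 0"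
          by (intro ennreal_tendsto_cmult lim0) (simp add: less_top)
        then show ?case by (simp add: mult.commute)
      qed
    qed measurable
    have "(\<integral>\<^sup>+x. ennreal (\<bar>v k x\<bar> powr p) * w x \<partial>lborel)
      \<le> (\<integral>\<^sup>+x. ennreal (min t (\<bar>v k x\<bar> powr p)) * w x \<partial>lborel) + ennreal (t powr (1 - q / p) * W * A)" for k
    proof -
      let ?c = "t powr (1 - q / p)"
      have "(\<integral>\<^sup>+x. ennreal (\<bar>v k x\<bar> powr p) * w x \<partial>lborel)
        \<le> (\<integral>\<^sup>+x. ennreal (min t (\<bar>v k x\<bar> powr p)) * w x + ennreal (?c * W) * ennreal (\<bar>v k x\<bar> powr q) \<partial>lborel)"
      proof (rule nn_integral_mono)
        fix x
        have "\<bar>v k x\<bar> powr p \<le> min t (\<bar>v k x\<bar> powr p) + ?c * \<bar>v k x\<bar> powr q"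
        proof (cases "\<bar>v k x\<bar> powr p \<le> t")
          case False
          then show ?thesis
            using truncation_bound[of "\<bar>v k x\<bar> powr p" t "q / p"] t p_pos p_less_q by (simp add: powr_powr)
        qed simp
        then have "ennreal (\<bar>v k x\<bar> powr p) * w x \<le> ennreal (min t (\<bar>v k x\<bar> powr p) + ?c * \<bar>v k x\<bar> powr q) * w x"
          by (intro mult_right_mono ennreal_leI) auto
        also have "\<dots> = ennreal (min t (\<bar>v k x\<bar> powr p)) * w x + ennreal (?c * \<bar>v k x\<bar> powr q) * w x"
          using t by (simp add: distrib_right)
        also have "\<dots> \<le> ennreal (min t (\<bar>v k x\<bar> powr p)) * w x + ennreal (?c * \<bar>v k x\<bar> powr q) * ennreal W"
          by (intro add_left_mono mult_left_mono w) auto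
        also have "ennreal (?c * \<bar>v k x\<bar> powr q) * ennreal W = ennreal (?c * W) * ennreal (\<bar>v k x\<bar> powr q)"
          using w(2) by (simp add: mult_ac flip: ennreal_mult)
        finally show "ennreal (\<bar>v k x\<bar> powr p) * w x \<le> ennreal (min t (\<bar>v k x\<bar> powr p)) * w x + ennreal (?c * W) * ennreal (\<bar>v k x\<bar> powr q)" .
      qed
      also have "\<dots> = (\<integral>\<^sup>+x. ennreal (min t (\<bar>v k x\<bar> powr p)) * w x \<partial>lborel) + ennreal (?c * W) * ennreal (\<integral>x. \<bar>v k x\<bar> powr q \<partial>lborel)"
        by (simp add: nn_integral_add nn_integral_cmult nn_integral_eq_integral[OF int])
      also have "\<dots> \<le> (\<integral>\<^sup>+x. ennreal (min t (\<bar>v k x\<bar> powr p)) * w x \<partial>lborel) + ennreal (?c * W) * ennreal A"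
        by (intro add_left_mono mult_left_mono ennreal_leI A) auto
      also have "ennreal (?c * W) * ennreal A = ennreal (?c * W * A)"
        using w(2) A0 by (simp flip: ennreal_mult)
      finally show ?thesis .
    qed
    then have "?L \<le> limsup (\<lambda>k. (\<integral>\<^sup>+x. ennreal (min t (\<bar>v k x\<bar> powr p)) * w x \<partial>lborel) + ennreal (t powr (1 - q / p) * W * A))"
      by (intro Limsup_mono always_eventually allI)
    also have "\<dots> = ennreal (t powr (1 - q / p) * W * A)"
      by (rule lim_imp_Limsup) (use tendsto_add[OF lim tendsto_const] in auto)
    finally show ?thesis .
  qed
  have "((\<lambda>t. ennreal (t powr (1 - q / p) * W * A)) \<longlongrightarrow> ennreal (0 * W * A)) at_top"
    using p_less_q p_pos
    by (intro tendsto_ennrealI tendsto_mult tendsto_const tendsto_neg_powr filterlim_ident) (simp add: field_simps)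
  moreover have "\<forall>\<^sub>F t in at_top. ?L \<le> ennreal (t powr (1 - q / p) * W * A)"
    using eventually_gt_at_top[of 0] by eventually_elim (rule step)
  ultimately have "?L \<le> ennreal (0 * W * A)" by (intro tendsto_lowerbound) auto
  then show "?L = 0" by simp
qed

text \<open>The constant \<open>C\<close> does not depend on the cutoff \<open>\<psi>\<close>, and the commutator of the fractional
  gradient with \<open>\<psi>\<close> disappears in the limit since \<open>u k - u0\<close> tends to \<open>0\<close> almost everywhere.\<close>

lemma cutoff_estimate:
  fixes u :: "nat \<Rightarrow> 'a \<Rightarrow> real" and u0 :: "'a \<Rightarrow> real"
  assumes u: "\<And>k. u k \<in> Dsp s p" and u0: "u0 \<in> Dsp s p"
    and A: "\<And>k. (\<integral>x. \<bar>u k x - u0 x\<bar> powr q \<partial>lborel) \<le> A"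
    and ae: "AE x in lborel. (\<lambda>k. u k x - u0 x) \<longlonglongrightarrow> 0"
    and c: "\<And>w :: 'a \<Rightarrow> real. w \<in> Dsp s p \<Longrightarrow> c * (\<integral>x. \<bar>w x\<bar> powr q \<partial>lborel) powr (p / q) \<le> enn2real (gagliardo_pow s p w)"
    and e: "0 < e"
  obtains C where "0 \<le> C"
    "\<And>(\<psi> :: 'a \<Rightarrow> real) W \<delta>. \<psi> \<in> borel_measurable borel \<Longrightarrow> (\<And>x. frac_grad_pow s p \<psi> x \<le> ennreal W) \<Longrightarrow> 0 \<le> W \<Longrightarrow>
      gagliardo_pow s p \<psi> < \<infinity> \<Longrightarrow> (\<forall>v\<in>Dsp s p. (\<lambda>x. \<psi> x * v x) \<in> Dsp s p) \<Longrightarrow> 0 < \<delta> \<Longrightarrow>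
      \<forall>\<^sub>F k in sequentially. ennreal (c * (\<integral>x. \<bar>\<psi> x * (u k x - u0 x)\<bar> powr q \<partial>lborel) powr (p / q))
        \<le> ennreal ((1 + e)\<^sup>2) * (\<integral>\<^sup>+x. ennreal (\<bar>\<psi> x\<bar> powr p) * frac_grad_pow s p (u k) x \<partial>lborel)
          + ennreal C * (\<integral>\<^sup>+x. ennreal (\<bar>\<psi> x\<bar> powr p) * frac_grad_pow s p u0 x \<partial>lborel) + ennreal \<delta>"
proof -
  obtain C where C: "0 \<le> C" "\<And>a b :: real. \<bar>a + b\<bar> powr p \<le> (1 + e) * \<bar>a\<bar> powr p + C * \<bar>b\<bar> powr p"
    using powr_add_le_eps[OF p_pos e] by blast
  have "\<forall>\<^sub>F k in sequentially. ennreal (c * (\<integral>x. \<bar>\<psi> x * (u k x - u0 x)\<bar> powr q \<partial>lborel) powr (p / q))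
        \<le> ennreal ((1 + e)\<^sup>2) * (\<integral>\<^sup>+x. ennreal (\<bar>\<psi> x\<bar> powr p) * frac_grad_pow s p (u k) x \<partial>lborel)
          + ennreal ((1 + e) * C) * (\<integral>\<^sup>+x. ennreal (\<bar>\<psi> x\<bar> powr p) * frac_grad_pow s p u0 x \<partial>lborel) + ennreal \<delta>"
    if \<psi>m [measurable]: "\<psi> \<in> borel_measurable borel" and \<psi>: "\<And>x. frac_grad_pow s p \<psi> x \<le> ennreal W" "0 \<le> W"
      "gagliardo_pow s p \<psi> < \<infinity>" "\<forall>v\<in>Dsp s p. (\<lambda>x. \<psi> x * v x) \<in> Dsp s p" and \<delta>: "0 < \<delta>" for \<psi> W \<delta>
  proof -
    note um [measurable] = DspD(2)[OF u] and u0m [measurable] = DspD(2)[OF u0]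
    define v where "v k x = u k x - u0 x" for k x
    have v: "v k \<in> Dsp s p" for k unfolding v_def[abs_def] by (rule Dsp_diff[OF u u0])
    note vm [measurable] = DspD(2)[OF v]
    let ?w = "frac_grad_pow s p \<psi>"
    have "(\<lambda>k. \<integral>\<^sup>+x. ennreal (\<bar>v k x\<bar> powr p) * ?w x \<partial>lborel) \<longlonglongrightarrow> 0"
      by (rule weighted_Lp_vanishing[OF DspD(1)[OF v], where A = A and W = W])
         (use A ae \<psi> in \<open>auto simp: v_def gagliardo_pow_eq[OF \<psi>m]\<close>)
    then have "(\<lambda>k. ennreal C * (\<integral>\<^sup>+x. ennreal (\<bar>v k x\<bar> powr p) * ?w x \<partial>lborel)) \<longlonglongrightarrow> ennreal C * 0"
      by (intro ennreal_tendsto_cmult) auto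
    then have "\<forall>\<^sub>F k in sequentially. ennreal C * (\<integral>\<^sup>+x. ennreal (\<bar>v k x\<bar> powr p) * ?w x \<partial>lborel) < ennreal \<delta>"
      by (rule order_tendstoD) (use \<delta> in simp)
    then show ?thesis
    proof eventually_elim
      case (elim k)
      let ?I = "\<lambda>g. \<integral>\<^sup>+x. ennreal (\<bar>\<psi> x\<bar> powr p) * frac_grad_pow s p g x \<partial>lborel"
      have \<psi>v: "(\<lambda>x. \<psi> x * v k x) \<in> Dsp s p" by (rule bspec[OF \<psi>(4) v])
      have "ennreal (c * (\<integral>x. \<bar>\<psi> x * v k x\<bar> powr q \<partial>lborel) powr (p / q)) \<le> ennreal (enn2real (gagliardo_pow s p (\<lambda>x. \<psi> x * v k x)))"
        by (rule ennreal_leI[OF c[OF \<psi>v]])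
      also have "\<dots> = gagliardo_pow s p (\<lambda>x. \<psi> x * v k x)"
        using gagliardo_pow_finite[OF \<psi>v] by simp
      also have "\<dots> \<le> ennreal (1 + e) * ?I (v k) + ennreal C * (\<integral>\<^sup>+x. ennreal (\<bar>v k x\<bar> powr p) * ?w x \<partial>lborel)"
        using e by (intro gagliardo_pow_mult_le vm \<psi>m C) auto
      finally have le1: "ennreal (c * (\<integral>x. \<bar>\<psi> x * v k x\<bar> powr q \<partial>lborel) powr (p / q))
        \<le> ennreal (1 + e) * ?I (v k) + ennreal C * (\<integral>\<^sup>+x. ennreal (\<bar>v k x\<bar> powr p) * ?w x \<partial>lborel)" .
      \<comment> \<open>Weak limits are available for the gradients of \<open>u k\<close>, not for
        those of \<open>u k - u0\<close>. The price of the change is the term with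
        \<open>u0\<close>.\<close>
      have le2: "?I (v k) \<le> ennreal (1 + e) * ?I (u k) + ennreal C * ?I u0"
      proof -
        have "?I (v k) \<le> (\<integral>\<^sup>+x. ennreal (\<bar>\<psi> x\<bar> powr p) * (ennreal (1 + e) * frac_grad_pow s p (u k) x + ennreal C * frac_grad_pow s p u0 x) \<partial>lborel)"
        proof (intro nn_integral_mono mult_left_mono)
          fix x
          have "frac_grad_pow s p (\<lambda>x. u k x + (-1) * u0 x) x \<le> ennreal (1 + e) * frac_grad_pow s p (u k) x + ennreal C * frac_grad_pow s p (\<lambda>x. (-1) * u0 x) x"
            using e by (intro frac_grad_pow_add_le C) auto
          also have "frac_grad_pow s p (\<lambda>x. (-1) * u0 x) x = frac_grad_pow s p u0 x"
            by (subst frac_grad_pow_cmult) auto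
          finally show "frac_grad_pow s p (v k) x \<le> ennreal (1 + e) * frac_grad_pow s p (u k) x + ennreal C * frac_grad_pow s p u0 x"
            by (simp add: v_def[abs_def])
        qed simp
        also have "\<dots> = (\<integral>\<^sup>+x. ennreal (1 + e) * (ennreal (\<bar>\<psi> x\<bar> powr p) * frac_grad_pow s p (u k) x)
            + ennreal C * (ennreal (\<bar>\<psi> x\<bar> powr p) * frac_grad_pow s p u0 x) \<partial>lborel)"
          by (intro nn_integral_cong) (simp add: distrib_left mult.left_commute)
        also have "\<dots> = ennreal (1 + e) * ?I (u k) + ennreal C * ?I u0"
          by (rule nn_integral_lincomb) measurable
        finally show ?thesis .
      qed
      \<comment> \<open>One factor \<open>1 + e\<close> comes from the Leibniz rule, the other from
        separating \<open>u0\<close>.\<close>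
      have e2: "ennreal ((1 + e)\<^sup>2) = ennreal (1 + e) * ennreal (1 + e)" "ennreal ((1 + e) * C) = ennreal (1 + e) * ennreal C"
        using e C(1) by (simp_all only: power2_eq_square ennreal_mult)
      note le1
      also have "ennreal (1 + e) * ?I (v k) + ennreal C * (\<integral>\<^sup>+x. ennreal (\<bar>v k x\<bar> powr p) * ?w x \<partial>lborel)
        \<le> ennreal (1 + e) * (ennreal (1 + e) * ?I (u k) + ennreal C * ?I u0) + ennreal C * (\<integral>\<^sup>+x. ennreal (\<bar>v k x\<bar> powr p) * ?w x \<partial>lborel)"
        by (intro add_right_mono mult_left_mono le2) simp
      also have "\<dots> = ennreal ((1 + e)\<^sup>2) * ?I (u k) + ennreal ((1 + e) * C) * ?I u0 + ennreal C * (\<integral>\<^sup>+x. ennreal (\<bar>v k x\<bar> powr p) * ?w x \<partial>lborel)"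
        unfolding e2 by (simp only: distrib_left mult.assoc)
      also have "\<dots> \<le> ennreal ((1 + e)\<^sup>2) * ?I (u k) + ennreal ((1 + e) * C) * ?I u0 + ennreal \<delta>"
        using elim by (intro add_left_mono) simp
      finally show ?case by (simp add: v_def)
    qed
  qed
  moreover have "0 \<le> (1 + e) * C" using e C(1) by simp
  ultimately show ?thesis by (rule that[rotated])
qed

end

section \<open>Concentration\<close>

lemma test_function_powr_C0:
  fixes \<phi> :: "'a::euclidean_space \<Rightarrow> real"
  assumes "\<phi> \<in> test_functions" "\<And>x. 0 \<le> \<phi> x" "0 < a"
  shows "(\<lambda>x. \<phi> x powr a) \<in> C0_functions"
proof -
  have "bounded {x. \<phi> x \<noteq> 0}" using assms(1) by (auto simp: test_functions_def)
  then obtain R where R: "\<And>x. \<phi> x \<noteq> 0 \<Longrightarrow> norm x \<le> R" by (auto simp: bounded_iff)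
  have "continuous_on UNIV \<phi>" using assms(1) Ck_fun_continuous[of 0 \<phi>] by (auto simp: test_functions_def)
  then have "continuous_on UNIV (\<lambda>x. \<phi> x powr a)"
    using assms by (intro continuous_on_powr') auto
  then show ?thesis
  proof (rule C0_functions_compact_support[of _ R])
    show "\<phi> x powr a = 0" if "R < norm x" for x using R[of x] that by (cases "\<phi> x = 0") auto
  qed
qed

lemma measure_le_cutoff:
  fixes N :: "'a::euclidean_space measure" and \<phi> :: "'a \<Rightarrow> real"
  assumes N: "finite_measure N" "sets N = sets borel" and \<phi>: "\<phi> \<in> test_functions" "\<And>x. 0 \<le> \<phi> x" "\<And>x. \<phi> x \<le> 1" and a: "0 < a"
  shows "compact K \<Longrightarrow> (\<And>x. x \<in> K \<Longrightarrow> \<phi> x = 1) \<Longrightarrow> measure N K \<le> (\<integral>x. \<phi> x powr a \<partial>N)"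
    and "open U \<Longrightarrow> (\<And>x. x \<notin> U \<Longrightarrow> \<phi> x = 0) \<Longrightarrow> (\<integral>x. \<phi> x powr a \<partial>N) \<le> measure N U"
proof -
  interpret finite_measure N by fact
  have space: "space N = UNIV" using sets_eq_imp_space_eq[OF N(2)] by simp
  have int: "integrable N (\<lambda>x. \<phi> x powr a)"
    by (rule integrable_C0_functions[OF N test_function_powr_C0[OF \<phi>(1,2) a]])
  have le1: "\<phi> x powr a \<le> 1" for x using powr_mono2[of a "\<phi> x" 1] \<phi> a by simp
  show "measure N K \<le> (\<integral>x. \<phi> x powr a \<partial>N)" if K: "compact K" "\<And>x. x \<in> K \<Longrightarrow> \<phi> x = 1"
  proof -
    have "K \<in> sets N" using K(1) by (simp add: N(2) borel_closed compact_imp_closed)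
    then have "(\<integral>x. indicat_real K x \<partial>N) \<le> (\<integral>x. \<phi> x powr a \<partial>N)"
      using K(2) by (intro integral_mono int integrable_real_indicator) (auto simp: emeasure_eq_measure split: split_indicator)
    then show ?thesis by (simp add: space)
  qed
  show "(\<integral>x. \<phi> x powr a \<partial>N) \<le> measure N U" if U: "open U" "\<And>x. x \<notin> U \<Longrightarrow> \<phi> x = 0"
  proof -
    have "U \<in> sets N" using U(1) by (simp add: N(2))
    then have "(\<integral>x. \<phi> x powr a \<partial>N) \<le> (\<integral>x. indicat_real U x \<partial>N)"
      using U(2) le1 by (intro integral_mono int integrable_real_indicator) (auto simp: emeasure_eq_measure split: split_indicator)
    then show ?thesis by (simp add: space)
  qed
qed

lemma nn_integral_powr_density:
  fixes \<psi> :: "'a::euclidean_space \<Rightarrow> real"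
  assumes [measurable]: "\<psi> \<in> borel_measurable borel" and \<psi>: "\<And>x. 0 \<le> \<psi> x" "\<And>x. \<psi> x \<le> 1" and "0 < a"
    and [measurable]: "f \<in> borel_measurable borel" and fin: "finite_measure (density lborel f)"
  shows "(\<integral>\<^sup>+x. ennreal (\<bar>\<psi> x\<bar> powr a) * f x \<partial>lborel) = ennreal (\<integral>x. \<psi> x powr a \<partial>density lborel f)"
    "integrable (density lborel f) (\<lambda>x. \<psi> x powr a)"
proof -
  interpret finite_measure "density lborel f" by fact
  have "\<psi> x powr a \<le> 1" for x
    using powr_mono2[of a "\<psi> x" 1] \<psi> \<open>0 < a\<close> by simp
  then show int: "integrable (density lborel f) (\<lambda>x. \<psi> x powr a)"
    by (intro integrable_const_bound[of _ 1]) auto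
  have "(\<integral>\<^sup>+x. ennreal (\<bar>\<psi> x\<bar> powr a) * f x \<partial>lborel) = (\<integral>\<^sup>+x. ennreal (\<psi> x powr a) \<partial>density lborel f)"
    using \<psi> by (subst nn_integral_density) (auto simp: mult.commute)
  also have "\<dots> = ennreal (\<integral>x. \<psi> x powr a \<partial>density lborel f)"
    by (rule nn_integral_eq_integral[OF int]) simp
  finally show "(\<integral>\<^sup>+x. ennreal (\<bar>\<psi> x\<bar> powr a) * f x \<partial>lborel) = ennreal (\<integral>x. \<psi> x powr a \<partial>density lborel f)" .
qed

context frac_sobolev
begin

lemma Dsp_diff_bounds:
  fixes u :: "nat \<Rightarrow> 'a \<Rightarrow> real" and u0 :: "'a \<Rightarrow> real"
  assumes u: "\<And>k. u k \<in> Dsp s p" and u0: "u0 \<in> Dsp s p" and M: "0 \<le> M" "\<And>k. gagliardo_pow s p (u k) \<le> ennreal M"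
  obtains A B where "0 \<le> A" "0 \<le> B" "\<And>k. gagliardo_pow s p (\<lambda>x. u k x - u0 x) \<le> ennreal B"
    "\<And>k. (\<integral>x. \<bar>u k x - u0 x\<bar> powr q \<partial>lborel) \<le> A" "\<And>k. (\<integral>x. \<bar>u k x\<bar> powr q \<partial>lborel) \<le> A"
proof -
  note [measurable] = DspD(2)[OF u] DspD(2)[OF u0]
  obtain C where C: "0 < C" "\<And>v :: 'a \<Rightarrow> real. v \<in> Dsp s p \<Longrightarrow>
    (\<integral>x. \<bar>v x\<bar> powr q \<partial>lborel) powr (p / q) \<le> C * enn2real (gagliardo_pow s p v)"
    by (rule sobolev_real) blast
  have bound: "(\<integral>x. \<bar>v x\<bar> powr q \<partial>lborel) \<le> (C * B) powr (q / p)"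
    if v: "v \<in> Dsp s p" and B: "gagliardo_pow s p v \<le> ennreal B" "0 \<le> B" for v :: "'a \<Rightarrow> real" and B
  proof -
    have "enn2real (gagliardo_pow s p v) \<le> B" using B enn2real_leI by blast
    then have "(\<integral>x. \<bar>v x\<bar> powr q \<partial>lborel) powr (p / q) \<le> C * B"
      using C(2)[OF v] C(1) by (meson mult_left_mono less_imp_le order_trans)
    then have "((\<integral>x. \<bar>v x\<bar> powr q \<partial>lborel) powr (p / q)) powr (q / p) \<le> (C * B) powr (q / p)"
      using p_pos q_pos by (intro powr_mono2) auto
    moreover have "0 \<le> (\<integral>x. \<bar>v x\<bar> powr q \<partial>lborel)" by (rule Bochner_Integration.integral_nonneg) simp
    ultimately show ?thesis using p_pos q_pos by (simp add: powr_powr)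
  qed
  define g where "g = enn2real (gagliardo_pow s p u0)"
  have g: "gagliardo_pow s p u0 = ennreal g" "0 \<le> g"
    using gagliardo_pow_finite[OF u0] by (simp_all add: g_def)
  have G: "gagliardo_pow s p (\<lambda>x. u k x - u0 x) \<le> ennreal (2 powr p * (M + g))" for k
  proof -
    have "gagliardo_pow s p (\<lambda>x. u k x + (-1) * u0 x) \<le> ennreal (2 powr p) * (gagliardo_pow s p (u k) + gagliardo_pow s p (\<lambda>x. (-1) * u0 x))"
      by (rule gagliardo_pow_add_le) auto
    also have "gagliardo_pow s p (\<lambda>x. (-1) * u0 x) = ennreal g"
      unfolding g(1)[symmetric] by (subst gagliardo_pow_cmult) auto
    also have "ennreal (2 powr p) * (gagliardo_pow s p (u k) + ennreal g) \<le> ennreal (2 powr p) * (ennreal M + ennreal g)"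
      by (intro mult_left_mono add_right_mono M(2)) auto
    also have "\<dots> = ennreal (2 powr p * (M + g))"
      using M(1) g(2) by (simp only: ennreal_mult ennreal_plus powr_ge_zero add_nonneg_nonneg)
    finally show ?thesis by simp
  qed
  have b1: "(\<integral>x. \<bar>u k x - u0 x\<bar> powr q \<partial>lborel) \<le> (C * (2 powr p * (M + g))) powr (q / p)" for k
    by (rule bound[OF Dsp_diff[OF u u0] G]) (use M(1) g(2) in simp)
  have b2: "(\<integral>x. \<bar>u k x\<bar> powr q \<partial>lborel) \<le> (C * M) powr (q / p)" for k
    by (rule bound[OF u M(2) M(1)])
  show ?thesis
  proof (rule that)
    show "0 \<le> max ((C * (2 powr p * (M + g))) powr (q / p)) ((C * M) powr (q / p))" by (simp add: le_max_iff_disj)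
    show "0 \<le> 2 powr p * (M + g)" using M(1) g(2) by simp
  qed (use G b1 b2 in \<open>auto simp: le_max_iff_disj\<close>)
qed

end

text \<open>The situation after all subsequences have been extracted: \<open>u\<close> is already
  the subsequence, the three families of measures have weak limits, and \<open>S\<close> is any
  admissible Sobolev constant.\<close>

locale concentration = frac_sobolev s p q T
  for s p q :: real and T :: "'a::euclidean_space itself" +
  fixes u :: "nat \<Rightarrow> 'a \<Rightarrow> real" and u0 :: "'a \<Rightarrow> real" and \<mu> \<nu>' \<nu> :: "'a measure" and M S :: real
  assumes u: "\<And>k. u k \<in> Dsp s p" and u0: "u0 \<in> Dsp s p"
    and M: "0 \<le> M" "\<And>k. gagliardo_pow s p (u k) \<le> ennreal M"
    and ae: "AE x in lborel. (\<lambda>k. u k x - u0 x) \<longlonglongrightarrow> 0"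
    and S: "0 < S" "\<And>w :: 'a \<Rightarrow> real. w \<in> Dsp s p \<Longrightarrow> S * (\<integral>x. \<bar>w x\<bar> powr q \<partial>lborel) powr (p / q) \<le> enn2real (gagliardo_pow s p w)"
    and \<mu>: "finite_measure \<mu>" "sets \<mu> = sets borel"
      "weakly_convergent_measures (\<lambda>k. density lborel (frac_grad_pow s p (u k))) \<mu>"
    and \<nu>': "finite_measure \<nu>'" "sets \<nu>' = sets borel"
      "weakly_convergent_measures (\<lambda>k. density lborel (\<lambda>y. ennreal (\<bar>u k y - u0 y\<bar> powr q))) \<nu>'"
    and \<nu>: "finite_measure \<nu>" "sets \<nu> = sets borel"
      "weakly_convergent_measures (\<lambda>k. density lborel (\<lambda>y. ennreal (\<bar>u k y\<bar> powr q))) \<nu>"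
begin

lemma measurable_u [measurable]: "u k \<in> borel_measurable borel" "u0 \<in> borel_measurable borel"
  by (rule DspD(2)[OF u] DspD(2)[OF u0])+

lemma diff_Dsp: "(\<lambda>x. u k x - u0 x) \<in> Dsp s p"
  by (rule Dsp_diff[OF u u0])

definition \<eta> where "\<eta> = density lborel (frac_grad_pow s p u0)"
definition \<eta>' where "\<eta>' = density lborel (\<lambda>y. ennreal (\<bar>u0 y\<bar> powr q))"

lemma density_frac_grad:
  fixes v :: "'a \<Rightarrow> real"
  assumes "v \<in> Dsp s p"
  shows "emeasure (density lborel (frac_grad_pow s p v)) UNIV = gagliardo_pow s p v"
    "finite_measure (density lborel (frac_grad_pow s p v))"
proof -
  note [measurable] = DspD(2)[OF assms]
  show *: "emeasure (density lborel (frac_grad_pow s p v)) UNIV = gagliardo_pow s p v"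
    by (subst emeasure_density) (simp_all add: gagliardo_pow_eq)
  show "finite_measure (density lborel (frac_grad_pow s p v))"
    by standard (use * gagliardo_pow_finite[OF assms] in auto)
qed

lemma density_Lq:
  fixes v :: "'a \<Rightarrow> real"
  assumes "v \<in> Dsp s p"
  shows "emeasure (density lborel (\<lambda>y. ennreal (\<bar>v y\<bar> powr q))) UNIV = ennreal (\<integral>x. \<bar>v x\<bar> powr q \<partial>lborel)"
    "finite_measure (density lborel (\<lambda>y. ennreal (\<bar>v y\<bar> powr q)))"
proof -
  note [measurable] = DspD(2)[OF assms]
  show *: "emeasure (density lborel (\<lambda>y. ennreal (\<bar>v y\<bar> powr q))) UNIV = ennreal (\<integral>x. \<bar>v x\<bar> powr q \<partial>lborel)"
    by (subst emeasure_density) (simp_all add: nn_integral_eq_integral[OF DspD(3)[OF assms]])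
  show "finite_measure (density lborel (\<lambda>y. ennreal (\<bar>v y\<bar> powr q)))"
    by standard (use * in auto)
qed

lemma \<eta>_facts: "finite_measure \<eta>" "sets \<eta> = sets borel" "measure \<eta> {x} = 0"
  and \<eta>'_facts: "finite_measure \<eta>'" "sets \<eta>' = sets borel"
proof -
  show "finite_measure \<eta>" "sets \<eta> = sets borel" "finite_measure \<eta>'" "sets \<eta>' = sets borel"
    using density_frac_grad[OF u0] density_Lq[OF u0] by (simp_all add: \<eta>_def \<eta>'_def)
  have "emeasure \<eta> {x} = (\<integral>\<^sup>+y. frac_grad_pow s p u0 y * indicator {x} y \<partial>lborel)"
    unfolding \<eta>_def by (rule emeasure_density) auto
  also have "\<dots> = 0"
    by (rule nn_integral_null_set) (simp add: countable_imp_null_set_lborel)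
  finally show "measure \<eta> {x} = 0" by (simp add: measure_def)
qed

lemma \<eta>_countable: "countable X \<Longrightarrow> emeasure \<eta> X = 0"
proof -
  assume X: "countable X"
  then have "X \<in> null_sets lborel" by (rule countable_imp_null_set_lborel)
  moreover have "X \<in> sets borel" by (rule sets.countable[OF _ X]) simp
  ultimately have "(\<integral>\<^sup>+y. frac_grad_pow s p u0 y * indicator X y \<partial>lborel) = 0"
    by (intro nn_integral_null_set)
  then show ?thesis
    unfolding \<eta>_def using \<open>X \<in> sets borel\<close> by (subst emeasure_density) auto
qed

lemma Lq_bound:
  obtains A where "0 \<le> A" "\<And>k. (\<integral>x. \<bar>u k x - u0 x\<bar> powr q \<partial>lborel) \<le> A" "\<And>k. (\<integral>x. \<bar>u k x\<bar> powr q \<partial>lborel) \<le> A"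
  by (rule Dsp_diff_bounds[OF u u0 M]) (rule that)

lemma integral_mult_powr_density:
  fixes \<psi> v :: "'a \<Rightarrow> real"
  assumes [measurable]: "\<psi> \<in> borel_measurable borel" and \<psi>: "\<And>x. 0 \<le> \<psi> x" "\<And>x. \<psi> x \<le> 1" and v: "v \<in> Dsp s p"
  shows "(\<integral>x. \<bar>\<psi> x * v x\<bar> powr q \<partial>lborel) = (\<integral>x. \<psi> x powr q \<partial>density lborel (\<lambda>y. ennreal (\<bar>v y\<bar> powr q)))"
proof -
  note [measurable] = DspD(2)[OF v]
  have "(\<lambda>x. \<psi> x * v x) \<in> Lq q"
    by (rule Lq_mult_bounded[OF DspD(1)[OF v], of _ 1]) (use \<psi> in auto)
  then have int: "integrable lborel (\<lambda>x. \<bar>\<psi> x * v x\<bar> powr q)" by (simp add: Lq_def)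
  have "ennreal (\<integral>x. \<bar>\<psi> x * v x\<bar> powr q \<partial>lborel) = (\<integral>\<^sup>+x. ennreal (\<bar>\<psi> x\<bar> powr q) * ennreal (\<bar>v x\<bar> powr q) \<partial>lborel)"
    by (subst nn_integral_eq_integral[OF int, symmetric]) (auto simp: abs_mult powr_mult ennreal_mult)
  also have "\<dots> = ennreal (\<integral>x. \<psi> x powr q \<partial>density lborel (\<lambda>y. ennreal (\<bar>v y\<bar> powr q)))"
    by (rule nn_integral_powr_density(1)) (use \<psi> q_pos density_Lq(2)[OF v] in auto)
  finally show ?thesis
    by (subst (asm) ennreal_inj) (auto intro: Bochner_Integration.integral_nonneg)
qed

lemma cutoff_real:
  assumes e: "0 < e"
  obtains C where "0 \<le> C"
    "\<And>(\<psi> :: 'a \<Rightarrow> real) W \<delta>. \<psi> \<in> borel_measurable borel \<Longrightarrow> (\<And>x. 0 \<le> \<psi> x) \<Longrightarrow> (\<And>x. \<psi> x \<le> 1) \<Longrightarrow>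
      (\<And>x. frac_grad_pow s p \<psi> x \<le> ennreal W) \<Longrightarrow> 0 \<le> W \<Longrightarrow>
      gagliardo_pow s p \<psi> < \<infinity> \<Longrightarrow> (\<forall>v\<in>Dsp s p. (\<lambda>x. \<psi> x * v x) \<in> Dsp s p) \<Longrightarrow> 0 < \<delta> \<Longrightarrow>
      \<forall>\<^sub>F k in sequentially. S * (\<integral>x. \<psi> x powr q \<partial>density lborel (\<lambda>y. ennreal (\<bar>u k y - u0 y\<bar> powr q))) powr (p / q)
        \<le> (1 + e)\<^sup>2 * (\<integral>x. \<psi> x powr p \<partial>density lborel (frac_grad_pow s p (u k))) + C * (\<integral>x. \<psi> x powr p \<partial>\<eta>) + \<delta>"
proof -
  obtain A where A: "\<And>k. (\<integral>x. \<bar>u k x - u0 x\<bar> powr q \<partial>lborel) \<le> A" by (rule Lq_bound) blast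
  obtain C where C: "0 \<le> C"
    "\<And>(\<psi> :: 'a \<Rightarrow> real) W \<delta>. \<psi> \<in> borel_measurable borel \<Longrightarrow> (\<And>x. frac_grad_pow s p \<psi> x \<le> ennreal W) \<Longrightarrow> 0 \<le> W \<Longrightarrow>
      gagliardo_pow s p \<psi> < \<infinity> \<Longrightarrow> (\<forall>v\<in>Dsp s p. (\<lambda>x. \<psi> x * v x) \<in> Dsp s p) \<Longrightarrow> 0 < \<delta> \<Longrightarrow>
      \<forall>\<^sub>F k in sequentially. ennreal (S * (\<integral>x. \<bar>\<psi> x * (u k x - u0 x)\<bar> powr q \<partial>lborel) powr (p / q))
        \<le> ennreal ((1 + e)\<^sup>2) * (\<integral>\<^sup>+x. ennreal (\<bar>\<psi> x\<bar> powr p) * frac_grad_pow s p (u k) x \<partial>lborel)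
          + ennreal C * (\<integral>\<^sup>+x. ennreal (\<bar>\<psi> x\<bar> powr p) * frac_grad_pow s p u0 x \<partial>lborel) + ennreal \<delta>"
    using cutoff_estimate[OF u u0 A ae S(2) e] by blast
  show ?thesis
  proof (rule that[OF C(1)])
    fix \<psi> :: "'a \<Rightarrow> real" and W \<delta> :: real
    assume \<psi>m: "\<psi> \<in> borel_measurable borel" and \<psi>: "\<And>x. 0 \<le> \<psi> x" "\<And>x. \<psi> x \<le> 1"
      and h: "\<And>x. frac_grad_pow s p \<psi> x \<le> ennreal W" "0 \<le> W" "gagliardo_pow s p \<psi> < \<infinity>"
        "\<forall>v\<in>Dsp s p. (\<lambda>x. \<psi> x * v x) \<in> Dsp s p" and \<delta>: "0 < \<delta>"
    show "\<forall>\<^sub>F k in sequentially. S * (\<integral>x. \<psi> x powr q \<partial>density lborel (\<lambda>y. ennreal (\<bar>u k y - u0 y\<bar> powr q))) powr (p / q)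
        \<le> (1 + e)\<^sup>2 * (\<integral>x. \<psi> x powr p \<partial>density lborel (frac_grad_pow s p (u k))) + C * (\<integral>x. \<psi> x powr p \<partial>\<eta>) + \<delta>"
      using C(2)[OF \<psi>m h \<delta>]
    proof eventually_elim
      case (elim k)
      have i1: "(\<integral>\<^sup>+x. ennreal (\<bar>\<psi> x\<bar> powr p) * frac_grad_pow s p (u k) x \<partial>lborel) = ennreal (\<integral>x. \<psi> x powr p \<partial>density lborel (frac_grad_pow s p (u k)))"
        by (rule nn_integral_powr_density(1)[OF \<psi>m \<psi> p_pos _ density_frac_grad(2)[OF u]]) auto
      have i2: "(\<integral>\<^sup>+x. ennreal (\<bar>\<psi> x\<bar> powr p) * frac_grad_pow s p u0 x \<partial>lborel) = ennreal (\<integral>x. \<psi> x powr p \<partial>\<eta>)"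
        unfolding \<eta>_def by (rule nn_integral_powr_density(1)[OF \<psi>m \<psi> p_pos _ density_frac_grad(2)[OF u0]]) auto
      have n1: "0 \<le> (\<integral>x. \<psi> x powr p \<partial>density lborel (frac_grad_pow s p (u k)))" "0 \<le> (\<integral>x. \<psi> x powr p \<partial>\<eta>)"
        by (rule Bochner_Integration.integral_nonneg; simp)+
      note elim
      also have "ennreal ((1 + e)\<^sup>2) * (\<integral>\<^sup>+x. ennreal (\<bar>\<psi> x\<bar> powr p) * frac_grad_pow s p (u k) x \<partial>lborel)
          + ennreal C * (\<integral>\<^sup>+x. ennreal (\<bar>\<psi> x\<bar> powr p) * frac_grad_pow s p u0 x \<partial>lborel) + ennreal \<delta>
        = ennreal ((1 + e)\<^sup>2 * (\<integral>x. \<psi> x powr p \<partial>density lborel (frac_grad_pow s p (u k))) + C * (\<integral>x. \<psi> x powr p \<partial>\<eta>) + \<delta>)"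
        unfolding i1 i2 using n1 C(1) \<delta>
        by (simp only: ennreal_mult ennreal_plus zero_le_power2 mult_nonneg_nonneg add_nonneg_nonneg less_imp_le)
      finally show ?case
        unfolding integral_mult_powr_density[OF \<psi>m \<psi> diff_Dsp]
        using n1 C(1) \<delta> by (subst (asm) ennreal_le_iff) (auto intro!: add_nonneg_nonneg)
    qed
  qed
qed

section \<open>The reverse Hoelder inequality and the atoms\<close>

lemma reverse_holder_test:
  assumes e: "0 < e"
  obtains C where "0 \<le> C" "\<And>\<phi> :: 'a \<Rightarrow> real. \<phi> \<in> test_functions \<Longrightarrow> (\<And>x. 0 \<le> \<phi> x) \<Longrightarrow> (\<And>x. \<phi> x \<le> 1) \<Longrightarrow>
    S * (\<integral>x. \<phi> x powr q \<partial>\<nu>') powr (p / q) \<le> (1 + e)\<^sup>2 * (\<integral>x. \<phi> x powr p \<partial>\<mu>) + C * (\<integral>x. \<phi> x powr p \<partial>\<eta>)"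
proof -
  obtain C where C: "0 \<le> C"
    "\<And>(\<psi> :: 'a \<Rightarrow> real) W \<delta>. \<psi> \<in> borel_measurable borel \<Longrightarrow> (\<And>x. 0 \<le> \<psi> x) \<Longrightarrow> (\<And>x. \<psi> x \<le> 1) \<Longrightarrow>
      (\<And>x. frac_grad_pow s p \<psi> x \<le> ennreal W) \<Longrightarrow> 0 \<le> W \<Longrightarrow>
      gagliardo_pow s p \<psi> < \<infinity> \<Longrightarrow> (\<forall>v\<in>Dsp s p. (\<lambda>x. \<psi> x * v x) \<in> Dsp s p) \<Longrightarrow> 0 < \<delta> \<Longrightarrow>
      \<forall>\<^sub>F k in sequentially. S * (\<integral>x. \<psi> x powr q \<partial>density lborel (\<lambda>y. ennreal (\<bar>u k y - u0 y\<bar> powr q))) powr (p / q)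
        \<le> (1 + e)\<^sup>2 * (\<integral>x. \<psi> x powr p \<partial>density lborel (frac_grad_pow s p (u k))) + C * (\<integral>x. \<psi> x powr p \<partial>\<eta>) + \<delta>"
    using cutoff_real[OF e] by blast
  show ?thesis
  proof (rule that[OF C(1)])
    fix \<phi> :: "'a \<Rightarrow> real" assume \<phi>: "\<phi> \<in> test_functions" "\<And>x. 0 \<le> \<phi> x" "\<And>x. \<phi> x \<le> 1"
    obtain W where W: "0 \<le> W" "\<And>x. frac_grad_pow s p \<phi> x \<le> ennreal W" "gagliardo_pow s p \<phi> < \<infinity>"
      using gagliardo_pow_test_function[OF \<phi>(1)] by blast
    have C0: "continuous_on UNIV (\<lambda>x. \<phi> x powr a)" "((\<lambda>x. \<phi> x powr a) \<longlongrightarrow> 0) at_infinity" if "0 < a" for a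
      using test_function_powr_C0[OF \<phi>(1,2) that] by (auto simp: C0_functions_def)
    have l1: "(\<lambda>k. \<integral>x. \<phi> x powr q \<partial>density lborel (\<lambda>y. ennreal (\<bar>u k y - u0 y\<bar> powr q))) \<longlonglongrightarrow> (\<integral>x. \<phi> x powr q \<partial>\<nu>')"
      using \<nu>'(3) C0[OF q_pos] by (simp add: weakly_convergent_measures_def)
    have l2: "(\<lambda>k. \<integral>x. \<phi> x powr p \<partial>density lborel (frac_grad_pow s p (u k))) \<longlonglongrightarrow> (\<integral>x. \<phi> x powr p \<partial>\<mu>)"
      using \<mu>(3) C0[OF p_pos] by (simp add: weakly_convergent_measures_def)
    show "S * (\<integral>x. \<phi> x powr q \<partial>\<nu>') powr (p / q) \<le> (1 + e)\<^sup>2 * (\<integral>x. \<phi> x powr p \<partial>\<mu>) + C * (\<integral>x. \<phi> x powr p \<partial>\<eta>)"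
    proof (rule field_le_epsilon)
      fix \<delta> :: real assume \<delta>: "0 < \<delta>"
      show "S * (\<integral>x. \<phi> x powr q \<partial>\<nu>') powr (p / q) \<le> (1 + e)\<^sup>2 * (\<integral>x. \<phi> x powr p \<partial>\<mu>) + C * (\<integral>x. \<phi> x powr p \<partial>\<eta>) + \<delta>"
      proof (rule tendsto_le[OF trivial_limit_sequentially])
        show "(\<lambda>k. (1 + e)\<^sup>2 * (\<integral>x. \<phi> x powr p \<partial>density lborel (frac_grad_pow s p (u k))) + C * (\<integral>x. \<phi> x powr p \<partial>\<eta>) + \<delta>)
          \<longlonglongrightarrow> (1 + e)\<^sup>2 * (\<integral>x. \<phi> x powr p \<partial>\<mu>) + C * (\<integral>x. \<phi> x powr p \<partial>\<eta>) + \<delta>"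
          by (intro tendsto_add tendsto_mult tendsto_const l2)
        show "(\<lambda>k. S * (\<integral>x. \<phi> x powr q \<partial>density lborel (\<lambda>y. ennreal (\<bar>u k y - u0 y\<bar> powr q))) powr (p / q))
          \<longlonglongrightarrow> S * (\<integral>x. \<phi> x powr q \<partial>\<nu>') powr (p / q)"
          using p_pos q_pos
          by (intro tendsto_mult tendsto_const tendsto_powr' l1) (auto intro!: always_eventually Bochner_Integration.integral_nonneg)
        show "\<forall>\<^sub>F k in sequentially. S * (\<integral>x. \<phi> x powr q \<partial>density lborel (\<lambda>y. ennreal (\<bar>u k y - u0 y\<bar> powr q))) powr (p / q)
          \<le> (1 + e)\<^sup>2 * (\<integral>x. \<phi> x powr p \<partial>density lborel (frac_grad_pow s p (u k))) + C * (\<integral>x. \<phi> x powr p \<partial>\<eta>) + \<delta>"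
          by (rule C(2)[OF test_functions_measurable[OF \<phi>(1)] \<phi>(2,3) W(2,1,3) ballI[OF Dsp_mult_test_function[OF \<phi>(1)]] \<delta>])
      qed
    qed
  qed
qed

text \<open>\<open>regular_comparison\<close> replaces cutoffs by Borel sets. For this the
  inequality is solved for \<open>\<nu>'\<close>, which gives the function H with exponent
  \<open>q / p\<close>.\<close>

lemma reverse_holder:
  assumes e: "0 < e"
  obtains C where "0 \<le> C" "\<And>E. E \<in> sets borel \<Longrightarrow>
    measure \<nu>' E \<le> (((1 + e)\<^sup>2 * measure \<mu> E + C * measure \<eta> E) / S) powr (q / p)"
proof -
  obtain C where C: "0 \<le> C" "\<And>\<phi> :: 'a \<Rightarrow> real. \<phi> \<in> test_functions \<Longrightarrow> (\<And>x. 0 \<le> \<phi> x) \<Longrightarrow> (\<And>x. \<phi> x \<le> 1) \<Longrightarrow>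
    S * (\<integral>x. \<phi> x powr q \<partial>\<nu>') powr (p / q) \<le> (1 + e)\<^sup>2 * (\<integral>x. \<phi> x powr p \<partial>\<mu>) + C * (\<integral>x. \<phi> x powr p \<partial>\<eta>)"
    using reverse_holder_test[OF e] by blast
  let ?H = "\<lambda>t. (t / S) powr (q / p)"
  have "measure \<nu>' E \<le> ?H ((1 + e)\<^sup>2 * measure \<mu> E + C * measure \<eta> E)" if E: "E \<in> sets borel" for E
  proof (rule regular_comparison[OF \<nu>'(1,2) \<mu>(1,2) \<eta>_facts(1,2) _ C(1) _ _ _ E])
    show "continuous_on {0..} ?H"
      using S(1) p_pos q_pos by (intro continuous_on_powr' continuous_intros) auto
    show "mono_on {0..} ?H"
      using S(1) p_pos q_pos by (intro mono_onI powr_mono2 divide_right_mono) auto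
    fix K U :: "'a set" assume KU: "compact K" "open U" "K \<subseteq> U"
    obtain \<phi> where \<phi>: "\<phi> \<in> test_functions" "\<And>x. 0 \<le> \<phi> x" "\<And>x. \<phi> x \<le> 1"
        "\<And>x. x \<in> K \<Longrightarrow> \<phi> x = 1" "\<And>x. x \<notin> U \<Longrightarrow> \<phi> x = 0"
      using smooth_cutoff[OF KU] by blast
    have "measure \<nu>' K \<le> (\<integral>x. \<phi> x powr q \<partial>\<nu>')"
      by (rule measure_le_cutoff(1)[OF \<nu>'(1,2) \<phi>(1,2,3) q_pos KU(1) \<phi>(4)])
    then have "measure \<nu>' K powr (p / q) \<le> (\<integral>x. \<phi> x powr q \<partial>\<nu>') powr (p / q)"
      using p_pos q_pos by (intro powr_mono2) auto
    then have "S * measure \<nu>' K powr (p / q) \<le> S * (\<integral>x. \<phi> x powr q \<partial>\<nu>') powr (p / q)"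
      using S(1) by (intro mult_left_mono) auto
    also have "\<dots> \<le> (1 + e)\<^sup>2 * (\<integral>x. \<phi> x powr p \<partial>\<mu>) + C * (\<integral>x. \<phi> x powr p \<partial>\<eta>)"
      by (rule C(2)[OF \<phi>(1,2,3)])
    also have "\<dots> \<le> (1 + e)\<^sup>2 * measure \<mu> U + C * measure \<eta> U"
      by (intro add_mono mult_left_mono C(1) zero_le_power2 measure_le_cutoff(2)[OF \<mu>(1,2) \<phi>(1,2,3) p_pos KU(2) \<phi>(5)]
          measure_le_cutoff(2)[OF \<eta>_facts(1,2) \<phi>(1,2,3) p_pos KU(2) \<phi>(5)])
    finally have "measure \<nu>' K powr (p / q) \<le> ((1 + e)\<^sup>2 * measure \<mu> U + C * measure \<eta> U) / S"
      using S(1) by (simp add: pos_le_divide_eq mult.commute)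
    then have "(measure \<nu>' K powr (p / q)) powr (q / p) \<le> ?H ((1 + e)\<^sup>2 * measure \<mu> U + C * measure \<eta> U)"
      using p_pos q_pos by (intro powr_mono2) auto
    then show "measure \<nu>' K \<le> ?H ((1 + e)\<^sup>2 * measure \<mu> U + C * measure \<eta> U)"
      using p_pos q_pos by (simp add: powr_powr)
  qed simp
  with C(1) show ?thesis by (rule that)
qed

text \<open>On a single point the term with C vanishes whatever the size of C, since
  \<open>\<eta>\<close> has no atoms. Only then does e tend to 0.\<close>

lemma atom_inequality: "measure \<nu>' {x} \<le> (measure \<mu> {x} / S) powr (q / p)"
proof -
  have "((\<lambda>e. (((1 + e)\<^sup>2 * measure \<mu> {x}) / S) powr (q / p)) \<longlongrightarrow> (((1 + 0)\<^sup>2 * measure \<mu> {x}) / S) powr (q / p)) (at_right 0)"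
    using S(1) p_pos q_pos
    by (intro tendsto_powr' tendsto_divide tendsto_mult tendsto_power tendsto_add tendsto_const tendsto_ident_at) auto
  moreover have "\<forall>\<^sub>F e in at_right 0. measure \<nu>' {x} \<le> (((1 + e)\<^sup>2 * measure \<mu> {x}) / S) powr (q / p)"
  proof -
    have "measure \<nu>' {x} \<le> (((1 + e)\<^sup>2 * measure \<mu> {x}) / S) powr (q / p)" if e: "0 < e" for e
    proof -
      obtain C where C: "\<And>E. E \<in> sets borel \<Longrightarrow>
        measure \<nu>' E \<le> (((1 + e)\<^sup>2 * measure \<mu> E + C * measure \<eta> E) / S) powr (q / p)"
        using reverse_holder[OF e] by blast
      show ?thesis using C[of "{x}"] by (simp add: \<eta>_facts(3))
    qed
    then show ?thesis by (simp add: eventually_at_filter)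
  qed
  ultimately have "measure \<nu>' {x} \<le> (((1 + 0)\<^sup>2 * measure \<mu> {x}) / S) powr (q / p)"
    by (intro tendsto_lowerbound) auto
  then show ?thesis by simp
qed

text \<open>\<open>no_diffuse_part\<close> leaves only the atoms of \<open>\<mu>\<close>. Those that
  are not atoms of \<open>\<nu>'\<close> form a countable set of points of measure 0.\<close>

lemma null_off_atoms: "measure \<nu>' (- {x. measure \<nu>' {x} \<noteq> 0}) = 0"
proof -
  \<comment> \<open>Sharpness is irrelevant here, so a fixed \<open>e = 1\<close> is enough; it
    gives the factor 4.\<close>
  obtain C where C: "0 \<le> C" "\<And>E. E \<in> sets borel \<Longrightarrow>
    measure \<nu>' E \<le> (((1 + 1)\<^sup>2 * measure \<mu> E + C * measure \<eta> E) / S) powr (q / p)"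
    using reverse_holder[of 1] by auto
  have null: "measure \<nu>' (- {x. measure \<mu> {x} \<noteq> 0}) = 0"
  proof (rule no_diffuse_part[OF \<nu>'(1,2) \<mu>(1,2) \<eta>_facts(1,2), where a = 4 and b = C and c = "(1 / S) powr (q / p)" and \<beta> = "q / p"])
    show "measure \<nu>' E \<le> (1 / S) powr (q / p) * (4 * measure \<mu> E + C * measure \<eta> E) powr (q / p)" if "E \<in> sets borel" for E
      using C(2)[OF that] S(1) C(1) by (simp add: powr_mult[symmetric])
  qed (use C(1) S(1) p_pos p_less_q \<eta>_facts(3) in auto)
  interpret N: finite_measure \<nu>' by (rule \<nu>'(1))
  interpret Mu: finite_measure \<mu> by (rule \<mu>(1))
  let ?Y = "{x. measure \<mu> {x} \<noteq> 0}" and ?X = "{x. measure \<nu>' {x} \<noteq> 0}"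
  have cY: "countable ?Y" by (rule Mu.countable_support)
  have "countable (?Y - ?X)" using cY by (rule countable_Diff)
  have "emeasure \<nu>' (\<Union>x\<in>?Y - ?X. {x}) = (\<integral>\<^sup>+x. emeasure \<nu>' {x} \<partial>count_space (?Y - ?X))"
    by (rule emeasure_UN_countable) (use \<open>countable (?Y - ?X)\<close> in \<open>auto simp: \<nu>'(2) disjoint_family_on_def\<close>)
  also have "\<dots> = (\<integral>\<^sup>+x. 0 \<partial>count_space (?Y - ?X))"
    by (intro nn_integral_cong) (auto simp: N.emeasure_eq_measure)
  finally have z: "measure \<nu>' (?Y - ?X) = 0" by (simp add: N.emeasure_eq_measure)
  have sY: "?Y - ?X \<in> sets \<nu>'" "- ?Y \<in> sets \<nu>'"
    unfolding \<nu>'(2) using sets.countable[OF _ cY, of borel] sets.countable[OF _ \<open>countable (?Y - ?X)\<close>, of borel]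
    by (auto intro: borel_comp)
  have "measure \<nu>' (- ?X) \<le> measure \<nu>' (- ?Y \<union> (?Y - ?X))"
    using sY by (intro N.finite_measure_mono) auto
  also have "\<dots> \<le> measure \<nu>' (- ?Y) + measure \<nu>' (?Y - ?X)"
    using sY by (intro measure_Un_le) auto
  also have "\<dots> = 0" using null z by simp
  finally show ?thesis by (simp add: measure_le_0_iff)
qed

text \<open>Fatou's lemma twice: in y for the gradient at almost every x, then in x against a
  cutoff.\<close>

lemma mu_ge_gradient:
  assumes E: "E \<in> sets borel"
  shows "measure \<eta> E \<le> measure \<mu> E"
proof -
  have fatou: "AE x in lborel. frac_grad_pow s p u0 x \<le> liminf (\<lambda>k. frac_grad_pow s p (u k) x)"
  proof -
    from ae have "AE x in lborel. (\<lambda>k. u k x) \<longlonglongrightarrow> u0 x"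
      by eventually_elim (simp add: LIM_zero_iff)
    then show ?thesis
    proof eventually_elim
      case (elim x)
      let ?k = "\<lambda>y. norm (x - y) powr (real DIM('a) + s * p)"
      have "frac_grad_pow s p u0 x = (\<integral>\<^sup>+y. ennreal (\<bar>u0 x - u0 y\<bar> powr p / ?k y) \<partial>lborel)"
        by (rule frac_grad_pow_eq) auto
      also have "\<dots> = (\<integral>\<^sup>+y. liminf (\<lambda>k. ennreal (\<bar>u k x - u k y\<bar> powr p / ?k y)) \<partial>lborel)"
      proof (rule nn_integral_cong_AE)
        show "AE y in lborel. ennreal (\<bar>u0 x - u0 y\<bar> powr p / ?k y) = liminf (\<lambda>k. ennreal (\<bar>u k x - u k y\<bar> powr p / ?k y))"
          using ae
        proof eventually_elim
          case (elim y)
          then have y: "(\<lambda>k. u k y) \<longlonglongrightarrow> u0 y" by (simp add: LIM_zero_iff)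
          show ?case
          proof (cases "x = y")
            case False
            have "(\<lambda>k. \<bar>u k x - u k y\<bar> powr p / ?k y) \<longlonglongrightarrow> \<bar>u0 x - u0 y\<bar> powr p / ?k y"
              using p_pos False
              by (intro tendsto_divide tendsto_powr' tendsto_rabs tendsto_diff \<open>(\<lambda>k. u k x) \<longlonglongrightarrow> u0 x\<close> y tendsto_const) auto
            then have "(\<lambda>k. ennreal (\<bar>u k x - u k y\<bar> powr p / ?k y)) \<longlonglongrightarrow> ennreal (\<bar>u0 x - u0 y\<bar> powr p / ?k y)"
              by (rule tendsto_ennrealI)
            then show ?thesis by (intro lim_imp_Liminf[symmetric]) auto
          qed (simp add: Liminf_const)
        qed
      qed
      also have "\<dots> \<le> liminf (\<lambda>k. \<integral>\<^sup>+y. ennreal (\<bar>u k x - u k y\<bar> powr p / ?k y) \<partial>lborel)"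
        by (rule nn_integral_liminf) measurable
      also have "\<dots> = liminf (\<lambda>k. frac_grad_pow s p (u k) x)"
        by (simp add: frac_grad_pow_eq)
      finally show ?case .
    qed
  qed
  \<comment> \<open>\<open>regular_comparison\<close> with H the identity and weight 0 on the second
    measure.\<close>
  have "measure \<eta> E \<le> (\<lambda>t. t) (1 * measure \<mu> E + 0 * measure \<mu> E)"
  proof (rule regular_comparison[OF \<eta>_facts(1,2) \<mu>(1,2) \<mu>(1,2) _ _ _ _ _ E])
    fix K U :: "'a set" assume KU: "compact K" "open U" "K \<subseteq> U"
    obtain \<phi> where \<phi>: "\<phi> \<in> test_functions" "\<And>x. 0 \<le> \<phi> x" "\<And>x. \<phi> x \<le> 1"
        "\<And>x. x \<in> K \<Longrightarrow> \<phi> x = 1" "\<And>x. x \<notin> U \<Longrightarrow> \<phi> x = 0"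
      using smooth_cutoff[OF KU] by blast
    note \<phi>m [measurable] = test_functions_measurable[OF \<phi>(1)]
    let ?f = "\<lambda>x. ennreal (\<bar>\<phi> x\<bar> powr p)"
    have conv: "(\<lambda>k. \<integral>x. \<phi> x powr p \<partial>density lborel (frac_grad_pow s p (u k))) \<longlonglongrightarrow> (\<integral>x. \<phi> x powr p \<partial>\<mu>)"
      using \<mu>(3) test_function_powr_C0[OF \<phi>(1,2) p_pos] by (simp add: weakly_convergent_measures_def C0_functions_def)
    have "ennreal (\<integral>x. \<phi> x powr p \<partial>\<eta>) = (\<integral>\<^sup>+x. ?f x * frac_grad_pow s p u0 x \<partial>lborel)"
      unfolding \<eta>_def by (rule nn_integral_powr_density(1)[OF \<phi>m \<phi>(2,3) p_pos _ density_frac_grad(2)[OF u0], symmetric]) auto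
    also have "\<dots> \<le> (\<integral>\<^sup>+x. liminf (\<lambda>k. ?f x * frac_grad_pow s p (u k) x) \<partial>lborel)"
    proof (rule nn_integral_mono_AE)
      show "AE x in lborel. ?f x * frac_grad_pow s p u0 x \<le> liminf (\<lambda>k. ?f x * frac_grad_pow s p (u k) x)"
        using fatou
      proof eventually_elim
        case (elim x)
        have "?f x * frac_grad_pow s p u0 x \<le> ?f x * liminf (\<lambda>k. frac_grad_pow s p (u k) x)"
          by (rule mult_left_mono[OF elim]) simp
        also have "\<dots> = liminf (\<lambda>k. ?f x * frac_grad_pow s p (u k) x)"
          by (rule Liminf_compose_continuous_mono[symmetric, where f = "\<lambda>t. ?f x * t"])
             (auto intro!: ennreal_continuous_on_cmult continuous_on_id monoI mult_left_mono)
        finally show ?case .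
      qed
    qed
    also have "\<dots> \<le> liminf (\<lambda>k. \<integral>\<^sup>+x. ?f x * frac_grad_pow s p (u k) x \<partial>lborel)"
      by (rule nn_integral_liminf) measurable
    also have "\<dots> = liminf (\<lambda>k. ennreal (\<integral>x. \<phi> x powr p \<partial>density lborel (frac_grad_pow s p (u k))))"
      by (subst nn_integral_powr_density(1)[OF \<phi>m \<phi>(2,3) p_pos _ density_frac_grad(2)[OF u]]) auto
    also have "\<dots> = ennreal (\<integral>x. \<phi> x powr p \<partial>\<mu>)"
      by (intro lim_imp_Liminf tendsto_ennrealI conv) simp
    finally have "(\<integral>x. \<phi> x powr p \<partial>\<eta>) \<le> (\<integral>x. \<phi> x powr p \<partial>\<mu>)"
      by (subst (asm) ennreal_le_iff) (auto intro: Bochner_Integration.integral_nonneg)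
    then show "measure \<eta> K \<le> 1 * measure \<mu> U + 0 * measure \<mu> U"
      using measure_le_cutoff(1)[OF \<eta>_facts(1,2) \<phi>(1,2,3) p_pos KU(1) \<phi>(4)]
        measure_le_cutoff(2)[OF \<mu>(1,2) \<phi>(1,2,3) p_pos KU(2) \<phi>(5)] by simp
  qed (auto intro: mono_onI continuous_intros)
  then show ?thesis by simp
qed

end

section \<open>Behaviour at infinity\<close>

lemma measure_outside_tendsto_0:
  fixes N :: "'a::euclidean_space measure"
  assumes "finite_measure N" "sets N = sets borel"
  shows "(\<lambda>j::nat. measure N {x. real j < norm x}) \<longlonglongrightarrow> 0"
proof -
  interpret finite_measure N by fact
  have "range (\<lambda>j::nat. {x::'a. real j < norm x}) \<subseteq> sets N"
    unfolding assms(2) by (auto intro!: borel_open open_Collect_less continuous_intros)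
  moreover have "decseq (\<lambda>j::nat. {x::'a. real j < norm x})"
    by (auto simp: decseq_def)
  ultimately have "(\<lambda>j::nat. measure N {x. real j < norm x}) \<longlonglongrightarrow> measure N (\<Inter>j::nat. {x. real j < norm x})"
    by (rule finite_Lim_measure_decseq)
  moreover have "(\<Inter>j::nat. {x::'a. real j < norm x}) = {}"
    using real_arch_simple by (auto simp: not_less[symmetric])
  ultimately show ?thesis by simp
qed

lemma integral_cutoff_density:
  fixes \<psi> :: "'a::euclidean_space \<Rightarrow> real"
  assumes \<psi>: "\<psi> \<in> borel_measurable borel" "\<And>x. 0 \<le> \<psi> x" "\<And>x. \<psi> x \<le> 1" and a: "0 < a"
    and f: "f \<in> borel_measurable borel" "finite_measure (density lborel f)" and B: "B \<in> sets borel"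
  shows "(\<And>x. x \<notin> B \<Longrightarrow> \<psi> x = 0) \<Longrightarrow> (\<integral>x. \<psi> x powr a \<partial>density lborel f) \<le> measure (density lborel f) B"
    and "(\<And>x. x \<in> B \<Longrightarrow> \<psi> x = 1) \<Longrightarrow> measure (density lborel f) B \<le> (\<integral>x. \<psi> x powr a \<partial>density lborel f)"
proof -
  interpret finite_measure "density lborel f" by (rule f(2))
  note int = nn_integral_powr_density(2)[OF \<psi> a f]
  have le1: "\<psi> x powr a \<le> 1" for x using powr_mono2[of a "\<psi> x" 1] \<psi> a by simp
  have intB: "integrable (density lborel f) (indicat_real B)"
    using B by (intro integrable_real_indicator) (auto simp: emeasure_eq_measure)
  have eq: "measure (density lborel f) B = (\<integral>x. indicat_real B x \<partial>density lborel f)" by simp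
  show "(\<integral>x. \<psi> x powr a \<partial>density lborel f) \<le> measure (density lborel f) B" if "\<And>x. x \<notin> B \<Longrightarrow> \<psi> x = 0"
    unfolding eq using that le1 by (intro integral_mono int intB) (auto split: split_indicator)
  show "measure (density lborel f) B \<le> (\<integral>x. \<psi> x powr a \<partial>density lborel f)" if "\<And>x. x \<in> B \<Longrightarrow> \<psi> x = 1"
    unfolding eq using that by (intro integral_mono int intB) (auto split: split_indicator)
qed

context concentration
begin

text \<open>Since \<open>\<phi> x powr q \<le> 1\<close>, the global L^1 convergence of the
  Brezis-Lieb lemma passes to the tested integrals.\<close>

lemma brezis_lieb_limit:
  assumes \<phi>: "\<phi> \<in> test_functions" "\<And>x. 0 \<le> \<phi> x" "\<And>x. \<phi> x \<le> 1"
  shows "(\<integral>x. \<phi> x powr q \<partial>\<nu>) = (\<integral>x. \<phi> x powr q \<partial>\<nu>') + (\<integral>x. \<phi> x powr q \<partial>\<eta>')"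
proof -
  note \<phi>m [measurable] = test_functions_measurable[OF \<phi>(1)]
  obtain A where A: "\<And>k. (\<integral>x. \<bar>u k x - u0 x\<bar> powr q \<partial>lborel) \<le> A" by (rule Lq_bound) blast
  let ?D = "\<lambda>k x. \<bar>u k x\<bar> powr q - \<bar>u k x - u0 x\<bar> powr q - \<bar>u0 x\<bar> powr q"
  have "(\<lambda>k. \<integral>x. \<bar>\<bar>(u k x - u0 x) + u0 x\<bar> powr q - \<bar>u k x - u0 x\<bar> powr q - \<bar>u0 x\<bar> powr q\<bar> \<partial>lborel) \<longlonglongrightarrow> 0"
    by (rule brezis_lieb[OF q_pos _ _ DspD(3)[OF diff_Dsp] DspD(3)[OF u0] A ae]) auto
  then have lim0: "(\<lambda>k. \<integral>x. \<bar>?D k x\<bar> \<partial>lborel) \<longlonglongrightarrow> 0" by simp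
  have \<phi>1: "\<phi> x powr q \<le> 1" for x using powr_mono2[of q "\<phi> x" 1] \<phi> q_pos by simp
  have eq: "(\<integral>x. \<bar>\<phi> x * v x\<bar> powr q \<partial>lborel) = (\<integral>x. \<phi> x powr q * \<bar>v x\<bar> powr q \<partial>lborel)" for v :: "'a \<Rightarrow> real"
    using \<phi>(2) by (simp add: abs_mult powr_mult)
  have int: "integrable lborel (\<lambda>x. \<phi> x powr q * \<bar>v x\<bar> powr q)" if v: "v \<in> Dsp s p" for v :: "'a \<Rightarrow> real"
  proof -
    have "(\<lambda>x. \<phi> x * v x) \<in> Lq q"
      by (rule Lq_mult_bounded[OF DspD(1)[OF v] \<phi>m, of 1]) (use \<phi> in simp)
    then show ?thesis using \<phi>(2) by (simp add: Lq_def abs_mult powr_mult)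
  qed
  let ?a = "\<lambda>k. \<integral>x. \<phi> x powr q \<partial>density lborel (\<lambda>y. ennreal (\<bar>u k y\<bar> powr q))"
  let ?b = "\<lambda>k. \<integral>x. \<phi> x powr q \<partial>density lborel (\<lambda>y. ennreal (\<bar>u k y - u0 y\<bar> powr q))"
  let ?c = "\<integral>x. \<phi> x powr q \<partial>\<eta>'"
  have iD: "integrable lborel (\<lambda>x. \<bar>?D k x\<bar>)" for k
    using DspD(3)[OF u] DspD(3)[OF diff_Dsp] DspD(3)[OF u0] by (intro integrable_abs Bochner_Integration.integrable_diff)
  have "\<bar>?a k - ?b k - ?c\<bar> \<le> (\<integral>x. \<bar>?D k x\<bar> \<partial>lborel)" for k
  proof -
    have "?a k - ?b k - ?c = (\<integral>x. \<phi> x powr q * \<bar>u k x\<bar> powr q \<partial>lborel) - (\<integral>x. \<phi> x powr q * \<bar>u k x - u0 x\<bar> powr q \<partial>lborel)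
        - (\<integral>x. \<phi> x powr q * \<bar>u0 x\<bar> powr q \<partial>lborel)"
      unfolding \<eta>'_def integral_mult_powr_density[OF \<phi>m \<phi>(2,3) u, symmetric] integral_mult_powr_density[OF \<phi>m \<phi>(2,3) diff_Dsp, symmetric]
        integral_mult_powr_density[OF \<phi>m \<phi>(2,3) u0, symmetric] eq ..
    also have "\<dots> = (\<integral>x. \<phi> x powr q * ?D k x \<partial>lborel)"
      using int[OF u[of k]] int[OF diff_Dsp[of k]] int[OF u0] by (simp add: right_diff_distrib)
    finally have "\<bar>?a k - ?b k - ?c\<bar> \<le> (\<integral>x. \<bar>\<phi> x powr q * ?D k x\<bar> \<partial>lborel)" by simp
    also have "\<dots> \<le> (\<integral>x. \<bar>?D k x\<bar> \<partial>lborel)"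
    proof (rule Bochner_Integration.integral_mono_AE')
      show "AE x in lborel. \<bar>\<phi> x powr q * ?D k x\<bar> \<le> \<bar>?D k x\<bar>"
        using \<phi>1 by (intro AE_I2) (simp add: abs_mult mult_left_le_one_le)
    qed (auto intro: iD)
    finally show ?thesis .
  qed
  then have "(\<lambda>k. ?a k - ?b k - ?c) \<longlonglongrightarrow> 0"
    by (intro Lim_null_comparison[OF _ lim0] always_eventually allI) simp
  moreover have "(\<lambda>k. ?a k - ?b k - ?c) \<longlonglongrightarrow> (\<integral>x. \<phi> x powr q \<partial>\<nu>) - (\<integral>x. \<phi> x powr q \<partial>\<nu>') - ?c"
    using \<nu>(3) \<nu>'(3) test_function_powr_C0[OF \<phi>(1,2) q_pos]
    by (intro tendsto_diff tendsto_const) (simp_all add: weakly_convergent_measures_def C0_functions_def)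
  ultimately have "(\<integral>x. \<phi> x powr q \<partial>\<nu>) - (\<integral>x. \<phi> x powr q \<partial>\<nu>') - ?c = 0"
    using LIMSEQ_unique by blast
  then show ?thesis by simp
qed

text \<open>Regularity yields only one inequality on Borel sets. Cutoffs equal to 1 on growing balls
  give the opposite inequality for the total masses, and applying the first one to both E and its
  complement forces equality.\<close>

lemma nu_decomposition:
  assumes E: "E \<in> sets borel"
  shows "measure \<nu> E = measure \<nu>' E + measure \<eta>' E"
proof -
  interpret N: finite_measure \<nu> by (rule \<nu>(1))
  interpret N': finite_measure \<nu>' by (rule \<nu>'(1))
  interpret H: finite_measure \<eta>' by (rule \<eta>'_facts(1))
  have space: "space \<nu> = UNIV" "space \<nu>' = UNIV" "space \<eta>' = UNIV"
    using sets_eq_imp_space_eq[OF \<nu>(2)] sets_eq_imp_space_eq[OF \<nu>'(2)] sets_eq_imp_space_eq[OF \<eta>'_facts(2)] by simp_all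
  have le: "measure \<nu> F \<le> measure \<nu>' F + measure \<eta>' F" if F: "F \<in> sets borel" for F
  proof -
    have "measure \<nu> F \<le> (\<lambda>t. t) (1 * measure \<nu>' F + 1 * measure \<eta>' F)"
    proof (rule regular_comparison[OF \<nu>(1,2) \<nu>'(1,2) \<eta>'_facts(1,2) _ _ _ _ _ F])
      fix K U :: "'a set" assume KU: "compact K" "open U" "K \<subseteq> U"
      obtain \<phi> where \<phi>: "\<phi> \<in> test_functions" "\<And>x. 0 \<le> \<phi> x" "\<And>x. \<phi> x \<le> 1"
          "\<And>x. x \<in> K \<Longrightarrow> \<phi> x = 1" "\<And>x. x \<notin> U \<Longrightarrow> \<phi> x = 0"
        using smooth_cutoff[OF KU] by blast
      show "measure \<nu> K \<le> 1 * measure \<nu>' U + 1 * measure \<eta>' U"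
        using measure_le_cutoff(1)[OF \<nu>(1,2) \<phi>(1,2,3) q_pos KU(1) \<phi>(4)] brezis_lieb_limit[OF \<phi>(1,2,3)]
          measure_le_cutoff(2)[OF \<nu>'(1,2) \<phi>(1,2,3) q_pos KU(2) \<phi>(5)]
          measure_le_cutoff(2)[OF \<eta>'_facts(1,2) \<phi>(1,2,3) q_pos KU(2) \<phi>(5)] by simp
    qed (auto intro: mono_onI continuous_intros)
    then show ?thesis by simp
  qed
  have ball: "measure \<nu>' (cball 0 (real j)) + measure \<eta>' (cball 0 (real j)) \<le> measure \<nu> UNIV" for j
  proof -
    obtain \<phi> where \<phi>: "\<phi> \<in> test_functions" "\<And>x. 0 \<le> \<phi> x" "\<And>x. \<phi> x \<le> 1"
        "\<And>x. x \<in> cball (0::'a) (real j) \<Longrightarrow> \<phi> x = 1" "\<And>x. x \<notin> UNIV \<Longrightarrow> \<phi> x = 0"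
      using smooth_cutoff[of "cball (0::'a) (real j)" UNIV] by auto
    have "measure \<nu>' (cball 0 (real j)) \<le> (\<integral>x. \<phi> x powr q \<partial>\<nu>')"
      by (rule measure_le_cutoff(1)[OF \<nu>'(1,2) \<phi>(1,2,3) q_pos compact_cball \<phi>(4)])
    moreover have "measure \<eta>' (cball 0 (real j)) \<le> (\<integral>x. \<phi> x powr q \<partial>\<eta>')"
      by (rule measure_le_cutoff(1)[OF \<eta>'_facts(1,2) \<phi>(1,2,3) q_pos compact_cball \<phi>(4)])
    ultimately show ?thesis
      using measure_le_cutoff(2)[OF \<nu>(1,2) \<phi>(1,2,3) q_pos open_UNIV \<phi>(5)] brezis_lieb_limit[OF \<phi>(1,2,3)]
      by linarith
  qed
  have UN: "(\<Union>j. cball (0::'a) (real j)) = UNIV"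
    using real_arch_simple by (auto simp: set_eq_iff)
  have rng: "range (\<lambda>j. cball (0::'a) (real j)) \<subseteq> sets borel" "incseq (\<lambda>j. cball (0::'a) (real j))"
    by (auto simp: incseq_def)
  have "(\<lambda>j. measure \<nu>' (cball 0 (real j)) + measure \<eta>' (cball 0 (real j))) \<longlonglongrightarrow> measure \<nu>' UNIV + measure \<eta>' UNIV"
    using N'.finite_Lim_measure_incseq[of "\<lambda>j. cball 0 (real j)"] H.finite_Lim_measure_incseq[of "\<lambda>j. cball 0 (real j)"] rng
    unfolding \<nu>'(2) \<eta>'_facts(2) UN by (intro tendsto_add) blast+
  then have total: "measure \<nu>' UNIV + measure \<eta>' UNIV \<le> measure \<nu> UNIV"
    by (rule LIMSEQ_le_const2) (use ball in auto)
  have "- E \<in> sets borel" using E by (rule borel_comp)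
  then have "measure \<nu> (- E) \<le> measure \<nu>' (- E) + measure \<eta>' (- E)" by (rule le)
  moreover have "measure \<nu> (- E) = measure \<nu> UNIV - measure \<nu> E"
    using N.finite_measure_compl[of E] E by (simp add: \<nu>(2) space Compl_eq_Diff_UNIV)
  moreover have "measure \<nu>' (- E) = measure \<nu>' UNIV - measure \<nu>' E"
    using N'.finite_measure_compl[of E] E by (simp add: \<nu>'(2) space Compl_eq_Diff_UNIV)
  moreover have "measure \<eta>' (- E) = measure \<eta>' UNIV - measure \<eta>' E"
    using H.finite_measure_compl[of E] E by (simp add: \<eta>'_facts(2) space Compl_eq_Diff_UNIV)
  ultimately show ?thesis using le[OF E] total by linarith
qed

text \<open>The cutoff is 0 on the ball of radius R and 1 beyond 2R, hence the two radii. The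
  constants depend on e but not on R, so that the tails of \<open>\<eta>\<close> and
  \<open>\<eta>'\<close> can be sent to 0 before e.\<close>

lemma tail_estimate:
  assumes e: "0 < e"
  obtains C C' where "0 \<le> C" "0 \<le> C'" "\<And>R. 0 < R \<Longrightarrow> \<forall>\<^sub>F k in sequentially.
    measure (density lborel (\<lambda>y. ennreal (\<bar>u k y\<bar> powr q))) {x. 2 * R < norm x}
      \<le> (1 + e) * (((1 + e)\<^sup>2 * measure (density lborel (frac_grad_pow s p (u k))) {x. R < norm x}
          + C * measure \<eta> {x. R < norm x} + e) / S) powr (q / p) + C' * measure \<eta>' {x. 2 * R < norm x}"
proof -
  obtain C where C: "0 \<le> C"
    "\<And>(\<psi> :: 'a \<Rightarrow> real) W \<delta>. \<psi> \<in> borel_measurable borel \<Longrightarrow> (\<And>x. 0 \<le> \<psi> x) \<Longrightarrow> (\<And>x. \<psi> x \<le> 1) \<Longrightarrow>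
      (\<And>x. frac_grad_pow s p \<psi> x \<le> ennreal W) \<Longrightarrow> 0 \<le> W \<Longrightarrow>
      gagliardo_pow s p \<psi> < \<infinity> \<Longrightarrow> (\<forall>v\<in>Dsp s p. (\<lambda>x. \<psi> x * v x) \<in> Dsp s p) \<Longrightarrow> 0 < \<delta> \<Longrightarrow>
      \<forall>\<^sub>F k in sequentially. S * (\<integral>x. \<psi> x powr q \<partial>density lborel (\<lambda>y. ennreal (\<bar>u k y - u0 y\<bar> powr q))) powr (p / q)
        \<le> (1 + e)\<^sup>2 * (\<integral>x. \<psi> x powr p \<partial>density lborel (frac_grad_pow s p (u k))) + C * (\<integral>x. \<psi> x powr p \<partial>\<eta>) + \<delta>"
    using cutoff_real[OF e] by blast
  obtain C' where C': "0 \<le> C'" "\<And>a b :: real. \<bar>a + b\<bar> powr q \<le> (1 + e) * \<bar>a\<bar> powr q + C' * \<bar>b\<bar> powr q"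
    using powr_add_le_eps[OF q_pos e] by blast
  show ?thesis
  proof (rule that[OF C(1) C'(1)])
    fix R :: real assume R: "0 < R"
    define B1 where "B1 = {x::'a. R < norm x}"
    define B2 where "B2 = {x::'a. 2 * R < norm x}"
    have B: "B1 \<in> sets borel" "B2 \<in> sets borel"
      unfolding B1_def B2_def by (auto intro!: borel_open open_Collect_less continuous_intros)
    have sub: "cball (0::'a) R \<subseteq> ball 0 (2 * R)" using R by auto
    obtain \<theta> where \<theta>: "\<theta> \<in> test_functions" "\<And>x. 0 \<le> \<theta> x" "\<And>x. \<theta> x \<le> 1"
        "\<And>x. x \<in> cball (0::'a) R \<Longrightarrow> \<theta> x = 1" "\<And>x. x \<notin> ball (0::'a) (2 * R) \<Longrightarrow> \<theta> x = 0"
      using smooth_cutoff[OF compact_cball open_ball sub] by blast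
    note \<theta>m [measurable] = test_functions_measurable[OF \<theta>(1)]
    obtain W where W: "0 \<le> W" "\<And>x. frac_grad_pow s p \<theta> x \<le> ennreal W" "gagliardo_pow s p \<theta> < \<infinity>"
      using gagliardo_pow_test_function[OF \<theta>(1)] by blast
    define \<psi> where "\<psi> x = 1 - \<theta> x" for x
    have \<psi>m: "\<psi> \<in> borel_measurable borel" unfolding \<psi>_def[abs_def] by measurable
    have \<psi>: "0 \<le> \<psi> x" "\<psi> x \<le> 1" for x using \<theta>(2,3) by (simp_all add: \<psi>_def)
    have \<psi>0: "\<psi> x = 0" if "x \<notin> B1" for x using \<theta>(4)[of x] that by (simp add: \<psi>_def B1_def)
    have \<psi>1: "\<psi> x = 1" if "x \<in> B2" for x using \<theta>(5)[of x] that by (simp add: \<psi>_def B2_def)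
    \<comment> \<open>Constants drop out of differences, so \<open>\<psi>\<close> has the bounded
      integrable gradient of a test function without being one.\<close>
    have grad: "frac_grad_pow s p \<psi> x = frac_grad_pow s p \<theta> x" for x
      unfolding frac_grad_pow_def by (simp add: \<psi>_def abs_minus_commute)
    have gag: "gagliardo_pow s p \<psi> = gagliardo_pow s p \<theta>"
      unfolding gagliardo_pow_eq[OF \<psi>m] gagliardo_pow_eq[OF \<theta>m] grad ..
    have Dsp: "\<forall>v\<in>Dsp s p. (\<lambda>x. \<psi> x * v x) \<in> Dsp s p"
    proof
      fix v :: "'a \<Rightarrow> real" assume v: "v \<in> Dsp s p"
      have "(\<lambda>x. v x - \<theta> x * v x) \<in> Dsp s p" by (intro Dsp_diff Dsp_mult_test_function v \<theta>(1))
      then show "(\<lambda>x. \<psi> x * v x) \<in> Dsp s p" by (simp add: \<psi>_def left_diff_distrib)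
    qed
    have "\<forall>\<^sub>F k in sequentially. S * (\<integral>x. \<psi> x powr q \<partial>density lborel (\<lambda>y. ennreal (\<bar>u k y - u0 y\<bar> powr q))) powr (p / q)
        \<le> (1 + e)\<^sup>2 * (\<integral>x. \<psi> x powr p \<partial>density lborel (frac_grad_pow s p (u k))) + C * (\<integral>x. \<psi> x powr p \<partial>\<eta>) + e"
      by (rule C(2)[OF \<psi>m \<psi>, of W]) (use W Dsp e in \<open>auto simp: grad gag\<close>)
    then show "\<forall>\<^sub>F k in sequentially.
      measure (density lborel (\<lambda>y. ennreal (\<bar>u k y\<bar> powr q))) {x. 2 * R < norm x}
        \<le> (1 + e) * (((1 + e)\<^sup>2 * measure (density lborel (frac_grad_pow s p (u k))) {x. R < norm x}
            + C * measure \<eta> {x. R < norm x} + e) / S) powr (q / p) + C' * measure \<eta>' {x. 2 * R < norm x}"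
      unfolding B1_def[symmetric] B2_def[symmetric]
    proof eventually_elim
      case (elim k)
      let ?Mk = "density lborel (frac_grad_pow s p (u k))"
      let ?Nk = "density lborel (\<lambda>y. ennreal (\<bar>u k y\<bar> powr q))"
      let ?Vk = "density lborel (\<lambda>y. ennreal (\<bar>u k y - u0 y\<bar> powr q))"
      define I where "I = (\<integral>x. \<psi> x powr q \<partial>?Vk)"
      have I0: "0 \<le> I" unfolding I_def by (rule Bochner_Integration.integral_nonneg) simp
      let ?X = "(1 + e)\<^sup>2 * measure ?Mk B1 + C * measure \<eta> B1 + e"
      have b1: "(\<integral>x. \<psi> x powr p \<partial>?Mk) \<le> measure ?Mk B1"
        by (rule integral_cutoff_density(1)[OF \<psi>m \<psi> p_pos _ density_frac_grad(2)[OF u] B(1) \<psi>0]) auto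
      have b2: "(\<integral>x. \<psi> x powr p \<partial>\<eta>) \<le> measure \<eta> B1"
        unfolding \<eta>_def by (rule integral_cutoff_density(1)[OF \<psi>m \<psi> p_pos _ density_frac_grad(2)[OF u0] B(1) \<psi>0]) auto
      have "S * I powr (p / q) \<le> ?X"
        using elim mult_left_mono[OF b1, of "(1 + e)\<^sup>2"] mult_left_mono[OF b2 C(1)] unfolding I_def by simp
      then have "I powr (p / q) \<le> ?X / S" using S(1) by (simp add: pos_le_divide_eq mult.commute)
      then have "(I powr (p / q)) powr (q / p) \<le> (?X / S) powr (q / p)"
        using p_pos q_pos by (intro powr_mono2) auto
      then have I_le: "I \<le> (?X / S) powr (q / p)" using I0 p_pos q_pos by (simp add: powr_powr)
      have V_le: "measure ?Vk B2 \<le> I"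
        unfolding I_def by (rule integral_cutoff_density(2)[OF \<psi>m \<psi> q_pos _ density_Lq(2)[OF diff_Dsp] B(2) \<psi>1]) auto
      interpret Nk: finite_measure ?Nk by (rule density_Lq(2)[OF u])
      interpret Vk: finite_measure ?Vk by (rule density_Lq(2)[OF diff_Dsp])
      interpret H: finite_measure \<eta>' by (rule \<eta>'_facts(1))
      \<comment> \<open>The return from \<open>u k - u0\<close> to \<open>u k\<close> costs a factor
        \<open>1 + e\<close> and a tail of \<open>u0\<close>.\<close>
      have "emeasure ?Nk B2 = (\<integral>\<^sup>+x. ennreal (\<bar>u k x\<bar> powr q) * indicator B2 x \<partial>lborel)"
        using B(2) by (intro emeasure_density) auto
      also have "\<dots> \<le> (\<integral>\<^sup>+x. ennreal (1 + e) * (ennreal (\<bar>u k x - u0 x\<bar> powr q) * indicator B2 x)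
          + ennreal C' * (ennreal (\<bar>u0 x\<bar> powr q) * indicator B2 x) \<partial>lborel)"
      proof (rule nn_integral_mono)
        fix x
        have "ennreal (\<bar>u k x\<bar> powr q) \<le> ennreal ((1 + e) * \<bar>u k x - u0 x\<bar> powr q + C' * \<bar>u0 x\<bar> powr q)"
          using C'(2)[of "u k x - u0 x" "u0 x"] by (intro ennreal_leI) simp
        also have "\<dots> = ennreal (1 + e) * ennreal (\<bar>u k x - u0 x\<bar> powr q) + ennreal C' * ennreal (\<bar>u0 x\<bar> powr q)"
          using e C'(1) by (simp only: ennreal_mult ennreal_plus mult_nonneg_nonneg add_nonneg_nonneg powr_ge_zero less_imp_le zero_le_one)
        finally show "ennreal (\<bar>u k x\<bar> powr q) * indicator B2 x \<le> ennreal (1 + e) * (ennreal (\<bar>u k x - u0 x\<bar> powr q) * indicator B2 x)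
          + ennreal C' * (ennreal (\<bar>u0 x\<bar> powr q) * indicator B2 x)"
          by (cases "x \<in> B2") simp_all
      qed
      also have "\<dots> = ennreal (1 + e) * (\<integral>\<^sup>+x. ennreal (\<bar>u k x - u0 x\<bar> powr q) * indicator B2 x \<partial>lborel)
          + ennreal C' * (\<integral>\<^sup>+x. ennreal (\<bar>u0 x\<bar> powr q) * indicator B2 x \<partial>lborel)"
        using B(2) by (intro nn_integral_lincomb) auto
      also have "(\<integral>\<^sup>+x. ennreal (\<bar>u k x - u0 x\<bar> powr q) * indicator B2 x \<partial>lborel) = emeasure ?Vk B2"
        using B(2) by (intro emeasure_density[symmetric]) auto
      also have "(\<integral>\<^sup>+x. ennreal (\<bar>u0 x\<bar> powr q) * indicator B2 x \<partial>lborel) = emeasure \<eta>' B2"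
        unfolding \<eta>'_def using B(2) by (intro emeasure_density[symmetric]) auto
      finally have "ennreal (measure ?Nk B2) \<le> ennreal (1 + e) * ennreal (measure ?Vk B2) + ennreal C' * ennreal (measure \<eta>' B2)"
        unfolding Nk.emeasure_eq_measure Vk.emeasure_eq_measure H.emeasure_eq_measure .
      also have "\<dots> = ennreal ((1 + e) * measure ?Vk B2 + C' * measure \<eta>' B2)"
        using e C'(1) by (simp only: ennreal_mult ennreal_plus mult_nonneg_nonneg add_nonneg_nonneg measure_nonneg less_imp_le zero_le_one)
      finally have "measure ?Nk B2 \<le> (1 + e) * measure ?Vk B2 + C' * measure \<eta>' B2"
        using e C'(1) by (subst (asm) ennreal_le_iff) (auto intro!: add_nonneg_nonneg)
      also have "\<dots> \<le> (1 + e) * (?X / S) powr (q / p) + C' * measure \<eta>' B2"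
        using order_trans[OF V_le I_le] e by (intro add_right_mono mult_left_mono) auto
      finally show ?case .
    qed
  qed
qed

text \<open>Three limits in this order: the limsup in k, then the radius, which removes the tails of
  \<open>u0\<close> despite the large constants, and finally e. The factor 2 in the radius does not
  change the limit that defines n.\<close>

lemma infinity_inequality:
  assumes m: "0 \<le> m" "((\<lambda>R::real. limsup (\<lambda>k. emeasure (density lborel (frac_grad_pow s p (u k))) {x. R < norm x})) \<longlongrightarrow> ennreal m) at_top"
    and n: "0 \<le> n" "((\<lambda>R::real. limsup (\<lambda>k. emeasure (density lborel (\<lambda>y. ennreal (\<bar>u k y\<bar> powr q))) {x. R < norm x})) \<longlongrightarrow> ennreal n) at_top"
  shows "n \<le> (m / S) powr (q / p)"
proof -
  let ?H = "\<lambda>t. (t / S) powr (q / p)"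
  let ?Mk = "\<lambda>k. density lborel (frac_grad_pow s p (u k))"
  let ?Nk = "\<lambda>k. density lborel (\<lambda>y. ennreal (\<bar>u k y\<bar> powr q))"
  \<comment> \<open>The products with 0 keep the shape of the limit of \<open>f\<close> below, where
    the tails have become 0.\<close>
  have step: "n \<le> (1 + e) * ?H ((1 + e)\<^sup>2 * (m + e) + C * 0 + e) + C' * 0" if e: "0 < e" and C: "0 \<le> C" "0 \<le> C'"
    and tail: "\<And>R. 0 < R \<Longrightarrow> \<forall>\<^sub>F k in sequentially. measure (?Nk k) {x. 2 * R < norm x}
      \<le> (1 + e) * ?H ((1 + e)\<^sup>2 * measure (?Mk k) {x. R < norm x} + C * measure \<eta> {x. R < norm x} + e) + C' * measure \<eta>' {x. 2 * R < norm x}"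
    for e C C'
  proof -
    define f where "f j = (1 + e) * ?H ((1 + e)\<^sup>2 * (m + e) + C * measure \<eta> {x. real j < norm x} + e) + C' * measure \<eta>' {x. 2 * real j < norm x}" for j
    have f0: "0 \<le> f j" for j unfolding f_def using e C by (intro add_nonneg_nonneg mult_nonneg_nonneg) auto
    have "ennreal m < ennreal (m + e)" using m(1) e by (simp add: ennreal_less_iff)
    then have "\<forall>\<^sub>F R in at_top. limsup (\<lambda>k. emeasure (?Mk k) {x. R < norm x}) < ennreal (m + e)"
      by (rule order_tendstoD(2)[OF m(2)])
    then have ev: "\<forall>\<^sub>F j in sequentially. limsup (\<lambda>k. emeasure (?Mk k) {x. real j < norm x}) < ennreal (m + e)"
      by (rule eventually_compose_filterlim) (rule filterlim_real_sequentially)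
    have le: "\<forall>\<^sub>F j in sequentially. limsup (\<lambda>k. emeasure (?Nk k) {x. 2 * real j < norm x}) \<le> ennreal (f j)"
      using ev eventually_gt_at_top[of 0]
    proof eventually_elim
      case (elim j)
      have "\<forall>\<^sub>F k in sequentially. emeasure (?Mk k) {x. real j < norm x} < ennreal (m + e)"
        using elim(1) by (rule Limsup_lessD)
      moreover have "0 < real j" using elim(2) by simp
      ultimately have "\<forall>\<^sub>F k in sequentially. emeasure (?Nk k) {x. 2 * real j < norm x} \<le> ennreal (f j)"
        using tail[of "real j"]
      proof (simp, elim eventually_elim2)
        fix k
        interpret Mk: finite_measure "?Mk k" by (rule density_frac_grad(2)[OF u])
        interpret Nk: finite_measure "?Nk k" by (rule density_Lq(2)[OF u])
        assume 1: "emeasure (?Mk k) {x. real j < norm x} < ennreal (m + e)"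
          and 2: "measure (?Nk k) {x. 2 * real j < norm x}
            \<le> (1 + e) * ?H ((1 + e)\<^sup>2 * measure (?Mk k) {x. real j < norm x} + C * measure \<eta> {x. real j < norm x} + e) + C' * measure \<eta>' {x. 2 * real j < norm x}"
        have mle: "measure (?Mk k) {x. real j < norm x} \<le> m + e"
          using 1 unfolding Mk.emeasure_eq_measure by (subst (asm) ennreal_less_iff) auto
        have "?H ((1 + e)\<^sup>2 * measure (?Mk k) {x. real j < norm x} + C * measure \<eta> {x. real j < norm x} + e)
          \<le> ?H ((1 + e)\<^sup>2 * (m + e) + C * measure \<eta> {x. real j < norm x} + e)"
          using S(1) p_pos q_pos e C mle
          by (intro powr_mono2 divide_right_mono add_right_mono mult_left_mono) (auto intro!: divide_nonneg_pos add_nonneg_nonneg)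
        then have "(1 + e) * ?H ((1 + e)\<^sup>2 * measure (?Mk k) {x. real j < norm x} + C * measure \<eta> {x. real j < norm x} + e)
          \<le> (1 + e) * ?H ((1 + e)\<^sup>2 * (m + e) + C * measure \<eta> {x. real j < norm x} + e)"
          using e by (intro mult_left_mono) auto
        with 2 have "measure (?Nk k) {x. 2 * real j < norm x} \<le> f j" unfolding f_def by linarith
        then show "emeasure (?Nk k) {x. 2 * real j < norm x} \<le> ennreal (f j)"
          by (simp add: Nk.emeasure_eq_measure ennreal_leI)
      qed
      then show ?case by (rule Limsup_bounded)
    qed
    have l1: "(\<lambda>j. measure \<eta> {x. real j < norm x}) \<longlonglongrightarrow> 0"
      by (rule measure_outside_tendsto_0[OF \<eta>_facts(1,2)])
    have l2: "(\<lambda>j. measure \<eta>' {x. 2 * real j < norm x}) \<longlonglongrightarrow> 0"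
    proof -
      have "strict_mono (\<lambda>j::nat. 2 * j)" by (simp add: strict_mono_def)
      from LIMSEQ_subseq_LIMSEQ[OF measure_outside_tendsto_0[OF \<eta>'_facts(1,2)] this]
      show ?thesis by (simp add: o_def)
    qed
    have pos: "0 < (1 + e)\<^sup>2 * (m + e) + C * 0 + e" using m(1) e by (auto intro!: add_nonneg_pos)
    have "f \<longlonglongrightarrow> (1 + e) * ?H ((1 + e)\<^sup>2 * (m + e) + C * 0 + e) + C' * 0"
      unfolding f_def[abs_def] using S(1) pos
      by (intro tendsto_add tendsto_mult tendsto_const tendsto_powr tendsto_divide l1 l2) auto
    then have fl: "(\<lambda>j. ennreal (f j)) \<longlonglongrightarrow> ennreal ((1 + e) * ?H ((1 + e)\<^sup>2 * (m + e) + C * 0 + e) + C' * 0)"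
      by (rule tendsto_ennrealI)
    have "filterlim (\<lambda>j. 2 * real j) at_top sequentially"
      by (intro filterlim_tendsto_pos_mult_at_top[OF tendsto_const] filterlim_real_sequentially) simp
    then have nl: "(\<lambda>j. limsup (\<lambda>k. emeasure (?Nk k) {x. 2 * real j < norm x})) \<longlonglongrightarrow> ennreal n"
      by (rule filterlim_compose[OF n(2)])
    have "ennreal n \<le> ennreal ((1 + e) * ?H ((1 + e)\<^sup>2 * (m + e) + C * 0 + e) + C' * 0)"
      by (rule tendsto_le[OF trivial_limit_sequentially fl nl le])
    then show ?thesis using e by (subst (asm) ennreal_le_iff) auto
  qed
  have "n \<le> (1 + e) * ?H ((1 + e)\<^sup>2 * (m + e) + e)" if e: "0 < e" for e
  proof (rule tail_estimate[OF e])
    fix C C' :: real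
    assume "0 \<le> C" "0 \<le> C'" "\<And>R. 0 < R \<Longrightarrow> \<forall>\<^sub>F k in sequentially. measure (?Nk k) {x. 2 * R < norm x}
      \<le> (1 + e) * ?H ((1 + e)\<^sup>2 * measure (?Mk k) {x. R < norm x} + C * measure \<eta> {x. R < norm x} + e) + C' * measure \<eta>' {x. 2 * R < norm x}"
    from step[OF e this] show ?thesis by simp
  qed
  then have "\<forall>\<^sub>F e in at_right 0. n \<le> (1 + e) * ?H ((1 + e)\<^sup>2 * (m + e) + e)"
    by (simp add: eventually_at_filter)
  moreover have "((\<lambda>e. (1 + e) * ?H ((1 + e)\<^sup>2 * (m + e) + e)) \<longlongrightarrow> (1 + 0) * ?H ((1 + 0)\<^sup>2 * (m + 0) + 0)) (at_right 0)"
  proof (intro tendsto_mult tendsto_powr' tendsto_divide tendsto_add tendsto_power tendsto_const tendsto_ident_at)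
    show "((1 + 0)\<^sup>2 * (m + 0) + 0) / S \<noteq> 0 \<or> 0 < q / p \<and> (\<forall>\<^sub>F x in at_right 0. 0 \<le> ((1 + x)\<^sup>2 * (m + x) + x) / S)"
      using S(1) p_pos q_pos m(1)
      by (auto simp: eventually_at_filter intro!: always_eventually divide_nonneg_pos add_nonneg_nonneg)
  qed (use S(1) p_pos in auto)
  ultimately have "n \<le> (1 + 0) * ?H ((1 + 0)\<^sup>2 * (m + 0) + 0)"
    by (intro tendsto_lowerbound) auto
  then show ?thesis by simp
qed

end

section \<open>The Sobolev constant and the main theorem\<close>

context frac_sobolev
begin

lemma test_functions_Dsp:
  assumes "(\<phi> :: 'a \<Rightarrow> real) \<in> test_functions"
  shows "\<phi> \<in> Dsp s p"
proof (rule DspI[OF test_functions_Lq[OF assms], of "\<lambda>_. \<phi>"])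
  show "(\<lambda>j. gagliardo_pow s p (\<lambda>x. \<phi> x - \<phi> x)) \<longlonglongrightarrow> 0"
    using gagliardo_pow_cmult[OF test_functions_measurable[OF assms], of 0] p_pos by simp
qed (rule assms)

text \<open>A real infimum is meaningful only for a nonempty set bounded below. The lower bound
  \<open>1 / C\<close> is the Sobolev inequality, and a cutoff equal to 1 on the unit ball is an
  admissible function.\<close>

lemma sobolev_const_facts:
  shows "0 < sobolev_const TYPE('a) s p"
    and "(w :: 'a \<Rightarrow> real) \<in> Dsp s p \<Longrightarrow>
      sobolev_const TYPE('a) s p * (\<integral>x. \<bar>w x\<bar> powr q \<partial>lborel) powr (p / q) \<le> enn2real (gagliardo_pow s p w)"
proof -
  define V where "V = {v \<in> Dsp s p. \<not> (AE x::'a in lborel. v x = 0)}"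
  define f where "f v = gagliardo_seminorm s p v powr p / Lq_norm q v powr p" for v :: "'a \<Rightarrow> real"
  have S: "sobolev_const TYPE('a) s p = (INF v\<in>V. f v)"
    by (simp add: sobolev_const_def V_def f_def q_def)
  let ?A = "\<lambda>v :: 'a \<Rightarrow> real. \<integral>x. \<bar>v x\<bar> powr q \<partial>lborel"
  have A0: "0 \<le> ?A v" for v by (rule Bochner_Integration.integral_nonneg) simp
  have f_eq: "f v = enn2real (gagliardo_pow s p v) / ?A v powr (p / q)" for v
    using p_pos by (simp add: f_def gagliardo_seminorm_def Lq_norm_def powr_powr)
  have A_zero: "AE x in lborel. v x = 0" if v: "v \<in> Dsp s p" and "?A v = 0" for v
  proof -
    have "AE x in lborel. \<bar>v x\<bar> powr q = 0"
      using integral_nonneg_eq_0_iff_AE[OF DspD(3)[OF v]] that(2) by simp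
    then show ?thesis by eventually_elim simp
  qed
  have A_pos: "0 < ?A v powr (p / q)" if "v \<in> V" for v
    using A_zero[of v] A0[of v] that by (auto simp: V_def)
  obtain C where C: "0 < C" "\<And>v :: 'a \<Rightarrow> real. v \<in> Dsp s p \<Longrightarrow> ?A v powr (p / q) \<le> C * enn2real (gagliardo_pow s p v)"
    by (rule sobolev_real) blast
  have lower: "1 / C \<le> f v" if "v \<in> V" for v
    using C(1) C(2)[of v] A_pos[OF that] that by (simp add: f_eq V_def field_simps)
  have "cball (0::'a) 1 \<subseteq> ball 0 2" by auto
  then obtain \<phi> where \<phi>: "\<phi> \<in> test_functions" "\<And>x. x \<in> cball (0::'a) 1 \<Longrightarrow> \<phi> x = 1"
    using smooth_cutoff[OF compact_cball open_ball] by metis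
  have "\<phi> \<in> V"
  proof -
    have "\<not> (AE x in lborel. \<phi> x = 0)"
    proof
      assume "AE x in lborel. \<phi> x = 0"
      then have "AE x in lborel. x \<notin> cball (0::'a) 1" by eventually_elim (use \<phi>(2) in force)
      then have "emeasure lborel (cball (0::'a) 1) = 0"
        by (subst (asm) AE_iff_measurable[of "cball (0::'a) 1"]) auto
      then have "unit_ball_vol (real DIM('a)) = 0" by (simp add: emeasure_cball)
      moreover have "0 < unit_ball_vol (real DIM('a))" by simp
      ultimately show False by linarith
    qed
    then show ?thesis using test_functions_Dsp[OF \<phi>(1)] by (simp add: V_def)
  qed
  then have "1 / C \<le> (INF v\<in>V. f v)" by (intro cINF_greatest lower) auto
  then show "0 < sobolev_const TYPE('a) s p" using C(1) by (simp add: S less_le_trans[OF divide_pos_pos[OF zero_less_one C(1)]])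
  show "sobolev_const TYPE('a) s p * ?A w powr (p / q) \<le> enn2real (gagliardo_pow s p w)" if w: "w \<in> Dsp s p"
  proof (cases "?A w = 0")
    case False
    then have "w \<in> V"
    proof -
      have "\<not> (AE x in lborel. w x = 0)"
      proof
        assume "AE x in lborel. w x = 0"
        then have "AE x in lborel. \<bar>w x\<bar> powr q = 0" by eventually_elim simp
        then have "?A w = 0" by (rule integral_eq_zero_AE)
        with False show False by simp
      qed
      then show ?thesis using w by (simp add: V_def)
    qed
    have "bdd_below (f ` V)" using lower by (auto intro!: bdd_belowI)
    then have "(INF v\<in>V. f v) \<le> f w" using \<open>w \<in> V\<close> by (rule cINF_lower)
    then show ?thesis using A_pos[OF \<open>w \<in> V\<close>] by (simp add: S f_eq pos_le_divide_eq)
  qed simp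
qed

end

section \<open>Extraction of subsequences and conclusion\<close>

lemma weakly_convergent_measures_subseqD:
  assumes "weakly_convergent_measures M N" "strict_mono r"
  shows "weakly_convergent_measures (\<lambda>k. M (r k)) N"
  using assms LIMSEQ_subseq_LIMSEQ[of _ _ r] unfolding weakly_convergent_measures_def o_def by blast

lemma measure_split:
  assumes "finite_measure N" and A: "A \<in> sets N" "X \<in> sets N"
  shows "measure N A = measure N (A - X) + measure N (A \<inter> X)"
proof -
  interpret finite_measure N by fact
  have "(A - X) \<union> (A \<inter> X) = A" "(A - X) \<inter> (A \<inter> X) = {}" by blast+
  then show ?thesis using finite_measure_Union[of "A - X" "A \<inter> X"] A by simp
qed

text \<open>The measures attached to a weakly convergent sequence need not converge in general, so a
  single subsequence \<open>r\<close> is chosen for all claims. The indices are naturals, which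
  encodes at most countably many atoms.\<close>

theorem theorem1p1:
  fixes s p :: real
    and u :: "nat \<Rightarrow> 'a::euclidean_space \<Rightarrow> real" and u0 :: "'a \<Rightarrow> real"
  defines "q \<equiv> crit_exp TYPE('a) s p" and "S \<equiv> sobolev_const TYPE('a) s p"
  assumes "0 < s" and "s < 1" and "1 \<le> p" and "s * p < real DIM('a)"
    and "weakly_convergent_Dsp s p u u0"
  shows "\<exists>(r :: nat \<Rightarrow> nat) (\<mu> :: 'a measure) (\<nu> :: 'a measure)
           (I :: nat set) (x :: nat \<Rightarrow> 'a) (m :: nat \<Rightarrow> real) (n :: nat \<Rightarrow> real)
           (m_inf :: real) (n_inf :: real).
    strict_mono r \<and>
    finite_measure \<mu> \<and> sets \<mu> = sets borel \<and>
    finite_measure \<nu> \<and> sets \<nu> = sets borel \<and>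
    (\<forall>i\<in>I. 0 < m i \<and> 0 < n i) \<and>
    weakly_convergent_measures (\<lambda>k. density lborel (frac_grad_pow s p (u (r k)))) \<mu> \<and>
    (\<forall>A\<in>sets borel.
       emeasure \<mu> A \<ge> emeasure (density lborel (frac_grad_pow s p u0)) A + dirac_sum I x m A) \<and>
    weakly_convergent_measures (\<lambda>k. density lborel (\<lambda>y. ennreal (\<bar>u (r k) y\<bar> powr q))) \<nu> \<and>
    (\<forall>A\<in>sets borel.
       emeasure \<nu> A =
         emeasure (density lborel (\<lambda>y. ennreal (\<bar>u0 y\<bar> powr q))) A + dirac_sum I x n A) \<and>
    (\<forall>i\<in>I. S powr (1 / p) * n i powr (1 / q) \<le> m i powr (1 / p)) \<and>
    0 \<le> n_inf \<and> 0 \<le> m_inf \<and>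
    ((\<lambda>R::real. limsup (\<lambda>k. \<integral>\<^sup>+y\<in>{y. norm y > R}. ennreal (\<bar>u (r k) y\<bar> powr q) \<partial>lborel))
       \<longlongrightarrow> ennreal n_inf) at_top \<and>
    ((\<lambda>R::real. limsup (\<lambda>k. \<integral>\<^sup>+y\<in>{y. norm y > R}. frac_grad_pow s p (u (r k)) y \<partial>lborel))
       \<longlongrightarrow> ennreal m_inf) at_top \<and>
    limsup (\<lambda>k. \<integral>\<^sup>+y. frac_grad_pow s p (u (r k)) y \<partial>lborel)
      = emeasure \<mu> UNIV + ennreal m_inf \<and>
    limsup (\<lambda>k. \<integral>\<^sup>+y. ennreal (\<bar>u (r k) y\<bar> powr q) \<partial>lborel)
      = emeasure \<nu> UNIV + ennreal n_inf \<and>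
    S powr (1 / p) * n_inf powr (1 / q) \<le> m_inf powr (1 / p)"
proof -
  interpret frac_sobolev s p q "TYPE('a)"
    using assms(3-6) by unfold_locales (simp_all add: q_def)
  have u: "u k \<in> Dsp s p" for k using assms(7) by (simp add: weakly_convergent_Dsp_def)
  have u0: "u0 \<in> Dsp s p" using assms(7) by (simp add: weakly_convergent_Dsp_def)
  have dual: "(\<lambda>k. F (u k)) \<longlonglongrightarrow> F u0" if "F \<in> Dsp_dual s p" for F
    using assms(7) that by (simp add: weakly_convergent_Dsp_def)
  obtain M where M: "0 \<le> M" "\<And>k. gagliardo_pow s p (u k) \<le> ennreal M"
    using weakly_convergent_Dsp_bounded[OF assms(7)] by blast
  obtain A B where A: "0 \<le> A" "\<And>k. (\<integral>x. \<bar>u k x - u0 x\<bar> powr q \<partial>lborel) \<le> A" "\<And>k. (\<integral>x. \<bar>u k x\<bar> powr q \<partial>lborel) \<le> A"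
    and B: "0 \<le> B" "\<And>k. gagliardo_pow s p (\<lambda>x. u k x - u0 x) \<le> ennreal B"
    by (rule Dsp_diff_bounds[OF u u0 M]) (rule that)
  have v: "(\<lambda>x. u k x - u0 x) \<in> Dsp s p" for k by (rule Dsp_diff[OF u u0])
  note um [measurable] = DspD(2)[OF u] DspD(2)[OF u0]
  \<comment> \<open>Weak convergence, tested on the integrals over balls.\<close>
  have null: "(\<lambda>k. \<integral>y. indicator (ball x \<rho>) y * (u k y - u0 y) \<partial>lborel) \<longlonglongrightarrow> 0" for x \<rho>
  proof -
    have "(\<lambda>k. (\<integral>y. indicator (ball x \<rho>) y * u k y \<partial>lborel) - (\<integral>y. indicator (ball x \<rho>) y * u0 y \<partial>lborel)) \<longlonglongrightarrow> 0"
      using dual[OF ball_integral_dual[of x \<rho>]] by (simp add: LIM_zero)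
    then show ?thesis
      using integrable_ball[OF DspD(1)[OF u], of x \<rho>] integrable_ball[OF DspD(1)[OF u0], of x \<rho>]
      by (simp add: right_diff_distrib)
  qed
  have L1: "(\<lambda>k. \<integral>\<^sup>+x. ennreal \<bar>u k x - u0 x\<bar> * indicator (cball 0 R) x \<partial>lborel) \<longlonglongrightarrow> 0" for R
    by (rule weakly_null_L1_local[OF DspD(1)[OF v] A(2) B(2,1) null])
  obtain r1 :: "nat \<Rightarrow> nat" where r1: "strict_mono r1" and ae1: "AE x in lborel. (\<lambda>k. u (r1 k) x - u0 x) \<longlonglongrightarrow> 0"
    by (rule AE_subsequence_of_local_L1[OF DspD(2)[OF v] L1]) (rule that)
  let ?G = "\<lambda>k. density lborel (frac_grad_pow s p (u k))"
  let ?V = "\<lambda>k. density lborel (\<lambda>y. ennreal (\<bar>u k y - u0 y\<bar> powr q))"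
  let ?N = "\<lambda>k. density lborel (\<lambda>y. ennreal (\<bar>u k y\<bar> powr q))"
  have G_mass: "emeasure (?G k) UNIV = gagliardo_pow s p (u k)" for k
    by (subst emeasure_density) (simp_all add: gagliardo_pow_eq)
  have mass: "emeasure (?G k) UNIV \<le> ennreal M" "emeasure (?V k) UNIV \<le> ennreal A" "emeasure (?N k) UNIV \<le> ennreal A" for k
  proof -
    show "emeasure (?G k) UNIV \<le> ennreal M" unfolding G_mass by (rule M)
    show "emeasure (?V k) UNIV \<le> ennreal A"
      using A(2)[of k] by (subst emeasure_density) (simp_all add: nn_integral_eq_integral[OF DspD(3)[OF v]] ennreal_leI)
    show "emeasure (?N k) UNIV \<le> ennreal A"
      using A(3)[of k] by (subst emeasure_density) (simp_all add: nn_integral_eq_integral[OF DspD(3)[OF u]] ennreal_leI)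
  qed
  \<comment> \<open>Three nested extractions; limits found earlier persist along later
    subsequences.\<close>
  obtain r2 \<mu> where r2: "strict_mono r2" and \<mu>: "finite_measure \<mu>" "sets \<mu> = sets borel"
      "weakly_convergent_measures (\<lambda>k. ?G (r1 (r2 k))) \<mu>"
    by (rule weakly_convergent_measures_subseq[of "\<lambda>k. ?G (r1 k)" M]) (use mass in auto)
  obtain r3 \<nu>' where r3: "strict_mono r3" and \<nu>': "finite_measure \<nu>'" "sets \<nu>' = sets borel"
      "weakly_convergent_measures (\<lambda>k. ?V (r1 (r2 (r3 k)))) \<nu>'"
    by (rule weakly_convergent_measures_subseq[of "\<lambda>k. ?V (r1 (r2 k))" A]) (use mass in auto)
  obtain r4 \<nu> where r4: "strict_mono r4" and \<nu>: "finite_measure \<nu>" "sets \<nu> = sets borel"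
      "weakly_convergent_measures (\<lambda>k. ?N (r1 (r2 (r3 (r4 k))))) \<nu>"
    by (rule weakly_convergent_measures_subseq[of "\<lambda>k. ?N (r1 (r2 (r3 k)))" A]) (use mass in auto)
  define r where "r k = r1 (r2 (r3 (r4 k)))" for k
  have r: "strict_mono r" using r1 r2 r3 r4 by (simp add: r_def strict_mono_def)
  have r34: "strict_mono (\<lambda>k. r3 (r4 k))" "strict_mono (\<lambda>k. r2 (r3 (r4 k)))"
    using r2 r3 r4 by (simp_all add: strict_mono_def)
  have \<mu>_conv: "weakly_convergent_measures (\<lambda>k. ?G (r k)) \<mu>"
    unfolding r_def using weakly_convergent_measures_subseqD[OF \<mu>(3) r34(1)] .
  have \<nu>'_conv: "weakly_convergent_measures (\<lambda>k. ?V (r k)) \<nu>'"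
    unfolding r_def using weakly_convergent_measures_subseqD[OF \<nu>'(3) r4] .
  have \<nu>_conv: "weakly_convergent_measures (\<lambda>k. ?N (r k)) \<nu>"
    unfolding r_def by (rule \<nu>(3))
  have ae: "AE x in lborel. (\<lambda>k. u (r k) x - u0 x) \<longlonglongrightarrow> 0"
    using ae1
  proof eventually_elim
    case (elim x)
    from LIMSEQ_subseq_LIMSEQ[OF this r34(2)] show ?case by (simp add: r_def o_def)
  qed
  note S = sobolev_const_facts[folded S_def]
  interpret concentration s p q "TYPE('a)" "\<lambda>k. u (r k)" u0 \<mu> \<nu>' \<nu> M S
    by (rule concentration.intro[OF frac_sobolev_axioms], rule concentration_axioms.intro)
      (fact u u0 M ae S \<mu>(1,2) \<mu>_conv \<nu>'(1,2) \<nu>'_conv \<nu>(1,2) \<nu>_conv)+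
  interpret Mu: finite_measure \<mu> by (rule \<mu>(1))
  interpret N': finite_measure \<nu>' by (rule \<nu>'(1))
  interpret Nu: finite_measure \<nu> by (rule \<nu>(1))
  interpret E: finite_measure \<eta> by (rule \<eta>_facts(1))
  interpret E': finite_measure \<eta>' by (rule \<eta>'_facts(1))
  obtain m_inf where m_inf: "0 \<le> m_inf"
      "((\<lambda>R::real. limsup (\<lambda>k. emeasure (?G (r k)) {x. R < norm x})) \<longlongrightarrow> ennreal m_inf) at_top"
      "limsup (\<lambda>k. emeasure (?G (r k)) UNIV) = emeasure \<mu> UNIV + ennreal m_inf"
    by (rule weakly_convergent_measures_mass[OF _ mass(1) \<mu>(1,2) \<mu>_conv]) auto
  obtain n_inf where n_inf: "0 \<le> n_inf"
      "((\<lambda>R::real. limsup (\<lambda>k. emeasure (?N (r k)) {x. R < norm x})) \<longlongrightarrow> ennreal n_inf) at_top"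
      "limsup (\<lambda>k. emeasure (?N (r k)) UNIV) = emeasure \<nu> UNIV + ennreal n_inf"
    by (rule weakly_convergent_measures_mass[OF _ mass(3) \<nu>(1,2) \<nu>_conv]) auto
  \<comment> \<open>Both final inequalities, at the atoms and at infinity, arise in the form solved
    for the mass; this is the common passage to roots.\<close>
  have root: "S powr (1 / p) * b powr (1 / q) \<le> a powr (1 / p)" if "0 \<le> a" "0 \<le> b" "b \<le> (a / S) powr (q / p)" for a b
  proof -
    have "b powr (1 / q) \<le> ((a / S) powr (q / p)) powr (1 / q)"
      using that q_pos by (intro powr_mono2) auto
    also have "\<dots> = a powr (1 / p) / S powr (1 / p)"
      using that S(1) q_pos p_pos by (simp add: powr_powr powr_divide)
    finally show ?thesis using S(1) by (simp add: pos_le_divide_eq mult.commute)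
  qed
  \<comment> \<open>The atoms of \<open>\<nu>'\<close> and not those of \<open>\<mu>\<close> are
    listed, since the weights of both sums must be positive.\<close>
  define X where "X = {x. measure \<nu>' {x} \<noteq> 0}"
  have X: "countable X" unfolding X_def by (rule N'.countable_support)
  define I where "I = to_nat_on X ` X"
  define x where "x = from_nat_into X"
  have xI: "x ` I = X" and inj: "inj_on x I"
    using X by (auto simp: I_def x_def image_image inj_on_def from_nat_into_to_nat_on)
  have X_borel: "X \<in> sets borel" by (rule sets.countable[OF _ X]) simp
  define m where "m i = measure \<mu> {x i}" for i
  define n where "n i = measure \<nu>' {x i}" for i
  have atom: "n i \<le> (m i / S) powr (q / p)" for i
    unfolding m_def n_def by (rule atom_inequality)
  have pos: "0 < n i" "0 < m i" if "i \<in> I" for i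
  proof -
    have "x i \<in> X" using that xI by blast
    then show "0 < n i" by (simp add: X_def n_def zero_less_measure_iff)
    \<comment> \<open>A vanishing \<open>m i\<close> would force
      \<open>n i \<le> 0 powr (q / p) = 0\<close>.\<close>
    then have "m i \<noteq> 0" using atom[of i] by auto
    then show "0 < m i" by (simp add: m_def zero_less_measure_iff)
  qed
  have dirac_m: "dirac_sum I x m A = emeasure \<mu> (A \<inter> X)" if "A \<in> sets borel" for A
    using dirac_sum_atoms[OF \<mu>(1,2) inj that] by (simp add: m_def[abs_def] xI)
  have dirac_n: "dirac_sum I x n A = emeasure \<nu>' (A \<inter> X)" if "A \<in> sets borel" for A
    using dirac_sum_atoms[OF \<nu>'(1,2) inj that] by (simp add: n_def[abs_def] xI)
  have mu_ge: "emeasure \<eta> A + dirac_sum I x m A \<le> emeasure \<mu> A" if A: "A \<in> sets borel" for A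
  proof -
    \<comment> \<open>\<open>\<eta>\<close> does not charge the countable set X. So the bound by the
      gradient is used off X, the atoms are counted on X, and the two add up.\<close>
    have "emeasure \<eta> (A \<inter> X) = 0" using X by (intro \<eta>_countable) auto
    then have "measure \<eta> (A \<inter> X) = 0" by (simp add: measure_def)
    moreover have "measure \<eta> A = measure \<eta> (A - X) + measure \<eta> (A \<inter> X)"
      by (rule measure_split[OF E.finite_measure_axioms]) (simp_all add: \<eta>_facts(2) A X_borel)
    moreover have "measure \<mu> A = measure \<mu> (A - X) + measure \<mu> (A \<inter> X)"
      by (rule measure_split[OF Mu.finite_measure_axioms]) (simp_all add: \<mu>(2) A X_borel)
    moreover have "measure \<eta> (A - X) \<le> measure \<mu> (A - X)"
      by (rule mu_ge_gradient) (use A X_borel in auto)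
    ultimately have "measure \<eta> A + measure \<mu> (A \<inter> X) \<le> measure \<mu> A" by linarith
    then show ?thesis
      unfolding dirac_m[OF A] E.emeasure_eq_measure Mu.emeasure_eq_measure by (simp flip: ennreal_plus)
  qed
  have nu_eq: "emeasure \<nu> A = emeasure \<eta>' A + dirac_sum I x n A" if A: "A \<in> sets borel" for A
  proof -
    have "measure \<nu>' (A - X) \<le> measure \<nu>' (- X)"
      by (intro N'.finite_measure_mono) (use X_borel in \<open>auto simp: \<nu>'(2) borel_comp\<close>)
    then have "measure \<nu>' (A - X) = 0" using null_off_atoms by (simp add: X_def measure_le_0_iff)
    moreover have "measure \<nu>' A = measure \<nu>' (A - X) + measure \<nu>' (A \<inter> X)"
      by (rule measure_split[OF N'.finite_measure_axioms]) (simp_all add: \<nu>'(2) A X_borel)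
    ultimately have "measure \<nu> A = measure \<eta>' A + measure \<nu>' (A \<inter> X)"
      using nu_decomposition[OF A] by simp
    then show ?thesis
      unfolding dirac_n[OF A] E'.emeasure_eq_measure N'.emeasure_eq_measure Nu.emeasure_eq_measure by simp
  qed
  have out: "{y::'a. R < norm y} \<in> sets borel" for R
    by (intro borel_open open_Collect_less continuous_intros)
  have G_out: "(\<integral>\<^sup>+y\<in>{y. norm y > R}. frac_grad_pow s p (u k) y \<partial>lborel) = emeasure (?G k) {x. R < norm x}" for R k
    using out by (subst emeasure_density) auto
  have N_out: "(\<integral>\<^sup>+y\<in>{y. norm y > R}. ennreal (\<bar>u k y\<bar> powr q) \<partial>lborel) = emeasure (?N k) {x. R < norm x}" for R k
    using out by (subst emeasure_density) auto
  have G_all: "(\<integral>\<^sup>+y. frac_grad_pow s p (u k) y \<partial>lborel) = emeasure (?G k) UNIV" for k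
    by (subst emeasure_density) auto
  have N_all: "(\<integral>\<^sup>+y. ennreal (\<bar>u k y\<bar> powr q) \<partial>lborel) = emeasure (?N k) UNIV" for k
    by (subst emeasure_density) auto
  have inf: "S powr (1 / p) * n_inf powr (1 / q) \<le> m_inf powr (1 / p)"
    by (intro root m_inf(1) n_inf(1) infinity_inequality m_inf(2) n_inf(2))
  show ?thesis
    by (rule exI[of _ r], rule exI[of _ \<mu>], rule exI[of _ \<nu>], rule exI[of _ I], rule exI[of _ x],
        rule exI[of _ m], rule exI[of _ n], rule exI[of _ m_inf], rule exI[of _ n_inf], unfold G_out N_out G_all N_all,
        intro conjI ballI r \<mu>(1,2) \<nu>(1,2) pos \<mu>_conv \<nu>_conv mu_ge[unfolded \<eta>_def] nu_eq[unfolded \<eta>'_def] inf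
          n_inf m_inf root[OF _ _ atom])
       (auto simp: m_def n_def)
qed

end
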